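(* Let $n>1$ and let $K_1,\ldots,K_n$ be infinite compact Hausdorff spaces. Then $C(K_1)\hat{\otimes}\cdots\hat{\otimes}C(K_n)$ has the Dunford-Pettis Property if and only if $K_1,\ldots,K_n$ are all scattered.
   Context: $C(K)$ denotes the Banach space (sup norm) of continuous scalar-valued functions on a compact Hausdorff space $K$, the scalar field $\mathbb{K}$ being $\mathbb{R}$ or $\mathbb{C}$. $E_1\hat{\otimes}\cdots\hat{\otimes}E_n$ denotes the (completed) projective tensor product of the Banach spaces $E_1,\ldots,E_n$. All operators are linear and continuous. An operator between Banach spaces is weakly compact if it maps bounded sets to relatively weakly compact sets, and completely continuous if it maps weakly convergent sequences to norm convergent sequences. A Banach space $E$ has the Dunford-Pettis Property (DPP) if, for every Banach space $F$, every weakly compact operator from $E$ into $F$ is completely continuous. A topological space is scattered if every nonempty subset has an isolated point in its relative topology. *)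

theory Defs
  imports "HOL-Analysis.Analysis" "HOL-Algebra.Module"
begin

text \<open>
  Spaces are modules in the sense of HOL-Algebra with a norm added.  Carriers and operations are
  explicit, so that one can quantify over Banach spaces inside a formula.  The scalar type \<open>'k\<close> is
  meant to be \<open>real\<close> or \<open>complex\<close>; the fields \<open>mult\<close> and \<open>one\<close> that the module record inherits from
  rings are irrelevant.
\<close>

record ('k, 'e) normed_module = "('k, 'e) module" +
  vnorm :: "'e \<Rightarrow> real"

text \<open>The scalar field serves both as the ring of scalars and as a one-dimensional space.\<close>

definition scalars :: "('k::real_normed_field, 'k) normed_module" where
  "scalars = \<lparr>carrier = UNIV, monoid.mult = (*), one = 1, zero = 0, add = (+), smult = (*), vnorm = norm\<rparr>"

text \<open>
  The library locale \<^locale>\<open>Metric_space\<close> asks for symmetry and non-negativity outside of the carrier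
  as well, hence the default value.
\<close>

definition vdist :: "('k, 'e) normed_module \<Rightarrow> 'e \<Rightarrow> 'e \<Rightarrow> real" where
  "vdist E x y = (if x \<in> carrier E \<and> y \<in> carrier E then vnorm E (x \<ominus>\<^bsub>E\<^esub> y) else 0)"

locale normed_space = Module.module scalars E
  for E :: "('k::real_normed_field, 'e) normed_module" (structure) +
  assumes vnorm_eq_0: "x \<in> carrier E \<Longrightarrow> vnorm E x = 0 \<longleftrightarrow> x = \<zero>"
    and vnorm_smult: "x \<in> carrier E \<Longrightarrow> vnorm E (c \<odot> x) = norm c * vnorm E x"
    and vnorm_triangle: "x \<in> carrier E \<Longrightarrow> y \<in> carrier E \<Longrightarrow> vnorm E (x \<oplus> y) \<le> vnorm E x + vnorm E y"

locale banach_space = normed_space +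
  assumes complete: "Metric_space.mcomplete (carrier E) (vdist E)"

definition norm_topology :: "('k, 'e) normed_module \<Rightarrow> 'e topology" where
  "norm_topology E = Metric_space.mtopology (carrier E) (vdist E)"

definition linear_map ::
  "('k, 'e) normed_module \<Rightarrow> ('k, 'f) normed_module \<Rightarrow> ('e \<Rightarrow> 'f) \<Rightarrow> bool" where
  "linear_map E F T \<longleftrightarrow> T \<in> carrier E \<rightarrow> carrier F \<and>
     (\<forall>x\<in>carrier E. \<forall>y\<in>carrier E. T (x \<oplus>\<^bsub>E\<^esub> y) = T x \<oplus>\<^bsub>F\<^esub> T y) \<and>
     (\<forall>c. \<forall>x\<in>carrier E. T (c \<odot>\<^bsub>E\<^esub> x) = c \<odot>\<^bsub>F\<^esub> T x)"

definition bounded_operator ::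
  "('k, 'e) normed_module \<Rightarrow> ('k, 'f) normed_module \<Rightarrow> ('e \<Rightarrow> 'f) \<Rightarrow> bool" where
  "bounded_operator E F T \<longleftrightarrow>
     linear_map E F T \<and> continuous_map (norm_topology E) (norm_topology F) T"

definition weak_topology :: "('k::real_normed_field, 'e) normed_module \<Rightarrow> 'e topology" where
  "weak_topology E = topology_generated_by
     {{x \<in> carrier E. \<phi> x \<in> U} |\<phi> U. bounded_operator E scalars \<phi> \<and> open U}"

definition weakly_compact_operator ::
  "('k::real_normed_field, 'e) normed_module \<Rightarrow> ('k, 'f) normed_module \<Rightarrow> ('e \<Rightarrow> 'f) \<Rightarrow> bool" where
  "weakly_compact_operator E F T \<longleftrightarrow> bounded_operator E F T \<and>
     (\<forall>B. Metric_space.mbounded (carrier E) (vdist E) B \<longrightarrow>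
        compactin (weak_topology F) (weak_topology F closure_of (T ` B)))"

definition completely_continuous ::
  "('k::real_normed_field, 'e) normed_module \<Rightarrow> ('k, 'f) normed_module \<Rightarrow> ('e \<Rightarrow> 'f) \<Rightarrow> bool" where
  "completely_continuous E F T \<longleftrightarrow> bounded_operator E F T \<and>
     (\<forall>s. range s \<subseteq> carrier E \<longrightarrow> (\<exists>x. limitin (weak_topology E) s x sequentially) \<longrightarrow>
        (\<exists>y. limitin (norm_topology F) (T \<circ> s) y sequentially))"

text \<open>
  HOL cannot quantify over types inside a formula, so the Banach spaces \<open>F\<close> are taken with carrier
  in the type \<open>(nat \<Rightarrow> 'e) + 'f\<close>.  Here \<open>'f\<close> is an arbitrary type parameter: a statement that is
  polymorphic in \<open>'f\<close> speaks about Banach spaces carried by any type whatsoever.  The left summand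
  makes every instance strong enough on its own: an operator on \<open>E\<close> may be replaced by its
  corestriction to the closure of its range, whose points are limits of sequences \<open>T \<circ> s\<close>
  with \<open>s :: nat \<Rightarrow> 'e\<close>.
\<close>

definition dunford_pettis ::
  "'f itself \<Rightarrow> ('k::real_normed_field, 'e) normed_module \<Rightarrow> bool" where
  "dunford_pettis _ E \<longleftrightarrow>
     (\<forall>(F :: ('k, (nat \<Rightarrow> 'e) + 'f) normed_module) T.
        banach_space F \<longrightarrow> weakly_compact_operator E F T \<longrightarrow> completely_continuous E F T)"

definition cauchy_seqs :: "('k, 'e) normed_module \<Rightarrow> (nat \<Rightarrow> 'e) set" where
  "cauchy_seqs E = {s. Metric_space.MCauchy (carrier E) (vdist E) s}"

definition cauchy_rel :: "('k, 'e) normed_module \<Rightarrow> ((nat \<Rightarrow> 'e) \<times> (nat \<Rightarrow> 'e)) set" where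
  "cauchy_rel E = {(s, t). s \<in> cauchy_seqs E \<and> t \<in> cauchy_seqs E \<and>
     (\<lambda>k. vdist E (s k) (t k)) \<longlonglongrightarrow> 0}"

definition completion :: "('k, 'e) normed_module \<Rightarrow> ('k, (nat \<Rightarrow> 'e) set) normed_module" where
  "completion E =
     \<lparr>carrier = cauchy_seqs E // cauchy_rel E,
      monoid.mult = undefined, one = undefined,
      zero = cauchy_rel E `` {\<lambda>_. \<zero>\<^bsub>E\<^esub>},
      add = (\<lambda>X Y. \<Union>s\<in>X. \<Union>t\<in>Y. cauchy_rel E `` {\<lambda>k. s k \<oplus>\<^bsub>E\<^esub> t k}),
      smult = (\<lambda>c X. \<Union>s\<in>X. cauchy_rel E `` {\<lambda>k. c \<odot>\<^bsub>E\<^esub> s k}),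
      vnorm = (\<lambda>X. the_elem ((\<lambda>s. lim (\<lambda>k. vnorm E (s k))) ` X))\<rparr>"

definition multilinear_forms ::
  "nat \<Rightarrow> (nat \<Rightarrow> ('k::real_normed_field, 'e) normed_module) \<Rightarrow> ((nat \<Rightarrow> 'e) \<Rightarrow> 'k) set" where
  "multilinear_forms n E =
     {A. \<forall>x \<in> (\<Pi>\<^sub>E i\<in>{..<n}. carrier (E i)). \<forall>i<n. linear_map (E i) scalars (\<lambda>y. A (x(i := y)))}"

text \<open>
  The algebraic tensor product of \<open>E 0, \<dots>, E (n - 1)\<close> is, as usual, realised inside
  the dual of the space of all (not necessarily continuous) \<open>n\<close>-linear forms, with \<open>x\<^sub>0 \<otimes> \<dots> \<otimes> x\<^bsub>n-1\<^esub>\<close> the evaluation at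
  \<open>(x\<^sub>0, \<dots>, x\<^bsub>n-1\<^esub>)\<close>.
\<close>

definition elementary_tensor ::
  "nat \<Rightarrow> (nat \<Rightarrow> ('k::real_normed_field, 'e) normed_module) \<Rightarrow> (nat \<Rightarrow> 'e) \<Rightarrow>
     (((nat \<Rightarrow> 'e) \<Rightarrow> 'k) \<Rightarrow> 'k)" where
  "elementary_tensor n E x = (\<lambda>A\<in>multilinear_forms n E. A x)"

text \<open>
  \<open>u = \<Sum>j<m. x\<^sub>j\<^sub>,\<^sub>0 \<otimes> \<dots> \<otimes> x\<^sub>j\<^sub>,\<^bsub>n-1\<^esub>\<close>.  For \<open>n > 0\<close> scalar coefficients can be absorbed into one
  of the factors, so the elements with such a representation form the span of the elementary
  tensors.
\<close>

definition tensor_rep ::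
  "nat \<Rightarrow> (nat \<Rightarrow> ('k::real_normed_field, 'e) normed_module) \<Rightarrow> (((nat \<Rightarrow> 'e) \<Rightarrow> 'k) \<Rightarrow> 'k) \<Rightarrow>
     nat \<Rightarrow> (nat \<Rightarrow> nat \<Rightarrow> 'e) \<Rightarrow> bool" where
  "tensor_rep n E u m x \<longleftrightarrow>
     (\<forall>j<m. x j \<in> (\<Pi>\<^sub>E i\<in>{..<n}. carrier (E i))) \<and>
     u = (\<lambda>A\<in>multilinear_forms n E. \<Sum>j<m. elementary_tensor n E (x j) A)"

definition algebraic_tensor ::
  "nat \<Rightarrow> (nat \<Rightarrow> ('k::real_normed_field, 'e) normed_module) \<Rightarrow>
     ('k, ((nat \<Rightarrow> 'e) \<Rightarrow> 'k) \<Rightarrow> 'k) normed_module" where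
  "algebraic_tensor n E =
     \<lparr>carrier = {u. \<exists>m x. tensor_rep n E u m x},
      monoid.mult = undefined, one = undefined,
      zero = (\<lambda>A\<in>multilinear_forms n E. 0),
      add = (\<lambda>u v. \<lambda>A\<in>multilinear_forms n E. u A + v A),
      smult = (\<lambda>c u. \<lambda>A\<in>multilinear_forms n E. c * u A),
      vnorm = (\<lambda>u. Inf {\<Sum>j<m. \<Prod>i<n. vnorm (E i) (x j i) |m x. tensor_rep n E u m x})\<rparr>"

definition projective_tensor ::
  "nat \<Rightarrow> (nat \<Rightarrow> ('k::real_normed_field, 'e) normed_module) \<Rightarrow>
     ('k, (nat \<Rightarrow> ((nat \<Rightarrow> 'e) \<Rightarrow> 'k) \<Rightarrow> 'k) set) normed_module" where
  "projective_tensor n E = completion (algebraic_tensor n E)"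

text \<open>Functions on the space are represented by extensional functions on the underlying type.\<close>

definition C_space :: "'a topology \<Rightarrow> ('k::real_normed_field, 'a \<Rightarrow> 'k) normed_module" where
  "C_space K =
     \<lparr>carrier = {f \<in> extensional (topspace K). continuous_map K euclidean f},
      monoid.mult = undefined, one = undefined,
      zero = (\<lambda>t\<in>topspace K. 0),
      add = (\<lambda>f g. \<lambda>t\<in>topspace K. f t + g t),
      smult = (\<lambda>c f. \<lambda>t\<in>topspace K. c * f t),
      vnorm = (\<lambda>f. SUP t\<in>topspace K. norm (f t))\<rparr>"

definition scattered_space :: "'a topology \<Rightarrow> bool" where
  "scattered_space X \<longleftrightarrow>
     (\<forall>S. S \<subseteq> topspace X \<longrightarrow> S \<noteq> {} \<longrightarrow> (\<exists>x\<in>S. openin (subtopology X S) {x}))"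

end

(*
  If all factors are scattered, every bounded sequence in C(K_i) has a pointwise convergent subsequence.
  For a weakly compact operator T on the tensor product, T(x_k) is norm null for sequences of elementary
  tensors with at least one pointwise null factor: Orlicz-Pettis settles factors with weakly subseries
  convergent sums, and truncation reduces pointwise null factors to those.  Hence T maps the elementary
  tensors of norm at most 1 onto a relatively norm compact set, so that finitely many of the functionals
  psi o T with |psi| <= 1 approximate all the others, and T is completely continuous.

  If K_i is not scattered, a dyadic tree of open sets around a dense-in-itself subset yields Rademacher-like
  functions f_k and a positive functional for which they are orthonormal, so that Bessel's inequality gives an
  operator from C(K_i) to l^2 taking f_k to the k-th unit vector.  In another factor choose disjoint bumps g_k,
  with peaks t_k.  The operator x (x) y |-> (q_k(x) y(t_k))_k into l^2 is weakly compact and sends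
  f_k (x) g_k to the unit vectors, while a Riesz product argument shows that f_k (x) g_k is weakly null.
*)
theory Submission
  imports Defs "HOL-Complex_Analysis.Great_Picard"
begin

section \<open>Normed modules\<close>

text \<open>Two obstacles shape the positive direction. Weak compactness of T only speaks about
  subseries that converge weakly, so one needs series of elementary tensors that are weakly
  unconditionally Cauchy although several factors vary at once. Averaging over signs provides them:
  it bounds the diagonal terms of a product of sums by the bound for the product itself. Moreover,
  pointwise null sequences need not be absolutely summing; truncation therefore compares each
  function with running maxima, whose increments telescope.

  In the other direction, sums of N tensors f_k (x) g_k with unimodular coefficients must have norm
  O(sqrt N). Scaling f_k by 1 / sqrt N keeps the complex Riesz product of the factors 1 - i e_k f_k
  below sqrt e in modulus, whereas real factors 1 + e_k f_k could grow like exp (sqrt N). The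
  product is carried as a pair of real functions to serve both scalar fields. Measures are replaced
  by positive functionals: a Hahn-Banach limit of averages over the finite levels of the
  tree.\<close>

lemma scalars_simps [simp]:
  "carrier scalars = UNIV" "a \<otimes>\<^bsub>scalars\<^esub> b = a * b" "\<one>\<^bsub>scalars\<^esub> = 1" "\<zero>\<^bsub>scalars\<^esub> = 0"
  "a \<oplus>\<^bsub>scalars\<^esub> b = a + b" "c \<odot>\<^bsub>scalars\<^esub> a = c * a" "vnorm scalars = norm"
  by (simp_all add: scalars_def)

lemma cring_scalars: "cring (scalars :: ('k::real_normed_field, 'k) normed_module)"
proof (rule cringI)
  show "abelian_group (scalars :: ('k, 'k) normed_module)"
  proof (rule abelian_groupI)
    show "\<exists>y\<in>carrier scalars. y \<oplus>\<^bsub>scalars\<^esub> x = \<zero>\<^bsub>scalars\<^esub>" for x :: 'k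
      by (rule bexI[of _ "- x"]) simp_all
  qed (simp_all add: add_ac)
  show "comm_monoid (scalars :: ('k, 'k) normed_module)"
    by (rule comm_monoidI) (simp_all add: mult_ac)
qed (simp add: distrib_right)

text \<open>The additive inverse of x is supplied as (-1) x through \<open>sl\<close> and
  \<open>s0\<close>, and the norm of zero is obtained by scaling with 0. An instance has to check
  closure, the algebraic laws, definiteness and the two norm laws.\<close>

lemma normed_spaceI:
  fixes E :: "('k::real_normed_field, 'e) normed_module" (structure)
  assumes "\<And>x y. x \<in> carrier E \<Longrightarrow> y \<in> carrier E \<Longrightarrow> x \<oplus> y \<in> carrier E"
    and "\<zero> \<in> carrier E"
    and "\<And>x y z. x \<in> carrier E \<Longrightarrow> y \<in> carrier E \<Longrightarrow> z \<in> carrier E \<Longrightarrow> (x \<oplus> y) \<oplus> z = x \<oplus> (y \<oplus> z)"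
    and "\<And>x y. x \<in> carrier E \<Longrightarrow> y \<in> carrier E \<Longrightarrow> x \<oplus> y = y \<oplus> x"
    and "\<And>x. x \<in> carrier E \<Longrightarrow> \<zero> \<oplus> x = x"
    and smc: "\<And>c x. x \<in> carrier E \<Longrightarrow> c \<odot> x \<in> carrier E"
    and sl: "\<And>a b x. x \<in> carrier E \<Longrightarrow> (a + b) \<odot> x = a \<odot> x \<oplus> b \<odot> x"
    and "\<And>a x y. x \<in> carrier E \<Longrightarrow> y \<in> carrier E \<Longrightarrow> a \<odot> (x \<oplus> y) = a \<odot> x \<oplus> a \<odot> y"
    and "\<And>a b x. x \<in> carrier E \<Longrightarrow> (a * b) \<odot> x = a \<odot> (b \<odot> x)"
    and s1: "\<And>x. x \<in> carrier E \<Longrightarrow> 1 \<odot> x = x"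
    and s0: "\<And>x. x \<in> carrier E \<Longrightarrow> 0 \<odot> x = \<zero>"
    and "\<And>x. x \<in> carrier E \<Longrightarrow> vnorm E x = 0 \<Longrightarrow> x = \<zero>"
    and ns: "\<And>c x. x \<in> carrier E \<Longrightarrow> vnorm E (c \<odot> x) = norm c * vnorm E x"
    and "\<And>x y. x \<in> carrier E \<Longrightarrow> y \<in> carrier E \<Longrightarrow> vnorm E (x \<oplus> y) \<le> vnorm E x + vnorm E y"
  shows "normed_space E"
proof -
  have inv: "\<exists>y\<in>carrier E. y \<oplus> x = \<zero>" if "x \<in> carrier E" for x
    using sl[OF that, of "-1" 1] smc[OF that, of "-1"] s1[OF that] s0[OF that] by auto
  have "abelian_group E"
    by (intro abelian_groupI assms(1-5) inv) assumption+
  then have "Module.module scalars E"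
    by (rule moduleI[OF cring_scalars]) (simp_all add: assms(6-10))
  moreover have "vnorm E \<zero> = 0"
    using ns[OF assms(2), of 0] s0[OF assms(2)] by simp
  then have "vnorm E x = 0 \<longleftrightarrow> x = \<zero>" if "x \<in> carrier E" for x
    using assms(12)[OF that] by auto
  ultimately show ?thesis
    by (intro normed_space.intro normed_space_axioms.intro assms(13,14))
qed

lemma normed_space_scalars: "normed_space (scalars :: ('k::real_normed_field, 'k) normed_module)"
  by (rule normed_spaceI) (simp_all add: algebra_simps norm_mult norm_triangle_ineq)

context normed_space
begin

lemma smult_in [simp, intro]: "x \<in> carrier E \<Longrightarrow> c \<odot> x \<in> carrier E"
  and smult_add_left: "x \<in> carrier E \<Longrightarrow> (a + b) \<odot> x = a \<odot> x \<oplus> b \<odot> x"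
  and smult_add_right: "x \<in> carrier E \<Longrightarrow> y \<in> carrier E \<Longrightarrow> a \<odot> (x \<oplus> y) = a \<odot> x \<oplus> a \<odot> y"
  and smult_smult: "x \<in> carrier E \<Longrightarrow> a \<odot> (b \<odot> x) = (a * b) \<odot> x"
  and smult_1 [simp]: "x \<in> carrier E \<Longrightarrow> 1 \<odot> x = x"
  and smult_0 [simp]: "x \<in> carrier E \<Longrightarrow> 0 \<odot> x = \<zero>"
  and smult_zero [simp]: "c \<odot> \<zero> = \<zero>"
  using smult_closed[of c x] smult_l_distr[of a b x] smult_r_distr[of a x y] smult_assoc1[of a b x] smult_one[of x]
    smult_l_null[of x] smult_r_null[of c]
  by simp_all

lemma minus_eq_smult: "x \<in> carrier E \<Longrightarrow> \<ominus> x = (-1) \<odot> x"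
  using smult_add_left[of x "-1" 1] by (simp add: M.minus_equality)

lemma diff_eq_smult: "x \<in> carrier E \<Longrightarrow> y \<in> carrier E \<Longrightarrow> x \<ominus> y = x \<oplus> (-1) \<odot> y"
  by (simp add: M.minus_eq minus_eq_smult)

lemma vnorm_zero [simp]: "vnorm E \<zero> = 0"
  by (simp add: vnorm_eq_0)

lemma vnorm_minus: "x \<in> carrier E \<Longrightarrow> vnorm E (\<ominus> x) = vnorm E x"
  by (simp add: minus_eq_smult vnorm_smult)

lemma vnorm_nonneg [simp]: "x \<in> carrier E \<Longrightarrow> 0 \<le> vnorm E x"
  using vnorm_triangle[of x "\<ominus> x"] by (simp add: M.r_neg vnorm_minus)

lemma diff_in [simp, intro]: "x \<in> carrier E \<Longrightarrow> y \<in> carrier E \<Longrightarrow> x \<ominus> y \<in> carrier E"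
  by simp

lemma diff_add_diff:
  "x \<in> carrier E \<Longrightarrow> y \<in> carrier E \<Longrightarrow> z \<in> carrier E \<Longrightarrow> (x \<ominus> y) \<oplus> (y \<ominus> z) = x \<ominus> z"
  by (simp add: M.minus_eq M.a_ac M.r_neg2 M.r_neg1)

lemma add_diff_add:
  "x \<in> carrier E \<Longrightarrow> y \<in> carrier E \<Longrightarrow> z \<in> carrier E \<Longrightarrow> w \<in> carrier E \<Longrightarrow>
   (x \<oplus> y) \<ominus> (z \<oplus> w) = (x \<ominus> z) \<oplus> (y \<ominus> w)"
  by (simp add: M.minus_eq M.a_ac M.minus_add)

lemma smult_diff:
  "x \<in> carrier E \<Longrightarrow> y \<in> carrier E \<Longrightarrow> c \<odot> (x \<ominus> y) = c \<odot> x \<ominus> c \<odot> y"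
  by (simp add: diff_eq_smult smult_add_right smult_smult)

lemma vnorm_diff_commute:
  "x \<in> carrier E \<Longrightarrow> y \<in> carrier E \<Longrightarrow> vnorm E (x \<ominus> y) = vnorm E (y \<ominus> x)"
  using vnorm_minus[of "x \<ominus> y"] by (simp add: M.minus_eq M.minus_add M.a_comm)

lemma vnorm_diff_triangle:
  "x \<in> carrier E \<Longrightarrow> y \<in> carrier E \<Longrightarrow> z \<in> carrier E \<Longrightarrow> vnorm E (x \<ominus> z) \<le> vnorm E (x \<ominus> y) + vnorm E (y \<ominus> z)"
  using vnorm_triangle[of "x \<ominus> y" "y \<ominus> z"] by (simp add: diff_add_diff)

lemma diff_zero [simp]: "x \<in> carrier E \<Longrightarrow> x \<ominus> \<zero> = x"
  by (simp add: M.minus_eq)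

lemma diff_self [simp]: "x \<in> carrier E \<Longrightarrow> x \<ominus> x = \<zero>"
  by (simp add: M.minus_eq M.r_neg)

lemma add_diff_cancel: "x \<in> carrier E \<Longrightarrow> y \<in> carrier E \<Longrightarrow> y \<oplus> (x \<ominus> y) = x"
  by (simp add: M.minus_eq M.a_ac M.r_neg M.r_neg2 M.r_neg1)

lemma diff_eq_zero_iff: "x \<in> carrier E \<Longrightarrow> y \<in> carrier E \<Longrightarrow> x \<ominus> y = \<zero> \<longleftrightarrow> x = y"
  using add_diff_cancel by fastforce

lemma vnorm_triangle_sub: "x \<in> carrier E \<Longrightarrow> y \<in> carrier E \<Longrightarrow> vnorm E x \<le> vnorm E y + vnorm E (x \<ominus> y)"
  using vnorm_triangle[of y "x \<ominus> y"] by (simp add: add_diff_cancel)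

lemma abs_vnorm_diff:
  "x \<in> carrier E \<Longrightarrow> y \<in> carrier E \<Longrightarrow> \<bar>vnorm E x - vnorm E y\<bar> \<le> vnorm E (x \<ominus> y)"
  using vnorm_triangle_sub[of x y] vnorm_triangle_sub[of y x] vnorm_diff_commute[of x y] by linarith

lemma Metric_space_vdist: "Metric_space (carrier E) (vdist E)"
  by unfold_locales
    (auto simp: vdist_def vnorm_diff_commute vnorm_eq_0 diff_eq_zero_iff vnorm_diff_triangle)

end

sublocale normed_space \<subseteq> metric: Metric_space "carrier E" "vdist E"
  by (rule Metric_space_vdist)

context normed_space
begin

lemma MCauchy_iff:
  "metric.MCauchy s \<longleftrightarrow>
     range s \<subseteq> carrier E \<and> (\<forall>\<epsilon>>0. \<exists>N. \<forall>m\<ge>N. \<forall>n\<ge>N. vnorm E (s m \<ominus> s n) < \<epsilon>)"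
proof -
  have "vdist E (s m) (s n) = vnorm E (s m \<ominus> s n)" if "range s \<subseteq> carrier E" for m n
    using that by (auto simp: vdist_def)
  then show ?thesis
    unfolding metric.MCauchy_def by metis
qed

text \<open>\<open>vdist\<close> takes the default value 0 off the carrier, so its values are norms
  of differences only for sequences inside it; hence the premise on the range.\<close>

lemma limitin_norm_iff:
  assumes "range s \<subseteq> carrier E"
  shows "limitin (norm_topology E) s x sequentially \<longleftrightarrow>
    x \<in> carrier E \<and> (\<lambda>k. vnorm E (s k \<ominus> x)) \<longlonglongrightarrow> 0"
proof (cases "x \<in> carrier E")
  case True
  have s: "s k \<in> carrier E" for k
    using assms by auto
  have "dist (vnorm E (s k \<ominus> x)) 0 = vdist E (s k) x" for k
    using True s by (simp add: vdist_def)
  then show ?thesis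
    using True s unfolding norm_topology_def metric.limitin_metric tendsto_iff by simp
qed (simp add: norm_topology_def metric.limitin_metric)

lemma mbounded_iff:
  "metric.mbounded B \<longleftrightarrow> B \<subseteq> carrier E \<and> (\<exists>C. \<forall>x\<in>B. vnorm E x \<le> C)"
proof
  assume "metric.mbounded B"
  then obtain a C where B: "B \<subseteq> metric.mcball a C"
    by (auto simp: metric.mbounded_def)
  have "vnorm E x \<le> vnorm E a + C" if "x \<in> B" for x
    using B that vnorm_triangle_sub[of x a] vnorm_diff_commute[of x a] by (fastforce simp: metric.in_mcball vdist_def)
  then show "B \<subseteq> carrier E \<and> (\<exists>C. \<forall>x\<in>B. vnorm E x \<le> C)"
    using B metric.mcball_subset_mspace by blast
next
  assume "B \<subseteq> carrier E \<and> (\<exists>C. \<forall>x\<in>B. vnorm E x \<le> C)"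
  then obtain C where C: "B \<subseteq> carrier E" "\<forall>x\<in>B. vnorm E x \<le> C"
    by blast
  then have "B \<subseteq> metric.mcball \<zero> C"
    by (auto simp: metric.in_mcball vdist_def M.minus_eq vnorm_minus subset_iff)
  then show "metric.mbounded B"
    by (auto simp: metric.mbounded_def)
qed

end

section \<open>Linear and bounded maps\<close>

lemma linear_mapD:
  assumes "linear_map E F T"
  shows "x \<in> carrier E \<Longrightarrow> T x \<in> carrier F"
    and "x \<in> carrier E \<Longrightarrow> y \<in> carrier E \<Longrightarrow> T (x \<oplus>\<^bsub>E\<^esub> y) = T x \<oplus>\<^bsub>F\<^esub> T y"
    and "x \<in> carrier E \<Longrightarrow> T (c \<odot>\<^bsub>E\<^esub> x) = c \<odot>\<^bsub>F\<^esub> T x"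
  using assms by (auto simp: linear_map_def)

lemma linear_map_diff:
  assumes "normed_space E" "normed_space F" "linear_map E F T" "x \<in> carrier E" "y \<in> carrier E"
  shows "T (x \<ominus>\<^bsub>E\<^esub> y) = T x \<ominus>\<^bsub>F\<^esub> T y"
  using assms by (simp add: normed_space.diff_eq_smult normed_space.smult_in linear_mapD)

lemma linear_map_zero:
  assumes "normed_space E" "normed_space F" "linear_map E F T"
  shows "T \<zero>\<^bsub>E\<^esub> = \<zero>\<^bsub>F\<^esub>"
proof -
  interpret E: normed_space E by fact
  interpret F: normed_space F by fact
  show ?thesis
    using linear_mapD(3)[OF assms(3), of "\<zero>\<^bsub>E\<^esub>" 0] linear_mapD(1)[OF assms(3), of "\<zero>\<^bsub>E\<^esub>"] by simp
qed

lemma linear_functional_diff: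
  assumes "normed_space E" "linear_map E scalars \<phi>" "x \<in> carrier E" "y \<in> carrier E"
  shows "\<phi> (x \<ominus>\<^bsub>E\<^esub> y) = \<phi> x - \<phi> y"
  using assms by (simp add: normed_space.diff_eq_smult normed_space.smult_in linear_mapD)

lemma bounded_operator_iff:
  fixes E :: "('k::real_normed_field, 'e) normed_module"
  assumes "normed_space E" "normed_space F"
  shows "bounded_operator E F T \<longleftrightarrow>
    linear_map E F T \<and> (\<exists>C. \<forall>x\<in>carrier E. vnorm F (T x) \<le> C * vnorm E x)"
proof -
  interpret E: normed_space E by fact
  interpret F: normed_space F by fact
  have "continuous_map (norm_topology E) (norm_topology F) T \<longleftrightarrow>
      (\<exists>C. \<forall>x\<in>carrier E. vnorm F (T x) \<le> C * vnorm E x)" (is "?l \<longleftrightarrow> ?r")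
    if T: "linear_map E F T"
  proof
    assume ?l
    then have "\<forall>a\<in>carrier E. \<forall>\<epsilon>>0. \<exists>\<delta>>0. \<forall>x. x \<in> carrier E \<and> vdist E a x < \<delta> \<longrightarrow> vdist F (T a) (T x) < \<epsilon>"
      unfolding norm_topology_def E.metric.metric_continuous_map[OF F.Metric_space_vdist] by blast
    then obtain d where d: "d > 0" and
      *: "\<And>x. x \<in> carrier E \<Longrightarrow> vdist E \<zero>\<^bsub>E\<^esub> x < d \<Longrightarrow> vdist F (T \<zero>\<^bsub>E\<^esub>) (T x) < 1"
      by (meson E.M.zero_closed zero_less_one)
    have small: "vnorm F (T x) < 1" if "x \<in> carrier E" "vnorm E x < d" for x
      using *[of x] that linear_mapD(1)[OF T] linear_map_zero[OF assms T]
      by (simp add: vdist_def E.vnorm_diff_commute[of "\<zero>\<^bsub>E\<^esub>"] F.vnorm_diff_commute[of "\<zero>\<^bsub>F\<^esub>"])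
    \<comment> \<open>Rescaling x to norm d/2 puts it into the ball on which T stays below 1; this
      is the origin of the constant 2/d.\<close>
    have "vnorm F (T x) \<le> (2/d) * vnorm E x" if x: "x \<in> carrier E" for x
    proof (cases "x = \<zero>\<^bsub>E\<^esub>")
      case True
      then show ?thesis
        using linear_map_zero[OF assms T] by simp
    next
      case False
      then have pos: "vnorm E x > 0"
        using x E.vnorm_eq_0[of x] E.vnorm_nonneg[of x] by linarith
      define c :: 'k where "c = of_real (d / (2 * vnorm E x))"
      have "norm c = d / (2 * vnorm E x)"
        using pos d unfolding c_def norm_of_real by simp
      moreover have "vnorm F (T (c \<odot>\<^bsub>E\<^esub> x)) < 1"
        using small[of "c \<odot>\<^bsub>E\<^esub> x"] x pos d \<open>norm c = _\<close> by (simp add: E.vnorm_smult)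
      ultimately have "d / (2 * vnorm E x) * vnorm F (T x) < 1"
        using x linear_mapD[OF T] by (simp add: F.vnorm_smult)
      then show ?thesis
        using pos d by (simp add: field_simps)
    qed
    then show ?r by blast
  next
    assume ?r
    then obtain C where C: "\<And>x. x \<in> carrier E \<Longrightarrow> vnorm F (T x) \<le> C * vnorm E x"
      by blast
    \<comment> \<open>|C| + 1 replaces C because it is positive, so that \<epsilon> / (|C| + 1) can
      serve as \<delta>.\<close>
    have C': "vdist F (T a) (T x) \<le> (\<bar>C\<bar> + 1) * vdist E a x" if "a \<in> carrier E" "x \<in> carrier E" for a x
    proof -
      have "vdist F (T a) (T x) = vnorm F (T (a \<ominus>\<^bsub>E\<^esub> x))"
        using that linear_mapD(1)[OF T] by (simp add: vdist_def linear_map_diff[OF assms T])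
      also have "\<dots> \<le> C * vnorm E (a \<ominus>\<^bsub>E\<^esub> x)"
        using that by (intro C) auto
      also have "\<dots> \<le> (\<bar>C\<bar> + 1) * vnorm E (a \<ominus>\<^bsub>E\<^esub> x)"
        using that by (intro mult_right_mono) auto
      finally show ?thesis
        using that by (simp add: vdist_def)
    qed
    show ?l
      unfolding norm_topology_def E.metric.metric_continuous_map[OF F.Metric_space_vdist]
    proof (intro conjI ballI allI impI)
      show "T ` carrier E \<subseteq> carrier F"
        using linear_mapD(1)[OF T] by auto
      fix a and \<epsilon> :: real assume a: "a \<in> carrier E" "\<epsilon> > 0"
      have "vdist F (T a) (T x) < \<epsilon>" if "x \<in> carrier E" "vdist E a x < \<epsilon> / (\<bar>C\<bar> + 1)" for x
      proof -
        have "(\<bar>C\<bar> + 1) * vdist E a x < \<epsilon>"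
          using that by (simp add: field_simps)
        then show ?thesis
          using C'[OF a(1) that(1)] by linarith
      qed
      then show "\<exists>\<delta>>0. \<forall>x. x \<in> carrier E \<and> vdist E a x < \<delta> \<longrightarrow> vdist F (T a) (T x) < \<epsilon>"
        using a by (intro exI[of _ "\<epsilon> / (\<bar>C\<bar> + 1)"]) auto
    qed
  qed
  then show ?thesis
    by (auto simp: bounded_operator_def)
qed

lemma bounded_functional_iff:
  assumes "normed_space E"
  shows "bounded_operator E scalars \<phi> \<longleftrightarrow>
    linear_map E scalars \<phi> \<and> (\<exists>C. \<forall>x\<in>carrier E. norm (\<phi> x) \<le> C * vnorm E x)"
  using bounded_operator_iff[OF assms normed_space_scalars, of \<phi>] by simp

lemma bounded_operatorE:
  assumes "normed_space E" "normed_space F" "bounded_operator E F T"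
  obtains C where "C > 0" "linear_map E F T" "\<And>x. x \<in> carrier E \<Longrightarrow> vnorm F (T x) \<le> C * vnorm E x"
proof -
  obtain C where C: "linear_map E F T" "\<And>x. x \<in> carrier E \<Longrightarrow> vnorm F (T x) \<le> C * vnorm E x"
    using assms bounded_operator_iff by blast
  have "vnorm F (T x) \<le> (\<bar>C\<bar> + 1) * vnorm E x" if "x \<in> carrier E" for x
    using C(2)[OF that] mult_right_mono[of C "\<bar>C\<bar> + 1" "vnorm E x"] normed_space.vnorm_nonneg[OF assms(1) that] by linarith
  then show thesis
    using that[of "\<bar>C\<bar> + 1"] C by auto
qed

lemma bounded_operator_compose:
  assumes "bounded_operator E F T" "bounded_operator F G S"
  shows "bounded_operator E G (\<lambda>x. S (T x))"
  using assms continuous_map_compose[of "norm_topology E" "norm_topology F" T "norm_topology G" S]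
  by (auto simp: bounded_operator_def linear_map_def o_def Pi_iff)

text \<open>Being eventually in every member that contains l passes to finite intersections and
  arbitrary unions; this is the induction over \<open>generate_topology_on\<close>.\<close>

lemma limitin_topology_generated_by:
  "limitin (topology_generated_by S) f l F \<longleftrightarrow>
     l \<in> \<Union>S \<and> (\<forall>U\<in>S. l \<in> U \<longrightarrow> (\<forall>\<^sub>F x in F. f x \<in> U))" (is "?l \<longleftrightarrow> ?r")
proof
  assume ?l
  then show ?r
    by (auto simp: limitin_def topology_generated_by_Basis)
next
  assume r: ?r
  have "l \<in> U \<Longrightarrow> \<forall>\<^sub>F x in F. f x \<in> U" if "generate_topology_on S U" for U
    using that
  proof induction
    case (UN K)
    then obtain k where "k \<in> K" "l \<in> k"
      by auto
    then show ?case
      using UN.IH[of k] by (auto elim: eventually_mono)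
  qed (use r in \<open>auto simp: eventually_conj_iff\<close>)
  then show ?l
    using r unfolding limitin_def by (simp add: openin_topology_generated_by_iff)
qed

section \<open>The weak topology and cluster points\<close>

lemma zero_functional: "normed_space E \<Longrightarrow> bounded_operator E scalars (\<lambda>_. 0)"
  by (auto simp: bounded_functional_iff linear_map_def intro!: exI[of _ 0])

lemma topspace_weak_topology:
  assumes "normed_space E"
  shows "topspace (weak_topology E) = carrier E"
proof -
  \<comment> \<open>The zero functional, with the whole field for U, makes the carrier itself a
    subbasic set.\<close>
  have "carrier E \<in> {{x \<in> carrier E. \<phi> x \<in> U} |\<phi> U. bounded_operator E scalars \<phi> \<and> open U}"
    using zero_functional[OF assms] by (intro CollectI exI[of _ "\<lambda>_. 0"] exI[of _ UNIV]) auto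
  then show ?thesis
    unfolding weak_topology_def topology_generated_by_topspace by blast
qed

lemma limitin_weak_iff:
  fixes E :: "('k::real_normed_field, 'e) normed_module"
  assumes "normed_space E" "range s \<subseteq> carrier E"
  shows "limitin (weak_topology E) s x F \<longleftrightarrow>
    x \<in> carrier E \<and> (\<forall>\<phi>. bounded_operator E scalars \<phi> \<longrightarrow> ((\<lambda>k. \<phi> (s k)) \<longlongrightarrow> \<phi> x) F)"
proof -
  let ?S = "{{x \<in> carrier E. \<phi> x \<in> U} |\<phi> U. bounded_operator E scalars \<phi> \<and> open U}"
  have "\<Union>?S = carrier E"
    using topspace_weak_topology[OF assms(1)] by (simp add: weak_topology_def)
  then have "limitin (weak_topology E) s x F \<longleftrightarrow> x \<in> carrier E \<and> (\<forall>U\<in>?S. x \<in> U \<longrightarrow> (\<forall>\<^sub>F k in F. s k \<in> U))"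
    unfolding weak_topology_def limitin_topology_generated_by by simp
  also have "\<dots> \<longleftrightarrow> x \<in> carrier E \<and> (\<forall>\<phi> U. bounded_operator E scalars \<phi> \<longrightarrow> open U \<longrightarrow> \<phi> x \<in> U \<longrightarrow> (\<forall>\<^sub>F k in F. \<phi> (s k) \<in> U))"
    (is "_ \<longleftrightarrow> _ \<and> ?r")
  proof -
    have "(\<forall>U\<in>{f \<phi> U |\<phi> U. P \<phi> U}. Q U) \<longleftrightarrow> (\<forall>\<phi> U. P \<phi> U \<longrightarrow> Q (f \<phi> U))"
      for f :: "('e \<Rightarrow> 'k) \<Rightarrow> 'k set \<Rightarrow> 'e set" and P Q
      by blast
    then have "(\<forall>U\<in>?S. x \<in> U \<longrightarrow> (\<forall>\<^sub>F k in F. s k \<in> U)) \<longleftrightarrow>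
      (\<forall>\<phi> U. bounded_operator E scalars \<phi> \<and> open U \<longrightarrow> x \<in> {x \<in> carrier E. \<phi> x \<in> U} \<longrightarrow>
        (\<forall>\<^sub>F k in F. s k \<in> {x \<in> carrier E. \<phi> x \<in> U}))"
      .
    then show ?thesis
      using assms(2) by (auto simp: image_subset_iff)
  qed
  finally show ?thesis
    by (auto simp: tendsto_def)
qed

lemma openin_weak_topology:
  "bounded_operator E scalars \<phi> \<Longrightarrow> open U \<Longrightarrow> openin (weak_topology E) {x \<in> carrier E. \<phi> x \<in> U}"
  unfolding weak_topology_def by (rule topology_generated_by_Basis) blast

text \<open>If every point of C had a neighbourhood that the sequence eventually leaves, finitely
  many of these would cover C. Weak topologies need not be metrizable, so a cluster point stands in
  for the limit of a subsequence.\<close>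

lemma compactin_imp_cluster_point:
  assumes "compactin X C" "range z \<subseteq> C"
  obtains y where "y \<in> C" "\<And>U. openin X U \<Longrightarrow> y \<in> U \<Longrightarrow> \<exists>\<^sub>F k in sequentially. z k \<in> U"
proof -
  have "\<exists>y\<in>C. \<forall>U. openin X U \<longrightarrow> y \<in> U \<longrightarrow> (\<exists>\<^sub>F k in sequentially. z k \<in> U)"
  proof (rule ccontr)
    assume "\<not> ?thesis"
    then obtain U where U: "\<And>y. y \<in> C \<Longrightarrow> openin X (U y) \<and> y \<in> U y \<and> (\<forall>\<^sub>F k in sequentially. z k \<notin> U y)"
      unfolding not_frequently[symmetric] by metis
    then have "C \<subseteq> \<Union>(U ` C)" "\<forall>V\<in>U ` C. openin X V"
      by auto
    then obtain \<F> where \<F>: "finite \<F>" "\<F> \<subseteq> U ` C" "C \<subseteq> \<Union>\<F>"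
      using assms(1) unfolding compactin_def by meson
    then have "\<forall>\<^sub>F k in sequentially. \<forall>V\<in>\<F>. z k \<notin> V"
      using U by (intro eventually_ball_finite) auto
    from eventually_happens'[OF sequentially_bot this] obtain k where "\<forall>V\<in>\<F>. z k \<notin> V"
      by (rule exE)
    moreover have "z k \<in> \<Union>\<F>"
      using \<F>(3) assms(2) by (meson range_subsetD subsetD)
    ultimately show False
      by blast
  qed
  then show thesis
    using that by blast
qed

section \<open>The Hahn--Banach theorem\<close>

text \<open>Conjugation, written so that it makes sense for \<open>real\<close> and \<open>complex\<close> alike.\<close>

definition conj_scalar :: "'k::{real_normed_field,euclidean_space} \<Rightarrow> 'k" where
  "conj_scalar x = (norm x)\<^sup>2 *\<^sub>R inverse x"

lemma mult_conj_scalar: "x * conj_scalar x = of_real ((norm x)\<^sup>2)"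
  by (cases "x = 0") (simp_all add: conj_scalar_def scaleR_conv_of_real)

lemma norm_conj_scalar [simp]: "norm (conj_scalar x) = norm x"
  by (cases "x = 0") (simp_all add: conj_scalar_def norm_inverse power2_eq_square)

text \<open>Polarization (\<open>dot_norm\<close>) reduces this to multiplicativity of the norm. It
  ties the inner product of the scalar type to its multiplication.\<close>

lemma inner_mult_mult_left: "(x * y) \<bullet> (x * z) = (norm x)\<^sup>2 * (y \<bullet> z)"
  for x :: "'k::{real_normed_field,euclidean_space}"
  unfolding dot_norm distrib_left[symmetric] norm_mult power_mult_distrib by (simp add: algebra_simps)

text \<open>Writing z as x times \<open>inverse x * z\<close> reduces this to the previous lemma.
  Additivity of the conjugate is read off from this adjointness, and so is homogeneity of the
  functional in \<open>Hahn_Banach_seminorm\<close>.\<close>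

lemma inner_mult_left_conj: "(x * y) \<bullet> z = y \<bullet> (conj_scalar x * z)"
proof (cases "x = 0")
  case False
  then have "(x * y) \<bullet> z = (x * y) \<bullet> (x * (inverse x * z))"
    by (simp add: mult.assoc[symmetric])
  also have "\<dots> = y \<bullet> (conj_scalar x * z)"
    unfolding inner_mult_mult_left by (simp add: conj_scalar_def)
  finally show ?thesis .
qed (simp add: conj_scalar_def)

lemma conj_scalar_add: "conj_scalar (x + y) = conj_scalar x + conj_scalar y"
proof -
  have "z \<bullet> conj_scalar (x + y) = z \<bullet> (conj_scalar x + conj_scalar y)" for z
    using inner_mult_left_conj[of "x + y" z 1] inner_mult_left_conj[of x z 1] inner_mult_left_conj[of y z 1]
    by (simp add: algebra_simps inner_add_left inner_add_right)
  then show ?thesis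
    by (metis vector_eq_ldot)
qed

lemma conj_scalar_scaleR: "conj_scalar (r *\<^sub>R x) = r *\<^sub>R conj_scalar x"
  unfolding conj_scalar_def norm_scaleR power_mult_distrib power2_abs
  by (cases "r = 0") (simp_all add: power2_eq_square inverse_scaleR_distrib)

lemma conj_scalar_mult: "conj_scalar (x * y) = conj_scalar x * conj_scalar y"
  by (simp add: conj_scalar_def norm_mult power_mult_distrib)

lemma conj_scalar_conj [simp]: "conj_scalar (conj_scalar x) = x"
proof (cases "x = 0")
  case False
  have "conj_scalar (conj_scalar x) = (norm x)\<^sup>2 *\<^sub>R inverse (conj_scalar x)"
    by (simp add: conj_scalar_def[of "conj_scalar x"])
  also have "\<dots> = ((norm x)\<^sup>2 * inverse ((norm x)\<^sup>2)) *\<^sub>R x"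
    by (simp add: conj_scalar_def inverse_scaleR_distrib)
  also have "(norm x)\<^sup>2 * inverse ((norm x)\<^sup>2) = 1"
    using False by simp
  finally show ?thesis
    by simp
qed (simp add: conj_scalar_def)

lemma conj_scalar_zero [simp]: "conj_scalar 0 = 0"
  by (simp add: conj_scalar_def)

lemma conj_scalar_sum: "conj_scalar (\<Sum>i\<in>A. f i) = (\<Sum>i\<in>A. conj_scalar (f i))"
  by (induction A rule: infinite_finite_induct) (simp_all add: conj_scalar_add)

section \<open>Sublinear functionals\<close>

definition sublinear_on :: "('k::real_normed_field, 'e) normed_module \<Rightarrow> ('e \<Rightarrow> real) \<Rightarrow> bool" where
  "sublinear_on E p \<longleftrightarrow>
     (\<forall>x\<in>carrier E. \<forall>y\<in>carrier E. p (x \<oplus>\<^bsub>E\<^esub> y) \<le> p x + p y) \<and>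
     (\<forall>t\<ge>0. \<forall>x\<in>carrier E. p (of_real t \<odot>\<^bsub>E\<^esub> x) = t * p x)"

lemma sublinear_onD:
  assumes "sublinear_on E p"
  shows "x \<in> carrier E \<Longrightarrow> y \<in> carrier E \<Longrightarrow> p (x \<oplus>\<^bsub>E\<^esub> y) \<le> p x + p y"
    and "t \<ge> 0 \<Longrightarrow> x \<in> carrier E \<Longrightarrow> p (of_real t \<odot>\<^bsub>E\<^esub> x) = t * p x"
  using assms by (auto simp: sublinear_on_def)

context normed_space
begin

lemma sublinear_on_zero:
  assumes "sublinear_on E p"
  shows "p \<zero> = 0"
  using sublinear_onD(2)[OF assms, of 0 \<zero>] by simp

lemma sublinear_on_minus:
  assumes "sublinear_on E p" "x \<in> carrier E"
  shows "- p (\<ominus> x) \<le> p x"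
  using sublinear_onD(1)[OF assms(1), of x "\<ominus> x"] assms sublinear_on_zero[OF assms(1)] by (simp add: M.r_neg)

text \<open>Lowering a sublinear functional so that it becomes linear along \<open>z\<close>.\<close>

lemma sublinear_on_lower:
  assumes p: "sublinear_on E p" and z: "z \<in> carrier E"
  obtains q where "sublinear_on E q" "\<And>x. x \<in> carrier E \<Longrightarrow> q x \<le> p x"
    "\<And>x. x \<notin> carrier E \<Longrightarrow> q x = 0"
    "\<And>x t. x \<in> carrier E \<Longrightarrow> t \<ge> 0 \<Longrightarrow> q x \<le> p (x \<oplus> of_real t \<odot> z) - t * p z"
proof -
  \<comment> \<open>For x = -z the choice t = 1 gives at most p 0 - p z = -p z, which is linearity
    along z; t = 0 shows that the infimum stays below p.\<close>
  define S where "S x = {p (x \<oplus> of_real t \<odot> z) - t * p z |t. t \<ge> 0}" for x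
  \<comment> \<open>The value 0 off the carrier makes a lowered functional comparable, as a total
    function, with the one it comes from; the minimality argument below compares functions
    everywhere.\<close>
  define q where "q x = (if x \<in> carrier E then Inf (S x) else 0)" for x
  have ne: "S x \<noteq> {}" for x
    by (auto simp: S_def intro: exI[of _ 0])
  \<comment> \<open>Subadditivity for (x + t z) + (-x) = t z bounds all members of
    \<open>S x\<close> from below.\<close>
  have lb: "- p (\<ominus> x) \<le> a" if "x \<in> carrier E" "a \<in> S x" for x a
  proof -
    obtain t where t: "t \<ge> 0" "a = p (x \<oplus> of_real t \<odot> z) - t * p z"
      using \<open>a \<in> S x\<close> by (auto simp: S_def)
    have "t * p z = p ((x \<oplus> of_real t \<odot> z) \<oplus> (\<ominus> x))"
      using t z that(1) sublinear_onD(2)[OF p t(1) z] by (simp add: M.a_ac M.r_neg M.r_neg2 M.r_neg1)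
    also have "\<dots> \<le> p (x \<oplus> of_real t \<odot> z) + p (\<ominus> x)"
      using z that by (intro sublinear_onD(1)[OF p]) auto
    finally show ?thesis
      using t by simp
  qed
  have bdd: "bdd_below (S x)" if "x \<in> carrier E" for x
    using lb[OF that] by (auto simp: bdd_below_def)
  have le: "q x \<le> a" if "x \<in> carrier E" "a \<in> S x" for x a
    using that bdd by (auto simp: q_def intro: cInf_lower)
  have ge: "c \<le> q x" if "x \<in> carrier E" "\<And>a. a \<in> S x \<Longrightarrow> c \<le> a" for x c
    using that ne[of x] by (auto simp: q_def intro: cInf_greatest)
  have q_le: "q x \<le> p (x \<oplus> of_real t \<odot> z) - t * p z" if "x \<in> carrier E" "t \<ge> 0" for x t
    using that by (intro le) (auto simp: S_def)
  have scale: "q (of_real c \<odot> x) \<le> c * q x" if x: "x \<in> carrier E" and c: "c > 0" for c x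
  proof -
    have "q (of_real c \<odot> x) / c \<le> q x"
    proof (rule ge[OF x])
      fix a assume "a \<in> S x"
      then obtain t where t: "t \<ge> 0" "a = p (x \<oplus> of_real t \<odot> z) - t * p z"
        by (auto simp: S_def)
      have "q (of_real c \<odot> x) \<le> p (of_real c \<odot> x \<oplus> of_real (c * t) \<odot> z) - (c * t) * p z"
        using x c t by (intro q_le) auto
      also have "of_real c \<odot> x \<oplus> of_real (c * t) \<odot> z = of_real c \<odot> (x \<oplus> of_real t \<odot> z)"
        using x z by (simp add: smult_add_right smult_smult)
      also have "p \<dots> - (c * t) * p z = c * a"
        using c x z t(1) sublinear_onD(2)[OF p, of c "x \<oplus> of_real t \<odot> z"] by (simp add: t(2) algebra_simps)
      finally show "q (of_real c \<odot> x) / c \<le> a"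
        using c by (simp add: field_simps)
    qed
    then show ?thesis
      using c by (simp add: field_simps)
  qed
  have "sublinear_on E q"
    unfolding sublinear_on_def
  proof (intro conjI ballI allI impI)
    fix x y assume xy: "x \<in> carrier E" "y \<in> carrier E"
    have "q (x \<oplus> y) - b \<le> q x" if "b \<in> S y" for b
    proof (rule ge[OF xy(1)])
      fix a assume "a \<in> S x"
      then obtain s where s: "s \<ge> 0" "a = p (x \<oplus> of_real s \<odot> z) - s * p z"
        by (auto simp: S_def)
      obtain t where t: "t \<ge> 0" "b = p (y \<oplus> of_real t \<odot> z) - t * p z"
        using \<open>b \<in> S y\<close> by (auto simp: S_def)
      have "q (x \<oplus> y) \<le> p ((x \<oplus> y) \<oplus> of_real (s + t) \<odot> z) - (s + t) * p z"
        using xy s t by (intro q_le) auto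
      also have "(x \<oplus> y) \<oplus> of_real (s + t) \<odot> z = (x \<oplus> of_real s \<odot> z) \<oplus> (y \<oplus> of_real t \<odot> z)"
        using xy z by (simp add: smult_add_left M.a_ac)
      also have "p \<dots> \<le> p (x \<oplus> of_real s \<odot> z) + p (y \<oplus> of_real t \<odot> z)"
        using xy z by (intro sublinear_onD(1)[OF p]) auto
      finally show "q (x \<oplus> y) - b \<le> a"
        using s t by (simp add: algebra_simps)
    qed
    then have "q (x \<oplus> y) - q x \<le> q y"
      by (intro ge[OF xy(2)]) (auto simp: algebra_simps)
    then show "q (x \<oplus> y) \<le> q x + q y"
      by simp
  next
    fix t :: real and x assume t: "0 \<le> t" and x: "x \<in> carrier E"
    show "q (of_real t \<odot> x) = t * q x"
    proof (cases "t = 0")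
      case True
      have "S \<zero> = {0}"
        using z by (auto simp: S_def sublinear_onD(2)[OF p] sublinear_on_zero[OF p] intro!: exI[of _ 0])
      then show ?thesis
        using True x by (simp add: q_def)
    next
      case False
      then have "q (of_real (1/t) \<odot> (of_real t \<odot> x)) \<le> 1/t * q (of_real t \<odot> x)"
        using t x by (intro scale) auto
      moreover have "of_real (1/t) \<odot> (of_real t \<odot> x) = x"
        using False x by (simp add: smult_smult flip: of_real_mult)
      ultimately show ?thesis
        using scale[OF x, of t] False t by (simp add: field_simps)
    qed
  qed
  moreover have "q x \<le> p x" if "x \<in> carrier E" for x
    using q_le[OF that, of 0] z that by simp
  ultimately show thesis
    using that q_le by (auto simp: q_def)
qed

text \<open>A minimal sublinear functional is linear, for lowering it along any b changes nothing.
  Lowering p along y before Zorn's lemma is applied forces the value at y: whatever lies below p' is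
  at most -p y at -y.\<close>

theorem Hahn_Banach_sublinear:
  assumes p: "sublinear_on E p" and y: "y \<in> carrier E"
  obtains \<psi> where "\<And>a b. a \<in> carrier E \<Longrightarrow> b \<in> carrier E \<Longrightarrow> \<psi> (a \<oplus> b) = \<psi> a + \<psi> b"
    "\<And>t a. a \<in> carrier E \<Longrightarrow> \<psi> (of_real t \<odot> a) = t * \<psi> a"
    "\<And>a. a \<in> carrier E \<Longrightarrow> \<psi> a \<le> p a" "\<psi> y = p y"
proof -
  obtain p' where p': "sublinear_on E p'" "\<And>x. x \<in> carrier E \<Longrightarrow> p' x \<le> p x"
    "\<And>x. x \<notin> carrier E \<Longrightarrow> p' x = 0"
    "\<And>x t. x \<in> carrier E \<Longrightarrow> t \<ge> 0 \<Longrightarrow> p' x \<le> p (x \<oplus> of_real t \<odot> y) - t * p y"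
    using sublinear_on_lower[OF p y] by blast
  define A where "A = {q. sublinear_on E q \<and> q \<le> p' \<and> (\<forall>x. x \<notin> carrier E \<longrightarrow> q x = 0)}"
  have "\<exists>m\<in>A. \<forall>a\<in>A. a \<le> m \<longrightarrow> a = m"
  \<comment> \<open>The order is reversed, so that the maximal element delivered is a minimal
    functional and chains need lower bounds.\<close>
  proof (rule predicate_Zorn)
    show "partial_order_on A (relation_of (\<lambda>m a. a \<le> m) A)"
      by (auto simp: partial_order_on_def preorder_on_def refl_on_def trans_def antisym_def relation_of_def)
  next
    fix C assume C: "C \<in> Chains (relation_of (\<lambda>m a. a \<le> m) A)"
    then have CA: "C \<subseteq> A" and chain: "\<And>a b. a \<in> C \<Longrightarrow> b \<in> C \<Longrightarrow> a \<le> b \<or> b \<le> a"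
      by (auto simp: Chains_def relation_of_def)
    show "\<exists>u\<in>A. \<forall>a\<in>C. u \<le> a"
    proof (cases "C = {}")
      case True
      then show ?thesis
        using p' by (auto simp: A_def)
    next
      case False
      define u where "u x = (INF q\<in>C. q x)" for x
      \<comment> \<open>A lower bound common to the whole chain, which makes its pointwise infimum
        finite.\<close>
      have lb: "- p' (\<ominus> x) \<le> q x" if "q \<in> C" "x \<in> carrier E" for q x
      proof -
        have "sublinear_on E q" "q (\<ominus> x) \<le> p' (\<ominus> x)"
          using that CA by (auto simp: A_def le_fun_def)
        then show ?thesis
          using sublinear_on_minus[of q x] that by simp
      qed
      have bdd: "bdd_below ((\<lambda>q. q x) ` C)" for x
      proof (cases "x \<in> carrier E")
        case True
        then show ?thesis
          using lb[of _ x] by (auto simp: bdd_below_def)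
      next
        case False
        show ?thesis
        proof (rule bdd_belowI2)
          fix q assume "q \<in> C"
          then have "q x = 0"
            using CA False by (auto simp: A_def)
          then show "0 \<le> q x"
            by simp
        qed
      qed
      have ule: "u x \<le> q x" if "q \<in> C" for q x
        unfolding u_def using bdd that by (intro cINF_lower) auto
      have uge: "c \<le> u x" if "\<And>q. q \<in> C \<Longrightarrow> c \<le> q x" for c x
        unfolding u_def using False that by (intro cINF_greatest) auto
      have "sublinear_on E u"
        unfolding sublinear_on_def
      proof (intro conjI ballI allI impI)
        fix a b assume ab: "a \<in> carrier E" "b \<in> carrier E"
        have "u (a \<oplus> b) - q' b \<le> u a" if "q' \<in> C" for q'
        proof (rule uge)
          fix q assume q: "q \<in> C"
          \<comment> \<open>Subadditivity of an infimum needs one functional below both q and q';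
            comparability in the chain provides it.\<close>
          define r where "r = (if q \<le> q' then q else q')"
          have r: "r \<in> C" "r \<le> q" "r \<le> q'"
            using chain[OF q that] q that by (auto simp: r_def)
          have "u (a \<oplus> b) \<le> r (a \<oplus> b)"
            using ule[OF r(1)] .
          also have "\<dots> \<le> r a + r b"
            using r CA ab by (intro sublinear_onD(1)[of E]) (auto simp: A_def)
          finally show "u (a \<oplus> b) - q' b \<le> q a"
            using le_funD[OF r(2), of a] le_funD[OF r(3), of b] by linarith
        qed
        then have "u (a \<oplus> b) - u a \<le> u b"
          by (intro uge) (auto simp: algebra_simps)
        then show "u (a \<oplus> b) \<le> u a + u b"
          by simp
      next
        fix t :: real and x assume t: "0 \<le> t" and x: "x \<in> carrier E"
        have eq: "q (of_real t \<odot> x) = t * q x" if "q \<in> C" for q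
          using that CA t x sublinear_onD(2)[of E q t x] by (auto simp: A_def)
        show "u (of_real t \<odot> x) = t * u x"
        proof (cases "t = 0")
          case True
          have "(INF q\<in>C. q (of_real t \<odot> x)) = (INF q\<in>C. 0)"
            using eq True by (intro INF_cong) auto
          then show ?thesis
            using True False by (simp add: u_def)
        next
          case F: False
          have "u (of_real t \<odot> x) / t \<le> u x"
          proof (rule uge)
            fix q assume "q \<in> C"
            then have "u (of_real t \<odot> x) \<le> t * q x"
              using ule[of q "of_real t \<odot> x"] eq[of q] by simp
            then show "u (of_real t \<odot> x) / t \<le> q x"
              using F t by (simp add: field_simps)
          qed
          moreover have "t * u x \<le> u (of_real t \<odot> x)"
          proof (rule uge)
            fix q assume "q \<in> C"
            then show "t * u x \<le> q (of_real t \<odot> x)"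
              using ule[of q x] eq[of q] t by (simp add: mult_left_mono)
          qed
          ultimately show ?thesis
            using F t by (simp add: field_simps)
        qed
      qed
      moreover have "u \<le> p'"
      proof (rule le_funI)
        fix x
        obtain q where "q \<in> C"
          using False by blast
        then have "q \<le> p'"
          using CA by (auto simp: A_def)
        then show "u x \<le> p' x"
          using ule[OF \<open>q \<in> C\<close>, of x] le_funD[of q p' x] by linarith
      qed
      moreover have "u x = 0" if "x \<notin> carrier E" for x
      proof -
        have "(INF q\<in>C. q x) = (INF q\<in>C. 0)"
          using that CA by (intro INF_cong) (auto simp: A_def)
        then show ?thesis
          using False by (simp add: u_def)
      qed
      ultimately have "u \<in> A"
        by (simp add: A_def)
      then show ?thesis
        using ule by (auto simp: le_fun_def)
    qed
  qed
  then obtain q where q: "sublinear_on E q" "q \<le> p'" "\<And>x. x \<notin> carrier E \<Longrightarrow> q x = 0"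
    and min: "\<And>r. sublinear_on E r \<Longrightarrow> r \<le> p' \<Longrightarrow> (\<And>x. x \<notin> carrier E \<Longrightarrow> r x = 0) \<Longrightarrow> r \<le> q \<Longrightarrow> r = q"
    by (auto simp: A_def)
  have add: "q (a \<oplus> b) = q a + q b" if ab: "a \<in> carrier E" "b \<in> carrier E" for a b
  proof -
    obtain r where r: "sublinear_on E r" "\<And>x. x \<in> carrier E \<Longrightarrow> r x \<le> q x"
      "\<And>x. x \<notin> carrier E \<Longrightarrow> r x = 0"
      "\<And>x t. x \<in> carrier E \<Longrightarrow> t \<ge> 0 \<Longrightarrow> r x \<le> q (x \<oplus> of_real t \<odot> b) - t * q b"
      using sublinear_on_lower[OF q(1) ab(2)] by blast
    have "r \<le> q"
    proof (rule le_funI)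
      fix x show "r x \<le> q x"
        using r(2,3)[of x] q(3)[of x] by (cases "x \<in> carrier E") simp_all
    qed
    \<comment> \<open>By minimality. The bound on r with t = 1 now reads q a \<le> q (a + b) - q b,
      the missing half of additivity.\<close>
    then have "r = q"
      by (intro min r(1,3) order_trans[OF \<open>r \<le> q\<close> q(2)]) assumption
    then show ?thesis
      using r(4)[of a 1] sublinear_onD(1)[OF q(1) ab] ab by simp
  qed
  have minus: "q (\<ominus> a) = - q a" if "a \<in> carrier E" for a
    using add[of a "\<ominus> a"] that sublinear_on_zero[OF q(1)] by (simp add: M.r_neg)
  show thesis
  proof
    show "q (of_real t \<odot> a) = t * q a" if "a \<in> carrier E" for t a
    proof (cases "t \<ge> 0")
      case False
      define b where "b = of_real (- t) \<odot> a"
      have b: "b \<in> carrier E" "of_real t \<odot> a = \<ominus> b"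
        using that by (simp_all add: b_def minus_eq_smult smult_smult)
      have "q b = - t * q a"
        unfolding b_def using False that by (intro sublinear_onD(2)[OF q(1)]) auto
      then show ?thesis
        unfolding b(2) minus[OF b(1)] by simp
    qed (rule sublinear_onD(2)[OF q(1) _ that])
    show "q a \<le> p a" if "a \<in> carrier E" for a
      using le_funD[OF q(2), of a] p'(2)[OF that] by linarith
    have "q (\<ominus> y) \<le> - p y"
      using le_funD[OF q(2), of "\<ominus> y"] p'(4)[of "\<ominus> y" 1] y sublinear_on_zero[OF p] by (simp add: M.l_neg)
    then show "q y = p y"
      using minus[OF y] le_funD[OF q(2), of y] p'(2)[OF y] by linarith
  qed (rule add)
qed

end

text \<open>The scalar functional is recovered from a real one. Over the complex numbers it is
  \<psi> x - i \<psi> (i x); the sum over \<open>Basis\<close> writes this formula for both fields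
  at once.\<close>

theorem Hahn_Banach_seminorm:
  fixes E :: "('k::{real_normed_field,euclidean_space}, 'e) normed_module" (structure)
  assumes "normed_space E"
    and p_add: "\<And>x y. x \<in> carrier E \<Longrightarrow> y \<in> carrier E \<Longrightarrow> p (x \<oplus> y) \<le> p x + p y"
    and p_smult: "\<And>c x. x \<in> carrier E \<Longrightarrow> p (c \<odot> x) = norm c * p x"
    and y: "y \<in> carrier E"
  obtains \<phi> where "linear_map E scalars \<phi>" "\<And>x. x \<in> carrier E \<Longrightarrow> norm (\<phi> x) \<le> p x" "\<phi> y = of_real (p y)"
proof -
  interpret normed_space E by fact
  have "sublinear_on E p"
    using p_add p_smult by (auto simp: sublinear_on_def)
  then obtain \<psi> where add: "\<And>a b. a \<in> carrier E \<Longrightarrow> b \<in> carrier E \<Longrightarrow> \<psi> (a \<oplus> b) = \<psi> a + \<psi> b"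
    and sm: "\<And>t a. a \<in> carrier E \<Longrightarrow> \<psi> (of_real t \<odot> a) = t * \<psi> a"
    and le: "\<And>a. a \<in> carrier E \<Longrightarrow> \<psi> a \<le> p a" and eq: "\<psi> y = p y"
    using Hahn_Banach_sublinear y by blast
  define \<phi> where "\<phi> x = (\<Sum>b\<in>Basis. \<psi> (conj_scalar b \<odot> x) *\<^sub>R b)" for x
  have sum: "\<psi> ((\<Sum>b\<in>B. c b *\<^sub>R d b) \<odot> x) = (\<Sum>b\<in>B. c b * \<psi> (d b \<odot> x))"
    if "x \<in> carrier E" "finite B" for x and B :: "'k set" and c d
    using that(2)
  proof induction
    case empty
    show ?case
      using sm[of \<zero> 0] that(1) by simp
  next
    case (insert b B)
    then show ?case
      using that(1) by (simp add: smult_add_left add scaleR_conv_of_real sm flip: smult_smult)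
  qed
  have inner: "\<phi> x \<bullet> z = \<psi> (conj_scalar z \<odot> x)" if "x \<in> carrier E" for x z
  proof -
    have "conj_scalar z = (\<Sum>b\<in>Basis. (z \<bullet> b) *\<^sub>R conj_scalar b)"
      by (subst (1) euclidean_representation[symmetric, of z]) (simp add: conj_scalar_sum conj_scalar_scaleR)
    then have "\<psi> (conj_scalar z \<odot> x) = (\<Sum>b\<in>Basis. (z \<bullet> b) * \<psi> (conj_scalar b \<odot> x))"
      using sum[OF that finite_Basis] by metis
    then show ?thesis
      by (simp add: \<phi>_def inner_sum_left inner_commute[of z] mult.commute)
  qed
  have lin: "linear_map E scalars \<phi>"
    unfolding linear_map_def
  proof (intro conjI ballI allI)
    fix a b assume "a \<in> carrier E" "b \<in> carrier E"
    then have "(\<phi> (a \<oplus> b)) \<bullet> z = (\<phi> a + \<phi> b) \<bullet> z" for z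
      by (simp add: inner inner_add_left smult_add_right add)
    then show "\<phi> (a \<oplus> b) = \<phi> a \<oplus>\<^bsub>scalars\<^esub> \<phi> b"
      by (metis vector_eq_rdot scalars_simps(5))
  next
    fix c a assume "a \<in> carrier E"
    then have "(\<phi> (c \<odot> a)) \<bullet> z = (c * \<phi> a) \<bullet> z" for z
      by (simp add: inner inner_mult_left_conj smult_smult conj_scalar_mult mult.commute)
    then show "\<phi> (c \<odot> a) = c \<odot>\<^bsub>scalars\<^esub> \<phi> a"
      by (metis vector_eq_rdot scalars_simps(6))
  qed auto
  \<comment> \<open>Testing with z = \<phi> x turns the square of |\<phi> x| into the value of
    \<psi> at conj (\<phi> x) x, where p equals |\<phi> x| p x.\<close>
  have bound: "norm (\<phi> x) \<le> p x" if x: "x \<in> carrier E" for x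
  proof -
    have "(norm (\<phi> x))\<^sup>2 \<le> p (conj_scalar (\<phi> x) \<odot> x)"
      using inner[OF x, of "\<phi> x"] le[of "conj_scalar (\<phi> x) \<odot> x"] x by (simp add: dot_square_norm)
    then have "norm (\<phi> x) * norm (\<phi> x) \<le> norm (\<phi> x) * p x"
      using p_smult[OF x] by (simp add: power2_eq_square)
    moreover have "0 \<le> p x"
      using p_add[of x "(-1) \<odot> x"] x p_smult[of x "-1"] p_smult[of \<zero> 0] smult_add_left[of x 1 "-1"] by simp
    ultimately show ?thesis
      by (cases "\<phi> x = 0") auto
  qed
  have "conj_scalar 1 = (1::'k)"
    by (simp add: conj_scalar_def)
  then have "\<phi> y \<bullet> 1 = p y"
    using inner[OF y, of 1] y eq by simp
  moreover have "0 \<le> p y"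
    using bound[OF y] norm_ge_zero order_trans by blast
  moreover have "\<phi> y \<bullet> of_real (p y) = p y * (\<phi> y \<bullet> 1)"
    by (simp add: of_real_def)
  \<comment> \<open>The component of \<phi> y along 1 is already p y, so |\<phi> y| \<le> p y leaves
    no room for another component.\<close>
  ultimately have "(norm (\<phi> y - of_real (p y)))\<^sup>2 = (norm (\<phi> y))\<^sup>2 - (p y)\<^sup>2"
    using dot_norm_neg[of "\<phi> y" "of_real (p y)"] by (simp add: power2_eq_square field_simps)
  then have "(norm (\<phi> y - of_real (p y)))\<^sup>2 \<le> 0"
    using power_mono[OF bound[OF y] norm_ge_zero, of 2] by simp
  then show thesis
    using that lin bound by simp
qed

lemma norming_functional:
  fixes E :: "('k::{real_normed_field,euclidean_space}, 'e) normed_module"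
  assumes "normed_space E" "y \<in> carrier E"
  obtains \<phi> where "linear_map E scalars \<phi>" "\<And>x. x \<in> carrier E \<Longrightarrow> norm (\<phi> x) \<le> vnorm E x" "\<phi> y = of_real (vnorm E y)"
proof -
  interpret normed_space E by fact
  show thesis
    using Hahn_Banach_seminorm[of E "vnorm E" y] that assms vnorm_triangle vnorm_smult by blast
qed

lemma bounded_functionalI:
  assumes "normed_space E" "linear_map E scalars \<phi>" "\<And>x. x \<in> carrier E \<Longrightarrow> norm (\<phi> x) \<le> C * vnorm E x"
  shows "bounded_operator E scalars \<phi>"
  unfolding bounded_functional_iff[OF assms(1)] using assms(2,3) by blast

section \<open>Spaces of continuous functions\<close>

abbreviation continuous_fun :: "'a topology \<Rightarrow> ('a \<Rightarrow> 'b::topological_space) \<Rightarrow> bool" where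
  "continuous_fun K f \<equiv> continuous_map K euclidean f"

lemma continuous_fun_mult:
  fixes f g :: "'a \<Rightarrow> 'k::real_normed_algebra"
  shows "continuous_fun K f \<Longrightarrow> continuous_fun K g \<Longrightarrow> continuous_fun K (\<lambda>t. f t * g t)"
  by (simp add: continuous_map_atin tendsto_mult)

lemma continuous_fun_of_real:
  "continuous_fun K f \<Longrightarrow> continuous_fun K (\<lambda>t. of_real (f t) :: 'k::real_normed_algebra_1)"
  by (simp add: continuous_map_atin tendsto_of_real)

lemma continuous_fun_const [simp]: "continuous_fun K (\<lambda>_. c)"
  by simp

lemma continuous_fun_add:
  fixes f g :: "'a \<Rightarrow> 'k::real_normed_vector"
  shows "continuous_fun K f \<Longrightarrow> continuous_fun K g \<Longrightarrow> continuous_fun K (\<lambda>t. f t + g t)"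
  by (simp add: continuous_map_atin tendsto_add)

lemma continuous_fun_diff:
  fixes f g :: "'a \<Rightarrow> 'k::real_normed_vector"
  shows "continuous_fun K f \<Longrightarrow> continuous_fun K g \<Longrightarrow> continuous_fun K (\<lambda>t. f t - g t)"
  by (simp add: continuous_map_atin tendsto_diff)

lemma continuous_fun_norm:
  fixes f :: "'a \<Rightarrow> 'k::real_normed_vector"
  shows "continuous_fun K f \<Longrightarrow> continuous_fun K (\<lambda>t. norm (f t))"
  by (simp add: continuous_map_atin tendsto_norm)

lemma continuous_fun_restrict [simp]:
  "continuous_fun K (restrict f (topspace K)) \<longleftrightarrow> continuous_fun K f"
  by (rule iffI; erule continuous_map_eq) simp_all

lemma C_space_simps:
  "carrier (C_space K) = {f \<in> extensional (topspace K). continuous_fun K f}"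
  "\<zero>\<^bsub>C_space K\<^esub> = (\<lambda>t\<in>topspace K. 0)"
  "f \<oplus>\<^bsub>C_space K\<^esub> g = (\<lambda>t\<in>topspace K. f t + g t)"
  "c \<odot>\<^bsub>C_space K\<^esub> f = (\<lambda>t\<in>topspace K. c * f t)"
  "vnorm (C_space K) f = (SUP t\<in>topspace K. norm (f t))"
  by (simp_all add: C_space_def)

lemma C_space_carrierD: "f \<in> carrier (C_space K) \<Longrightarrow> continuous_fun K f"
  by (simp add: C_space_simps)

lemma restrict_in_C_space [simp]:
  "restrict f (topspace K) \<in> carrier (C_space K) \<longleftrightarrow> continuous_fun K f"
  by (simp add: C_space_simps)

lemma restrict_C_space [simp]: "f \<in> carrier (C_space K) \<Longrightarrow> restrict f (topspace K) = f"
  by (simp add: C_space_simps extensional_restrict)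

lemma continuous_fun_bounded:
  fixes f :: "'a \<Rightarrow> 'k::real_normed_vector"
  assumes "compact_space K" "continuous_fun K f"
  obtains c where "c > 0" "\<And>t. t \<in> topspace K \<Longrightarrow> norm (f t) \<le> c"
proof -
  have "compact (f ` topspace K)"
    using assms image_compactin[of K "topspace K" euclidean f] by (simp add: compact_space_def)
  then have "bounded (f ` topspace K)"
    by (rule compact_imp_bounded)
  then show thesis
    using that by (auto simp: bounded_pos)
qed

lemma C_space_norm_le:
  assumes "compact_space K" "continuous_fun K f" "t \<in> topspace K"
  shows "norm (f t) \<le> vnorm (C_space K) f"
proof -
  obtain c where "\<And>t. t \<in> topspace K \<Longrightarrow> norm (f t) \<le> c"
    using continuous_fun_bounded[OF assms(1,2)] by blast
  then show ?thesis
    using assms(3) unfolding C_space_simps by (intro cSUP_upper bdd_aboveI2[where M = c])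
qed

lemma C_space_vnorm_le:
  assumes "topspace K \<noteq> {}" "\<And>t. t \<in> topspace K \<Longrightarrow> norm (f t) \<le> c"
  shows "vnorm (C_space K) f \<le> c"
  using assms unfolding C_space_simps by (intro cSUP_least) auto

lemma normed_space_C_space:
  assumes "compact_space K" "topspace K \<noteq> {}"
  shows "normed_space (C_space K :: ('k::real_normed_field, 'a \<Rightarrow> 'k) normed_module)"
proof (rule normed_spaceI; (simp only: C_space_simps(1-4))?)
  fix x :: "'a \<Rightarrow> 'k" and c
  assume x: "x \<in> {f \<in> extensional (topspace K). continuous_fun K f}"
  then have cx: "continuous_fun K x"
    by simp
  show "x = (\<lambda>t\<in>topspace K. 0)" if "vnorm (C_space K) x = 0"
  proof
    fix t show "x t = (\<lambda>t\<in>topspace K. 0) t"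
      using C_space_norm_le[OF assms(1) cx, of t] that x by (auto simp: extensional_def)
  qed
  show "vnorm (C_space K) (\<lambda>t\<in>topspace K. c * x t) = norm c * vnorm (C_space K) x"
  proof (cases "c = 0")
    case True
    then show ?thesis
      using assms by (simp add: C_space_simps cong: SUP_cong_simp)
  next
    case False
    have cc: "continuous_fun K (\<lambda>t\<in>topspace K. c * x t)"
      using cx by (simp add: continuous_fun_mult)
    have "norm (x t) \<le> vnorm (C_space K) (\<lambda>t\<in>topspace K. c * x t) / norm c" if "t \<in> topspace K" for t
      using C_space_norm_le[OF assms(1) cc that] False that by (simp add: norm_mult field_simps)
    then have "vnorm (C_space K) x \<le> vnorm (C_space K) (\<lambda>t\<in>topspace K. c * x t) / norm c"
      using assms by (intro C_space_vnorm_le)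
    then show ?thesis
      using False C_space_norm_le[OF assms(1) cx] assms
      by (intro antisym C_space_vnorm_le) (auto simp: norm_mult field_simps intro!: mult_right_mono)
  qed
  fix y :: "'a \<Rightarrow> 'k"
  assume y: "y \<in> {f \<in> extensional (topspace K). continuous_fun K f}"
  then have cy: "continuous_fun K y"
    by simp
  show "vnorm (C_space K) (\<lambda>t\<in>topspace K. x t + y t) \<le> vnorm (C_space K) x + vnorm (C_space K) y"
    using assms C_space_norm_le[OF assms(1) cx] C_space_norm_le[OF assms(1) cy]
    by (intro C_space_vnorm_le) (auto intro: order_trans[OF norm_triangle_ineq] add_mono)
qed (simp_all add: continuous_fun_add continuous_fun_mult,
  (auto simp: extensional_def restrict_def algebra_simps fun_eq_iff)?)

lemma linear_map_C_space:
  assumes "linear_map (C_space K) scalars L" "continuous_fun K f" "continuous_fun K g"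
  shows "L (\<lambda>t\<in>topspace K. f t + g t) = L (restrict f (topspace K)) + L (restrict g (topspace K))"
    and "L (\<lambda>t\<in>topspace K. c * f t) = c * L (restrict f (topspace K))"
proof -
  have "(\<lambda>t\<in>topspace K. f t + g t) = restrict f (topspace K) \<oplus>\<^bsub>C_space K\<^esub> restrict g (topspace K)"
    by (auto simp: C_space_simps)
  then show "L (\<lambda>t\<in>topspace K. f t + g t) = L (restrict f (topspace K)) + L (restrict g (topspace K))"
    using assms linear_mapD(2)[OF assms(1), of "restrict f (topspace K)" "restrict g (topspace K)"] by simp
  have "(\<lambda>t\<in>topspace K. c * f t) = c \<odot>\<^bsub>C_space K\<^esub> restrict f (topspace K)"
    by (auto simp: C_space_simps)
  then show "L (\<lambda>t\<in>topspace K. c * f t) = c * L (restrict f (topspace K))"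
    using assms linear_mapD(3)[OF assms(1), of "restrict f (topspace K)" c] by simp
qed

lemma continuous_fun_sum_list:
  fixes P :: "('c \<times> ('a \<Rightarrow> 'k::real_normed_field)) list"
  assumes "\<And>a h. (a, h) \<in> set P \<Longrightarrow> continuous_fun K h"
  shows "continuous_fun K (\<lambda>t. \<Sum>(a, h)\<leftarrow>P. w a * h t)"
  using assms by (induction P) (auto intro!: continuous_fun_add continuous_fun_mult)

lemma linear_map_C_space_sum_list:
  fixes P :: "('c \<times> ('a \<Rightarrow> 'k::real_normed_field)) list"
  assumes L: "linear_map (C_space K) scalars L" and "\<And>a h. (a, h) \<in> set P \<Longrightarrow> continuous_fun K h"
  shows "L (\<lambda>t\<in>topspace K. \<Sum>(a, h)\<leftarrow>P. w a * h t) = (\<Sum>(a, h)\<leftarrow>P. w a * L (restrict h (topspace K)))"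
  using assms(2)
proof (induction P)
  case Nil
  show ?case
    using linear_map_C_space(2)[OF L, of "\<lambda>_. 0" "\<lambda>_. 0" 0] by (simp only: list.map sum_list.Nil mult_zero_left continuous_fun_const)
next
  case (Cons p P)
  obtain a h where p: "p = (a, h)"
    by force
  have h: "continuous_fun K h"
    using Cons.prems[of a h] p by simp
  have "L (\<lambda>t\<in>topspace K. w a * h t + (\<Sum>(a, h)\<leftarrow>P. w a * h t)) =
      L (\<lambda>t\<in>topspace K. w a * h t) + L (\<lambda>t\<in>topspace K. \<Sum>(a, h)\<leftarrow>P. w a * h t)"
    using h Cons.prems by (intro linear_map_C_space[OF L] continuous_fun_sum_list continuous_fun_mult) auto
  moreover have "L (\<lambda>t\<in>topspace K. \<Sum>(a, h)\<leftarrow>P. w a * h t) = (\<Sum>(a, h)\<leftarrow>P. w a * L (restrict h (topspace K)))"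
    using Cons.prems by (intro Cons.IH) (meson list.set_intros(2))
  ultimately show ?case
    unfolding p list.map sum_list.Cons prod.case linear_map_C_space(2)[OF L h h] by (simp only:)
qed

text \<open>Every finite set of functions lies in a space on which finitely many point evaluations are
  coordinates.\<close>

lemma interpolation:
  fixes Y :: "('a \<Rightarrow> 'k::real_normed_field) set"
  assumes "finite Y" "\<And>f. f \<in> Y \<Longrightarrow> continuous_fun K f"
  obtains P where "\<And>p h. (p, h) \<in> set P \<Longrightarrow> p \<in> topspace K \<and> continuous_fun K h"
    "\<And>f t. f \<in> Y \<Longrightarrow> t \<in> topspace K \<Longrightarrow> f t = (\<Sum>(p, h)\<leftarrow>P. f p * h t)"
proof -
  have "\<exists>P. (\<forall>(p, h)\<in>set P. p \<in> topspace K \<and> continuous_fun K h) \<and>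
      (\<forall>f\<in>Y. \<forall>t\<in>topspace K. f t = (\<Sum>(p, h)\<leftarrow>P. f p * h t))"
    using assms
  proof induction
    case empty
    show ?case
      by (intro exI[of _ "[]"]) auto
  next
    case (insert f Y)
    obtain P where P: "\<And>p h. (p, h) \<in> set P \<Longrightarrow> p \<in> topspace K \<and> continuous_fun K h"
      and rep: "\<And>g t. g \<in> Y \<Longrightarrow> t \<in> topspace K \<Longrightarrow> g t = (\<Sum>(p, h)\<leftarrow>P. g p * h t)"
      using insert by fastforce
    \<comment> \<open>The residual of f under the interpolation at the old nodes. If it vanishes, P
      still works; otherwise a point where it does not vanish becomes a new node.\<close>
    define r where "r t = f t - (\<Sum>(p, h)\<leftarrow>P. f p * h t)" for t
    have r: "continuous_fun K r"
      unfolding r_def using insert.prems P by (intro continuous_fun_diff continuous_fun_sum_list) auto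
    show ?case
    proof (cases "\<forall>t\<in>topspace K. r t = 0")
      case True
      then show ?thesis
        using P rep by (intro exI[of _ P]) (auto simp: r_def)
    next
      case False
      then obtain s where s: "s \<in> topspace K" "r s \<noteq> 0"
        by blast
      define r' where "r' t = r t * inverse (r s)" for t
      \<comment> \<open>r' is 1 at the new node s, and every old function is corrected by a multiple
        of r' so as to vanish there. Members of Y are already reproduced at s, so for them nothing
        changes.\<close>
      define Q where "Q = (s, r') # map (\<lambda>(p, h). (p, \<lambda>t. h t - h s * r' t)) P"
      have r': "continuous_fun K r'"
        unfolding r'_def using r by (intro continuous_fun_mult) auto
      have *: "(\<Sum>(p, h)\<leftarrow>map (\<lambda>(p, h). (p, \<lambda>t. h t - h s * r' t)) P'. g p * h t) =
          (\<Sum>(p, h)\<leftarrow>P'. g p * h t) - (\<Sum>(p, h)\<leftarrow>P'. g p * h s) * r' t" for g t and P' :: "('a \<times> ('a \<Rightarrow> 'k)) list"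
        by (induction P') (auto simp: algebra_simps)
      have Q: "(\<Sum>(p, h)\<leftarrow>Q. g p * h t) = (\<Sum>(p, h)\<leftarrow>P. g p * h t) + (g s - (\<Sum>(p, h)\<leftarrow>P. g p * h s)) * r' t" for g t
        using *[of g t P] by (simp add: Q_def algebra_simps)
      have "g t = (\<Sum>(p, h)\<leftarrow>Q. g p * h t)" if "g \<in> insert f Y" "t \<in> topspace K" for g t
      proof (cases "g = f")
        case True
        have "f s - (\<Sum>(p, h)\<leftarrow>P. f p * h s) = r s" "f t = (\<Sum>(p, h)\<leftarrow>P. f p * h t) + r t"
          by (simp_all add: r_def)
        moreover have "r s * r' t = r t"
          using s by (simp add: r'_def)
        ultimately show ?thesis
          unfolding True Q by simp
      next
        case False
        then have "g \<in> Y"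
          using that by simp
        then show ?thesis
          using rep[of g t] rep[of g s] that s by (simp add: Q)
      qed
      moreover have "\<forall>(p, h)\<in>set Q. p \<in> topspace K \<and> continuous_fun K h"
        using P s r' by (auto simp: Q_def intro!: continuous_fun_diff continuous_fun_mult)
      ultimately show ?thesis
        by (intro exI[of _ Q]) blast
    qed
  qed
  then show thesis
    using that by blast
qed

section \<open>Algebraic tensor products\<close>

lemma algebraic_tensor_simps:
  "carrier (algebraic_tensor n E) = {u. \<exists>m x. tensor_rep n E u m x}"
  "\<zero>\<^bsub>algebraic_tensor n E\<^esub> = (\<lambda>A\<in>multilinear_forms n E. 0)"
  "u \<oplus>\<^bsub>algebraic_tensor n E\<^esub> v = (\<lambda>A\<in>multilinear_forms n E. u A + v A)"
  "c \<odot>\<^bsub>algebraic_tensor n E\<^esub> u = (\<lambda>A\<in>multilinear_forms n E. c * u A)"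
  "vnorm (algebraic_tensor n E) u = Inf {\<Sum>j<m. \<Prod>i<n. vnorm (E i) (x j i) |m x. tensor_rep n E u m x}"
  by (simp_all add: algebraic_tensor_def)

lemma multilinear_formsD:
  "A \<in> multilinear_forms n E \<Longrightarrow> x \<in> (\<Pi>\<^sub>E i\<in>{..<n}. carrier (E i)) \<Longrightarrow> i < n \<Longrightarrow>
    linear_map (E i) scalars (\<lambda>y. A (x(i := y)))"
  by (auto simp: multilinear_forms_def)

lemma multilinear_formsI:
  "(\<And>x i. x \<in> (\<Pi>\<^sub>E i\<in>{..<n}. carrier (E i)) \<Longrightarrow> i < n \<Longrightarrow> linear_map (E i) scalars (\<lambda>y. A (x(i := y))))
    \<Longrightarrow> A \<in> multilinear_forms n E"
  by (auto simp: multilinear_forms_def)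

lemma PiE_fun_upd_lessThan:
  "x \<in> (\<Pi>\<^sub>E i\<in>{..<n}. S i) \<Longrightarrow> y \<in> S i \<Longrightarrow> i < n \<Longrightarrow> x(i := y) \<in> (\<Pi>\<^sub>E i\<in>{..<n}. S i)"
  by (auto simp: PiE_iff extensional_def)

lemma sum_lessThan_append:
  "(\<Sum>j<m + m'. f (if j < m then x j else y (j - m))) = (\<Sum>j<m. f (x j)) + (\<Sum>j<m'. f (y j))"
  for f :: "'b \<Rightarrow> 'c::comm_monoid_add" and m m' :: nat
  by (induction m') (simp_all add: add.assoc)

lemma tensor_rep_eval:
  "tensor_rep n E u m x \<Longrightarrow> A \<in> multilinear_forms n E \<Longrightarrow> u A = (\<Sum>j<m. A (x j))"
  by (simp add: tensor_rep_def elementary_tensor_def)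

lemma tensor_rep_iff:
  "tensor_rep n E u m x \<longleftrightarrow>
     (\<forall>j<m. x j \<in> (\<Pi>\<^sub>E i\<in>{..<n}. carrier (E i))) \<and> u = (\<lambda>A\<in>multilinear_forms n E. \<Sum>j<m. A (x j))"
  unfolding tensor_rep_def elementary_tensor_def by (auto cong: restrict_cong)

text \<open>Representations are concatenated; the triangle inequality for the projective norm rests
  on this.\<close>

lemma tensor_rep_add:
  assumes "tensor_rep n E u m x" "tensor_rep n E v m' y"
  shows "tensor_rep n E (u \<oplus>\<^bsub>algebraic_tensor n E\<^esub> v) (m + m') (\<lambda>j. if j < m then x j else y (j - m))"
proof -
  have eq: "u \<oplus>\<^bsub>algebraic_tensor n E\<^esub> v =
      (\<lambda>A\<in>multilinear_forms n E. \<Sum>j<m + m'. A (if j < m then x j else y (j - m)))"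
    using assms unfolding tensor_rep_iff algebraic_tensor_simps
    by (intro restrict_ext) (simp add: sum_lessThan_append)
  have "(if j < m then x j else y (j - m)) \<in> (\<Pi>\<^sub>E i\<in>{..<n}. carrier (E i))" if "j < m + m'" for j
  proof (cases "j < m")
    case True
    then show ?thesis
      unfolding if_P[OF True] using assms(1) unfolding tensor_rep_iff by blast
  next
    case False
    then have "j - m < m'"
      using that by linarith
    then show ?thesis
      unfolding if_not_P[OF False] using assms(2) unfolding tensor_rep_iff by blast
  qed
  then show ?thesis
    unfolding tensor_rep_iff eq by (intro conjI allI impI refl)
qed

lemma elementary_tensor_rep:
  "x \<in> (\<Pi>\<^sub>E i\<in>{..<n}. carrier (E i)) \<Longrightarrow> tensor_rep n E (elementary_tensor n E x) 1 (\<lambda>_. x)"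
  unfolding tensor_rep_iff elementary_tensor_def by simp

section \<open>The projective norm on the algebraic tensor product\<close>

locale tensor_factors =
  fixes n :: nat and E :: "nat \<Rightarrow> ('k::real_normed_field, 'e) normed_module"
  assumes n_pos: "n > 0" and factor: "\<And>i. i < n \<Longrightarrow> normed_space (E i)"
begin

abbreviation "tuples \<equiv> \<Pi>\<^sub>E i\<in>{..<n}. carrier (E i)"

text \<open>The scalar goes into factor 0, which exists because n > 0; the product of the norms then
  gains the factor |c| by \<open>prod_vnorm_smult\<close>.\<close>

lemma tensor_rep_smult:
  assumes "tensor_rep n E u m x"
  shows "tensor_rep n E (c \<odot>\<^bsub>algebraic_tensor n E\<^esub> u) m (\<lambda>j. (x j)(0 := c \<odot>\<^bsub>E 0\<^esub> x j 0))"
proof -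
  have x: "x j \<in> tuples" if "j < m" for j
    using assms that by (simp add: tensor_rep_iff)
  then have x0: "x j 0 \<in> carrier (E 0)" if "j < m" for j
    using n_pos that by (auto simp: PiE_iff)
  have eval: "A ((x j)(0 := c \<odot>\<^bsub>E 0\<^esub> x j 0)) = c * A (x j)" if "A \<in> multilinear_forms n E" "j < m" for A j
    using linear_mapD(3)[OF multilinear_formsD[OF that(1) x[OF that(2)] n_pos] x0[OF that(2)], of c] by simp
  have "c \<odot>\<^bsub>algebraic_tensor n E\<^esub> u = (\<lambda>A\<in>multilinear_forms n E. \<Sum>j<m. c * A (x j))"
    using assms by (auto simp: tensor_rep_iff algebraic_tensor_simps sum_distrib_left)
  also have "\<dots> = (\<lambda>A\<in>multilinear_forms n E. \<Sum>j<m. A ((x j)(0 := c \<odot>\<^bsub>E 0\<^esub> x j 0)))"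
    by (intro restrict_ext sum.cong) (auto simp: eval)
  finally show ?thesis
    unfolding tensor_rep_iff
    by (intro conjI allI impI PiE_fun_upd_lessThan[OF x normed_space.smult_in[OF factor[OF n_pos] x0] n_pos])
qed

lemma prod_vnorm_smult:
  assumes "x \<in> tuples"
  shows "(\<Prod>i<n. vnorm (E i) ((x(0 := c \<odot>\<^bsub>E 0\<^esub> x 0)) i)) = norm c * (\<Prod>i<n. vnorm (E i) (x i))"
proof -
  have "x 0 \<in> carrier (E 0)"
    using assms n_pos by (auto simp: PiE_iff)
  moreover have "(\<Prod>i\<in>{..<n} - {0}. vnorm (E i) ((x(0 := c \<odot>\<^bsub>E 0\<^esub> x 0)) i)) =
      (\<Prod>i\<in>{..<n} - {0}. vnorm (E i) (x i))"
    by (intro prod.cong) auto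
  moreover have "0 \<in> {..<n}"
    using n_pos by simp
  ultimately show ?thesis
    unfolding prod.remove[OF finite_lessThan \<open>0 \<in> {..<n}\<close>]
    using n_pos by (simp add: normed_space.vnorm_smult[OF factor])
qed

lemma prod_vnorm_nonneg: "x \<in> tuples \<Longrightarrow> 0 \<le> (\<Prod>i<n. vnorm (E i) (x i))"
  by (intro prod_nonneg) (auto simp: PiE_iff intro: normed_space.vnorm_nonneg[OF factor])

lemma tensor_rep_sum_nonneg: "tensor_rep n E u m x \<Longrightarrow> 0 \<le> (\<Sum>j<m. \<Prod>i<n. vnorm (E i) (x j i))"
  by (intro sum_nonneg prod_vnorm_nonneg) (auto simp: tensor_rep_iff)

lemma vnorm_tensor_le:
  assumes "tensor_rep n E u m x"
  shows "vnorm (algebraic_tensor n E) u \<le> (\<Sum>j<m. \<Prod>i<n. vnorm (E i) (x j i))"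
  unfolding algebraic_tensor_simps
  using assms tensor_rep_sum_nonneg by (intro cInf_lower) (auto intro!: bdd_belowI[where m = 0])

lemma vnorm_tensor_geI:
  assumes "u \<in> carrier (algebraic_tensor n E)"
    and "\<And>m x. tensor_rep n E u m x \<Longrightarrow> c \<le> (\<Sum>j<m. \<Prod>i<n. vnorm (E i) (x j i))"
  shows "c \<le> vnorm (algebraic_tensor n E) u"
  using assms unfolding algebraic_tensor_simps by (intro cInf_greatest) auto

text \<open>All laws except definiteness follow by manipulating representations, for arbitrary
  factors. Definiteness enters as \<open>sep\<close>; for function spaces it comes from point
  evaluations.\<close>

lemma algebraic_tensor_normed_space:
  assumes sep: "\<And>u. u \<in> carrier (algebraic_tensor n E) \<Longrightarrow> vnorm (algebraic_tensor n E) u = 0 \<Longrightarrow>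
    u = \<zero>\<^bsub>algebraic_tensor n E\<^esub>"
  shows "normed_space (algebraic_tensor n E)"
proof (rule normed_spaceI)
  let ?T = "algebraic_tensor n E"
  show "\<zero>\<^bsub>?T\<^esub> \<in> carrier ?T"
    unfolding algebraic_tensor_simps by (auto simp: tensor_rep_iff intro!: exI[of _ "0::nat"])
  show "u \<oplus>\<^bsub>?T\<^esub> v \<in> carrier ?T" if "u \<in> carrier ?T" "v \<in> carrier ?T" for u v
    using that tensor_rep_add unfolding algebraic_tensor_simps(1) by blast
  show smult: "c \<odot>\<^bsub>?T\<^esub> u \<in> carrier ?T" if "u \<in> carrier ?T" for c u
    using that tensor_rep_smult unfolding algebraic_tensor_simps(1) by blast
  show "u = \<zero>\<^bsub>?T\<^esub>" if "u \<in> carrier ?T" "vnorm ?T u = 0" for u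
    using sep[OF that] .
  have ext: "u \<in> extensional (multilinear_forms n E)" if "u \<in> carrier ?T" for u
    using that by (auto simp: algebraic_tensor_simps(1) tensor_rep_iff)
  show "1 \<odot>\<^bsub>?T\<^esub> u = u" "\<zero>\<^bsub>?T\<^esub> \<oplus>\<^bsub>?T\<^esub> u = u" if "u \<in> carrier ?T" for u
    using ext[OF that] by (auto simp: algebraic_tensor_simps extensional_def restrict_def)
  show "vnorm ?T (u \<oplus>\<^bsub>?T\<^esub> v) \<le> vnorm ?T u + vnorm ?T v" if uv: "u \<in> carrier ?T" "v \<in> carrier ?T" for u v
  proof -
    have "vnorm ?T (u \<oplus>\<^bsub>?T\<^esub> v) - vnorm ?T v \<le> vnorm ?T u"
    proof (rule vnorm_tensor_geI[OF uv(1)])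
      fix m x assume x: "tensor_rep n E u m x"
      have "vnorm ?T (u \<oplus>\<^bsub>?T\<^esub> v) - (\<Sum>j<m. \<Prod>i<n. vnorm (E i) (x j i)) \<le> vnorm ?T v"
      proof (rule vnorm_tensor_geI[OF uv(2)])
        fix m' y assume y: "tensor_rep n E v m' y"
        show "vnorm ?T (u \<oplus>\<^bsub>?T\<^esub> v) - (\<Sum>j<m. \<Prod>i<n. vnorm (E i) (x j i)) \<le> (\<Sum>j<m'. \<Prod>i<n. vnorm (E i) (y j i))"
          using vnorm_tensor_le[OF tensor_rep_add[OF x y]]
          unfolding sum_lessThan_append[of "\<lambda>z. \<Prod>i<n. vnorm (E i) (z i)" m x y m'] by simp
      qed
      then show "vnorm ?T (u \<oplus>\<^bsub>?T\<^esub> v) - vnorm ?T v \<le> (\<Sum>j<m. \<Prod>i<n. vnorm (E i) (x j i))"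
        by simp
    qed
    then show ?thesis
      by simp
  qed
  \<comment> \<open>Only this inequality is proved from representations; applied to the inverse of c
    it gives the reverse one.\<close>
  have le: "vnorm ?T (c \<odot>\<^bsub>?T\<^esub> u) \<le> norm c * vnorm ?T u" if u: "u \<in> carrier ?T" and c: "c \<noteq> 0" for c u
  proof -
    have "vnorm ?T (c \<odot>\<^bsub>?T\<^esub> u) / norm c \<le> vnorm ?T u"
    proof (rule vnorm_tensor_geI[OF u])
      fix m x assume x: "tensor_rep n E u m x"
      have "(\<Sum>j<m. \<Prod>i<n. vnorm (E i) (((x j)(0 := c \<odot>\<^bsub>E 0\<^esub> x j 0)) i)) = norm c * (\<Sum>j<m. \<Prod>i<n. vnorm (E i) (x j i))"
        using x unfolding sum_distrib_left tensor_rep_iff by (intro sum.cong prod_vnorm_smult) auto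
      then show "vnorm ?T (c \<odot>\<^bsub>?T\<^esub> u) / norm c \<le> (\<Sum>j<m. \<Prod>i<n. vnorm (E i) (x j i))"
        using vnorm_tensor_le[OF tensor_rep_smult[OF x, of c]] c by (simp add: field_simps)
    qed
    then show ?thesis
      using c by (simp add: field_simps)
  qed
  show "vnorm ?T (c \<odot>\<^bsub>?T\<^esub> u) = norm c * vnorm ?T u" if u: "u \<in> carrier ?T" for c u
  proof (cases "c = 0")
    case True
    have "tensor_rep n E (c \<odot>\<^bsub>?T\<^esub> u) 0 (\<lambda>_ _. undefined)"
      using True by (simp add: tensor_rep_iff algebraic_tensor_simps cong: restrict_cong)
    then have "vnorm ?T (c \<odot>\<^bsub>?T\<^esub> u) \<le> 0"
      using vnorm_tensor_le by fastforce
    moreover have "0 \<le> vnorm ?T (c \<odot>\<^bsub>?T\<^esub> u)"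
      using smult[OF u] tensor_rep_sum_nonneg by (intro vnorm_tensor_geI)
    ultimately show ?thesis
      using True by simp
  next
    case False
    have "inverse c \<odot>\<^bsub>?T\<^esub> (c \<odot>\<^bsub>?T\<^esub> u) = u"
      using ext[OF u] False by (auto simp: algebraic_tensor_simps extensional_def restrict_def fun_eq_iff)
    then have "vnorm ?T u \<le> vnorm ?T (c \<odot>\<^bsub>?T\<^esub> u) / norm c"
      using le[OF smult[OF u, of c], of "inverse c"] False by (simp add: norm_inverse divide_inverse mult.commute)
    then show ?thesis
      using le[OF u False] False by (simp add: field_simps)
  qed
qed (auto simp: algebraic_tensor_simps restrict_def algebra_simps fun_eq_iff)

lemma elementary_tensor_in [simp]:
  "x \<in> tuples \<Longrightarrow> elementary_tensor n E x \<in> carrier (algebraic_tensor n E)"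
  unfolding algebraic_tensor_simps using elementary_tensor_rep by blast

lemma vnorm_elementary_tensor_le:
  "x \<in> tuples \<Longrightarrow> vnorm (algebraic_tensor n E) (elementary_tensor n E x) \<le> (\<Prod>i<n. vnorm (E i) (x i))"
  using vnorm_tensor_le[OF elementary_tensor_rep, of x] by simp

text \<open>Summing the bound over a representation and taking the infimum suffices, since the
  projective norm is the largest one compatible with the product bound. Functionals and maps into
  sequence spaces are estimated in this way.\<close>

lemma seminorm_tensor_bound:
  assumes p_zero: "p \<zero>\<^bsub>algebraic_tensor n E\<^esub> \<le> 0"
    and p_add: "\<And>u v. u \<in> carrier (algebraic_tensor n E) \<Longrightarrow> v \<in> carrier (algebraic_tensor n E) \<Longrightarrow>
      p (u \<oplus>\<^bsub>algebraic_tensor n E\<^esub> v) \<le> p u + p v"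
    and p_el: "\<And>x. x \<in> tuples \<Longrightarrow> p (elementary_tensor n E x) \<le> C * (\<Prod>i<n. vnorm (E i) (x i))"
    and C: "C \<ge> 0" and u: "u \<in> carrier (algebraic_tensor n E)"
  shows "p u \<le> C * vnorm (algebraic_tensor n E) u"
proof -
  have le: "p u \<le> C * (\<Sum>j<m. \<Prod>i<n. vnorm (E i) (x j i))" if "tensor_rep n E u m x" for u m x
    using that
  proof (induction m arbitrary: u)
    case 0
    then have "u = \<zero>\<^bsub>algebraic_tensor n E\<^esub>"
      unfolding tensor_rep_iff algebraic_tensor_simps by simp
    then show ?case
      using p_zero by simp
  next
    case (Suc m)
    define v where "v = (\<lambda>A\<in>multilinear_forms n E. \<Sum>j<m. A (x j))"
    have x: "x m \<in> tuples"
      using Suc.prems by (simp add: tensor_rep_iff)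
    have v: "tensor_rep n E v m x"
      using Suc.prems by (simp add: tensor_rep_iff v_def)
    then have vc: "v \<in> carrier (algebraic_tensor n E)"
      unfolding algebraic_tensor_simps(1) by blast
    have "u = v \<oplus>\<^bsub>algebraic_tensor n E\<^esub> elementary_tensor n E (x m)"
      using Suc.prems by (auto simp: tensor_rep_iff v_def algebraic_tensor_simps elementary_tensor_def)
    then have "p u \<le> p v + p (elementary_tensor n E (x m))"
      using p_add[OF vc elementary_tensor_in[OF x]] by simp
    then show ?case
      using Suc.IH[OF v] p_el[OF x] by (simp add: distrib_left)
  qed
  show ?thesis
  \<comment> \<open>The infimum is compared after division by C, hence the separate case.\<close>
  proof (cases "C = 0")
    case True
    obtain m x where "tensor_rep n E u m x"
      using u by (auto simp: algebraic_tensor_simps(1))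
    then show ?thesis
      using True le by fastforce
  next
    case False
    then have "p u / C \<le> vnorm (algebraic_tensor n E) u"
      using C le by (intro vnorm_tensor_geI[OF u]) (simp add: field_simps)
    then show ?thesis
      using False C by (simp add: field_simps)
  qed
qed

end

lemma multilinear_form_vanishes:
  fixes K :: "nat \<Rightarrow> 'a topology" and x :: "nat \<Rightarrow> nat \<Rightarrow> 'a \<Rightarrow> 'k::real_normed_field"
  defines "E \<equiv> \<lambda>i. C_space (K i) :: ('k, 'a \<Rightarrow> 'k) normed_module"
  assumes A: "A \<in> multilinear_forms n E"
    and x: "\<And>j. j < m \<Longrightarrow> x j \<in> (\<Pi>\<^sub>E i\<in>{..<n}. carrier (E i))"
    and zero: "\<And>t. (\<And>i. i < n \<Longrightarrow> t i \<in> topspace (K i)) \<Longrightarrow> (\<Sum>j<m. \<Prod>i<n. x j i (t i)) = 0"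
    and ne: "\<And>i. i < n \<Longrightarrow> topspace (K i) \<noteq> {}"
  shows "(\<Sum>j<m. A (x j)) = 0"
proof -
  \<comment> \<open>z holds the entries of the form in the slots from k on, where the tensor factors
    are evaluated at t; at k = n no such slot is left.\<close>
  have "(\<Sum>j<m. (\<Prod>i\<in>{k..<n}. x j i (t i)) * A (\<lambda>i\<in>{..<n}. if i < k then x j i else z i)) = 0"
    if "k \<le> n" "z \<in> (\<Pi>\<^sub>E i\<in>{..<n}. carrier (E i))" "\<And>i. i < n \<Longrightarrow> t i \<in> topspace (K i)" for k t z
    using that
  proof (induction k arbitrary: t z)
    case 0
    then show ?case
      using zero[of t] by (simp add: atLeast0LessThan flip: sum_distrib_right)
  next
    case (Suc k)
    then have k: "k < n"
      by simp
    have Ek: "E k = C_space (K k)"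
      by (simp add: E_def)
    have xk: "x j k \<in> carrier (E k)" if "j < m" for j
      using x[OF that] k by (auto simp: PiE_iff)
    obtain P where P: "\<And>p h. (p, h) \<in> set P \<Longrightarrow> p \<in> topspace (K k) \<and> continuous_fun (K k) h"
      and rep: "\<And>f t. f \<in> (\<lambda>j. x j k) ` {..<m} \<Longrightarrow> t \<in> topspace (K k) \<Longrightarrow> f t = (\<Sum>(p, h)\<leftarrow>P. f p * h t)"
      using interpolation[of "(\<lambda>j. x j k) ` {..<m}" "K k"] xk[unfolded Ek] by (auto dest: C_space_carrierD)
    define w where "w j f = (\<lambda>i\<in>{..<n}. if i < k then x j i else (z(k := f)) i)" for j f
    have w: "w j f \<in> (\<Pi>\<^sub>E i\<in>{..<n}. carrier (E i))" if "j < m" "f \<in> carrier (E k)" for j f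
      using x[OF that(1)] that Suc.prems by (auto simp: w_def PiE_iff)
    have expand: "A (w j (x j k)) = (\<Sum>(p, h)\<leftarrow>P. x j k p * A (w j (restrict h (topspace (K k)))))" if j: "j < m" for j
    proof -
      have upd: "(w j (x j k))(k := f) = w j f" for f
        using k by (auto simp: w_def)
      have L: "linear_map (C_space (K k)) scalars (\<lambda>f. A (w j f))"
        using multilinear_formsD[OF A w[OF j xk[OF j]] k] by (simp add: upd Ek)
      have "x j k = (\<lambda>t\<in>topspace (K k). \<Sum>(p, h)\<leftarrow>P. x j k p * h t)"
        using rep[of "x j k"] xk[OF j, unfolded Ek] j by (auto simp: C_space_simps extensional_def restrict_def fun_eq_iff)
      then show ?thesis
        using linear_map_C_space_sum_list[OF L, of P "x j k"] P by auto
    qed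
    have head: "(\<lambda>i\<in>{..<n}. if i < Suc k then x j i else z i) = w j (x j k)" for j
      by (auto simp: w_def)
    have "(\<Sum>j<m. (\<Prod>i\<in>{Suc k..<n}. x j i (t i)) * A (w j (x j k))) =
        (\<Sum>j<m. \<Sum>(p, h)\<leftarrow>P. (\<Prod>i\<in>{Suc k..<n}. x j i (t i)) * (x j k p * A (w j (restrict h (topspace (K k))))))"
      by (intro sum.cong) (auto simp: expand sum_list_const_mult[symmetric] case_prod_unfold)
    also have "\<dots> = (\<Sum>(p, h)\<leftarrow>P. \<Sum>j<m. (\<Prod>i\<in>{Suc k..<n}. x j i (t i)) * (x j k p * A (w j (restrict h (topspace (K k))))))"
      by (induction P) (auto simp: sum.distrib)
    also have "\<dots> = 0"
    proof -
      have "(\<Sum>j<m. (\<Prod>i\<in>{Suc k..<n}. x j i (t i)) * (x j k p * A (w j (restrict h (topspace (K k)))))) = 0"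
        if "(p, h) \<in> set P" for p h
      proof -
        define h' where "h' = restrict h (topspace (K k))"
        have h': "h' \<in> carrier (E k)"
          using P[OF that] by (simp add: h'_def Ek)
        have "(\<Sum>j<m. (\<Prod>i\<in>{k..<n}. x j i ((t(k := p)) i)) * A (w j h')) = 0"
          unfolding w_def using Suc.prems P[OF that] h' k
          by (intro Suc.IH PiE_fun_upd_lessThan) auto
        moreover have "(\<Prod>i\<in>{k..<n}. x j i ((t(k := p)) i)) = x j k p * (\<Prod>i\<in>{Suc k..<n}. x j i (t i))" for j
          using k by (simp add: prod.atLeast_Suc_lessThan)
        ultimately show ?thesis
          by (simp add: h'_def mult_ac)
      qed
      then have "map (\<lambda>(p, h). \<Sum>j<m. (\<Prod>i\<in>{Suc k..<n}. x j i (t i)) * (x j k p * A (w j (restrict h (topspace (K k)))))) P = map (\<lambda>_. 0) P"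
        by (intro map_cong) auto
      from arg_cong[OF this, of sum_list] show ?thesis
        by (simp only: sum_list_0)
    qed
    finally show ?case
      by (simp add: head)
  qed
  note * = this
  define t where "t i = (SOME s. s \<in> topspace (K i))" for i
  have "\<And>i. i < n \<Longrightarrow> t i \<in> topspace (K i)"
    unfolding t_def using ne by (simp only: some_in_eq not_False_eq_True)
  then have "(\<Sum>j<m. A (\<lambda>i\<in>{..<n}. if i < n then x j i else (\<lambda>i\<in>{..<n}. \<zero>\<^bsub>E i\<^esub>) i)) = 0"
    using *[of n "\<lambda>i\<in>{..<n}. \<zero>\<^bsub>E i\<^esub>" t] by (auto simp: E_def C_space_simps)
  moreover have "(\<lambda>i\<in>{..<n}. if i < n then x j i else (\<lambda>i\<in>{..<n}. \<zero>\<^bsub>E i\<^esub>) i) = x j" if "j < m" for j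
    using x[OF that] by (auto simp: PiE_iff extensional_def)
  ultimately show ?thesis
    by simp
qed

lemma linear_map_scalarsI:
  assumes "\<And>x y. x \<in> carrier E \<Longrightarrow> y \<in> carrier E \<Longrightarrow> T (x \<oplus>\<^bsub>E\<^esub> y) = T x + T y"
    and "\<And>c x. x \<in> carrier E \<Longrightarrow> T (c \<odot>\<^bsub>E\<^esub> x) = c * T x"
  shows "linear_map E scalars T"
  using assms by (auto simp: linear_map_def)

text \<open>Products of point evaluations are multilinear forms bounded by the projective norm, so a
  tensor of norm 0 vanishes at every point of the product, and
  \<open>multilinear_form_vanishes\<close> makes it zero.\<close>

theorem algebraic_tensor_C_space_normed:
  fixes K :: "nat \<Rightarrow> 'a topology"
  defines "E \<equiv> \<lambda>i. C_space (K i) :: ('k::real_normed_field, 'a \<Rightarrow> 'k) normed_module"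
  assumes "n > 0" "\<And>i. i < n \<Longrightarrow> compact_space (K i)" "\<And>i. i < n \<Longrightarrow> topspace (K i) \<noteq> {}"
  shows "normed_space (algebraic_tensor n E)"
proof -
  interpret tensor_factors n E
    using assms(2-) unfolding E_def by (intro tensor_factors.intro normed_space_C_space)
  show ?thesis
  proof (rule algebraic_tensor_normed_space)
    fix u assume u: "u \<in> carrier (algebraic_tensor n E)" "vnorm (algebraic_tensor n E) u = 0"
    obtain m x where rep: "tensor_rep n E u m x"
      using u by (auto simp: algebraic_tensor_simps(1))
    have "(\<Sum>j<m. \<Prod>i<n. x j i (t i)) = 0" if t: "\<And>i. i < n \<Longrightarrow> t i \<in> topspace (K i)" for t
    proof -
      define D where "D y = (\<Prod>i<n. y i (t i))" for y :: "nat \<Rightarrow> 'a \<Rightarrow> 'k"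
      have upd: "D (y(i := f)) = f (t i) * (\<Prod>i\<in>{..<n} - {i}. y i (t i))" if "i < n" for y i f
        using that by (simp add: D_def prod.remove[of "{..<n}" i])
      have D: "D \<in> multilinear_forms n E"
        using t by (intro multilinear_formsI linear_map_scalarsI) (auto simp: upd E_def C_space_simps algebra_simps)
      have "norm (u D) \<le> 1 * vnorm (algebraic_tensor n E) u"
      proof (rule seminorm_tensor_bound[where p = "\<lambda>u. norm (u D)"])
        fix y assume y: "y \<in> tuples"
        have "norm (D y) = (\<Prod>i<n. norm (y i (t i)))"
          by (simp add: D_def prod_norm)
        also have "\<dots> \<le> (\<Prod>i<n. vnorm (E i) (y i))"
          using y t assms by (intro prod_mono) (auto simp: E_def PiE_iff intro!: C_space_norm_le C_space_carrierD)
        finally show "norm (elementary_tensor n E y D) \<le> 1 * (\<Prod>i<n. vnorm (E i) (y i))"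
          using D by (simp add: elementary_tensor_def)
      qed (use D u in \<open>auto simp: algebraic_tensor_simps norm_triangle_ineq\<close>)
      then have "u D = 0"
        using u by simp
      then show ?thesis
        using tensor_rep_eval[OF rep D] by (simp add: D_def)
    qed
    then have "(\<Sum>j<m. A (x j)) = 0" if "A \<in> multilinear_forms n E" for A
      using multilinear_form_vanishes[of A n K m x] that rep assms by (auto simp: E_def tensor_rep_iff)
    then show "u = \<zero>\<^bsub>algebraic_tensor n E\<^esub>"
      using rep by (auto simp: tensor_rep_iff algebraic_tensor_simps)
  qed
qed

section \<open>Completions\<close>

context normed_space
begin

definition cls :: "(nat \<Rightarrow> 'e) \<Rightarrow> (nat \<Rightarrow> 'e) set" where
  "cls s = cauchy_rel E `` {s}"

lemma cauchy_seqs_iff: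
  "s \<in> cauchy_seqs E \<longleftrightarrow>
     range s \<subseteq> carrier E \<and> (\<forall>\<epsilon>>0. \<exists>N. \<forall>m\<ge>N. \<forall>n\<ge>N. vnorm E (s m \<ominus> s n) < \<epsilon>)"
  by (simp add: cauchy_seqs_def MCauchy_iff)

lemma cauchy_seqs_in: "s \<in> cauchy_seqs E \<Longrightarrow> s k \<in> carrier E"
  by (auto simp: cauchy_seqs_iff)

lemma cauchy_rel_iff:
  "(s, t) \<in> cauchy_rel E \<longleftrightarrow>
     s \<in> cauchy_seqs E \<and> t \<in> cauchy_seqs E \<and> (\<lambda>k. vnorm E (s k \<ominus> t k)) \<longlonglongrightarrow> 0"
proof -
  have "(\<lambda>k. vdist E (s k) (t k)) = (\<lambda>k. vnorm E (s k \<ominus> t k))" if "s \<in> cauchy_seqs E" "t \<in> cauchy_seqs E"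
    using that cauchy_seqs_in by (auto simp: vdist_def)
  then show ?thesis
    by (auto simp: cauchy_rel_def)
qed

lemma tendsto_zero_vnorm_le:
  assumes "(\<lambda>k. g k) \<longlonglongrightarrow> (0::real)" "\<And>k. f k \<in> carrier E" "\<And>k. vnorm E (f k) \<le> g k"
  shows "(\<lambda>k. vnorm E (f k)) \<longlonglongrightarrow> 0"
  by (rule tendsto_sandwich[OF _ _ tendsto_const assms(1)]) (simp_all add: assms)

lemma equiv_cauchy_rel: "equiv (cauchy_seqs E) (cauchy_rel E)"
proof (rule equivI)
  show "cauchy_rel E \<subseteq> cauchy_seqs E \<times> cauchy_seqs E"
    by (auto simp: cauchy_rel_def)
  show "refl_on (cauchy_seqs E) (cauchy_rel E)"
    by (rule refl_onI) (simp add: cauchy_rel_iff cauchy_seqs_in)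
  show "sym (cauchy_rel E)"
  proof (rule symI)
    fix s t assume st: "(s, t) \<in> cauchy_rel E"
    then have "vnorm E (t k \<ominus> s k) = vnorm E (s k \<ominus> t k)" for k
      by (intro vnorm_diff_commute cauchy_seqs_in) (simp_all add: cauchy_rel_iff)
    then show "(t, s) \<in> cauchy_rel E"
      using st by (simp add: cauchy_rel_iff)
  qed
  show "trans (cauchy_rel E)"
  proof (rule transI)
    fix s t u assume st: "(s, t) \<in> cauchy_rel E" and tu: "(t, u) \<in> cauchy_rel E"
    then have c: "s k \<in> carrier E" "t k \<in> carrier E" "u k \<in> carrier E" for k
      by (simp_all add: cauchy_rel_iff cauchy_seqs_in)
    have "(\<lambda>k. vnorm E (s k \<ominus> t k) + vnorm E (t k \<ominus> u k)) \<longlonglongrightarrow> 0"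
      using st tu tendsto_add[of "\<lambda>k. vnorm E (s k \<ominus> t k)" 0 sequentially "\<lambda>k. vnorm E (t k \<ominus> u k)" 0]
      by (simp add: cauchy_rel_iff)
    then have "(\<lambda>k. vnorm E (s k \<ominus> u k)) \<longlonglongrightarrow> 0"
      by (rule tendsto_zero_vnorm_le) (simp_all add: c vnorm_diff_triangle)
    then show "(s, u) \<in> cauchy_rel E"
      using st tu by (simp add: cauchy_rel_iff)
  qed
qed

lemma cls_eq_iff:
  assumes "s \<in> cauchy_seqs E" "t \<in> cauchy_seqs E"
  shows "cls s = cls t \<longleftrightarrow> (\<lambda>k. vnorm E (s k \<ominus> t k)) \<longlonglongrightarrow> 0"
  unfolding cls_def eq_equiv_class_iff[OF equiv_cauchy_rel assms] cauchy_rel_iff using assms by simp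

lemma in_cls_iff:
  "s \<in> cauchy_seqs E \<Longrightarrow> t \<in> cls s \<longleftrightarrow> t \<in> cauchy_seqs E \<and> cls t = cls s"
proof -
  assume s: "s \<in> cauchy_seqs E"
  have "t \<in> cls s \<longleftrightarrow> t \<in> cauchy_seqs E \<and> cls s = cls t"
    using cls_eq_iff[OF s, of t] s by (auto simp: cls_def cauchy_rel_iff)
  then show ?thesis
    by (simp add: eq_commute)
qed

lemma self_in_cls: "s \<in> cauchy_seqs E \<Longrightarrow> s \<in> cls s"
  by (simp add: in_cls_iff)

lemma cauchy_seqs_const: "x \<in> carrier E \<Longrightarrow> (\<lambda>_. x) \<in> cauchy_seqs E"
  by (auto simp: cauchy_seqs_iff)

lemma cauchy_seqs_add:
  assumes s: "s \<in> cauchy_seqs E" and t: "t \<in> cauchy_seqs E"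
  shows "(\<lambda>k. s k \<oplus> t k) \<in> cauchy_seqs E"
  unfolding cauchy_seqs_iff
proof (intro conjI allI impI)
  show "range (\<lambda>k. s k \<oplus> t k) \<subseteq> carrier E"
    using cauchy_seqs_in[OF s] cauchy_seqs_in[OF t] by auto
  fix \<epsilon> :: real assume "\<epsilon> > 0"
  then have e: "\<epsilon> / 2 > 0"
    by simp
  obtain M where M: "\<And>m n. m \<ge> M \<Longrightarrow> n \<ge> M \<Longrightarrow> vnorm E (s m \<ominus> s n) < \<epsilon> / 2"
    using s e unfolding cauchy_seqs_iff by meson
  obtain N where N: "\<And>m n. m \<ge> N \<Longrightarrow> n \<ge> N \<Longrightarrow> vnorm E (t m \<ominus> t n) < \<epsilon> / 2"
    using t e unfolding cauchy_seqs_iff by meson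
  show "\<exists>N. \<forall>m\<ge>N. \<forall>n\<ge>N. vnorm E ((s m \<oplus> t m) \<ominus> (s n \<oplus> t n)) < \<epsilon>"
  proof (intro exI[of _ "max M N"] allI impI)
    fix m n assume "max M N \<le> m" "max M N \<le> n"
    then have "vnorm E (s m \<ominus> s n) < \<epsilon> / 2" "vnorm E (t m \<ominus> t n) < \<epsilon> / 2"
      using M N by simp_all
    moreover have "vnorm E ((s m \<oplus> t m) \<ominus> (s n \<oplus> t n)) \<le> vnorm E (s m \<ominus> s n) + vnorm E (t m \<ominus> t n)"
      using cauchy_seqs_in[OF s] cauchy_seqs_in[OF t] by (simp add: add_diff_add vnorm_triangle)
    ultimately show "vnorm E ((s m \<oplus> t m) \<ominus> (s n \<oplus> t n)) < \<epsilon>"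
      by simp
  qed
qed

lemma cauchy_seqs_smult:
  assumes s: "s \<in> cauchy_seqs E"
  shows "(\<lambda>k. c \<odot> s k) \<in> cauchy_seqs E"
  unfolding cauchy_seqs_iff
proof (intro conjI allI impI)
  show "range (\<lambda>k. c \<odot> s k) \<subseteq> carrier E"
    using cauchy_seqs_in[OF s] by auto
  fix \<epsilon> :: real assume "\<epsilon> > 0"
  then have e: "\<epsilon> / (norm c + 1) > 0"
    by (simp add: add_nonneg_pos)
  obtain M where M: "\<And>m n. m \<ge> M \<Longrightarrow> n \<ge> M \<Longrightarrow> vnorm E (s m \<ominus> s n) < \<epsilon> / (norm c + 1)"
    using s e unfolding cauchy_seqs_iff by meson
  show "\<exists>N. \<forall>m\<ge>N. \<forall>n\<ge>N. vnorm E (c \<odot> s m \<ominus> c \<odot> s n) < \<epsilon>"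
  proof (intro exI[of _ M] allI impI)
    fix m n assume "M \<le> m" "M \<le> n"
    moreover have "norm c + 1 > 0"
      by (simp add: add_nonneg_pos)
    ultimately have "(norm c + 1) * vnorm E (s m \<ominus> s n) < \<epsilon>"
      using M[of m n] by (simp add: pos_less_divide_eq mult.commute)
    moreover have "vnorm E (c \<odot> s m \<ominus> c \<odot> s n) = norm c * vnorm E (s m \<ominus> s n)"
      using cauchy_seqs_in[OF s] by (simp flip: smult_diff add: vnorm_smult)
    moreover have "0 \<le> vnorm E (s m \<ominus> s n)"
      using cauchy_seqs_in[OF s] by simp
    ultimately show "vnorm E (c \<odot> s m \<ominus> c \<odot> s n) < \<epsilon>"
      by (simp add: distrib_right)
  qed
qed

lemma cls_in: "s \<in> cauchy_seqs E \<Longrightarrow> cls s \<in> carrier (completion E)"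
  by (simp add: completion_def cls_def quotientI)

lemma completion_cases:
  assumes "X \<in> carrier (completion E)"
  obtains s where "s \<in> cauchy_seqs E" "X = cls s"
  using assms by (auto simp: completion_def cls_def elim: quotientE)

lemma completion_zero: "\<zero>\<^bsub>completion E\<^esub> = cls (\<lambda>_. \<zero>)"
  by (simp add: completion_def cls_def)

text \<open>The sum is defined as a union over all representatives; it is a single class because
  equivalent sequences have equivalent sums.\<close>

lemma completion_add:
  assumes s: "s \<in> cauchy_seqs E" and t: "t \<in> cauchy_seqs E"
  shows "cls s \<oplus>\<^bsub>completion E\<^esub> cls t = cls (\<lambda>k. s k \<oplus> t k)"
proof -
  have "cls (\<lambda>k. s' k \<oplus> t' k) = cls (\<lambda>k. s k \<oplus> t k)" if "s' \<in> cls s" "t' \<in> cls t" for s' t'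
  proof -
    have s': "s' \<in> cauchy_seqs E" "(\<lambda>k. vnorm E (s' k \<ominus> s k)) \<longlonglongrightarrow> 0"
      using that s in_cls_iff cls_eq_iff by blast+
    have t': "t' \<in> cauchy_seqs E" "(\<lambda>k. vnorm E (t' k \<ominus> t k)) \<longlonglongrightarrow> 0"
      using that t in_cls_iff cls_eq_iff by blast+
    have c: "s k \<in> carrier E" "s' k \<in> carrier E" "t k \<in> carrier E" "t' k \<in> carrier E" for k
      using cauchy_seqs_in s s'(1) t t'(1) by blast+
    have "(\<lambda>k. vnorm E (s' k \<ominus> s k) + vnorm E (t' k \<ominus> t k)) \<longlonglongrightarrow> 0"
      using tendsto_add[OF s'(2) t'(2)] by simp
    then have "(\<lambda>k. vnorm E ((s' k \<oplus> t' k) \<ominus> (s k \<oplus> t k))) \<longlonglongrightarrow> 0"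
      by (rule tendsto_zero_vnorm_le) (simp_all add: add_diff_add vnorm_triangle c)
    then show ?thesis
      using s s' t t' by (simp add: cls_eq_iff cauchy_seqs_add)
  qed
  then have "(\<Union>s'\<in>cls s. \<Union>t'\<in>cls t. cls (\<lambda>k. s' k \<oplus> t' k)) = (\<Union>s'\<in>cls s. \<Union>t'\<in>cls t. cls (\<lambda>k. s k \<oplus> t k))"
    by simp
  also have "\<dots> = cls (\<lambda>k. s k \<oplus> t k)"
    using self_in_cls[OF s] self_in_cls[OF t] by blast
  finally show ?thesis
    by (simp add: completion_def cls_def)
qed

lemma completion_smult:
  assumes s: "s \<in> cauchy_seqs E"
  shows "c \<odot>\<^bsub>completion E\<^esub> cls s = cls (\<lambda>k. c \<odot> s k)"
proof -
  have "cls (\<lambda>k. c \<odot> s' k) = cls (\<lambda>k. c \<odot> s k)" if "s' \<in> cls s" for s'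
  proof -
    have s': "s' \<in> cauchy_seqs E" "(\<lambda>k. vnorm E (s' k \<ominus> s k)) \<longlonglongrightarrow> 0"
      using that s in_cls_iff cls_eq_iff by blast+
    have "(\<lambda>k. norm c * vnorm E (s' k \<ominus> s k)) \<longlonglongrightarrow> 0"
      using tendsto_mult[OF tendsto_const s'(2)] by simp
    moreover have "vnorm E (c \<odot> s' k \<ominus> c \<odot> s k) = norm c * vnorm E (s' k \<ominus> s k)" for k
      using s s' by (simp add: cauchy_seqs_in vnorm_smult flip: smult_diff)
    ultimately show ?thesis
      using s s' by (simp add: cls_eq_iff cauchy_seqs_smult)
  qed
  then have "(\<Union>s'\<in>cls s. cls (\<lambda>k. c \<odot> s' k)) = (\<Union>s'\<in>cls s. cls (\<lambda>k. c \<odot> s k))"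
    by simp
  also have "\<dots> = cls (\<lambda>k. c \<odot> s k)"
    using self_in_cls[OF s] by blast
  finally show ?thesis
    by (simp add: completion_def cls_def)
qed

lemma cauchy_seqs_vnorm_convergent:
  assumes s: "s \<in> cauchy_seqs E"
  shows "convergent (\<lambda>k. vnorm E (s k))"
  unfolding Cauchy_convergent_iff[symmetric]
proof (rule metric_CauchyI)
  fix \<epsilon> :: real assume "\<epsilon> > 0"
  then obtain M where M: "\<And>m n. m \<ge> M \<Longrightarrow> n \<ge> M \<Longrightarrow> vnorm E (s m \<ominus> s n) < \<epsilon>"
    using s unfolding cauchy_seqs_iff by meson
  have "dist (vnorm E (s m)) (vnorm E (s n)) < \<epsilon>" if "m \<ge> M" "n \<ge> M" for m n
    using M[OF that] abs_vnorm_diff[of "s m" "s n"] cauchy_seqs_in[OF s] by (simp add: dist_real_def)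
  then show "\<exists>M. \<forall>m\<ge>M. \<forall>n\<ge>M. dist (vnorm E (s m)) (vnorm E (s n)) < \<epsilon>"
    by blast
qed

lemma completion_vnorm:
  assumes s: "s \<in> cauchy_seqs E"
  shows "(\<lambda>k. vnorm E (s k)) \<longlonglongrightarrow> vnorm (completion E) (cls s)"
proof -
  have "lim (\<lambda>k. vnorm E (t k)) = lim (\<lambda>k. vnorm E (s k))" if "t \<in> cls s" for t
  proof -
    have t: "t \<in> cauchy_seqs E" "(\<lambda>k. vnorm E (t k \<ominus> s k)) \<longlonglongrightarrow> 0"
      using that s in_cls_iff cls_eq_iff by blast+
    have "(\<lambda>k. vnorm E (t k) - vnorm E (s k)) \<longlonglongrightarrow> 0"
      using t(2)
    proof (rule Lim_null_comparison[rotated])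
      show "\<forall>\<^sub>F k in sequentially. norm (vnorm E (t k) - vnorm E (s k)) \<le> vnorm E (t k \<ominus> s k)"
        using abs_vnorm_diff cauchy_seqs_in[OF s] cauchy_seqs_in[OF t(1)] by simp
    qed
    moreover have "(\<lambda>k. vnorm E (s k)) \<longlonglongrightarrow> lim (\<lambda>k. vnorm E (s k))"
      using cauchy_seqs_vnorm_convergent[OF s] by (simp add: convergent_LIMSEQ_iff)
    ultimately have "(\<lambda>k. vnorm E (t k)) \<longlonglongrightarrow> lim (\<lambda>k. vnorm E (s k))"
      using tendsto_add by fastforce
    then show ?thesis
      by (rule limI)
  qed
  then have "(\<lambda>t. lim (\<lambda>k. vnorm E (t k))) ` cls s = (\<lambda>t. lim (\<lambda>k. vnorm E (s k))) ` cls s"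
    by (rule image_cong[OF refl])
  also have "\<dots> = {lim (\<lambda>k. vnorm E (s k))}"
    by (rule image_constant[OF self_in_cls[OF s]])
  finally have "vnorm (completion E) (cls s) = lim (\<lambda>k. vnorm E (s k))"
    by (simp add: completion_def)
  then show ?thesis
    using cauchy_seqs_vnorm_convergent[OF s] by (simp add: convergent_LIMSEQ_iff)
qed

lemma completion_vnorm_eqI:
  assumes "s \<in> cauchy_seqs E" "(\<lambda>k. vnorm E (s k)) \<longlonglongrightarrow> l"
  shows "vnorm (completion E) (cls s) = l"
  using LIMSEQ_unique completion_vnorm assms by blast

lemmas completion_rules =
  completion_zero completion_add completion_smult cauchy_seqs_add cauchy_seqs_smult cauchy_seqs_const

lemma normed_space_completion: "normed_space (completion E)"
proof (rule normed_spaceI)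
  let ?C = "completion E"
  show "\<zero>\<^bsub>?C\<^esub> \<in> carrier ?C"
    by (simp add: completion_zero cls_in cauchy_seqs_const)
  fix X assume "X \<in> carrier ?C"
  then obtain s where s: "s \<in> cauchy_seqs E" and X: "X = cls s"
    by (rule completion_cases)
  note sc = cauchy_seqs_in[OF s]
  show "\<zero>\<^bsub>?C\<^esub> \<oplus>\<^bsub>?C\<^esub> X = X" "1 \<odot>\<^bsub>?C\<^esub> X = X" "0 \<odot>\<^bsub>?C\<^esub> X = \<zero>\<^bsub>?C\<^esub>"
    by (simp_all add: X completion_rules s sc)
  show "X = \<zero>\<^bsub>?C\<^esub>" if "vnorm ?C X = 0"
  proof -
    have "(\<lambda>k. vnorm E (s k \<ominus> \<zero>)) \<longlonglongrightarrow> 0"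
      using completion_vnorm[OF s] that sc by (simp add: X)
    then show ?thesis
      by (simp add: X completion_rules cls_eq_iff s)
  qed
  fix c
  show "c \<odot>\<^bsub>?C\<^esub> X \<in> carrier ?C"
    by (simp add: X completion_rules cls_in s)
  show "vnorm ?C (c \<odot>\<^bsub>?C\<^esub> X) = norm c * vnorm ?C X"
  proof -
    have "(\<lambda>k. vnorm E (c \<odot> s k)) \<longlonglongrightarrow> norm c * vnorm ?C X"
      using tendsto_mult[OF tendsto_const completion_vnorm[OF s], of "norm c"] sc by (simp add: vnorm_smult X)
    then show ?thesis
      unfolding X completion_smult[OF s] by (intro completion_vnorm_eqI cauchy_seqs_smult s)
  qed
  fix d
  show "(c + d) \<odot>\<^bsub>?C\<^esub> X = c \<odot>\<^bsub>?C\<^esub> X \<oplus>\<^bsub>?C\<^esub> d \<odot>\<^bsub>?C\<^esub> X" "(c * d) \<odot>\<^bsub>?C\<^esub> X = c \<odot>\<^bsub>?C\<^esub> (d \<odot>\<^bsub>?C\<^esub> X)"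
    by (simp_all add: X completion_rules s sc smult_add_left smult_smult)
  fix Y assume "Y \<in> carrier ?C"
  then obtain t where t: "t \<in> cauchy_seqs E" and Y: "Y = cls t"
    by (rule completion_cases)
  note tc = cauchy_seqs_in[OF t]
  show "X \<oplus>\<^bsub>?C\<^esub> Y \<in> carrier ?C"
    by (simp add: X Y completion_rules cls_in s t)
  show "X \<oplus>\<^bsub>?C\<^esub> Y = Y \<oplus>\<^bsub>?C\<^esub> X" "c \<odot>\<^bsub>?C\<^esub> (X \<oplus>\<^bsub>?C\<^esub> Y) = c \<odot>\<^bsub>?C\<^esub> X \<oplus>\<^bsub>?C\<^esub> c \<odot>\<^bsub>?C\<^esub> Y"
    by (simp_all add: X Y completion_rules s sc t tc smult_add_right M.a_comm)
  show "vnorm ?C (X \<oplus>\<^bsub>?C\<^esub> Y) \<le> vnorm ?C X + vnorm ?C Y"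
    unfolding X Y completion_add[OF s t]
    using completion_vnorm[OF cauchy_seqs_add[OF s t]] tendsto_add[OF completion_vnorm[OF s] completion_vnorm[OF t]]
    by (rule LIMSEQ_le) (simp add: vnorm_triangle sc tc)
  fix Z assume "Z \<in> carrier ?C"
  then obtain u where u: "u \<in> cauchy_seqs E" and Z: "Z = cls u"
    by (rule completion_cases)
  show "(X \<oplus>\<^bsub>?C\<^esub> Y) \<oplus>\<^bsub>?C\<^esub> Z = X \<oplus>\<^bsub>?C\<^esub> (Y \<oplus>\<^bsub>?C\<^esub> Z)"
    by (simp add: X Y Z completion_rules s sc t tc u cauchy_seqs_in M.a_assoc)
qed

section \<open>The embedding into the completion, and extension of maps\<close>

definition emb :: "'e \<Rightarrow> (nat \<Rightarrow> 'e) set" where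
  "emb x = cls (\<lambda>_. x)"

lemma emb_linear: "linear_map E (completion E) emb"
  by (simp add: linear_map_def emb_def cls_in completion_rules)

lemmas emb_in = linear_mapD(1)[OF emb_linear]
  and emb_add = linear_mapD(2)[OF emb_linear]
  and emb_smult = linear_mapD(3)[OF emb_linear]

lemma vnorm_emb: "x \<in> carrier E \<Longrightarrow> vnorm (completion E) (emb x) = vnorm E x"
  unfolding emb_def by (intro completion_vnorm_eqI cauchy_seqs_const tendsto_const)

lemma emb_approx:
  assumes s: "s \<in> cauchy_seqs E"
  shows "(\<lambda>k. vnorm (completion E) (cls s \<ominus>\<^bsub>completion E\<^esub> emb (s k))) \<longlonglongrightarrow> 0"
proof (rule LIMSEQ_I)
  interpret C: normed_space "completion E"
    by (rule normed_space_completion)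
  fix \<epsilon> :: real assume "\<epsilon> > 0"
  then have "\<epsilon> / 2 > 0"
    by simp
  then obtain N where N: "\<And>m n. m \<ge> N \<Longrightarrow> n \<ge> N \<Longrightarrow> vnorm E (s m \<ominus> s n) < \<epsilon> / 2"
    using s unfolding cauchy_seqs_iff by meson
  have "norm (vnorm (completion E) (cls s \<ominus>\<^bsub>completion E\<^esub> emb (s k)) - 0) < \<epsilon>" if k: "k \<ge> N" for k
  proof -
    have sk: "s j \<in> carrier E" for j
      by (rule cauchy_seqs_in[OF s])
    have c: "cls s \<in> carrier (completion E)" "emb (s k) \<in> carrier (completion E)"
      by (simp_all add: cls_in s emb_in sk)
    have d: "(\<lambda>j. s j \<oplus> (-1) \<odot> s k) \<in> cauchy_seqs E"
      by (intro cauchy_seqs_add s cauchy_seqs_const smult_in sk)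
    have "cls s \<ominus>\<^bsub>completion E\<^esub> emb (s k) = cls (\<lambda>j. s j \<oplus> (-1) \<odot> s k)"
      unfolding C.diff_eq_smult[OF c] by (simp add: emb_def completion_rules s sk)
    moreover have "(\<lambda>j. vnorm E (s j \<ominus> s k)) \<longlonglongrightarrow> vnorm (completion E) (cls (\<lambda>j. s j \<oplus> (-1) \<odot> s k))"
      using completion_vnorm[OF d] by (simp add: diff_eq_smult sk)
    then have "vnorm (completion E) (cls (\<lambda>j. s j \<oplus> (-1) \<odot> s k)) \<le> \<epsilon> / 2"
      using N[OF _ k] by (intro LIMSEQ_le_const2) (auto intro!: exI[of _ N] less_imp_le)
    moreover have "0 \<le> vnorm (completion E) (cls s \<ominus>\<^bsub>completion E\<^esub> emb (s k))"
      using c by simp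
    ultimately show ?thesis
      using \<open>\<epsilon> > 0\<close> by simp
  qed
  then show "\<exists>N. \<forall>k\<ge>N. norm (vnorm (completion E) (cls s \<ominus>\<^bsub>completion E\<^esub> emb (s k)) - 0) < \<epsilon>"
    by blast
qed

text \<open>Both sides are continuous along \<open>emb (s k)\<close>, so a constant valid on the
  embedded space carries over. The a priori bound B makes the error term tend to 0 and leaves no
  trace in the constant.\<close>

lemma completion_functional_bound:
  assumes "bounded_operator (completion E) scalars \<psi>"
    and le: "\<And>x. x \<in> carrier E \<Longrightarrow> norm (\<psi> (emb x)) \<le> c * vnorm E x"
    and X: "X \<in> carrier (completion E)"
  shows "norm (\<psi> X) \<le> c * vnorm (completion E) X"
proof -
  interpret C: normed_space "completion E"
    by (rule normed_space_completion)
  obtain s where s: "s \<in> cauchy_seqs E" and X_eq: "X = cls s"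
    using X by (rule completion_cases)
  obtain B where B: "B > 0" "linear_map (completion E) scalars \<psi>"
      "\<And>Y. Y \<in> carrier (completion E) \<Longrightarrow> norm (\<psi> Y) \<le> B * vnorm (completion E) Y"
    using bounded_operatorE[OF normed_space_completion normed_space_scalars assms(1)] by auto
  have es: "emb (s k) \<in> carrier (completion E)" for k
    by (simp add: emb_in cauchy_seqs_in[OF s])
  have "norm (\<psi> X) \<le> c * vnorm E (s k) + B * vnorm (completion E) (X \<ominus>\<^bsub>completion E\<^esub> emb (s k))" for k
  proof -
    have "\<psi> X = \<psi> (emb (s k)) + \<psi> (X \<ominus>\<^bsub>completion E\<^esub> emb (s k))"
      using linear_functional_diff[OF normed_space_completion B(2) X es] by simp
    then show ?thesis
      using le[OF cauchy_seqs_in[OF s], of k] B(3)[of "X \<ominus>\<^bsub>completion E\<^esub> emb (s k)"] X es[of k]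
        norm_triangle_ineq[of "\<psi> (emb (s k))" "\<psi> (X \<ominus>\<^bsub>completion E\<^esub> emb (s k))"] by simp
  qed
  moreover have "(\<lambda>k. c * vnorm E (s k) + B * vnorm (completion E) (X \<ominus>\<^bsub>completion E\<^esub> emb (s k)))
      \<longlonglongrightarrow> c * vnorm (completion E) X + B * 0"
    unfolding X_eq by (intro tendsto_intros completion_vnorm emb_approx s)
  ultimately show ?thesis
    using LIMSEQ_le_const by fastforce
qed

end

text \<open>The image of a class is the limit of R along a representative, which exists since F is
  complete; \<open>uniq\<close> shows that it depends on the class alone. The choice operator in R'
  turns this relation into a function.\<close>

lemma completion_extension:
  fixes E :: "('k::real_normed_field, 'e) normed_module"
  assumes "normed_space E" "banach_space F" and R: "linear_map E F R"
    and bound: "\<And>x. x \<in> carrier E \<Longrightarrow> vnorm F (R x) \<le> B * vnorm E x" and B: "B \<ge> 0"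
  obtains R' where "bounded_operator (completion E) F R'"
    "\<And>x. x \<in> carrier E \<Longrightarrow> R' (normed_space.emb E x) = R x"
proof -
  interpret E: normed_space E by fact
  interpret F: banach_space F by fact
  have FN: "normed_space F"
    by (rule F.normed_space_axioms)
  note Rc = linear_mapD(1)[OF R]
  have Rdiff: "R (x \<ominus>\<^bsub>E\<^esub> y) = R x \<ominus>\<^bsub>F\<^esub> R y" if "x \<in> carrier E" "y \<in> carrier E" for x y
    using linear_map_diff[OF assms(1) FN R that] .
  define L where "L s y \<longleftrightarrow> y \<in> carrier F \<and> (\<lambda>k. vnorm F (R (s k) \<ominus>\<^bsub>F\<^esub> y)) \<longlonglongrightarrow> 0" for s y
  have ex: "\<exists>y. L s y" if s: "s \<in> cauchy_seqs E" for s
  proof -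
    have sk: "s k \<in> carrier E" for k
      by (rule E.cauchy_seqs_in[OF s])
    have r: "range (\<lambda>k. R (s k)) \<subseteq> carrier F"
      using Rc[OF sk] by auto
    have "F.metric.MCauchy (\<lambda>k. R (s k))"
      unfolding F.MCauchy_iff
    proof (intro conjI allI impI r)
      fix \<epsilon> :: real assume "\<epsilon> > 0"
      \<comment> \<open>B may be 0, hence the division by B + 1.\<close>
      then have "\<epsilon> / (B + 1) > 0"
        using B by simp
      then obtain N where N: "\<And>m n. m \<ge> N \<Longrightarrow> n \<ge> N \<Longrightarrow> vnorm E (s m \<ominus>\<^bsub>E\<^esub> s n) < \<epsilon> / (B + 1)"
        using s unfolding E.cauchy_seqs_iff by meson
      have "vnorm F (R (s m) \<ominus>\<^bsub>F\<^esub> R (s n)) < \<epsilon>" if "m \<ge> N" "n \<ge> N" for m n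
      proof -
        have "vnorm F (R (s m) \<ominus>\<^bsub>F\<^esub> R (s n)) \<le> B * vnorm E (s m \<ominus>\<^bsub>E\<^esub> s n)"
          using bound[of "s m \<ominus>\<^bsub>E\<^esub> s n"] sk by (simp add: Rdiff)
        also have "\<dots> \<le> (B + 1) * vnorm E (s m \<ominus>\<^bsub>E\<^esub> s n)"
          using sk B by (intro mult_right_mono) auto
        also have "\<dots> < \<epsilon>"
          using N[OF that] B by (simp add: field_simps)
        finally show ?thesis .
      qed
      then show "\<exists>N. \<forall>m\<ge>N. \<forall>n\<ge>N. vnorm F (R (s m) \<ominus>\<^bsub>F\<^esub> R (s n)) < \<epsilon>"
        by blast
    qed
    then obtain y where "limitin F.metric.mtopology (\<lambda>k. R (s k)) y sequentially"
      using F.complete unfolding F.metric.mcomplete_def by blast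
    then show ?thesis
      using F.limitin_norm_iff[OF r, of y] unfolding norm_topology_def L_def by blast
  qed
  have uniq: "y = z" if s: "s \<in> cauchy_seqs E" and t: "t \<in> cauchy_seqs E" and st: "E.cls s = E.cls t"
      and y: "L s y" and z: "L t z" for s t y z
  proof -
    have sk: "s k \<in> carrier E" "t k \<in> carrier E" for k
      using E.cauchy_seqs_in s t by blast+
    have yz: "y \<in> carrier F" "z \<in> carrier F"
      using y z by (simp_all add: L_def)
    have d: "(\<lambda>k. vnorm E (s k \<ominus>\<^bsub>E\<^esub> t k)) \<longlonglongrightarrow> 0"
      using st E.cls_eq_iff[OF s t] by simp
    have "(\<lambda>k. vnorm F (R (s k) \<ominus>\<^bsub>F\<^esub> y) + B * vnorm E (s k \<ominus>\<^bsub>E\<^esub> t k) + vnorm F (R (t k) \<ominus>\<^bsub>F\<^esub> z)) \<longlonglongrightarrow> 0 + B * 0 + 0"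
      using y z unfolding L_def by (intro tendsto_intros d) auto
    moreover have "vnorm F (y \<ominus>\<^bsub>F\<^esub> z) \<le> vnorm F (R (s k) \<ominus>\<^bsub>F\<^esub> y) + B * vnorm E (s k \<ominus>\<^bsub>E\<^esub> t k) + vnorm F (R (t k) \<ominus>\<^bsub>F\<^esub> z)" for k
    proof -
      have "vnorm F (y \<ominus>\<^bsub>F\<^esub> z) \<le> vnorm F (y \<ominus>\<^bsub>F\<^esub> R (s k)) + vnorm F (R (s k) \<ominus>\<^bsub>F\<^esub> z)"
        using yz Rc sk by (intro F.vnorm_diff_triangle) auto
      moreover have "vnorm F (R (s k) \<ominus>\<^bsub>F\<^esub> z) \<le> vnorm F (R (s k) \<ominus>\<^bsub>F\<^esub> R (t k)) + vnorm F (R (t k) \<ominus>\<^bsub>F\<^esub> z)"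
        using yz Rc sk by (intro F.vnorm_diff_triangle) auto
      moreover have "vnorm F (R (s k) \<ominus>\<^bsub>F\<^esub> R (t k)) \<le> B * vnorm E (s k \<ominus>\<^bsub>E\<^esub> t k)"
        using bound[of "s k \<ominus>\<^bsub>E\<^esub> t k"] sk by (simp add: Rdiff)
      moreover have "vnorm F (y \<ominus>\<^bsub>F\<^esub> R (s k)) = vnorm F (R (s k) \<ominus>\<^bsub>F\<^esub> y)"
        using yz Rc sk by (intro F.vnorm_diff_commute) auto
      ultimately show ?thesis
        by linarith
    qed
    ultimately have "vnorm F (y \<ominus>\<^bsub>F\<^esub> z) \<le> 0"
      using LIMSEQ_le_const by fastforce
    then have "vnorm F (y \<ominus>\<^bsub>F\<^esub> z) = 0"
      using F.vnorm_nonneg[OF F.diff_in[OF yz]] by linarith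
    then show ?thesis
      using yz F.vnorm_eq_0 F.diff_eq_zero_iff F.diff_in by metis
  qed
  define R' where "R' X = (SOME y. \<exists>s\<in>cauchy_seqs E. X = E.cls s \<and> L s y)" for X
  have R'_eq: "R' (E.cls s) = y" if s: "s \<in> cauchy_seqs E" and y: "L s y" for s y
  proof -
    have "\<exists>t\<in>cauchy_seqs E. E.cls s = E.cls t \<and> L t (R' (E.cls s))"
      unfolding R'_def using s y by (intro someI_ex[of "\<lambda>y. \<exists>t\<in>cauchy_seqs E. E.cls s = E.cls t \<and> L t y"]) blast
    then show ?thesis
      using uniq s y by metis
  qed
  show thesis
  proof
    have lin: "linear_map (completion E) F R'"
      unfolding linear_map_def
    proof (intro conjI ballI allI funcsetI)
      fix X assume "X \<in> carrier (completion E)"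
      then obtain s where s: "s \<in> cauchy_seqs E" and X: "X = E.cls s"
        by (rule E.completion_cases)
      obtain y where y: "L s y"
        using ex[OF s] by blast
      have R'X: "R' X = y"
        using R'_eq[OF s y] X by simp
      show "R' X \<in> carrier F"
        using y R'X by (simp add: L_def)
      show "R' (c \<odot>\<^bsub>completion E\<^esub> X) = c \<odot>\<^bsub>F\<^esub> R' X" for c
      proof -
        have "(\<lambda>k. norm c * vnorm F (R (s k) \<ominus>\<^bsub>F\<^esub> y)) \<longlonglongrightarrow> norm c * 0"
          using y unfolding L_def by (intro tendsto_intros) auto
        then have "(\<lambda>k. vnorm F (c \<odot>\<^bsub>F\<^esub> (R (s k) \<ominus>\<^bsub>F\<^esub> y))) \<longlonglongrightarrow> 0"
          using y Rc E.cauchy_seqs_in[OF s] by (simp add: F.vnorm_smult L_def)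
        then have "L (\<lambda>k. c \<odot>\<^bsub>E\<^esub> s k) (c \<odot>\<^bsub>F\<^esub> y)"
          using y Rc E.cauchy_seqs_in[OF s] linear_mapD(3)[OF R] by (simp add: L_def F.smult_diff)
        then show ?thesis
          unfolding R'X unfolding X E.completion_smult[OF s] by (intro R'_eq E.cauchy_seqs_smult s)
      qed
      fix Y assume "Y \<in> carrier (completion E)"
      then obtain t where t: "t \<in> cauchy_seqs E" and Y: "Y = E.cls t"
        by (rule E.completion_cases)
      obtain z where z: "L t z"
        using ex[OF t] by blast
      have R'Y: "R' Y = z"
        using R'_eq[OF t z] Y by simp
      have "(\<lambda>k. vnorm F (R (s k) \<ominus>\<^bsub>F\<^esub> y) + vnorm F (R (t k) \<ominus>\<^bsub>F\<^esub> z)) \<longlonglongrightarrow> 0 + 0"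
        using y z unfolding L_def by (intro tendsto_intros) auto
      then have "(\<lambda>k. vnorm F ((R (s k) \<oplus>\<^bsub>F\<^esub> R (t k)) \<ominus>\<^bsub>F\<^esub> (y \<oplus>\<^bsub>F\<^esub> z))) \<longlonglongrightarrow> 0"
        using y z Rc E.cauchy_seqs_in[OF s] E.cauchy_seqs_in[OF t]
        by (intro F.tendsto_zero_vnorm_le[of "\<lambda>k. vnorm F (R (s k) \<ominus>\<^bsub>F\<^esub> y) + vnorm F (R (t k) \<ominus>\<^bsub>F\<^esub> z)"])
          (simp_all add: F.add_diff_add F.vnorm_triangle L_def)
      then have "L (\<lambda>k. s k \<oplus>\<^bsub>E\<^esub> t k) (y \<oplus>\<^bsub>F\<^esub> z)"
        using y z Rc E.cauchy_seqs_in[OF s] E.cauchy_seqs_in[OF t] linear_mapD(2)[OF R] by (simp add: L_def)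
      then show "R' (X \<oplus>\<^bsub>completion E\<^esub> Y) = R' X \<oplus>\<^bsub>F\<^esub> R' Y"
        unfolding R'X R'Y unfolding X Y E.completion_add[OF s t] by (intro R'_eq E.cauchy_seqs_add s t)
    qed
    have "vnorm F (R' X) \<le> B * vnorm (completion E) X" if "X \<in> carrier (completion E)" for X
    proof -
      obtain s where s: "s \<in> cauchy_seqs E" and X: "X = E.cls s"
        using \<open>X \<in> carrier (completion E)\<close> by (rule E.completion_cases)
      obtain y where y: "L s y"
        using ex[OF s] by blast
      have sk: "s k \<in> carrier E" for k
        by (rule E.cauchy_seqs_in[OF s])
      have "vnorm F y \<le> B * vnorm E (s k) + vnorm F (R (s k) \<ominus>\<^bsub>F\<^esub> y)" for k
        using y bound[OF sk, of k] Rc[OF sk, of k] F.vnorm_triangle_sub[of y "R (s k)"] F.vnorm_diff_commute[of y "R (s k)"]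
        by (simp add: L_def)
      moreover have "(\<lambda>k. B * vnorm E (s k) + vnorm F (R (s k) \<ominus>\<^bsub>F\<^esub> y)) \<longlonglongrightarrow> B * vnorm (completion E) X + 0"
        using y unfolding X L_def by (intro tendsto_intros E.completion_vnorm s) auto
      ultimately have "vnorm F y \<le> B * vnorm (completion E) X"
        using LIMSEQ_le_const by fastforce
      then show ?thesis
        using R'_eq[OF s y] X by simp
    qed
    then show "bounded_operator (completion E) F R'"
      unfolding bounded_operator_iff[OF E.normed_space_completion FN] using lin by blast
    show "R' (E.emb x) = R x" if "x \<in> carrier E" for x
      unfolding E.emb_def using that Rc[OF that] by (intro R'_eq E.cauchy_seqs_const) (simp_all add: L_def)
  qed
qed

section \<open>The projective tensor product of spaces of continuous functions\<close>

text \<open>The parameter \<kappa> fixes the scalar field, which n and K do not determine.\<close>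

locale C_tensor =
  fixes n :: nat and K :: "nat \<Rightarrow> 'a topology" and \<kappa> :: "'k::real_normed_field itself"
  assumes n_pos: "n > 0" and compact: "\<And>i. i < n \<Longrightarrow> compact_space (K i)"
    and nonempty: "\<And>i. i < n \<Longrightarrow> topspace (K i) \<noteq> {}"
begin

definition E :: "nat \<Rightarrow> ('k, 'a \<Rightarrow> 'k) normed_module" where
  "E i = C_space (K i)"

definition A where "A = algebraic_tensor n E"

definition X where "X = projective_tensor n E"

text \<open>Here \<open>x\<close> is a tuple of total functions; they are cut down to the carriers.\<close>

definition tup :: "(nat \<Rightarrow> 'a \<Rightarrow> 'k) \<Rightarrow> nat \<Rightarrow> 'a \<Rightarrow> 'k" where
  "tup x = (\<lambda>i\<in>{..<n}. restrict (x i) (topspace (K i)))"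

definition tens where "tens x = normed_space.emb A (elementary_tensor n E (tup x))"

definition cont_tuple :: "(nat \<Rightarrow> 'a \<Rightarrow> 'k) \<Rightarrow> bool" where
  "cont_tuple x \<longleftrightarrow> (\<forall>i<n. continuous_fun (K i) (x i))"

lemma normed_E: "i < n \<Longrightarrow> normed_space (E i)"
  unfolding E_def by (intro normed_space_C_space compact nonempty)

lemma tensor_factors_E: "tensor_factors n E"
  by (intro tensor_factors.intro n_pos normed_E)

sublocale T: tensor_factors n E
  by (rule tensor_factors_E)

lemma normed_A: "normed_space A"
  unfolding A_def E_def[abs_def] by (intro algebraic_tensor_C_space_normed n_pos compact nonempty)

sublocale A: normed_space A
  by (rule normed_A)

lemma X_eq: "X = completion A"
  by (simp add: X_def A_def projective_tensor_def)

lemma normed_X: "normed_space X"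
  unfolding X_eq by (rule A.normed_space_completion)

sublocale X: normed_space X
  by (rule normed_X)

lemma tup_in: "cont_tuple x \<Longrightarrow> tup x \<in> T.tuples"
  by (auto simp: tup_def cont_tuple_def E_def)

lemma tens_in [simp]: "cont_tuple x \<Longrightarrow> tens x \<in> carrier X"
  unfolding tens_def X_eq by (intro A.emb_in) (simp add: A_def tup_in)

lemma cont_tuple_upd: "cont_tuple x \<Longrightarrow> continuous_fun (K i) f \<Longrightarrow> cont_tuple (x(i := f))"
  by (auto simp: cont_tuple_def)

lemma cont_tupleD: "cont_tuple x \<Longrightarrow> i < n \<Longrightarrow> continuous_fun (K i) (x i)"
  by (simp add: cont_tuple_def)

lemma tup_upd: "i < n \<Longrightarrow> tup (x(i := f)) = (tup x)(i := restrict f (topspace (K i)))"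
  by (auto simp: tup_def)

lemma elementary_in: "cont_tuple x \<Longrightarrow> elementary_tensor n E (tup x) \<in> carrier A"
  by (simp add: A_def tup_in)

lemma tens_add:
  assumes x: "cont_tuple x" and i: "i < n" and f: "continuous_fun (K i) f" and g: "continuous_fun (K i) g"
  shows "tens (x(i := \<lambda>t. f t + g t)) = tens (x(i := f)) \<oplus>\<^bsub>X\<^esub> tens (x(i := g))"
proof -
  have "B (tup (x(i := \<lambda>t. f t + g t))) = B (tup (x(i := f))) + B (tup (x(i := g)))"
    if B: "B \<in> multilinear_forms n E" for B
    using linear_map_C_space(1)[OF multilinear_formsD[OF B tup_in[OF x] i, unfolded E_def] f g] i
    by (simp add: tup_upd)
  then have "elementary_tensor n E (tup (x(i := \<lambda>t. f t + g t))) =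
      elementary_tensor n E (tup (x(i := f))) \<oplus>\<^bsub>A\<^esub> elementary_tensor n E (tup (x(i := g)))"
    unfolding A_def algebraic_tensor_simps elementary_tensor_def by (intro restrict_ext) simp
  then show ?thesis
    unfolding tens_def X_eq using elementary_in[OF cont_tuple_upd[OF x f]] elementary_in[OF cont_tuple_upd[OF x g]]
    by (simp only: A.emb_add)
qed

lemma tens_smult:
  assumes x: "cont_tuple x" and i: "i < n" and f: "continuous_fun (K i) f"
  shows "tens (x(i := \<lambda>t. c * f t)) = c \<odot>\<^bsub>X\<^esub> tens (x(i := f))"
proof -
  have "B (tup (x(i := \<lambda>t. c * f t))) = c * B (tup (x(i := f)))"
    if B: "B \<in> multilinear_forms n E" for B
    using linear_map_C_space(2)[OF multilinear_formsD[OF B tup_in[OF x] i, unfolded E_def] f f, of c] i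
    by (simp add: tup_upd)
  then have "elementary_tensor n E (tup (x(i := \<lambda>t. c * f t))) = c \<odot>\<^bsub>A\<^esub> elementary_tensor n E (tup (x(i := f)))"
    unfolding A_def algebraic_tensor_simps elementary_tensor_def by (intro restrict_ext) simp
  then show ?thesis
    unfolding tens_def X_eq using elementary_in[OF cont_tuple_upd[OF x f]]
    by (simp only: A.emb_smult)
qed

lemma vnorm_tens_le:
  assumes x: "cont_tuple x" and c: "\<And>i t. i < n \<Longrightarrow> t \<in> topspace (K i) \<Longrightarrow> norm (x i t) \<le> c i"
  shows "vnorm X (tens x) \<le> (\<Prod>i<n. c i)"
proof -
  have "vnorm X (tens x) = vnorm A (elementary_tensor n E (tup x))"
    unfolding tens_def X_eq by (intro A.vnorm_emb) (simp add: A_def tup_in x)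
  also have "\<dots> \<le> (\<Prod>i<n. vnorm (E i) (tup x i))"
    unfolding A_def by (rule T.vnorm_elementary_tensor_le[OF tup_in[OF x]])
  also have "\<dots> \<le> (\<Prod>i<n. c i)"
  proof (intro prod_mono conjI)
    fix i assume "i \<in> {..<n}"
    then have i: "i < n"
      by simp
    show "0 \<le> vnorm (E i) (tup x i)"
      using tup_in[OF x] i by (intro normed_space.vnorm_nonneg[OF normed_E]) (auto simp: PiE_iff)
    show "vnorm (E i) (tup x i) \<le> c i"
      unfolding E_def using i c nonempty by (intro C_space_vnorm_le) (auto simp: tup_def)
  qed
  finally show ?thesis .
qed

text \<open>The factors are normalised one by one (\<open>z k\<close> has its first k factors
  scaled); then \<open>seminorm_tensor_bound\<close> and density of the algebraic tensors finish.
  This is how a finite net for tensors of unit factors becomes an estimate for norms of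
  functionals.\<close>

lemma functional_bound_by_tens:
  assumes \<psi>: "bounded_operator X scalars \<psi>" and c: "c \<ge> 0"
    and le: "\<And>x. cont_tuple x \<Longrightarrow> (\<And>i t. i < n \<Longrightarrow> t \<in> topspace (K i) \<Longrightarrow> norm (x i t) \<le> 1) \<Longrightarrow> norm (\<psi> (tens x)) \<le> c"
    and u: "u \<in> carrier X"
  shows "norm (\<psi> u) \<le> c * vnorm X u"
proof -
  obtain B where B: "B > 0" "linear_map X scalars \<psi>"
      "\<And>v. v \<in> carrier X \<Longrightarrow> norm (\<psi> v) \<le> B * vnorm X v"
    using bounded_operatorE[OF normed_X normed_space_scalars \<psi>] by auto
  have el: "norm (\<psi> (tens y)) \<le> c * (\<Prod>i<n. vnorm (E i) (y i))" if y: "y \<in> T.tuples" for y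
  proof -
    define a where "a i = vnorm (E i) (y i)" for i
    have yc: "y i \<in> carrier (C_space (K i))" if "i < n" for i
      using y that by (auto simp: PiE_iff E_def)
    have cont: "cont_tuple y"
      using yc by (auto simp: cont_tuple_def intro: C_space_carrierD)
    have a_nonneg: "0 \<le> a i" if "i < n" for i
      unfolding a_def using normed_space.vnorm_nonneg[OF normed_E[OF that]] yc[OF that] by (simp add: E_def)
    have y_le: "norm (y i t) \<le> a i" if "i < n" "t \<in> topspace (K i)" for i t
      unfolding a_def E_def using that by (intro C_space_norm_le compact C_space_carrierD yc)
    show ?thesis
    \<comment> \<open>A factor of norm 0 cannot be normalised, but then the tensor has norm
      0.\<close>
    proof (cases "\<exists>i<n. a i = 0")
      case True
      then have "(\<Prod>i<n. a i) = 0"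
        by auto
      then have "vnorm X (tens y) \<le> 0"
        using vnorm_tens_le[OF cont y_le] by linarith
      then have "norm (\<psi> (tens y)) \<le> 0"
        using B(3)[OF tens_in[OF cont]] B(1) by (meson mult_nonneg_nonpos less_imp_le order_trans)
      then show ?thesis
        using \<open>(\<Prod>i<n. a i) = 0\<close> unfolding a_def by (simp only: mult_zero_right)
    next
      case False
      then have a_pos: "0 < a i" if "i < n" for i
        using a_nonneg[OF that] that by force
      define z where "z k i = (if i < k then (\<lambda>t. of_real (inverse (a i)) * y i t) else y i)" for k i
      have zc: "cont_tuple (z k)" for k
        using cont by (auto simp: cont_tuple_def z_def intro!: continuous_fun_mult)
      have "norm (\<psi> (tens y)) = (\<Prod>i<k. a i) * norm (\<psi> (tens (z k)))" if "k \<le> n" for k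
        using that
      proof (induction k)
        case 0
        then show ?case
          by (simp add: z_def)
      next
        case (Suc k)
        have k: "k < n"
          using Suc.prems by simp
        have eq: "z (Suc k) = (z k)(k := \<lambda>t. of_real (inverse (a k)) * y k t)" "(z k)(k := y k) = z k"
          by (auto simp: z_def fun_eq_iff)
        have "tens (z (Suc k)) = of_real (inverse (a k)) \<odot>\<^bsub>X\<^esub> tens (z k)"
          using tens_smult[OF zc[of k] k cont_tupleD[OF cont k], of "of_real (inverse (a k))"] unfolding eq .
        then have "norm (\<psi> (tens (z (Suc k)))) = inverse (a k) * norm (\<psi> (tens (z k)))"
          using linear_mapD(3)[OF B(2) tens_in[OF zc[of k]]] a_pos[OF k] by (simp add: norm_mult norm_inverse)
        then show ?case
          using Suc.IH a_pos[OF k] k by simp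
      qed
      then have "norm (\<psi> (tens y)) = (\<Prod>i<n. a i) * norm (\<psi> (tens (z n)))"
        by simp
      moreover have "norm (\<psi> (tens (z n))) \<le> c"
      proof (rule le[OF zc])
        fix i t assume it: "i < n" "t \<in> topspace (K i)"
        then have "inverse (a i) * norm (y i t) \<le> 1"
          using y_le[OF it] a_pos[OF it(1)] by (simp add: field_simps)
        then show "norm (z n i t) \<le> 1"
          using it a_pos[OF it(1)] by (simp add: z_def norm_mult norm_inverse)
      qed
      then have "(\<Prod>i<n. a i) * norm (\<psi> (tens (z n))) \<le> (\<Prod>i<n. a i) * c"
        using a_nonneg by (intro mult_left_mono prod_nonneg) auto
      ultimately show ?thesis
        unfolding a_def by (simp add: mult.commute)
    qed
  qed
  have tens_el: "tens y = A.emb (elementary_tensor n E y)" if y: "y \<in> T.tuples" for y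
  proof -
    have "tup y = y"
    proof
      fix i show "tup y i = y i"
        using y by (cases "i < n") (auto simp: tup_def PiE_iff E_def extensional_def[of "{..<n}"])
    qed
    then show ?thesis
      by (simp add: tens_def)
  qed
  have "norm (\<psi> (A.emb v)) \<le> c * vnorm (algebraic_tensor n E) v" if v: "v \<in> carrier A" for v
  proof (rule T.seminorm_tensor_bound[where p = "\<lambda>v. norm (\<psi> (A.emb v))"])
    show "norm (\<psi> (A.emb \<zero>\<^bsub>algebraic_tensor n E\<^esub>)) \<le> 0"
      using B(3)[of "A.emb \<zero>\<^bsub>A\<^esub>"] A.vnorm_emb[of "\<zero>\<^bsub>A\<^esub>"] A.emb_in[of "\<zero>\<^bsub>A\<^esub>"] by (simp add: X_eq flip: A_def)
    show "norm (\<psi> (A.emb (u \<oplus>\<^bsub>algebraic_tensor n E\<^esub> w))) \<le> norm (\<psi> (A.emb u)) + norm (\<psi> (A.emb w))"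
      if "u \<in> carrier (algebraic_tensor n E)" "w \<in> carrier (algebraic_tensor n E)" for u w
      using that linear_mapD(2)[OF B(2), of "A.emb u" "A.emb w"] A.emb_in[of u] A.emb_in[of w]
      by (simp add: X_eq A.emb_add norm_triangle_ineq flip: A_def)
    show "norm (\<psi> (A.emb (elementary_tensor n E y))) \<le> c * (\<Prod>i<n. vnorm (E i) (y i))" if "y \<in> T.tuples" for y
      using el[OF that] tens_el[OF that] by simp
  qed (use c v in \<open>simp_all add: A_def\<close>)
  then have "norm (\<psi> (A.emb v)) \<le> c * vnorm A v" if "v \<in> carrier A" for v
    using that by (simp only: A_def)
  then show ?thesis
    using A.completion_functional_bound[of \<psi> c u] \<psi> u by (simp add: X_eq)
qed

end

section \<open>Pointwise null sequences and multilinear maps\<close>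

definition bdd_seq :: "'a topology \<Rightarrow> (nat \<Rightarrow> 'a \<Rightarrow> 'k::real_normed_vector) \<Rightarrow> bool" where
  "bdd_seq T s \<longleftrightarrow> (\<exists>c. \<forall>k. \<forall>t\<in>topspace T. norm (s k t) \<le> c)"

definition null_seq :: "'a topology \<Rightarrow> (nat \<Rightarrow> 'a \<Rightarrow> 'k::real_normed_vector) \<Rightarrow> bool" where
  "null_seq T s \<longleftrightarrow> bdd_seq T s \<and> (\<forall>t\<in>topspace T. (\<lambda>k. s k t) \<longlonglongrightarrow> 0)"

definition conv_seq :: "'a topology \<Rightarrow> (nat \<Rightarrow> 'a \<Rightarrow> 'k::real_normed_vector) \<Rightarrow> bool" where
  "conv_seq T s \<longleftrightarrow> bdd_seq T s \<and> (\<forall>t\<in>topspace T. convergent (\<lambda>k. s k t))"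

text \<open>For continuous functions on a compact space these are the weakly unconditionally Cauchy
  series.\<close>

definition abs_summing :: "'a topology \<Rightarrow> (nat \<Rightarrow> 'a \<Rightarrow> 'k::real_normed_vector) \<Rightarrow> bool" where
  "abs_summing T s \<longleftrightarrow> (\<exists>c. \<forall>m. \<forall>t\<in>topspace T. (\<Sum>k<m. norm (s k t)) \<le> c)"

lemma bdd_seq_compose: "bdd_seq T s \<Longrightarrow> bdd_seq T (\<lambda>k. s (r k))"
  unfolding bdd_seq_def by blast

lemma null_seq_compose: "null_seq T s \<Longrightarrow> filterlim r sequentially sequentially \<Longrightarrow> null_seq T (\<lambda>k. s (r k))"
  unfolding null_seq_def using bdd_seq_compose filterlim_compose by blast

lemma conv_seq_compose:
  "conv_seq T s \<Longrightarrow> filterlim r sequentially sequentially \<Longrightarrow> conv_seq T (\<lambda>k. s (r k))"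
  unfolding conv_seq_def convergent_def using bdd_seq_compose filterlim_compose by blast

lemma abs_summing_imp_bdd_seq:
  assumes "abs_summing T s"
  shows "bdd_seq T s"
proof -
  obtain c where c: "\<And>m t. t \<in> topspace T \<Longrightarrow> (\<Sum>k<m. norm (s k t)) \<le> c"
    using assms unfolding abs_summing_def by blast
  have "norm (s k t) \<le> c" if "t \<in> topspace T" for k t
    using c[OF that, of "Suc k"] sum_nonneg[of "{..<k}" "\<lambda>k. norm (s k t)"] by simp
  then show ?thesis
    unfolding bdd_seq_def by blast
qed

lemma abs_summing_compose:
  assumes "abs_summing T s" "strict_mono r"
  shows "abs_summing T (\<lambda>k. s (r k))"
proof -
  obtain c where c: "\<And>m t. t \<in> topspace T \<Longrightarrow> (\<Sum>k<m. norm (s k t)) \<le> c"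
    using assms unfolding abs_summing_def by blast
  have "(\<Sum>k<m. norm (s (r k) t)) \<le> c" if "t \<in> topspace T" for m t
  proof -
    have "inj_on r {..<m}"
      using assms(2) by (auto simp: inj_on_def strict_mono_eq)
    then have "(\<Sum>k<m. norm (s (r k) t)) = (\<Sum>k\<in>r ` {..<m}. norm (s k t))"
      by (simp only: sum.reindex o_def)
    also have "\<dots> \<le> (\<Sum>k<r m. norm (s k t))"
      using assms(2) by (intro sum_mono2) (auto simp: strict_mono_less)
    finally show ?thesis
      using c[OF that, of "r m"] by linarith
  qed
  then show ?thesis
    unfolding abs_summing_def by blast
qed

lemma continuous_fun_bounded_ex:
  fixes f :: "'a \<Rightarrow> 'k::real_normed_vector"
  assumes "compact_space K" "continuous_fun K f"
  shows "\<exists>c>0. \<forall>t\<in>topspace K. norm (f t) \<le> c"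
proof (rule continuous_fun_bounded[OF assms])
  fix c :: real assume c: "c > 0" "\<And>t. t \<in> topspace K \<Longrightarrow> norm (f t) \<le> c"
  show ?thesis
    by (intro exI[of _ c] conjI ballI c)
qed

lemma not_tendsto_zero_subseq:
  fixes f :: "nat \<Rightarrow> real"
  assumes "\<And>k. f k \<ge> 0" "\<not> f \<longlonglongrightarrow> 0"
  shows "\<exists>\<epsilon>>0. \<exists>r :: nat \<Rightarrow> nat. strict_mono r \<and> (\<forall>k. f (r k) \<ge> \<epsilon>)"
proof -
  obtain \<epsilon> where e: "\<epsilon> > 0" "\<And>N. \<exists>k\<ge>N. f k \<ge> \<epsilon>"
    using assms unfolding LIMSEQ_iff by (auto simp: not_less)
  then have inf: "infinite {k. f k \<ge> \<epsilon>}"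
    unfolding infinite_nat_iff_unbounded_le by blast
  then show ?thesis
    using e(1) strict_mono_enumerate[OF inf] enumerate_in_set[OF inf] by blast
qed

text \<open>The model for \<open>N x\<close> is the norm of T at the elementary tensor of x.
  Truncation works with subadditivity in each slot, the product bound and the case of absolutely
  summing factors.\<close>

locale multi_seminorm = C_tensor n K \<kappa>
  for n and K :: "nat \<Rightarrow> 'a topology" and \<kappa> :: "'k::{real_normed_field,euclidean_space} itself" +
  fixes N :: "(nat \<Rightarrow> 'a \<Rightarrow> 'k) \<Rightarrow> real" and M :: real
  assumes M_nonneg: "M \<ge> 0" and N_nonneg: "\<And>x. cont_tuple x \<Longrightarrow> 0 \<le> N x"
    and N_add: "\<And>x i f g. cont_tuple x \<Longrightarrow> i < n \<Longrightarrow> continuous_fun (K i) f \<Longrightarrow> continuous_fun (K i) g \<Longrightarrow>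
      N (x(i := \<lambda>t. f t + g t)) \<le> N (x(i := f)) + N (x(i := g))"
    and N_bound: "\<And>x c. cont_tuple x \<Longrightarrow> (\<And>i t. i < n \<Longrightarrow> t \<in> topspace (K i) \<Longrightarrow> norm (x i t) \<le> c i) \<Longrightarrow>
      N x \<le> M * (\<Prod>i<n. c i)"
    and N_summing: "\<And>x W. (\<And>k. cont_tuple (x k)) \<Longrightarrow> W \<subseteq> {..<n} \<Longrightarrow> W \<noteq> {} \<Longrightarrow>
      (\<And>i. i \<in> W \<Longrightarrow> abs_summing (K i) (\<lambda>k. x k i)) \<Longrightarrow>
      (\<And>i k. i < n \<Longrightarrow> i \<notin> W \<Longrightarrow> x k i = x 0 i) \<Longrightarrow> (\<lambda>k. N (x k)) \<longlonglongrightarrow> 0"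
begin

lemma N_telescope:
  assumes "cont_tuple x" "i < n" "\<And>j. continuous_fun (K i) (g j)"
  shows "N (x(i := g 0)) \<le> (\<Sum>j<m. N (x(i := \<lambda>t. g j t - g (Suc j) t))) + N (x(i := g m))"
proof (induction m)
  case (Suc m)
  have "N (x(i := g m)) \<le> N (x(i := \<lambda>t. g m t - g (Suc m) t)) + N (x(i := g (Suc m)))"
    using N_add[of x i "\<lambda>t. g m t - g (Suc m) t" "g (Suc m)"] assms by (simp add: continuous_fun_diff)
  then show ?case
    using Suc.IH unfolding sum.lessThan_Suc by linarith
qed simp

lemma N_zero:
  assumes "cont_tuple x" "i < n" "\<And>t. t \<in> topspace (K i) \<Longrightarrow> x i t = 0"
  shows "N x = 0"
proof -
  have "\<exists>c. \<forall>t\<in>topspace (K j). norm (x j t) \<le> c" if j: "j < n" for j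
    using continuous_fun_bounded_ex[OF compact[OF j] cont_tupleD[OF assms(1) j]] by blast
  then obtain c where c: "\<And>j t. j < n \<Longrightarrow> t \<in> topspace (K j) \<Longrightarrow> norm (x j t) \<le> c j"
    by metis
  have "N x \<le> M * (\<Prod>j<n. (c(i := 0)) j)"
    using assms c by (intro N_bound) auto
  also have "(\<Prod>j<n. (c(i := 0)) j) = 0"
    using assms(2) by (intro prod_zero) auto
  finally show ?thesis
    using N_nonneg[OF assms(1)] by simp
qed

end

section \<open>Running maxima and truncation\<close>

primrec running_max :: "(nat \<Rightarrow> 'a \<Rightarrow> real) \<Rightarrow> nat \<Rightarrow> nat \<Rightarrow> 'a \<Rightarrow> real" where
  "running_max a m 0 t = a m t"
| "running_max a m (Suc d) t = max (running_max a m d t) (a (m + Suc d) t)"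

lemma continuous_fun_running_max:
  "(\<And>k. continuous_fun T (a k)) \<Longrightarrow> continuous_fun T (running_max a m d)"
proof (induction d)
  case 0
  then show ?case
    by simp
next
  case (Suc d)
  then have "continuous_fun T (\<lambda>t. max (running_max a m d t) (a (m + Suc d) t))"
    by (intro continuous_map_real_max) auto
  then show ?case
    by simp
qed

lemma running_max_mono: "d \<le> d' \<Longrightarrow> running_max a m d t \<le> running_max a m d' t"
  by (induction d' rule: dec_induct) auto

lemma le_running_max: "j \<le> d \<Longrightarrow> a (m + j) t \<le> running_max a m d t"
  by (induction d) (auto simp: le_Suc_eq)

lemma running_max_attained: "\<exists>l\<ge>m. running_max a m d t = a l t"
proof (induction d)
  case 0
  then show ?case
    by auto
next
  case (Suc d)
  then show ?case
    by (cases "running_max a m d t \<le> a (m + Suc d) t") (auto simp: max_def intro!: exI[of _ "m + Suc d"])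
qed

text \<open>For w > 0 this is the radial retraction of the scalars onto the ball of radius w;
  writing it with \<open>max\<close> keeps it continuous in w and z jointly.\<close>

definition clip :: "real \<Rightarrow> 'k::real_normed_field \<Rightarrow> 'k" where
  "clip w z = of_real (w / max w (norm z)) * z"

lemma clip:
  assumes "w > 0"
  shows "norm (clip w z) \<le> norm z" "norm (clip w z) \<le> w"
    "norm (z - clip w z) \<le> max 0 (norm z - w)"
proof -
  consider "norm z \<le> w" | "w < norm z"
    by linarith
  then have "norm (clip w z) \<le> norm z \<and> norm (clip w z) \<le> w \<and> norm (z - clip w z) \<le> max 0 (norm z - w)"
  proof cases
    case 1
    then have "clip w z = z"
      using assms by (simp add: clip_def max_absorb1)
    then show ?thesis
      using 1 by simp
  next
    case 2
    then have m: "max w (norm z) = norm z" and z: "norm z > 0"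
      using assms by (simp, linarith)
    have cw: "norm (clip w z) = w"
      unfolding clip_def m norm_mult norm_of_real using z assms by simp
    have "z - clip w z = of_real (1 - w / norm z) * z"
      unfolding clip_def m by (simp add: algebra_simps)
    then have "norm (z - clip w z) = \<bar>1 - w / norm z\<bar> * norm z"
      by (simp only: norm_mult norm_of_real)
    also have "\<bar>1 - w / norm z\<bar> = 1 - w / norm z"
      using 2 z by simp
    also have "(1 - w / norm z) * norm z = norm z - w"
      using z by (simp add: left_diff_distrib)
    finally have "norm (z - clip w z) = norm z - w" .
    then show ?thesis
      using 2 cw by simp
  qed
  then show "norm (clip w z) \<le> norm z" "norm (clip w z) \<le> w"
      "norm (z - clip w z) \<le> max 0 (norm z - w)"
    by simp_all
qed

lemma continuous_fun_clip:
  assumes "continuous_fun T w" "continuous_fun T f" "\<And>t. t \<in> topspace T \<Longrightarrow> w t > 0"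
  shows "continuous_fun T (\<lambda>t. clip (w t) (f t))"
proof -
  have "max (w t) (norm (f t)) \<noteq> 0" if "t \<in> topspace T" for t
    using assms(3)[OF that] less_max_iff_disj[of 0 "w t" "norm (f t)"] by linarith
  then show ?thesis
    unfolding clip_def using assms(1,2)
    by (intro continuous_fun_mult continuous_fun_of_real continuous_map_real_divide continuous_map_real_max continuous_fun_norm)
qed

context multi_seminorm
begin

text \<open>Induction on the set of null factors. In the chosen slot i the function f k is cut down
  at the heights V 0 + \<delta>, V 1 + \<delta>, ..., where V m is the maximum of |f m|, |f (m +
  1)|, ... over a stretch so long that its later growth costs N at most \<eta> m. The pieces cut off
  are therefore cheap, and the remainder is uniformly small because at each point one of finitely
  many V m lies below \<delta>.\<close>

lemma null_or_summing_tendsto_zero: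
  assumes "finite Z"
  shows "\<lbrakk>\<And>k. cont_tuple (x k); W \<union> Z \<subseteq> {..<n}; W \<union> Z \<noteq> {}; W \<inter> Z = {};
      \<And>i. i \<in> W \<Longrightarrow> abs_summing (K i) (\<lambda>k. x k i); \<And>i. i \<in> Z \<Longrightarrow> null_seq (K i) (\<lambda>k. x k i);
      \<And>i k. i < n \<Longrightarrow> i \<notin> W \<union> Z \<Longrightarrow> x k i = x 0 i\<rbrakk> \<Longrightarrow> (\<lambda>k. N (x k)) \<longlonglongrightarrow> 0"
  using assms
proof (induction Z arbitrary: x W rule: finite_induct)
  case empty
  show ?case
  proof (rule N_summing[of x W, OF empty.prems(1)])
    show "W \<subseteq> {..<n}" "W \<noteq> {}"
      using empty.prems(2,3) by simp_all
    show "x k i = x 0 i" if "i < n" "i \<notin> W" for i k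
      using that by (intro empty.prems(7)) simp_all
  qed (rule empty.prems(5))
next
  case (insert i Z)
  note cx = insert.prems(1)
  have i: "i < n" "i \<notin> W"
    using insert.prems(2-4) by auto
  define f where "f k = x k i" for k
  have cf: "continuous_fun (K i) (f k)" for k
    using cont_tupleD[OF cx i(1)] by (simp add: f_def)
  have bdd: "bdd_seq (K j) (\<lambda>k. x k j)" if j: "j < n" for j
  proof -
    consider "j \<in> W" | "j \<in> insert i Z" | "j \<notin> W \<union> insert i Z"
      by blast
    then show ?thesis
    proof cases
      case 1
      then show ?thesis
        using insert.prems(5) abs_summing_imp_bdd_seq by blast
    next
      case 2
      then show ?thesis
        using insert.prems(6) unfolding null_seq_def by blast
    next
      case 3
      obtain c where c: "\<And>t. t \<in> topspace (K j) \<Longrightarrow> norm (x 0 j t) \<le> c"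
        using continuous_fun_bounded_ex[OF compact[OF j] cont_tupleD[OF cx j]] by blast
      have "norm (x k j t) \<le> c" if "t \<in> topspace (K j)" for k t
        using insert.prems(7)[OF j 3, of k] c[OF that] by simp
      then show ?thesis
        unfolding bdd_seq_def by blast
    qed
  qed
  then have "\<exists>c. \<forall>k. \<forall>t\<in>topspace (K j). norm (x k j t) \<le> c" if "j < n" for j
    using that unfolding bdd_seq_def by blast
  then obtain c where c: "\<And>j k t. j < n \<Longrightarrow> t \<in> topspace (K j) \<Longrightarrow> norm (x k j t) \<le> c j"
    by metis
  define H where "H m d t = running_max (\<lambda>k t. norm (f k t)) m d t" for m d t
  have cH: "continuous_fun (K i) (H m d)" for m d
    unfolding H_def by (intro continuous_fun_running_max continuous_fun_norm cf)
  have H_mono: "H m d t \<le> H m d' t" if "d \<le> d'" for m d d' t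
    unfolding H_def using that by (rule running_max_mono)
  have f_le_H: "norm (f (m + j) t) \<le> H m d t" if "j \<le> d" for m j d t
    unfolding H_def using that le_running_max[of j d "\<lambda>k t. norm (f k t)"] by blast
  have H_attained: "\<exists>l\<ge>m. H m d t = norm (f l t)" for m d t
    unfolding H_def by (rule running_max_attained)
  \<comment> \<open>If no q worked, there would be functions e dominated by successive increments of
    the running maximum on which N stays above \<eta>. The increments telescope, so these functions
    are absolutely summing; slot i moves from Z to W, and the induction hypothesis gives a
    contradiction.\<close>
  have exhaust: "\<exists>q. \<forall>d>q. \<forall>e. continuous_fun (K i) e \<longrightarrow>
      (\<forall>t\<in>topspace (K i). norm (e t) \<le> H m d t - H m q t) \<longrightarrow> N ((x (m + d))(i := e)) \<le> \<eta>"
    if \<eta>: "\<eta> > 0" for m \<eta>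
  proof (rule ccontr)
    assume "\<not> ?thesis"
    then have "\<forall>q. \<exists>d e. d > q \<and> continuous_fun (K i) e \<and>
        (\<forall>t\<in>topspace (K i). norm (e t) \<le> H m d t - H m q t) \<and> \<eta> < N ((x (m + d))(i := e))"
      by (simp add: not_le)
    then obtain D e where D: "\<And>q. D q > q" and ce: "\<And>q. continuous_fun (K i) (e q)"
      and e_le: "\<And>q t. t \<in> topspace (K i) \<Longrightarrow> norm (e q t) \<le> H m (D q) t - H m q t"
      and big: "\<And>q. \<eta> < N ((x (m + D q))(i := e q))"
      by metis
    define q where "q j = (D ^^ j) 0" for j
    have q_Suc: "q (Suc j) = D (q j)" for j
      by (simp add: q_def)
    have q_mono: "strict_mono q"
      unfolding strict_mono_Suc_iff q_Suc using D by blast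
    \<comment> \<open>The tuple belongs to the far end of the j-th increment, because
      \<open>e (q j)\<close> was found together with \<open>x (m + D (q j))\<close>.\<close>
    define r where "r j = m + q (Suc j)" for j
    have r: "strict_mono r"
      using q_mono by (auto simp: r_def strict_mono_def)
    define y where "y j = (x (r j))(i := e (q j))" for j
    have y_i: "y j i = e (q j)" and y_other: "i' \<noteq> i \<Longrightarrow> y j i' = x (r j) i'" for j i'
      by (simp_all add: y_def)
    have "(\<lambda>j. N (y j)) \<longlonglongrightarrow> 0"
    proof (rule insert.IH[of y "insert i W"])
      show "cont_tuple (y j)" for j
        unfolding y_def by (intro cont_tuple_upd cx ce)
      show "insert i W \<union> Z \<subseteq> {..<n}" "insert i W \<union> Z \<noteq> {}"
        using insert.prems(2-4) by auto
      show "insert i W \<inter> Z = {}"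
        using insert.hyps insert.prems(2-4) by auto
      show "abs_summing (K i') (\<lambda>j. y j i')" if i': "i' \<in> insert i W" for i'
      proof (cases "i' = i")
        case True
        have "(\<Sum>j<J. norm (y j i t)) \<le> c i" if t: "t \<in> topspace (K i)" for J t
        proof -
          have "(\<Sum>j<J. norm (y j i t)) \<le> (\<Sum>j<J. H m (q (Suc j)) t - H m (q j) t)"
            using e_le[OF t] by (intro sum_mono) (simp add: y_i q_Suc)
          also have "\<dots> = H m (q J) t - H m (q 0) t"
            by (rule sum_lessThan_telescope)
          also have "\<dots> \<le> c i"
          proof -
            obtain l where "H m (q J) t = norm (f l t)"
              using H_attained by blast
            then have "H m (q J) t \<le> c i"
              using c[OF i(1) t, of l] by (simp add: f_def)
            moreover have "0 \<le> H m (q 0) t"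
              using f_le_H[of 0 "q 0" m t] norm_ge_zero order_trans by blast
            ultimately show ?thesis
              by linarith
          qed
          finally show ?thesis .
        qed
        then show ?thesis
          unfolding True abs_summing_def by blast
      next
        case False
        then have "i' \<in> W"
          using i' by blast
        then show ?thesis
          using abs_summing_compose[OF insert.prems(5) r] y_other[OF False] by simp
      qed
      show "null_seq (K i') (\<lambda>j. y j i')" if i': "i' \<in> Z" for i'
      proof -
        have "i' \<noteq> i"
          using i' insert.hyps by blast
        then show ?thesis
          using null_seq_compose[OF insert.prems(6) filterlim_subseq[OF r]] i' y_other by simp
      qed
      show "y j i' = y 0 i'" if "i' < n" "i' \<notin> insert i W \<union> Z" for i' j
      proof -
        have "i' \<noteq> i" "i' \<notin> W \<union> insert i Z"
          using that(2) by auto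
        then show ?thesis
          using insert.prems(7)[OF that(1), of "r j"] insert.prems(7)[OF that(1), of "r 0"] y_other by simp
      qed
    qed
    then have "\<forall>\<^sub>F j in sequentially. N (y j) < \<eta>"
      using \<eta> by (rule order_tendstoD)
    then obtain j where "N (y j) < \<eta>"
      using eventually_happens'[OF sequentially_bot] by blast
    then show False
      using big[of "q j"] by (simp add: y_def r_def q_Suc)
  qed
  show ?case
  proof (rule LIMSEQ_I)
    fix \<epsilon> :: real assume \<epsilon>: "\<epsilon> > 0"
    \<comment> \<open>Geometric costs, adding up to at most \<epsilon> / 2 however many cuts are
      made.\<close>
    define \<eta> where "\<eta> j = \<epsilon> / 4 * (1/2) ^ j" for j :: nat
    have \<eta>_pos: "\<eta> j > 0" for j
      using \<epsilon> by (simp add: \<eta>_def)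
    have \<eta>_sum: "(\<Sum>j<m. \<eta> j) \<le> \<epsilon> / 2" for m
    proof -
      have "(\<Sum>j<m. \<eta> j) = \<epsilon> / 4 * (\<Sum>j<m. (1/2) ^ j)"
        by (simp add: \<eta>_def sum_distrib_left)
      also have "(\<Sum>j<m. (1/2::real) ^ j) = 2 * (1 - (1/2) ^ m)"
        by (simp add: sum_gp_strict)
      also have "\<epsilon> / 4 * \<dots> \<le> \<epsilon> / 4 * 2"
        using \<epsilon> by (intro mult_left_mono) auto
      finally show ?thesis
        by simp
    qed
    have "\<forall>m. \<exists>q. \<forall>d>q. \<forall>e. continuous_fun (K i) e \<longrightarrow>
        (\<forall>t\<in>topspace (K i). norm (e t) \<le> H m d t - H m q t) \<longrightarrow> N ((x (m + d))(i := e)) \<le> \<eta> m"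
      using exhaust[OF \<eta>_pos] by (intro allI)
    from choice[OF this] obtain Q where Q_all: "\<forall>m. \<forall>d>Q m. \<forall>e. continuous_fun (K i) e \<longrightarrow>
        (\<forall>t\<in>topspace (K i). norm (e t) \<le> H m d t - H m (Q m) t) \<longrightarrow> N ((x (m + d))(i := e)) \<le> \<eta> m"
      by (rule exE)
    have Q: "N ((x (m + d))(i := e)) \<le> \<eta> m" if "d > Q m" "continuous_fun (K i) e"
        "\<And>t. t \<in> topspace (K i) \<Longrightarrow> norm (e t) \<le> H m d t - H m (Q m) t" for m d e
      using Q_all[rule_format, of m d e] that by simp
    define V where "V m = H m (Q m)" for m
    have V_nonneg: "0 \<le> V m t" for m t
      unfolding V_def using f_le_H[of 0 "Q m" m t] norm_ge_zero order_trans by blast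
    define C where "C = M * (\<Prod>j\<in>{..<n} - {i}. \<bar>c j\<bar>)"
    have C: "C \<ge> 0"
      unfolding C_def by (intro mult_nonneg_nonneg M_nonneg prod_nonneg) auto
    \<comment> \<open>The remainder has size at most 2 \<delta> in slot i, and C collects M and the
      bounds of the other slots; this choice makes its cost less than \<epsilon> / 2.\<close>
    define \<delta> where "\<delta> = \<epsilon> / (4 * (C + 1))"
    have \<delta>: "\<delta> > 0" "C * (2 * \<delta>) < \<epsilon> / 2"
      using \<epsilon> C by (simp_all add: \<delta>_def field_simps)
    \<comment> \<open>A maximum is attained: \<open>V L t\<close> is one of the values |f l t| with
      l \<ge> L, so it becomes small with them.\<close>
    have "\<exists>m. V m t < \<delta>" if t: "t \<in> topspace (K i)" for t
    proof -
      have "(\<lambda>k. f k t) \<longlonglongrightarrow> 0"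
        using insert.prems(6)[of i] t unfolding null_seq_def f_def by blast
      then obtain L where L: "\<And>l. l \<ge> L \<Longrightarrow> norm (f l t) < \<delta>"
        using \<delta>(1) unfolding LIMSEQ_iff by fastforce
      obtain l where "l \<ge> L" "V L t = norm (f l t)"
        using H_attained[of L "Q L" t] unfolding V_def by blast
      then show ?thesis
        using L[of l] by (intro exI[of _ L]) simp
    qed
    then have cover: "topspace (K i) \<subseteq> \<Union>(range (\<lambda>m. {t \<in> topspace (K i). V m t \<in> {..<\<delta>}}))"
      by auto
    have "openin (K i) {t \<in> topspace (K i). V m t \<in> {..<\<delta>}}" for m
      unfolding V_def using cH by (intro openin_continuous_map_preimage[of "K i" euclidean]) auto
    then obtain \<F> where \<F>: "finite \<F>" "\<F> \<subseteq> range (\<lambda>m. {t \<in> topspace (K i). V m t \<in> {..<\<delta>}})"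
        "topspace (K i) \<subseteq> \<Union>\<F>"
      using compact[OF i(1)] cover unfolding compact_space_def compactin_def
      by (metis (mono_tags, lifting) rangeE)
    obtain I where I: "finite I" "\<F> = (\<lambda>m. {t \<in> topspace (K i). V m t \<in> {..<\<delta>}}) ` I"
      using finite_subset_image[OF \<F>(1,2)] by blast
    obtain M0 where M0: "\<And>m. m \<in> I \<Longrightarrow> m \<le> M0"
      using I(1) by (meson finite_nat_set_iff_bounded_le)
    have small: "\<exists>m\<le>M0. V m t < \<delta>" if "t \<in> topspace (K i)" for t
      using \<F>(3) that M0 unfolding I(2) by auto
    have "N (x k) < \<epsilon>" if k: "k \<ge> M0" for k
    proof -
      \<comment> \<open>Successive truncations of \<open>f k\<close>. Adding \<delta> keeps the
        heights positive, as \<open>clip\<close> requires.\<close>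
      define g where "g j = rec_nat (f k) (\<lambda>j u t. clip (V j t + \<delta>) (u t)) j" for j
      have g_0: "g 0 = f k" and g_Suc: "g (Suc j) t = clip (V j t + \<delta>) (g j t)" for j t
        by (simp_all add: g_def)
      have pos: "V j t + \<delta> > 0" for j t
        using V_nonneg[of j t] \<delta>(1) by simp
      have cg: "continuous_fun (K i) (g j)" for j
      proof (induction j)
        case (Suc j)
        have "continuous_fun (K i) (\<lambda>t. clip (V j t + \<delta>) (g j t))"
          using pos Suc cH unfolding V_def by (intro continuous_fun_clip continuous_fun_add) auto
        then show ?case
          by (simp add: g_Suc[symmetric])
      qed (simp add: g_0 cf)
      have g_le: "norm (g j t) \<le> norm (f k t)" for j t
      proof (induction j)
        case (Suc j)
        show ?case
          using clip(1)[OF pos[of j t], of "g j t"] Suc by (simp add: g_Suc)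
      qed (simp add: g_0)
      have g_antimono: "norm (g j' t) \<le> norm (g j t)" if "j \<le> j'" for j j' t
        using that
      proof (induction j' rule: dec_induct)
        case (step j')
        then show ?case
          using clip(1)[OF pos[of j' t], of "g j' t"] by (simp add: g_Suc)
      qed simp
      have g_small: "norm (g (Suc k) t) \<le> 2 * \<delta>" if t: "t \<in> topspace (K i)" for t
      proof -
        obtain j where j: "j \<le> M0" "V j t < \<delta>"
          using small[OF t] by blast
        have "norm (g (Suc k) t) \<le> norm (g (Suc j) t)"
          using j(1) k by (intro g_antimono) simp
        also have "\<dots> \<le> V j t + \<delta>"
          using clip(2)[OF pos[of j t], of "g j t"] by (simp add: g_Suc)
        finally show ?thesis
          using j(2) by simp
      qed
      have piece: "N ((x k)(i := \<lambda>t. g j t - g (Suc j) t)) \<le> \<eta> j" if j: "j < Suc k" for j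
      proof -
        define d where "d = k - j"
        have kd: "k = j + d"
          using j by (simp add: d_def)
        have ce: "continuous_fun (K i) (\<lambda>t. g j t - g (Suc j) t)"
          by (intro continuous_fun_diff cg)
        \<comment> \<open>g j is dominated by f k, and |f k| is among the functions entering
          \<open>H j (k - j)\<close>; so the piece cut off is bounded by the growth of the running
          maximum beyond Q j.\<close>
        have le: "norm (g j t - g (Suc j) t) \<le> max 0 (norm (f k t) - V j t)" for t
          using clip(3)[OF pos[of j t], of "g j t"] g_le[of j t] \<delta>(1) by (simp add: g_Suc)
        show ?thesis
        proof (cases "d > Q j")
          case True
          have "norm (g j t - g (Suc j) t) \<le> H j d t - H j (Q j) t" for t
            using le[of t] f_le_H[of d d j t] H_mono[of "Q j" d j t] True by (simp add: kd V_def)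
          then show ?thesis
            using Q[OF True ce] by (simp add: kd)
        next
          case False
          \<comment> \<open>Here |f k| is among the functions whose maximum is V j, so nothing is
            cut off.\<close>
          have "g j t - g (Suc j) t = 0" for t
            using le[of t] f_le_H[of d "Q j" j t] False by (simp add: kd V_def)
          then have "N ((x k)(i := \<lambda>t. g j t - g (Suc j) t)) = 0"
            by (intro N_zero[OF cont_tuple_upd[OF cx ce] i(1)]) simp
          then show ?thesis
            using \<eta>_pos[of j] by simp
        qed
      qed
      have "N ((x k)(i := g (Suc k))) \<le> M * (\<Prod>j<n. ((\<lambda>j. \<bar>c j\<bar>)(i := 2 * \<delta>)) j)"
      proof (rule N_bound[OF cont_tuple_upd[OF cx cg]])
        fix j t assume "j < n" "t \<in> topspace (K j)"
        then show "norm (((x k)(i := g (Suc k))) j t) \<le> ((\<lambda>j. \<bar>c j\<bar>)(i := 2 * \<delta>)) j"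
          using g_small[of t] c[of j t k] by (cases "j = i") auto
      qed
      also have "(\<Prod>j<n. ((\<lambda>j. \<bar>c j\<bar>)(i := 2 * \<delta>)) j) = 2 * \<delta> * (\<Prod>j\<in>{..<n} - {i}. \<bar>c j\<bar>)"
      proof -
        have "i \<in> {..<n}"
          using i by simp
        have "(\<Prod>j\<in>{..<n} - {i}. ((\<lambda>j. \<bar>c j\<bar>)(i := 2 * \<delta>)) j) = (\<Prod>j\<in>{..<n} - {i}. \<bar>c j\<bar>)"
          by (intro prod.cong) auto
        then show ?thesis
          unfolding prod.remove[OF finite_lessThan \<open>i \<in> {..<n}\<close>] by simp
      qed
      finally have last: "N ((x k)(i := g (Suc k))) \<le> C * (2 * \<delta>)"
        by (simp only: C_def mult_ac)
      have "(x k)(i := g 0) = x k"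
        by (simp add: g_0 f_def)
      then have "N (x k) \<le> (\<Sum>j<Suc k. N ((x k)(i := \<lambda>t. g j t - g (Suc j) t))) + N ((x k)(i := g (Suc k)))"
        using N_telescope[where x = "x k" and g = g and m = "Suc k", OF cx i(1) cg] by simp
      also have "(\<Sum>j<Suc k. N ((x k)(i := \<lambda>t. g j t - g (Suc j) t))) \<le> (\<Sum>j<Suc k. \<eta> j)"
        using piece by (intro sum_mono) simp
      finally show ?thesis
        using last \<eta>_sum[of "Suc k"] \<delta>(2) by linarith
    qed
    then show "\<exists>no. \<forall>k\<ge>no. norm (N (x k) - 0) < \<epsilon>"
      using N_nonneg[OF cx] by (intro exI[of _ M0]) simp
  qed
qed

lemma null_and_convergent_tendsto_zero:
  assumes "finite R"
  shows "\<lbrakk>\<And>k. cont_tuple (x k); Z \<union> R \<subseteq> {..<n}; Z \<noteq> {}; Z \<inter> R = {};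
      \<And>i. i \<in> Z \<Longrightarrow> null_seq (K i) (\<lambda>k. x k i); \<And>i. i \<in> R \<Longrightarrow> conv_seq (K i) (\<lambda>k. x k i);
      \<And>i k. i < n \<Longrightarrow> i \<notin> Z \<union> R \<Longrightarrow> x k i = x 0 i\<rbrakk> \<Longrightarrow> (\<lambda>k. N (x k)) \<longlonglongrightarrow> 0"
  using assms
proof (induction R arbitrary: x Z rule: finite_induct)
  case empty
  have "finite Z"
    by (rule finite_subset[of Z "{..<n}"]) (use empty.prems(2) in simp_all)
  then show ?case
  proof (rule null_or_summing_tendsto_zero[of Z x "{}", OF _ empty.prems(1)])
    show "{} \<union> Z \<subseteq> {..<n}" "{} \<union> Z \<noteq> {}" "{} \<inter> Z = {}"
      using empty.prems(2,3) by simp_all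
    show "x k i = x 0 i" if "i < n" "i \<notin> {} \<union> Z" for i k
      using that by (intro empty.prems(7)) simp_all
    show "null_seq (K i) (\<lambda>k. x k i)" if "i \<in> Z" for i
      by (rule empty.prems(5)[OF that])
  qed simp_all
next
  case (insert i R)
  note cx = insert.prems(1)
  have i: "i < n" "i \<notin> Z"
    using insert.prems(2-4) by auto
  show ?case
  proof (rule ccontr)
    assume not_null: "\<not> (\<lambda>k. N (x k)) \<longlonglongrightarrow> 0"
    have "\<exists>\<epsilon>>0. \<exists>r :: nat \<Rightarrow> nat. strict_mono r \<and> (\<forall>k. N (x (r k)) \<ge> \<epsilon>)"
      by (rule not_tendsto_zero_subseq[OF N_nonneg[OF cx] not_null])
    then obtain \<epsilon> and r :: "nat \<Rightarrow> nat" where \<epsilon>: "\<epsilon> > 0" and r: "strict_mono r" and big: "\<And>k. N (x (r k)) \<ge> \<epsilon>"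
      by blast
    have r_lim: "filterlim r sequentially sequentially"
      by (rule filterlim_subseq[OF r])
    have frozen: "(\<lambda>k. N ((x (r k))(i := x (r l) i))) \<longlonglongrightarrow> 0" for l
    proof (rule insert.IH[of "\<lambda>k. (x (r k))(i := x (r l) i)" Z])
      show "cont_tuple ((x (r k))(i := x (r l) i))" for k
        using cx i by (intro cont_tuple_upd cont_tupleD)
      show "Z \<union> R \<subseteq> {..<n}" "Z \<noteq> {}" "Z \<inter> R = {}"
        using insert.prems(2-4) by auto
      show "null_seq (K i') (\<lambda>k. ((x (r k))(i := x (r l) i)) i')" if "i' \<in> Z" for i'
      proof -
        have "i' \<noteq> i"
          using that i by blast
        then show ?thesis
          using null_seq_compose[OF insert.prems(5)[OF that] r_lim] by simp
      qed
      show "conv_seq (K i') (\<lambda>k. ((x (r k))(i := x (r l) i)) i')" if "i' \<in> R" for i'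
      proof -
        have "i' \<noteq> i"
          using that insert.hyps by blast
        then show ?thesis
          using conv_seq_compose[OF insert.prems(6) r_lim, of i'] that by simp
      qed
      show "((x (r k))(i := x (r l) i)) i' = ((x (r 0))(i := x (r l) i)) i'" if "i' < n" "i' \<notin> Z \<union> R" for i' k
        using insert.prems(7)[OF that(1), of "r k"] insert.prems(7)[OF that(1), of "r 0"] that(2) by (cases "i' = i") auto
    qed
    have "\<exists>k>l. N ((x (r k))(i := x (r l) i)) < \<epsilon> / 2" for l
    proof -
      have "\<forall>\<^sub>F k in sequentially. N ((x (r k))(i := x (r l) i)) < \<epsilon> / 2"
        using \<epsilon> by (intro order_tendstoD(2)[OF frozen]) simp
      then obtain k0 where "\<And>k. k \<ge> k0 \<Longrightarrow> N ((x (r k))(i := x (r l) i)) < \<epsilon> / 2"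
        unfolding eventually_sequentially by blast
      then show ?thesis
        by (intro exI[of _ "max k0 (Suc l)"]) auto
    qed
    then obtain \<tau> where \<tau>: "\<And>l. \<tau> l > l" and small: "\<And>l. N ((x (r (\<tau> l)))(i := x (r l) i)) < \<epsilon> / 2"
      by metis
    have "filterlim \<tau> sequentially sequentially"
      using \<tau> by (intro filterlim_at_top_mono[OF filterlim_ident]) (auto intro!: always_eventually less_imp_le)
    then have lim: "filterlim (\<lambda>l. r (\<tau> l)) sequentially sequentially"
      using filterlim_compose[OF r_lim] by blast
    define y where "y l = (x (r (\<tau> l)))(i := \<lambda>t. x (r (\<tau> l)) i t - x (r l) i t)" for l
    have ci: "continuous_fun (K i) (x k i)" for k
      using cx i by (intro cont_tupleD)
    have y_i: "y l i = (\<lambda>t. x (r (\<tau> l)) i t - x (r l) i t)" and y_other: "i' \<noteq> i \<Longrightarrow> y l i' = x (r (\<tau> l)) i'" for l i'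
      by (simp_all add: y_def)
    have "(\<lambda>l. N (y l)) \<longlonglongrightarrow> 0"
    proof (rule insert.IH[of y "insert i Z"])
      show "cont_tuple (y l)" for l
        unfolding y_def by (intro cont_tuple_upd cx continuous_fun_diff ci)
      show "insert i Z \<union> R \<subseteq> {..<n}" "insert i Z \<noteq> {}" "insert i Z \<inter> R = {}"
        using insert.prems(2-4) insert.hyps by auto
      show "null_seq (K i') (\<lambda>l. y l i')" if i': "i' \<in> insert i Z" for i'
      proof (cases "i' = i")
        case True
        have conv: "conv_seq (K i) (\<lambda>k. x k i)"
          using insert.prems(6) by blast
        then obtain c where c: "\<And>k t. t \<in> topspace (K i) \<Longrightarrow> norm (x k i t) \<le> c"
          unfolding conv_seq_def bdd_seq_def by blast
        have "norm (y l i t) \<le> c + c" if "t \<in> topspace (K i)" for l t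
          using c[OF that, of "r (\<tau> l)"] c[OF that, of "r l"] norm_triangle_ineq4[of "x (r (\<tau> l)) i t" "x (r l) i t"]
          by (simp add: y_i)
        moreover have "(\<lambda>l. y l i t) \<longlonglongrightarrow> 0" if t: "t \<in> topspace (K i)" for t
        proof -
          obtain a where a: "(\<lambda>k. x k i t) \<longlonglongrightarrow> a"
            using conv t unfolding conv_seq_def convergent_def by blast
          show ?thesis
            using tendsto_diff[OF filterlim_compose[OF a lim] filterlim_compose[OF a r_lim]] by (simp add: y_i)
        qed
        ultimately show ?thesis
          unfolding True null_seq_def bdd_seq_def by blast
      next
        case False
        then have "i' \<in> Z"
          using i' by blast
        then show ?thesis
          using null_seq_compose[OF insert.prems(5) lim] y_other[OF False] by simp
      qed
      show "conv_seq (K i') (\<lambda>l. y l i')" if i': "i' \<in> R" for i'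
      proof -
        have "i' \<noteq> i"
          using i' insert.hyps by blast
        then show ?thesis
          using conv_seq_compose[OF insert.prems(6) lim, of i'] i' y_other by simp
      qed
      show "y l i' = y 0 i'" if "i' < n" "i' \<notin> insert i Z \<union> R" for i' l
      proof -
        have "i' \<noteq> i" "i' \<notin> Z \<union> insert i R"
          using that(2) by auto
        then show ?thesis
          using insert.prems(7)[OF that(1), of "r (\<tau> l)"] insert.prems(7)[OF that(1), of "r (\<tau> 0)"] y_other by simp
      qed
    qed
    then have "\<forall>\<^sub>F l in sequentially. N (y l) < \<epsilon> / 2"
      using \<epsilon> by (intro order_tendstoD) auto
    then obtain l where l: "N (y l) < \<epsilon> / 2"
      using eventually_happens'[OF sequentially_bot] by blast
    have "N ((x (r (\<tau> l)))(i := \<lambda>t. (x (r (\<tau> l)) i t - x (r l) i t) + x (r l) i t)) \<le>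
        N (y l) + N ((x (r (\<tau> l)))(i := x (r l) i))"
      unfolding y_def by (intro N_add cx i continuous_fun_diff ci)
    then have "N (x (r (\<tau> l))) \<le> N (y l) + N ((x (r (\<tau> l)))(i := x (r l) i))"
      by simp
    then show False
      using big[of "\<tau> l"] small[of l] l by linarith
  qed
qed

end

section \<open>Scattered compact spaces\<close>

text \<open>An isolated point of the complement of the union of all open sets with countable image would
  have a neighbourhood with countable image.\<close>

lemma scattered_countable_image:
  fixes f :: "nat \<Rightarrow> 'a \<Rightarrow> 'b::metric_space"
  assumes "compact_space K" "Hausdorff_space K" "scattered_space K"
    and f: "\<And>k. continuous_fun K (f k)"
  shows "countable ((\<lambda>t k. f k t) ` topspace K)"
proof -
  define \<Phi> where "\<Phi> t = (\<lambda>k. f k t)" for t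
  define \<U> where "\<U> = {U. openin K U \<and> countable (\<Phi> ` U)}"
  have compact_countable: "countable (\<Phi> ` C)" if C: "compactin K C" "C \<subseteq> \<Union>\<U>" for C
  proof -
    have "\<forall>U\<in>\<U>. openin K U"
      by (auto simp: \<U>_def)
    then obtain \<F> where \<F>: "finite \<F>" "\<F> \<subseteq> \<U>" "C \<subseteq> \<Union>\<F>"
      using C unfolding compactin_def by meson
    have "countable (\<Union>U\<in>\<F>. \<Phi> ` U)"
      by (rule countable_UN[OF countable_finite[OF \<F>(1)]]) (use \<F>(2) in \<open>auto simp: \<U>_def\<close>)
    then show ?thesis
      by (rule countable_subset[rotated]) (use \<F>(3) in blast)
  qed
  have "topspace K \<subseteq> \<Union>\<U>"
  proof (rule ccontr)
    assume "\<not> topspace K \<subseteq> \<Union>\<U>"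
    then have "topspace K - \<Union>\<U> \<noteq> {}"
      by blast
    then obtain x where x: "x \<in> topspace K - \<Union>\<U>" "openin (subtopology K (topspace K - \<Union>\<U>)) {x}"
      using assms(3) unfolding scattered_space_def by blast
    then obtain O' where O': "openin K O'" "{x} = O' \<inter> (topspace K - \<Union>\<U>)"
      unfolding openin_subtopology by blast
    have "regular_space K"
      using assms(1,2) compact_Hausdorff_imp_regular_space by blast
    then have "neighbourhood_base_of (closedin K) K"
      by (simp only: neighbourhood_base_of_closedin)
    moreover have "x \<in> O'"
      using O'(2) by (metis IntD1 singletonI)
    ultimately have "\<exists>U V. openin K U \<and> closedin K V \<and> x \<in> U \<and> U \<subseteq> V \<and> V \<subseteq> O'"
      using O'(1) by (simp only: neighbourhood_base_of)
    then obtain U V where UV: "openin K U" "closedin K V" "x \<in> U" "U \<subseteq> V" "V \<subseteq> O'"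
      by (elim exE conjE)
    \<comment> \<open>\<open>B k m\<close> holds the points that f k tells apart from x by at least
      1 / (m + 1). The closed neighbourhood V meets each of these sets in a compact set covered by
      \<U>, and the points of V outside all of them have the same image as x.\<close>
    define B where "B k m = {t \<in> topspace K. dist (f k t) (f k x) \<in> {1 / real (Suc m)..}}" for k m
    have closed: "closedin K (B k m)" for k m
    proof -
      have "continuous_fun K (\<lambda>t. dist (f k t) (f k x))"
        using f[of k] by (simp add: continuous_map_atin tendsto_dist)
      then show ?thesis
        unfolding B_def by (intro closedin_continuous_map_preimage[of K euclidean]) auto
    qed
    have x_notin: "x \<notin> B k m" for k m
      by (simp add: B_def)
    have "V \<inter> B k m \<subseteq> \<Union>\<U>" for k m
    proof
      fix t assume t: "t \<in> V \<inter> B k m"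
      then have "t \<in> O'" "t \<in> topspace K" "t \<noteq> x"
        using UV(5) x_notin[of k m] by (auto simp: B_def)
      moreover have "t \<notin> O' \<inter> (topspace K - \<Union>\<U>)"
        unfolding O'(2)[symmetric] using \<open>t \<noteq> x\<close> by simp
      ultimately show "t \<in> \<Union>\<U>"
        by simp
    qed
    moreover have "compactin K (V \<inter> B k m)" for k m
      using closed UV(2) assms(1) by (intro closedin_compact_space closedin_Int)
    ultimately have "countable (\<Phi> ` (V \<inter> B k m))" for k m
      using compact_countable by blast
    then have "countable (insert (\<Phi> x) (\<Union>k. \<Union>m. \<Phi> ` (V \<inter> B k m)))"
      by auto
    moreover have "\<Phi> ` U \<subseteq> insert (\<Phi> x) (\<Union>k. \<Union>m. \<Phi> ` (V \<inter> B k m))"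
    proof
      fix p assume "p \<in> \<Phi> ` U"
      then obtain t where t: "t \<in> U" "p = \<Phi> t"
        by blast
      show "p \<in> insert (\<Phi> x) (\<Union>k. \<Union>m. \<Phi> ` (V \<inter> B k m))"
      proof (cases "\<Phi> t = \<Phi> x")
        case False
        then obtain k where "f k t \<noteq> f k x"
          by (auto simp: \<Phi>_def)
        then have "0 < dist (f k t) (f k x)"
          by simp
        then obtain m where "inverse (real (Suc m)) < dist (f k t) (f k x)"
          using reals_Archimedean by blast
        then have "t \<in> B k m"
          using t(1) openin_subset[OF UV(1)] by (auto simp: B_def inverse_eq_divide)
        then show ?thesis
          using t UV(4) by blast
      qed (use t in simp)
    qed
    ultimately have "countable (\<Phi> ` U)"
      by (rule countable_subset[rotated])
    then have "U \<in> \<U>"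
      using UV(1) by (simp add: \<U>_def)
    then show False
      using x(1) UV(3) by blast
  qed
  then show ?thesis
    using compact_countable[of "topspace K"] assms(1) unfolding \<Phi>_def compact_space_def by blast
qed

text \<open>Pointwise convergence on K depends only on the image of K under all the f k together.
  That image is countable, so a diagonal sequence suffices.\<close>

lemma scattered_convergent_subseq:
  fixes f :: "nat \<Rightarrow> 'a \<Rightarrow> 'k::{real_normed_vector,heine_borel}"
  assumes "compact_space K" "Hausdorff_space K" "scattered_space K"
    and f: "\<And>k. continuous_fun K (f k)" and bdd: "\<And>k t. t \<in> topspace K \<Longrightarrow> norm (f k t) \<le> c"
  obtains r where "strict_mono r" "conv_seq K (\<lambda>k. f (r k))"
proof -
  define P where "P = (\<lambda>t k. f k t) ` topspace K"
  have "countable P"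
    unfolding P_def by (rule scattered_countable_image[OF assms(1-4)])
  moreover have "norm (p k) \<le> c" if "p \<in> P" for p k
    using that bdd by (auto simp: P_def)
  ultimately obtain r where r: "strict_mono r" "\<And>p. p \<in> P \<Longrightarrow> \<exists>l. (\<lambda>k. p (r k)) \<longlonglongrightarrow> l"
    using function_convergent_subsequence[of P "\<lambda>k p. p k" c] by blast
  have "conv_seq K (\<lambda>k. f (r k))"
    unfolding conv_seq_def bdd_seq_def convergent_def
  proof (intro conjI ballI exI[of _ c] allI bdd)
    fix t assume "t \<in> topspace K"
    then show "\<exists>l. (\<lambda>k. f (r k) t) \<longlonglongrightarrow> l"
      using r(2)[of "\<lambda>k. f k t"] by (simp add: P_def)
  qed
  then show thesis
    using that r(1) by blast
qed

section \<open>Weakly subseries convergent series\<close>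

text \<open>Combinations are indexed by lists, so that those with coefficients from a countable set
  are visibly countable in number.\<close>

primrec lin_comb :: "('k, 'e) normed_module \<Rightarrow> (nat \<Rightarrow> 'e) \<Rightarrow> (nat \<times> 'k) list \<Rightarrow> 'e" where
  "lin_comb F y [] = \<zero>\<^bsub>F\<^esub>"
| "lin_comb F y (p # l) = (snd p \<odot>\<^bsub>F\<^esub> y (fst p)) \<oplus>\<^bsub>F\<^esub> lin_comb F y l"

context normed_space
begin

context
  fixes y :: "nat \<Rightarrow> 'e"
  assumes y_in: "\<And>j. y j \<in> carrier E"
begin

lemma lin_comb_in [simp]: "lin_comb E y l \<in> carrier E"
  by (induction l) (simp_all add: y_in)

lemma lin_comb_append: "lin_comb E y (l @ l') = lin_comb E y l \<oplus> lin_comb E y l'"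
  by (induction l) (simp_all add: y_in M.a_assoc)

lemma lin_comb_scale: "lin_comb E y (map (\<lambda>p. (fst p, c * snd p)) l) = c \<odot> lin_comb E y l"
  by (induction l) (simp_all add: y_in smult_add_right smult_smult)

lemma lin_comb_approx:
  assumes D: "\<And>z \<delta>. \<delta> > 0 \<Longrightarrow> \<exists>d\<in>D. norm (z - d) < \<delta>" and "\<eta> > 0"
  shows "\<exists>l'\<in>lists (UNIV \<times> D). vnorm E (lin_comb E y l \<ominus> lin_comb E y l') < \<eta>"
  using assms(2)
proof (induction l arbitrary: \<eta>)
  case Nil
  then show ?case
    by (intro bexI[of _ "[]"]) simp_all
next
  case (Cons p l)
  have "\<eta> / 2 > 0"
    using Cons.prems by simp
  then obtain l' where l': "l' \<in> lists (UNIV \<times> D)" "vnorm E (lin_comb E y l \<ominus> lin_comb E y l') < \<eta> / 2"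
    using Cons.IH by blast
  define v where "v = y (fst p)"
  have v: "v \<in> carrier E"
    by (simp add: v_def y_in)
  have pos: "vnorm E v + 1 > 0"
    using vnorm_nonneg[OF v] by linarith
  then have "\<eta> / (2 * (vnorm E v + 1)) > 0"
    using Cons.prems by simp
  then obtain d where d: "d \<in> D" "norm (snd p - d) < \<eta> / (2 * (vnorm E v + 1))"
    using D by blast
  have "norm (snd p - d) * vnorm E v \<le> norm (snd p - d) * (vnorm E v + 1)"
    by (intro mult_left_mono) simp_all
  also have "\<dots> < \<eta> / 2"
    using d(2) pos by (simp add: field_simps)
  finally have "vnorm E ((snd p - d) \<odot> v) < \<eta> / 2"
    using v by (simp add: vnorm_smult)
  moreover have "snd p \<odot> v \<ominus> d \<odot> v = (snd p - d) \<odot> v"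
    using v smult_add_left[OF v, of "snd p" "- d"] by (simp add: diff_eq_smult smult_smult)
  moreover have "(snd p \<odot> v \<oplus> lin_comb E y l) \<ominus> (d \<odot> v \<oplus> lin_comb E y l') =
      (snd p \<odot> v \<ominus> d \<odot> v) \<oplus> (lin_comb E y l \<ominus> lin_comb E y l')"
    using v by (simp add: add_diff_add)
  moreover have "vnorm E (\<dots>) \<le> vnorm E (snd p \<odot> v \<ominus> d \<odot> v) + vnorm E (lin_comb E y l \<ominus> lin_comb E y l')"
    using v by (intro vnorm_triangle) simp_all
  ultimately have "vnorm E (lin_comb E y (p # l) \<ominus> lin_comb E y ((fst p, d) # l')) < \<eta>"
    using l'(2) by (simp add: v_def[symmetric])
  then show ?case
    using l'(1) d(1) by (intro bexI[of _ "(fst p, d) # l'"]) simp_all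
qed

text \<open>The quotient norm modulo the span of the y j. Used as the dominating seminorm in the
  Hahn-Banach theorem, it yields functionals that vanish on that span.\<close>

definition span_dist :: "'e \<Rightarrow> real" where
  "span_dist x = (INF l. vnorm E (x \<ominus> lin_comb E y l))"

lemma span_dist_le:
  assumes "x \<in> carrier E"
  shows "span_dist x \<le> vnorm E (x \<ominus> lin_comb E y l)"
  unfolding span_dist_def using assms by (intro cINF_lower bdd_belowI2[where m = 0]) simp_all

lemma span_dist_geI:
  assumes "\<And>l. c \<le> vnorm E (x \<ominus> lin_comb E y l)"
  shows "c \<le> span_dist x"
  unfolding span_dist_def using assms by (intro cINF_greatest) simp_all

lemma span_dist_add:
  assumes x: "x \<in> carrier E" and z: "z \<in> carrier E"
  shows "span_dist (x \<oplus> z) \<le> span_dist x + span_dist z"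
proof -
  have "span_dist (x \<oplus> z) \<le> vnorm E (x \<ominus> lin_comb E y l) + vnorm E (z \<ominus> lin_comb E y l')" for l l'
  proof -
    have "span_dist (x \<oplus> z) \<le> vnorm E ((x \<oplus> z) \<ominus> lin_comb E y (l @ l'))"
      using x z by (intro span_dist_le) simp
    also have "(x \<oplus> z) \<ominus> lin_comb E y (l @ l') = (x \<ominus> lin_comb E y l) \<oplus> (z \<ominus> lin_comb E y l')"
      using x z by (simp add: lin_comb_append add_diff_add)
    also have "vnorm E \<dots> \<le> vnorm E (x \<ominus> lin_comb E y l) + vnorm E (z \<ominus> lin_comb E y l')"
      using x z by (intro vnorm_triangle) simp_all
    finally show ?thesis .
  qed
  then have "span_dist (x \<oplus> z) - vnorm E (x \<ominus> lin_comb E y l) \<le> span_dist z" for l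
    by (intro span_dist_geI) (simp add: algebra_simps)
  then have "span_dist (x \<oplus> z) - span_dist z \<le> span_dist x"
    by (intro span_dist_geI) (simp add: algebra_simps)
  then show ?thesis
    by simp
qed

lemma span_dist_smult:
  assumes x: "x \<in> carrier E"
  shows "span_dist (c \<odot> x) = norm c * span_dist x"
proof -
  have nonneg: "0 \<le> span_dist z" if "z \<in> carrier E" for z
    using that by (intro span_dist_geI) simp
  have le: "span_dist (c \<odot> z) \<le> norm c * span_dist z" if z: "z \<in> carrier E" and c: "c \<noteq> 0" for c z
  proof -
    have "span_dist (c \<odot> z) / norm c \<le> span_dist z"
    proof (rule span_dist_geI)
      fix l
      have "span_dist (c \<odot> z) \<le> vnorm E (c \<odot> z \<ominus> c \<odot> lin_comb E y l)"
        unfolding lin_comb_scale[symmetric] using z by (intro span_dist_le) simp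
      also have "\<dots> = norm c * vnorm E (z \<ominus> lin_comb E y l)"
        using z by (simp add: vnorm_smult flip: smult_diff)
      finally show "span_dist (c \<odot> z) / norm c \<le> vnorm E (z \<ominus> lin_comb E y l)"
        using c by (simp add: pos_divide_le_eq mult.commute)
    qed
    then show ?thesis
      using c by (simp add: pos_divide_le_eq mult.commute)
  qed
  show ?thesis
  proof (cases "c = 0")
    case True
    then show ?thesis
      using span_dist_le[of "\<zero>" "[]"] nonneg[of "\<zero>"] x by simp
  next
    case False
    have "span_dist (inverse c \<odot> (c \<odot> x)) \<le> norm (inverse c) * span_dist (c \<odot> x)"
      using x False by (intro le) simp_all
    then have "span_dist x \<le> inverse (norm c) * span_dist (c \<odot> x)"
      using x False by (simp add: smult_smult norm_inverse)
    then have "norm c * span_dist x \<le> span_dist (c \<odot> x)"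
      using False by (simp add: field_simps)
    then show ?thesis
      using le[OF x False] by simp
  qed
qed

end

end

text \<open>The Orlicz-Pettis theorem, by a Baire category argument on the sets of natural numbers.
  The points Y S lie in the closed span of the y j, which is separable, so for each \<rho> countably
  many sets of the form {S. norm of Y S - c m \<le> \<rho>} cover everything. Each is closed,
  because \<phi> (Y S) depends on finitely many members of S up to a small tail. One of them
  contains all sets that agree with some T below some N, and for j \<ge> N the vector y j is a
  difference of two such points Y S.\<close>

theorem weakly_subseries_convergent_null:
  fixes F :: "('k::{real_normed_field,euclidean_space}, 'e) normed_module"
  assumes "normed_space F" and y_in: "\<And>j. y j \<in> carrier F"
    and summ: "\<And>\<phi>. bounded_operator F scalars \<phi> \<Longrightarrow> summable (\<lambda>j. norm (\<phi> (y j)))"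
    and Y_in: "\<And>S. Y S \<in> carrier F"
    and Y: "\<And>S \<phi>. bounded_operator F scalars \<phi> \<Longrightarrow> \<phi> (Y S) = (\<Sum>j. if j \<in> S then \<phi> (y j) else 0)"
  shows "(\<lambda>j. vnorm F (y j)) \<longlonglongrightarrow> 0"
proof -
  interpret F: normed_space F by fact
  let ?p = "F.span_dist y"
  note sd_add = F.span_dist_add[where y = y, OF y_in] and sd_smult = F.span_dist_smult[where y = y, OF y_in]
    and sd_le = F.span_dist_le[where y = y, OF y_in] and lc_in = F.lin_comb_in[where y = y, OF y_in]
    and lc_approx = F.lin_comb_approx[where y = y, OF y_in]
  \<comment> \<open>A functional that realises the distance of Y S from the span kills every y j,
    hence also the sum of the subseries.\<close>
  have p_zero: "?p (Y S) = 0" for S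
  proof -
    obtain \<phi> where \<phi>: "linear_map F scalars \<phi>" "\<And>x. x \<in> carrier F \<Longrightarrow> norm (\<phi> x) \<le> ?p x" "\<phi> (Y S) = of_real (?p (Y S))"
      using Hahn_Banach_seminorm[of F ?p "Y S", OF assms(1) sd_add sd_smult Y_in] by blast
    have "norm (\<phi> x) \<le> 1 * vnorm F x" if "x \<in> carrier F" for x
      using \<phi>(2)[OF that] sd_le[OF that, of "[]"] that by simp
    then have b: "bounded_operator F scalars \<phi>"
      by (rule bounded_functionalI[OF assms(1) \<phi>(1)])
    have "?p (y j) \<le> 0" for j
      using sd_le[OF y_in[of j], of "[(j, 1)]"] y_in[of j] by simp
    then have "norm (\<phi> (y j)) \<le> 0" for j
      using \<phi>(2)[OF y_in[of j]] order_trans by blast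
    then have "(\<lambda>j. if j \<in> S then \<phi> (y j) else 0) = (\<lambda>_. 0)"
      by (auto simp: fun_eq_iff)
    then have "\<phi> (Y S) = 0"
      unfolding Y[OF b, of S] by (simp only: suminf_zero)
    then show ?thesis
      using \<phi>(3) by simp
  qed
  obtain D :: "'k set" where D: "countable D" "\<And>X. open X \<Longrightarrow> X \<noteq> {} \<Longrightarrow> \<exists>d\<in>D. d \<in> X"
    using countable_dense_exists by blast
  have D': "\<exists>d\<in>D. norm (z - d) < \<delta>" if "\<delta> > 0" for z :: 'k and \<delta>
    using D(2)[of "ball z \<delta>"] that by (auto simp: dist_norm)
  define C where "C = lin_comb F y ` lists (UNIV \<times> D)"
  have "C \<noteq> {}"
    unfolding C_def using lists.Nil by blast
  moreover have "countable C"
    unfolding C_def by (intro countable_image countable_lists countable_SIGMA countableI_type D(1))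
  ultimately have "range (from_nat_into C) = C"
    by (rule range_from_nat_into)
  then obtain c :: "nat \<Rightarrow> 'e" where c: "range c = C"
    by (rule that)
  have c_in: "c m \<in> carrier F" for m
  proof -
    have "c m \<in> C"
      unfolding c[symmetric] by (rule rangeI)
    then show ?thesis
      using lc_in unfolding C_def by auto
  qed
  have dense: "\<exists>m. vnorm F (Y S \<ominus>\<^bsub>F\<^esub> c m) < \<eta>" if "\<eta> > 0" for S \<eta>
  proof -
    have "(INF l. vnorm F (Y S \<ominus>\<^bsub>F\<^esub> lin_comb F y l)) < \<eta> / 2"
      using p_zero[of S] that unfolding F.span_dist_def[where y = y, OF y_in] by linarith
    moreover have "bdd_below (range (\<lambda>l. vnorm F (Y S \<ominus>\<^bsub>F\<^esub> lin_comb F y l)))"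
      using Y_in lc_in by (intro bdd_belowI2[where m = 0]) simp
    ultimately obtain l where l: "vnorm F (Y S \<ominus>\<^bsub>F\<^esub> lin_comb F y l) < \<eta> / 2"
      by (subst (asm) cINF_less_iff) auto
    have "\<eta> / 2 > 0"
      using that by simp
    then obtain l' where l': "l' \<in> lists (UNIV \<times> D)" "vnorm F (lin_comb F y l \<ominus>\<^bsub>F\<^esub> lin_comb F y l') < \<eta> / 2"
      using lc_approx[OF D'] by blast
    obtain m where m: "c m = lin_comb F y l'"
      using l'(1) c unfolding C_def by (metis imageE imageI rangeI)
    have "vnorm F (Y S \<ominus>\<^bsub>F\<^esub> c m) \<le> vnorm F (Y S \<ominus>\<^bsub>F\<^esub> lin_comb F y l) + vnorm F (lin_comb F y l \<ominus>\<^bsub>F\<^esub> c m)"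
      using Y_in lc_in c_in by (intro F.vnorm_diff_triangle)
    then show ?thesis
      using l l'(2) m by (intro exI[of _ m]) simp
  qed
  define agree where "agree N S T \<longleftrightarrow> (\<forall>j<N. j \<in> S \<longleftrightarrow> j \<in> T)" for N :: nat and S T :: "nat set"
  \<comment> \<open>A functional norming u = Y S - z changes by less than the excess over \<rho> if
    S is altered only beyond N'. That N' exceeds N makes the prefixes in the Baire construction
    grow.\<close>
  have open_condition: "\<exists>N'>N. \<forall>S'. agree N' S' S \<longrightarrow> vnorm F (Y S' \<ominus>\<^bsub>F\<^esub> z) > \<rho>"
    if z: "z \<in> carrier F" and large: "vnorm F (Y S \<ominus>\<^bsub>F\<^esub> z) > \<rho>" for S z \<rho> and N :: nat
  proof -
    define u where "u = Y S \<ominus>\<^bsub>F\<^esub> z"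
    have u: "u \<in> carrier F"
      using Y_in z by (simp add: u_def)
    obtain \<phi> where \<phi>: "linear_map F scalars \<phi>" "\<And>x. x \<in> carrier F \<Longrightarrow> norm (\<phi> x) \<le> vnorm F x"
        "\<phi> u = of_real (vnorm F u)"
      using norming_functional[OF assms(1) u] by blast
    have "norm (\<phi> x) \<le> 1 * vnorm F x" if "x \<in> carrier F" for x
      using \<phi>(2)[OF that] by simp
    then have b: "bounded_operator F scalars \<phi>"
      by (rule bounded_functionalI[OF assms(1) \<phi>(1)])
    define a where "a j = norm (\<phi> (y j))" for j
    have a: "summable a"
      unfolding a_def by (rule summ[OF b])
    have "vnorm F u - \<rho> > 0"
      using large by (simp add: u_def)
    then obtain N0 where N0: "\<And>k. k \<ge> N0 \<Longrightarrow> norm (\<Sum>i. a (i + k)) < vnorm F u - \<rho>"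
      using suminf_exist_split[OF _ a] by blast
    define N' where "N' = max N0 (Suc N)"
    have "vnorm F (Y S' \<ominus>\<^bsub>F\<^esub> z) > \<rho>" if ag: "agree N' S' S" for S'
    proof -
      define g where "g R j = (if j \<in> R then \<phi> (y j) else 0)" for R j
      have g: "summable (g R)" for R
        by (rule summable_comparison_test'[OF a, of 0]) (simp add: g_def a_def)
      have Yg: "\<phi> (Y R) = suminf (g R)" for R
        unfolding Y[OF b] g_def[abs_def] by (rule refl)
      have gd: "summable (\<lambda>j. g S j - g S' j)"
        by (intro summable_diff g)
      have "\<phi> (Y S) - \<phi> (Y S') = (\<Sum>j. g S j - g S' j)"
        unfolding Yg by (rule suminf_diff[OF g g])
      also have "\<dots> = (\<Sum>i. g S (i + N') - g S' (i + N')) + (\<Sum>i<N'. g S i - g S' i)"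
        by (rule suminf_split_initial_segment[OF gd])
      also have "(\<Sum>i<N'. g S i - g S' i) = 0"
        using ag by (intro sum.neutral) (simp add: agree_def g_def)
      finally have eq: "\<phi> (Y S) - \<phi> (Y S') = (\<Sum>i. g S (i + N') - g S' (i + N'))"
        by simp
      have "norm (\<Sum>i. g S (i + N') - g S' (i + N')) \<le> (\<Sum>i. a (i + N'))"
        by (rule norm_suminf_le) (simp_all add: g_def a_def[symmetric] summable_iff_shift a, simp add: a_def)
      also have "\<dots> < vnorm F u - \<rho>"
        using N0[of N'] by (simp add: N'_def)
      finally have diff: "norm (\<phi> (Y S) - \<phi> (Y S')) < vnorm F u - \<rho>"
        unfolding eq .
      have "vnorm F u = norm (\<phi> (Y S) - \<phi> z)"
        using \<phi>(3) linear_functional_diff[OF assms(1) \<phi>(1) Y_in z, of S] F.vnorm_nonneg[OF u]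
        by (simp add: u_def)
      also have "\<dots> = norm ((\<phi> (Y S) - \<phi> (Y S')) + (\<phi> (Y S') - \<phi> z))"
        by simp
      also have "\<dots> \<le> norm (\<phi> (Y S) - \<phi> (Y S')) + norm (\<phi> (Y S') - \<phi> z)"
        by (rule norm_triangle_ineq)
      also have "\<phi> (Y S') - \<phi> z = \<phi> (Y S' \<ominus>\<^bsub>F\<^esub> z)"
        using linear_functional_diff[OF assms(1) \<phi>(1) Y_in z] by simp
      also have "norm \<dots> \<le> vnorm F (Y S' \<ominus>\<^bsub>F\<^esub> z)"
        using Y_in z by (intro \<phi>(2)) simp
      finally show ?thesis
        using diff by linarith
    qed
    then show ?thesis
      by (intro exI[of _ N']) (simp add: N'_def)
  qed
  have Baire: "\<exists>N T m. \<forall>S. agree N S T \<longrightarrow> vnorm F (Y S \<ominus>\<^bsub>F\<^esub> c m) \<le> \<rho>" if \<rho>: "\<rho> > 0" for \<rho>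
  proof (rule ccontr)
    assume "\<not> ?thesis"
    then have "\<exists>S. agree N S T \<and> vnorm F (Y S \<ominus>\<^bsub>F\<^esub> c m) > \<rho>" for N T m
      by (meson not_le)
    then have step: "\<exists>q. fst q > fst p \<and> agree (fst p) (snd q) (snd p) \<and>
        (\<forall>S'. agree (fst q) S' (snd q) \<longrightarrow> vnorm F (Y S' \<ominus>\<^bsub>F\<^esub> c m) > \<rho>)" for p :: "nat \<times> nat set" and m
      using open_condition[OF c_in] by (metis fst_conv snd_conv)
    define G :: "nat \<Rightarrow> nat \<times> nat set \<Rightarrow> nat \<times> nat set" where
      "G m p = (SOME q. fst q > fst p \<and> agree (fst p) (snd q) (snd p) \<and>
        (\<forall>S'. agree (fst q) S' (snd q) \<longrightarrow> vnorm F (Y S' \<ominus>\<^bsub>F\<^esub> c m) > \<rho>))" for m p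
    have G: "fst (G m p) > fst p" "agree (fst p) (snd (G m p)) (snd p)"
        "agree (fst (G m p)) S' (snd (G m p)) \<Longrightarrow> vnorm F (Y S' \<ominus>\<^bsub>F\<^esub> c m) > \<rho>" for m p S'
      using someI_ex[OF step[of p m]] unfolding G_def[symmetric] by blast+
    \<comment> \<open>Nested prefixes, the m-th step of which moves away from c m. The set S
      assembled from them has a point Y S at distance more than \<rho> from every c m, against
      density.\<close>
    define P where "P = rec_nat (0, {}) G"
    have P_Suc: "P (Suc m) = G m (P m)" for m
      by (simp add: P_def)
    have agree_later: "fst (P m) \<le> fst (P m') \<and> agree (fst (P m)) (snd (P m')) (snd (P m))" if "m \<le> m'" for m m'
      using that
    proof (induction m' rule: dec_induct)
      case base
      then show ?case
        by (simp add: agree_def)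
    next
      case (step m')
      then show ?case
        using G(1)[of "P m'" m'] G(2)[of "P m'" m'] unfolding P_Suc agree_def by force
    qed
    define S where "S = {j. \<exists>m. j < fst (P m) \<and> j \<in> snd (P m)}"
    have "agree (fst (P m)) S (snd (P m))" for m
      unfolding agree_def
    proof (intro allI impI iffI)
      fix j assume j: "j < fst (P m)"
      show "j \<in> S" if "j \<in> snd (P m)"
        using that j by (auto simp: S_def)
      assume "j \<in> S"
      then obtain m' where m': "j < fst (P m')" "j \<in> snd (P m')"
        by (auto simp: S_def)
      show "j \<in> snd (P m)"
        using agree_later[of m m'] agree_later[of m' m] j m' unfolding agree_def by (cases "m \<le> m'") auto
    qed
    then have "vnorm F (Y S \<ominus>\<^bsub>F\<^esub> c m) > \<rho>" for m
      using G(3)[of m "P m" S] by (simp flip: P_Suc)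
    then show False
      using dense[OF \<rho>, of S] by (meson less_asym)
  qed
  show ?thesis
  proof (rule LIMSEQ_I)
    fix \<epsilon> :: real assume \<epsilon>: "\<epsilon> > 0"
    then have "\<epsilon> / 3 > 0"
      by simp
    then obtain N T m where NTm: "\<And>S. agree N S T \<Longrightarrow> vnorm F (Y S \<ominus>\<^bsub>F\<^esub> c m) \<le> \<epsilon> / 3"
      using Baire by blast
    have "vnorm F (y j) < \<epsilon>" if j: "j \<ge> N" for j
    proof -
      \<comment> \<open>Both S and \<open>insert j S\<close> agree with T below N, and they differ
        in j alone.\<close>
      define S where "S = T \<inter> {..<N}"
      have jS: "j \<notin> S"
        using j by (simp add: S_def)
      obtain \<phi> where \<phi>: "linear_map F scalars \<phi>" "\<And>x. x \<in> carrier F \<Longrightarrow> norm (\<phi> x) \<le> vnorm F x"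
          "\<phi> (y j) = of_real (vnorm F (y j))"
        using norming_functional[OF assms(1) y_in] by blast
      have "norm (\<phi> x) \<le> 1 * vnorm F x" if "x \<in> carrier F" for x
        using \<phi>(2)[OF that] by simp
      then have b: "bounded_operator F scalars \<phi>"
        by (rule bounded_functionalI[OF assms(1) \<phi>(1)])
      define g where "g R i = (if i \<in> R then \<phi> (y i) else 0)" for R i
      have g: "summable (g R)" for R
        by (rule summable_comparison_test'[OF summ[OF b], of 0]) (simp add: g_def)
      have Yg: "\<phi> (Y R) = suminf (g R)" for R
        unfolding Y[OF b] g_def[abs_def] by (rule refl)
      have "\<phi> (Y (insert j S)) - \<phi> (Y S) = (\<Sum>i. g (insert j S) i - g S i)"
        unfolding Yg by (rule suminf_diff[OF g g])
      also have "\<dots> = (\<Sum>i. if i = j then \<phi> (y i) else 0)"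
        using jS by (intro suminf_cong) (auto simp: g_def)
      also have "\<dots> = (\<Sum>i\<in>{j}. if i = j then \<phi> (y i) else 0)"
        by (rule suminf_finite) simp_all
      finally have "\<phi> (y j) = \<phi> (Y (insert j S)) - \<phi> (Y S)"
        by simp
      also have "\<dots> = \<phi> (Y (insert j S) \<ominus>\<^bsub>F\<^esub> Y S)"
        using linear_functional_diff[OF assms(1) \<phi>(1) Y_in Y_in] by simp
      finally have eq: "\<phi> (y j) = \<phi> (Y (insert j S) \<ominus>\<^bsub>F\<^esub> Y S)" .
      have "vnorm F (y j) = norm (\<phi> (y j))"
        unfolding \<phi>(3) using F.vnorm_nonneg[OF y_in, of j] by simp
      also have "\<dots> \<le> vnorm F (Y (insert j S) \<ominus>\<^bsub>F\<^esub> Y S)"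
        unfolding eq by (intro \<phi>(2) F.diff_in Y_in)
      also have "\<dots> \<le> vnorm F (Y (insert j S) \<ominus>\<^bsub>F\<^esub> c m) + vnorm F (c m \<ominus>\<^bsub>F\<^esub> Y S)"
        using Y_in c_in by (intro F.vnorm_diff_triangle)
      also have "vnorm F (c m \<ominus>\<^bsub>F\<^esub> Y S) = vnorm F (Y S \<ominus>\<^bsub>F\<^esub> c m)"
        using Y_in c_in by (intro F.vnorm_diff_commute)
      also have "vnorm F (Y (insert j S) \<ominus>\<^bsub>F\<^esub> c m) + vnorm F (Y S \<ominus>\<^bsub>F\<^esub> c m) \<le> \<epsilon> / 3 + \<epsilon> / 3"
        using j by (intro add_mono NTm) (auto simp: agree_def S_def)
      finally show ?thesis
        using \<epsilon> by linarith
    qed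
    then show "\<exists>no. \<forall>j\<ge>no. norm (vnorm F (y j) - 0) < \<epsilon>"
      using F.vnorm_nonneg[OF y_in] by (intro exI[of _ N]) simp
  qed
qed

section \<open>Averaging over signs\<close>

context C_tensor
begin

context
  fixes \<beta> :: "(nat \<Rightarrow> 'a \<Rightarrow> 'k) \<Rightarrow> 'k"
  assumes \<beta>_add: "\<And>x i f g. cont_tuple x \<Longrightarrow> i < n \<Longrightarrow> continuous_fun (K i) f \<Longrightarrow> continuous_fun (K i) g \<Longrightarrow>
      \<beta> (x(i := \<lambda>t. f t + g t)) = \<beta> (x(i := f)) + \<beta> (x(i := g))"
    and \<beta>_mult: "\<And>x i f c. cont_tuple x \<Longrightarrow> i < n \<Longrightarrow> continuous_fun (K i) f \<Longrightarrow>
      \<beta> (x(i := \<lambda>t. c * f t)) = c * \<beta> (x(i := f))"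
begin

lemma \<beta>_add_mult:
  assumes "cont_tuple x" "i < n" "continuous_fun (K i) f" "continuous_fun (K i) g"
  shows "\<beta> (x(i := \<lambda>t. f t + c * g t)) = \<beta> (x(i := f)) + c * \<beta> (x(i := g))"
  using \<beta>_add[OF assms(1,2,3), of "\<lambda>t. c * g t"] \<beta>_mult[OF assms(1,2,4), of c] assms(4)
  by (simp add: continuous_fun_mult)

lemma norm_le_average:
  fixes P Q R :: 'k
  assumes "norm P \<le> M" "norm Q \<le> M" "P + Q = R + R"
  shows "norm R \<le> M"
proof -
  have "2 * norm R = norm (R + R)"
    by (metis mult_2 norm_mult norm_numeral)
  also have "\<dots> \<le> M + M"
    unfolding assms(3)[symmetric] using norm_triangle_ineq[of P Q] assms(1,2) by linarith
  finally show ?thesis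
    by simp
qed

text \<open>Expand by multilinearity and average over the signs on W with product 1, or with product
  -1. A mixed term carries the product of the signs over a proper nonempty subset of W, which
  averages to 0; the terms of a and x remain, the latter with the prescribed sign. The vector v is
  carried along for the induction in \<open>norm_sum_multilinear_le\<close>.\<close>

lemma sign_average:
  assumes "finite W"
  shows "\<lbrakk>W \<noteq> {}; W \<subseteq> {..<n}; cont_tuple a; cont_tuple x; \<forall>i. i \<notin> W \<longrightarrow> a i = x i;
      \<forall>\<sigma> :: nat \<Rightarrow> 'k. (\<forall>i. \<sigma> i = 1 \<or> \<sigma> i = -1) \<longrightarrow>
        norm (\<beta> (\<lambda>i. if i \<in> W then (\<lambda>t. a i t + \<sigma> i * x i t) else a i) + v) \<le> M\<rbrakk> \<Longrightarrow>
      norm (\<beta> a + \<beta> x + v) \<le> M \<and> norm (\<beta> a - \<beta> x + v) \<le> M"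
  using \<open>finite W\<close>
proof (induction W arbitrary: a x rule: finite_induct)
  case empty
  then show ?case
    by blast
next
  case (insert i W)
  have i: "i < n" "i \<notin> W" and W: "W \<subseteq> {..<n}"
    using insert.prems(2) insert.hyps by auto
  have c: "continuous_fun (K i) (a i)" "continuous_fun (K i) (x i)"
    using insert.prems(3,4) i by (auto intro: cont_tupleD)
  have cs: "continuous_fun (K i) (\<lambda>t. a i t + s * x i t)" for s
    using c by (intro continuous_fun_add continuous_fun_mult) auto
  show ?case
  proof (cases "W = {}")
    case True
    have x: "x = a(i := x i)"
      using insert.prems(5) unfolding True by (auto simp: fun_eq_iff)
    have eq: "\<beta> (\<lambda>j. if j \<in> insert i W then (\<lambda>t. a j t + s * x j t) else a j) = \<beta> a + s * \<beta> x" for s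
    proof -
      have "(\<lambda>j. if j \<in> insert i W then (\<lambda>t. a j t + s * x j t) else a j) = a(i := \<lambda>t. a i t + s * x i t)"
        unfolding True by auto
      then show ?thesis
        using \<beta>_add_mult[OF insert.prems(3) i(1) c, of s] x by simp
    qed
    have "norm (\<beta> a + s * \<beta> x + v) \<le> M" if "s = 1 \<or> s = -1" for s
      using insert.prems(6)[rule_format, of "\<lambda>_. s"] that unfolding eq by simp
    from this[of 1] this[of "-1"] show ?thesis
      by simp
  next
    case False
  \<comment> \<open>Giving slot i of both a and x the entry a + s x leaves a smaller W. Adding the
    conclusions for s = 1 and s = -1, taken with opposite signs, isolates the wanted combination
    twice.\<close>
  define a' where "a' s = a(i := \<lambda>t. a i t + s * x i t)" for s
  define x' where "x' s = x(i := \<lambda>t. a i t + s * x i t)" for s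
  have IH: "norm (\<beta> (a' s) + \<beta> (x' s) + v) \<le> M \<and> norm (\<beta> (a' s) - \<beta> (x' s) + v) \<le> M"
    if s: "s = 1 \<or> s = -1" for s
  proof (rule insert.IH[OF False W])
    show "cont_tuple (a' s)" "cont_tuple (x' s)"
      unfolding a'_def x'_def by (intro cont_tuple_upd insert.prems(3,4) cs)+
    show "\<forall>j. j \<notin> W \<longrightarrow> a' s j = x' s j"
      using insert.prems(5) by (simp add: a'_def x'_def)
    show "\<forall>\<sigma> :: nat \<Rightarrow> 'k. (\<forall>i. \<sigma> i = 1 \<or> \<sigma> i = -1) \<longrightarrow>
        norm (\<beta> (\<lambda>j. if j \<in> W then (\<lambda>t. a' s j t + \<sigma> j * x' s j t) else a' s j) + v) \<le> M"
    proof (intro allI impI)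
      fix \<sigma> :: "nat \<Rightarrow> 'k" assume \<sigma>: "\<forall>i. \<sigma> i = 1 \<or> \<sigma> i = -1"
      have "(\<lambda>j. if j \<in> W then (\<lambda>t. a' s j t + \<sigma> j * x' s j t) else a' s j) =
          (\<lambda>j. if j \<in> insert i W then (\<lambda>t. a j t + (\<sigma>(i := s)) j * x j t) else a j)"
        using i(2) by (auto simp: a'_def x'_def fun_eq_iff)
      then show "norm (\<beta> (\<lambda>j. if j \<in> W then (\<lambda>t. a' s j t + \<sigma> j * x' s j t) else a' s j) + v) \<le> M"
        using insert.prems(6)[rule_format, of "\<sigma>(i := s)"] \<sigma> s by simp
    qed
  qed
  have ba: "\<beta> (a' s) = \<beta> a + s * \<beta> (a(i := x i))" for s
    using \<beta>_add_mult[OF insert.prems(3) i(1) c, of s] by (simp add: a'_def)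
  have bx: "\<beta> (x' s) = \<beta> (x(i := a i)) + s * \<beta> x" for s
    using \<beta>_add_mult[OF insert.prems(4) i(1) c, of s] by (simp add: x'_def)
  have "norm (\<beta> a + \<beta> x + v) \<le> M"
    by (rule norm_le_average[of "\<beta> (a' 1) + \<beta> (x' 1) + v" M "\<beta> (a' (-1)) - \<beta> (x' (-1)) + v"])
      (use IH[of 1] IH[of "-1"] in \<open>simp_all add: ba bx\<close>)
  moreover have "norm (\<beta> a - \<beta> x + v) \<le> M"
    by (rule norm_le_average[of "\<beta> (a' 1) - \<beta> (x' 1) + v" M "\<beta> (a' (-1)) + \<beta> (x' (-1)) + v"])
      (use IH[of 1] IH[of "-1"] in \<open>simp_all add: ba bx\<close>)
  ultimately show ?thesis ..
  qed
qed

text \<open>Only the diagonal terms of a product of sums occur, yet they obey the bound of the full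
  product: the last tuple is absorbed into a with all choices of signs, and the sign average keeps
  just \<beta> a and \<beta> (x m).\<close>

lemma norm_sum_multilinear_le:
  fixes x :: "nat \<Rightarrow> nat \<Rightarrow> 'a \<Rightarrow> 'k"
  assumes W: "W \<subseteq> {..<n}" "W \<noteq> {}"
    and bound: "\<And>z. cont_tuple z \<Longrightarrow> (\<And>i t. i < n \<Longrightarrow> t \<in> topspace (K i) \<Longrightarrow> norm (z i t) \<le> C i) \<Longrightarrow> norm (\<beta> z) \<le> M"
    and u_le: "\<And>i t. i < n \<Longrightarrow> i \<notin> W \<Longrightarrow> t \<in> topspace (K i) \<Longrightarrow> norm (u i t) \<le> C i"
  shows "\<lbrakk>cont_tuple a; \<And>k. cont_tuple (x k); \<And>i. i \<notin> W \<Longrightarrow> a i = u i; \<And>i k. i \<notin> W \<Longrightarrow> x k i = u i;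
      \<And>i t. i \<in> W \<Longrightarrow> t \<in> topspace (K i) \<Longrightarrow> norm (a i t) + (\<Sum>k<m. norm (x k i t)) \<le> C i\<rbrakk> \<Longrightarrow>
      norm (\<beta> a + (\<Sum>k<m. \<beta> (x k))) \<le> M"
proof (induction m arbitrary: a)
  case 0
  have "norm (a i t) \<le> C i" if "i < n" "t \<in> topspace (K i)" for i t
  proof (cases "i \<in> W")
    case True
    then show ?thesis
      using 0(5)[OF True that(2)] by simp
  next
    case False
    then show ?thesis
      using u_le[OF that(1) False that(2)] 0(3)[OF False] by simp
  qed
  then show ?case
    using bound[OF 0(1)] by simp
next
  case (Suc m)
  have "finite W"
    using W(1) by (rule finite_subset) simp
  have "norm (\<beta> a + \<beta> (x m) + (\<Sum>k<m. \<beta> (x k))) \<le> M \<and> norm (\<beta> a - \<beta> (x m) + (\<Sum>k<m. \<beta> (x k))) \<le> M"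
  proof (rule sign_average[OF \<open>finite W\<close> W(2) W(1) Suc.prems(1) Suc.prems(2)])
    show "\<forall>i. i \<notin> W \<longrightarrow> a i = x m i"
      using Suc.prems(3) Suc.prems(4)[of _ m] by metis
    show "\<forall>\<sigma> :: nat \<Rightarrow> 'k. (\<forall>i. \<sigma> i = 1 \<or> \<sigma> i = -1) \<longrightarrow>
        norm (\<beta> (\<lambda>i. if i \<in> W then (\<lambda>t. a i t + \<sigma> i * x m i t) else a i) + (\<Sum>k<m. \<beta> (x k))) \<le> M"
    proof (intro allI impI)
      fix \<sigma> :: "nat \<Rightarrow> 'k" assume \<sigma>: "\<forall>i. \<sigma> i = 1 \<or> \<sigma> i = -1"
      define b where "b i = (if i \<in> W then (\<lambda>t. a i t + \<sigma> i * x m i t) else a i)" for i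
      have "norm (\<beta> b + (\<Sum>k<m. \<beta> (x k))) \<le> M"
      proof (rule Suc.IH[OF _ Suc.prems(2) _ Suc.prems(4)])
        show "cont_tuple b"
          unfolding cont_tuple_def
        proof (intro allI impI)
          fix i assume i: "i < n"
          show "continuous_fun (K i) (b i)"
            using cont_tupleD[OF Suc.prems(1) i] cont_tupleD[OF Suc.prems(2) i, of m]
            by (cases "i \<in> W") (auto simp: b_def intro!: continuous_fun_add continuous_fun_mult)
        qed
        show "b i = u i" if "i \<notin> W" for i
          using Suc.prems(3)[OF that] that by (simp add: b_def)
        show "norm (b i t) + (\<Sum>k<m. norm (x k i t)) \<le> C i" if i: "i \<in> W" and t: "t \<in> topspace (K i)" for i t
        proof -
          have "norm (\<sigma> i) = 1"
            using \<sigma>[rule_format, of i] by auto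
          then have "norm (b i t) \<le> norm (a i t) + norm (x m i t)"
            using i norm_triangle_ineq[of "a i t" "\<sigma> i * x m i t"] by (simp add: b_def norm_mult)
          then show ?thesis
            using Suc.prems(5)[OF i t] by simp
        qed
      qed assumption
      then show "norm (\<beta> (\<lambda>i. if i \<in> W then (\<lambda>t. a i t + \<sigma> i * x m i t) else a i) + (\<Sum>k<m. \<beta> (x k))) \<le> M"
        by (simp only: b_def[abs_def])
    qed
  qed
  then show ?case
    by (simp add: add_ac)
qed

text \<open>Unimodular factors in one slot of W turn all values \<beta> (x k) into their absolute
  values and leave the assumptions intact; the induction of the previous lemma starts from a tuple
  that is 0 on W.\<close>

lemma sum_norm_multilinear_le:
  fixes x :: "nat \<Rightarrow> nat \<Rightarrow> 'a \<Rightarrow> 'k"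
  assumes W: "W \<subseteq> {..<n}" "W \<noteq> {}"
    and bound: "\<And>z. cont_tuple z \<Longrightarrow> (\<And>i t. i < n \<Longrightarrow> t \<in> topspace (K i) \<Longrightarrow> norm (z i t) \<le> C i) \<Longrightarrow> norm (\<beta> z) \<le> M"
    and u_le: "\<And>i t. i < n \<Longrightarrow> i \<notin> W \<Longrightarrow> t \<in> topspace (K i) \<Longrightarrow> norm (u i t) \<le> C i"
    and x: "\<And>k. cont_tuple (x k)" and xu: "\<And>i k. i \<notin> W \<Longrightarrow> x k i = u i"
    and sum_le: "\<And>i t. i \<in> W \<Longrightarrow> t \<in> topspace (K i) \<Longrightarrow> (\<Sum>k<m. norm (x k i t)) \<le> C i"
  shows "(\<Sum>k<m. norm (\<beta> (x k))) \<le> M"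
proof -
  obtain i0 where i0: "i0 \<in> W"
    using W(2) by blast
  then have i0n: "i0 < n"
    using W(1) by auto
  define \<theta> where "\<theta> k = (if \<beta> (x k) = 0 then 1 else of_real (norm (\<beta> (x k))) / \<beta> (x k))" for k
  have \<theta>: "norm (\<theta> k) = 1" "\<theta> k * \<beta> (x k) = of_real (norm (\<beta> (x k)))" for k
    by (simp_all add: \<theta>_def norm_divide)
  define x' where "x' k = (x k)(i0 := \<lambda>t. \<theta> k * x k i0 t)" for k
  define a where "a i = (if i \<in> W then (\<lambda>_. 0) else u i)" for i
  have ca: "cont_tuple a"
    unfolding cont_tuple_def
  proof (intro allI impI)
    fix i assume "i < n"
    then show "continuous_fun (K i) (a i)"
      using cont_tupleD[OF x[of 0], of i] xu[of i 0] by (cases "i \<in> W") (simp_all add: a_def)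
  qed
  have \<beta>a: "\<beta> a = 0"
  proof -
    have "a = a(i0 := \<lambda>t. 0 * a i0 t)"
      using i0 by (auto simp: a_def)
    then have "\<beta> a = \<beta> (a(i0 := \<lambda>t. 0 * a i0 t))"
      by (rule arg_cong)
    also have "\<dots> = 0 * \<beta> (a(i0 := a i0))"
      by (intro \<beta>_mult ca i0n cont_tupleD)
    finally show ?thesis
      by simp
  qed
  have \<beta>x: "\<beta> (x' k) = of_real (norm (\<beta> (x k)))" for k
    using \<beta>_mult[OF x[of k] i0n cont_tupleD[OF x[of k] i0n], of "\<theta> k"] \<theta>(2)[of k] by (simp add: x'_def)
  have "norm (\<beta> a + (\<Sum>k<m. \<beta> (x' k))) \<le> M"
  proof (rule norm_sum_multilinear_le[OF W bound u_le ca])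
    show "cont_tuple (x' k)" for k
      unfolding x'_def by (intro cont_tuple_upd x continuous_fun_mult cont_tupleD[OF x i0n]) simp
    show "a i = u i" "x' k i = u i" if "i \<notin> W" for i k
      using that xu[OF that, of k] i0 by (auto simp: a_def x'_def)
    show "norm (a i t) + (\<Sum>k<m. norm (x' k i t)) \<le> C i" if "i \<in> W" "t \<in> topspace (K i)" for i t
    proof -
      have "norm (x' k i t) = norm (x k i t)" for k
        by (simp add: x'_def norm_mult \<theta>(1))
      then show ?thesis
        using sum_le[OF that] that(1) by (simp add: a_def)
    qed
  qed assumption+
  moreover have "(\<Sum>k<m. \<beta> (x' k)) = of_real (\<Sum>k<m. norm (\<beta> (x k)))"
    by (simp add: \<beta>x)
  ultimately show ?thesis
    unfolding \<beta>a by (simp only: add_0 norm_of_real)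
qed

end

lemma tens_cong: "(\<And>i. i < n \<Longrightarrow> x i = y i) \<Longrightarrow> tens x = tens y"
  unfolding tens_def tup_def by (metis (mono_tags, lifting) lessThan_iff restrict_ext)

text \<open>The point is uniformity in \<phi>: tensors with absolutely summing factors form a weakly
  unconditionally Cauchy series, even if several slots vary at once.\<close>

lemma summing_functional_bound:
  fixes x :: "nat \<Rightarrow> nat \<Rightarrow> 'a \<Rightarrow> 'k"
  assumes W: "W \<subseteq> {..<n}" "W \<noteq> {}" and x: "\<And>k. cont_tuple (x k)"
    and const: "\<And>i k. i < n \<Longrightarrow> i \<notin> W \<Longrightarrow> x k i = x 0 i"
    and C: "\<And>i t. i < n \<Longrightarrow> i \<notin> W \<Longrightarrow> t \<in> topspace (K i) \<Longrightarrow> norm (x 0 i t) \<le> C i"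
      "\<And>i t m. i \<in> W \<Longrightarrow> t \<in> topspace (K i) \<Longrightarrow> (\<Sum>k<m. norm (x k i t)) \<le> C i"
    and \<phi>: "linear_map X scalars \<phi>" "\<And>u. u \<in> carrier X \<Longrightarrow> norm (\<phi> u) \<le> B * vnorm X u" "B \<ge> 0"
  shows "(\<Sum>k<m. norm (\<phi> (tens (x k)))) \<le> B * (\<Prod>i<n. C i)"
proof -
  \<comment> \<open>\<open>sum_norm_multilinear_le\<close> compares tuples at all indices off W.
    From n on they are made equal here, which \<open>tens\<close> does not see.\<close>
  define x' where "x' k i = (if i < n then x k i else undefined)" for k i
  have x'_eq: "tens (x' k) = tens (x k)" for k
    by (rule tens_cong) (simp add: x'_def)
  have "(\<Sum>k<m. norm (\<phi> (tens (x' k)))) \<le> B * (\<Prod>i<n. C i)"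
  proof (rule sum_norm_multilinear_le[where \<beta> = "\<lambda>z. \<phi> (tens z)" and u = "x' 0" and C = C and x = x' and M = "B * (\<Prod>i<n. C i)" and W = W and m = m])
    show "W \<subseteq> {..<n}" "W \<noteq> {}"
      by (rule W)+
    show "\<phi> (tens (z(i := \<lambda>t. f t + g t))) = \<phi> (tens (z(i := f))) + \<phi> (tens (z(i := g)))"
      if "cont_tuple z" "i < n" "continuous_fun (K i) f" "continuous_fun (K i) g" for z i f g
      using linear_mapD(2)[OF \<phi>(1)] that by (simp add: tens_add cont_tuple_upd)
    show "\<phi> (tens (z(i := \<lambda>t. c * f t))) = c * \<phi> (tens (z(i := f)))"
      if "cont_tuple z" "i < n" "continuous_fun (K i) f" for z i f c
      using linear_mapD(3)[OF \<phi>(1)] that by (simp add: tens_smult cont_tuple_upd)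
    show "norm (\<phi> (tens z)) \<le> B * (\<Prod>i<n. C i)"
      if z: "cont_tuple z" "\<And>i t. i < n \<Longrightarrow> t \<in> topspace (K i) \<Longrightarrow> norm (z i t) \<le> C i" for z
    proof -
      have "norm (\<phi> (tens z)) \<le> B * vnorm X (tens z)"
        using z(1) by (intro \<phi>(2)) simp
      also have "\<dots> \<le> B * (\<Prod>i<n. C i)"
        by (rule mult_left_mono[OF vnorm_tens_le[OF z] \<phi>(3)])
      finally show ?thesis .
    qed
    show "norm (x' 0 i t) \<le> C i" if "i < n" "i \<notin> W" "t \<in> topspace (K i)" for i t
      using C(1)[OF that] that(1) by (simp add: x'_def)
    show "cont_tuple (x' k)" for k
      using x[of k] by (simp add: cont_tuple_def x'_def)
    show "x' k i = x' 0 i" if "i \<notin> W" for i k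
      using const[OF _ that, of k] by (simp add: x'_def)
    show "(\<Sum>k<m. norm (x' k i t)) \<le> C i" if "i \<in> W" "t \<in> topspace (K i)" for i t
    proof -
      have "i < n"
        using that(1) W(1) by auto
      then show ?thesis
        using C(2)[OF that, of m] by (simp add: x'_def)
    qed
  qed
  then show ?thesis
    by (simp only: x'_eq)
qed

end

section \<open>Uniform boundedness\<close>

text \<open>A gliding hump: the coefficient of each new norming functional is chosen so that the partial sum
  is large at the corresponding point, and the tail is too small to undo this.\<close>

theorem weakly_bounded_imp_bounded:
  fixes E :: "('k::{real_normed_field,euclidean_space}, 'e) normed_module"
  assumes "normed_space E" and u_in: "\<And>k. u k \<in> carrier E"
    and weak: "\<And>\<phi>. bounded_operator E scalars \<phi> \<Longrightarrow> \<exists>c. \<forall>k::nat. norm (\<phi> (u k)) \<le> c"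
  shows "\<exists>c. \<forall>k. vnorm E (u k) \<le> c"
proof (rule ccontr)
  interpret normed_space E by fact
  assume "\<not> ?thesis"
  \<comment> \<open>The factor 4 ^ j compensates the weight q j below, so that q j times the norm of
    w j exceeds j.\<close>
  then have "\<forall>j. \<exists>k. vnorm E (u k) > 4 ^ j * real j"
    by (meson not_le)
  from choice[OF this] obtain \<kappa> :: "nat \<Rightarrow> nat" where \<kappa>: "\<And>j. vnorm E (u (\<kappa> j)) > 4 ^ j * real j"
    by blast
  define w where "w j = u (\<kappa> j)" for j
  have w_in: "w j \<in> carrier E" for j
    by (simp add: w_def u_in)
  have w_large: "vnorm E (w j) > 4 ^ j * real j" for j
    using \<kappa> by (simp add: w_def)
  have "\<exists>\<phi>. linear_map E scalars \<phi> \<and> (\<forall>x\<in>carrier E. norm (\<phi> x) \<le> vnorm E x) \<and>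
      \<phi> (w j) = of_real (vnorm E (w j))" for j
    using norming_functional[OF assms(1) w_in] by metis
  then obtain g where g: "\<And>j. linear_map E scalars (g j)" "\<And>j x. x \<in> carrier E \<Longrightarrow> norm (g j x) \<le> vnorm E x"
      "\<And>j. g j (w j) = of_real (vnorm E (w j))"
    by metis
  define q :: "nat \<Rightarrow> real" where "q j = (1/4) ^ j" for j
  \<comment> \<open>The j-th summand is added only if the partial sum is too small at w j; either
    way the new partial sum is there at least half of q j times the norm of w j.\<close>
  define \<psi> where "\<psi> = rec_nat (\<lambda>_. 0) (\<lambda>j p x. p x + (if norm (p (w j)) \<ge> q j * vnorm E (w j) / 2 then 0 else of_real (q j) * g j x))"
  define f where "f j x = (if norm (\<psi> j (w j)) \<ge> q j * vnorm E (w j) / 2 then 0 else of_real (q j) * g j x)" for j x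
  have \<psi>_0: "\<psi> 0 x = 0" and \<psi>_Suc: "\<psi> (Suc j) x = \<psi> j x + f j x" for j x
    by (simp_all add: \<psi>_def f_def)
  have \<psi>_sum: "\<psi> j x = (\<Sum>i<j. f i x)" for j x
    by (induction j) (simp_all add: \<psi>_0 \<psi>_Suc)
  have f_add: "f j (x \<oplus>\<^bsub>E\<^esub> y) = f j x + f j y" if "x \<in> carrier E" "y \<in> carrier E" for j x y
    using linear_mapD(2)[OF g(1) that] by (simp add: f_def distrib_left)
  have f_smult: "f j (c \<odot>\<^bsub>E\<^esub> x) = c * f j x" if "x \<in> carrier E" for j x c
    using linear_mapD(3)[OF g(1) that] by (simp add: f_def)
  have q_nonneg: "0 \<le> q j" for j
    by (simp add: q_def)
  then have norm_q: "norm (of_real (q j) :: 'k) = q j" for j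
    by simp
  have f_le: "norm (f j x) \<le> q j * vnorm E x" if "x \<in> carrier E" for j x
    using mult_left_mono[OF g(2)[OF that, of j] q_nonneg[of j]] vnorm_nonneg[OF that] q_nonneg[of j]
    by (simp add: f_def norm_mult norm_q)
  have q_summable: "summable q"
    unfolding q_def by (rule summable_geometric) simp
  have f_summable: "summable (\<lambda>j. f j x)" if "x \<in> carrier E" for x
    by (rule summable_comparison_test'[OF summable_mult2[OF q_summable, of "vnorm E x"], of 0]) (simp add: f_le[OF that])
  define \<phi> where "\<phi> x = (\<Sum>j. f j x)" for x
  have lin: "linear_map E scalars \<phi>"
  proof (rule linear_map_scalarsI)
    show "\<phi> (x \<oplus>\<^bsub>E\<^esub> y) = \<phi> x + \<phi> y" if "x \<in> carrier E" "y \<in> carrier E" for x y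
      using suminf_add[OF f_summable[OF that(1)] f_summable[OF that(2)]] by (simp add: \<phi>_def f_add that)
    show "\<phi> (c \<odot>\<^bsub>E\<^esub> x) = c * \<phi> x" if "x \<in> carrier E" for c x
      using suminf_mult[OF f_summable[OF that], of c] by (simp add: \<phi>_def f_smult that)
  qed
  have tail: "norm (\<phi> x - \<psi> m x) \<le> q m * 4 / 3 * vnorm E x" if x: "x \<in> carrier E" for m x
  proof -
    have "\<phi> x - \<psi> m x = (\<Sum>j. f (j + m) x)"
      using suminf_split_initial_segment[OF f_summable[OF x], of m] by (simp add: \<phi>_def \<psi>_sum)
    also have "norm \<dots> \<le> (\<Sum>j. q j * (q m * vnorm E x))"
    proof (rule norm_suminf_le)
      show "norm (f (j + m) x) \<le> q j * (q m * vnorm E x)" for j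
        using f_le[OF x, of "j + m"] by (simp add: q_def power_add mult.assoc)
      show "summable (\<lambda>j. q j * (q m * vnorm E x))"
        by (rule summable_mult2[OF q_summable])
    qed
    also have "\<dots> = (\<Sum>j. q j) * (q m * vnorm E x)"
      by (rule suminf_mult2[OF q_summable, symmetric])
    also have "(\<Sum>j. q j) = 4 / 3"
      unfolding q_def by (subst suminf_geometric) simp_all
    finally show ?thesis
      by (simp add: mult.assoc mult.commute mult.left_commute)
  qed
  have "norm (\<phi> x) \<le> (4 / 3) * vnorm E x" if "x \<in> carrier E" for x
    using tail[OF that, of 0] by (simp add: \<psi>_0 q_def)
  then have "bounded_operator E scalars \<phi>"
    by (rule bounded_functionalI[OF assms(1) lin])
  then obtain c where c: "\<And>k. norm (\<phi> (u k)) \<le> c"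
    using weak by blast
  have large: "norm (\<psi> (Suc j) (w j)) \<ge> q j * vnorm E (w j) / 2" for j
  proof (cases "norm (\<psi> j (w j)) \<ge> q j * vnorm E (w j) / 2")
    case True
    then show ?thesis
      by (simp add: \<psi>_Suc f_def)
  next
    case False
    have "norm (f j (w j)) = q j * vnorm E (w j)"
      using False g(3)[of j] vnorm_nonneg[OF w_in, of j] q_nonneg[of j] by (simp add: f_def norm_mult norm_q)
    then show ?thesis
      using False norm_triangle_ineq4[of "\<psi> j (w j) + f j (w j)" "\<psi> j (w j)"] by (simp add: \<psi>_Suc)
  qed
  have "real j \<le> 6 * c" for j
  proof -
    have "norm (\<psi> (Suc j) (w j)) \<le> norm (\<phi> (w j)) + norm (\<phi> (w j) - \<psi> (Suc j) (w j))"
      using norm_triangle_ineq4[of "\<phi> (w j)" "\<phi> (w j) - \<psi> (Suc j) (w j)"] by simp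
    then have "q j * vnorm E (w j) / 2 \<le> c + q (Suc j) * 4 / 3 * vnorm E (w j)"
      using large[of j] tail[OF w_in, of j "Suc j"] c[of "\<kappa> j"] by (simp add: w_def)
    \<comment> \<open>The tail beyond j has norm at most 4/3 times q (j + 1), that is q j / 3, and
      1/2 - 1/3 = 1/6.\<close>
    then have "q j * vnorm E (w j) / 6 \<le> c"
      by (simp add: q_def)
    moreover have "real j \<le> q j * vnorm E (w j)"
      using w_large[of j] by (simp add: q_def power_one_over field_simps)
    ultimately show ?thesis
      by linarith
  qed
  moreover obtain j :: nat where "6 * c < real j"
    using reals_Archimedean2 by blast
  ultimately show False
    by (meson not_le)
qed

section \<open>Scattered spaces yield the Dunford--Pettis property\<close>

locale weakly_compact_on_tensor = C_tensor n K \<kappa>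
  for n and K :: "nat \<Rightarrow> 'a topology" and \<kappa> :: "'k::{real_normed_field,euclidean_space} itself" +
  fixes F :: "('k, 'f) normed_module" and T
  assumes normed_F: "normed_space F" and weakly_compact: "weakly_compact_operator X F T"
begin

sublocale F: normed_space F
  by (rule normed_F)

lemma T_bounded: "bounded_operator X F T"
  using weakly_compact by (simp add: weakly_compact_operator_def)

lemma T_linear: "linear_map X F T"
  using T_bounded by (simp add: bounded_operator_def)

lemmas T_in = linear_mapD(1)[OF T_linear]
  and T_add = linear_mapD(2)[OF T_linear]
  and T_smult = linear_mapD(3)[OF T_linear]

text \<open>Compactness yields a cluster point rather than a limit. Its values are pinned down at
  the functionals along which the sequence converges, and for partial sums of the series below these
  are all functionals.\<close>

lemma weak_cluster_point:
  assumes z: "\<And>m. z m \<in> carrier X" "\<And>m. vnorm X (z m) \<le> c"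
  obtains y where "y \<in> carrier F"
    "\<And>\<phi> l. bounded_operator F scalars \<phi> \<Longrightarrow> (\<lambda>m. \<phi> (T (z m))) \<longlonglongrightarrow> l \<Longrightarrow> \<phi> y = l"
proof -
  define B where "B = {u \<in> carrier X. vnorm X u \<le> c}"
  have "X.metric.mbounded B"
    unfolding X.mbounded_iff B_def by blast
  then have comp: "compactin (weak_topology F) (weak_topology F closure_of (T ` B))"
    using weakly_compact unfolding weakly_compact_operator_def by blast
  have "T ` B \<subseteq> topspace (weak_topology F)"
    unfolding topspace_weak_topology[OF normed_F] using T_in by (auto simp: B_def)
  then have sub: "T ` B \<subseteq> weak_topology F closure_of (T ` B)"
    by (rule closure_of_subset)
  have "range (\<lambda>m. T (z m)) \<subseteq> weak_topology F closure_of (T ` B)"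
    using z sub by (auto simp: B_def)
  then obtain y where y: "y \<in> weak_topology F closure_of (T ` B)"
      "\<And>U. openin (weak_topology F) U \<Longrightarrow> y \<in> U \<Longrightarrow> \<exists>\<^sub>F m in sequentially. T (z m) \<in> U"
    using compactin_imp_cluster_point[OF comp] by metis
  have y_in: "y \<in> carrier F"
    using y(1) closure_of_subset_topspace[of "weak_topology F"] topspace_weak_topology[OF normed_F] by blast
  have "\<phi> y = l" if \<phi>: "bounded_operator F scalars \<phi>" and l: "(\<lambda>m. \<phi> (T (z m))) \<longlonglongrightarrow> l" for \<phi> l
  proof (rule ccontr)
    assume "\<phi> y \<noteq> l"
    then obtain U V where UV: "open U" "open V" "\<phi> y \<in> U" "l \<in> V" "U \<inter> V = {}"
      by (rule separation_t2[THEN iffD1, elim_format]) blast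
    have "\<exists>\<^sub>F m in sequentially. T (z m) \<in> {x \<in> carrier F. \<phi> x \<in> U}"
      using UV(3) y_in by (intro y(2) openin_weak_topology \<phi> UV(1)) simp
    moreover have "\<forall>\<^sub>F m in sequentially. \<phi> (T (z m)) \<in> V"
      using l UV(2,4) by (rule topological_tendstoD)
    ultimately have "\<exists>\<^sub>F m in sequentially. T (z m) \<in> {x \<in> carrier F. \<phi> x \<in> U} \<and> \<phi> (T (z m)) \<in> V"
      by (rule frequently_eventually_frequently)
    then obtain m where "\<phi> (T (z m)) \<in> U" "\<phi> (T (z m)) \<in> V"
      using frequently_ex by fastforce
    then show False
      using UV(5) by blast
  qed
  then show thesis
    using that y_in by blast
qed

text \<open>Partial sums over any set S stay in one ball, because
  \<open>summing_functional_bound\<close> is uniform over functionals. T maps that ball into a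
  relatively weakly compact set, so every subseries has a weak sum Y S and the Orlicz-Pettis theorem
  applies.\<close>

lemma summing_tendsto_zero:
  fixes x :: "nat \<Rightarrow> nat \<Rightarrow> 'a \<Rightarrow> 'k"
  assumes x: "\<And>k. cont_tuple (x k)" and W: "W \<subseteq> {..<n}" "W \<noteq> {}"
    and summing: "\<And>i. i \<in> W \<Longrightarrow> abs_summing (K i) (\<lambda>k. x k i)"
    and const: "\<And>i k. i < n \<Longrightarrow> i \<notin> W \<Longrightarrow> x k i = x 0 i"
  shows "(\<lambda>k. vnorm F (T (tens (x k)))) \<longlonglongrightarrow> 0"
proof -
  have "\<exists>c. if i \<in> W then \<forall>m. \<forall>t\<in>topspace (K i). (\<Sum>k<m. norm (x k i t)) \<le> c
      else \<forall>t\<in>topspace (K i). norm (x 0 i t) \<le> c" if i: "i < n" for i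
  proof (cases "i \<in> W")
    case True
    then show ?thesis
      using summing[OF True] unfolding abs_summing_def by simp
  next
    case False
    then show ?thesis
      using continuous_fun_bounded_ex[OF compact[OF i] cont_tupleD[OF x[of 0] i]] by auto
  qed
  then obtain C where C: "\<And>i. i < n \<Longrightarrow> if i \<in> W then \<forall>m. \<forall>t\<in>topspace (K i). (\<Sum>k<m. norm (x k i t)) \<le> C i
      else \<forall>t\<in>topspace (K i). norm (x 0 i t) \<le> C i"
    by metis
  have C1: "norm (x 0 i t) \<le> C i" if "i < n" "i \<notin> W" "t \<in> topspace (K i)" for i t
    using C[OF that(1)] that(2,3) by simp
  have C2: "(\<Sum>k<m. norm (x k i t)) \<le> C i" if "i \<in> W" "t \<in> topspace (K i)" for i t m
  proof -
    have "i < n"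
      using that(1) W(1) by auto
    then show ?thesis
      using C[of i] that by simp
  qed
  note bound = summing_functional_bound[OF W x const C1 C2]
  define M where "M = (\<Prod>i<n. C i)"
  have summable_X: "summable (\<lambda>k. norm (\<phi> (tens (x k))))" if \<phi>: "bounded_operator X scalars \<phi>" for \<phi>
  proof -
    obtain B where B: "B > 0" "linear_map X scalars \<phi>" "\<And>u. u \<in> carrier X \<Longrightarrow> norm (\<phi> u) \<le> B * vnorm X u"
      using bounded_operatorE[OF normed_X normed_space_scalars \<phi>] by auto
    have "(\<Sum>k<m. norm (\<phi> (tens (x k)))) \<le> B * M" for m
      unfolding M_def using B(1) by (intro bound B(2,3)) simp_all
    then have "(\<Sum>k\<le>m. norm (\<phi> (tens (x k)))) \<le> B * M" for m
      unfolding lessThan_Suc_atMost[symmetric] .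
    then show ?thesis
      by (intro bounded_imp_summable[where B = "B * M"]) simp_all
  qed
  define s where "s S = rec_nat \<zero>\<^bsub>X\<^esub> (\<lambda>k v. if k \<in> S then v \<oplus>\<^bsub>X\<^esub> tens (x k) else v)" for S
  have s_0: "s S 0 = \<zero>\<^bsub>X\<^esub>" and s_Suc: "s S (Suc k) = (if k \<in> S then s S k \<oplus>\<^bsub>X\<^esub> tens (x k) else s S k)" for S k
    by (simp_all add: s_def)
  have s_in: "s S m \<in> carrier X" for S m
    by (induction m) (simp_all add: s_0 s_Suc x)
  have \<phi>_s: "\<phi> (s S m) = (\<Sum>k<m. if k \<in> S then \<phi> (tens (x k)) else 0)" if \<phi>: "linear_map X scalars \<phi>" for \<phi> S m
  proof (induction m)
    case 0
    then show ?case
      using linear_map_zero[OF normed_X normed_space_scalars \<phi>] by (simp add: s_0)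
  next
    case (Suc m)
    then show ?case
      using linear_mapD(2)[OF \<phi> s_in[of S m], of "tens (x m)"] x[of m] by (simp add: s_Suc)
  qed
  have s_bound: "vnorm X (s S m) \<le> M" for S m
  proof -
    obtain \<phi> where \<phi>: "linear_map X scalars \<phi>" "\<And>u. u \<in> carrier X \<Longrightarrow> norm (\<phi> u) \<le> vnorm X u"
        "\<phi> (s S m) = of_real (vnorm X (s S m))"
      using norming_functional[OF normed_X s_in] by blast
    have "vnorm X (s S m) = norm (\<phi> (s S m))"
      unfolding \<phi>(3) using s_in by simp
    also have "\<dots> \<le> (\<Sum>k<m. norm (if k \<in> S then \<phi> (tens (x k)) else 0))"
      unfolding \<phi>_s[OF \<phi>(1)] by (rule norm_sum)
    also have "\<dots> \<le> (\<Sum>k<m. norm (\<phi> (tens (x k))))"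
      by (intro sum_mono) simp
    also have "\<dots> \<le> 1 * M"
      unfolding M_def by (intro bound \<phi>(1)) (simp_all add: \<phi>(2))
    finally show ?thesis
      by simp
  qed
  have "\<exists>y. y \<in> carrier F \<and> (\<forall>\<phi> l. bounded_operator F scalars \<phi> \<longrightarrow> (\<lambda>m. \<phi> (T (s S m))) \<longlonglongrightarrow> l \<longrightarrow> \<phi> y = l)" for S
    by (rule weak_cluster_point[of "s S" M, OF s_in s_bound]) blast
  then obtain Y where Y: "\<And>S. Y S \<in> carrier F"
      "\<And>S \<phi> l. bounded_operator F scalars \<phi> \<Longrightarrow> (\<lambda>m. \<phi> (T (s S m))) \<longlonglongrightarrow> l \<Longrightarrow> \<phi> (Y S) = l"
    by metis
  show ?thesis
  proof (rule weakly_subseries_convergent_null[OF normed_F, where Y = Y])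
    show "T (tens (x j)) \<in> carrier F" for j
      by (intro T_in tens_in x)
    show "Y S \<in> carrier F" for S
      by (rule Y(1))
    fix \<phi> assume \<phi>: "bounded_operator F scalars \<phi>"
    have \<phi>T: "bounded_operator X scalars (\<lambda>u. \<phi> (T u))"
      by (rule bounded_operator_compose[OF T_bounded \<phi>])
    show summ: "summable (\<lambda>j. norm (\<phi> (T (tens (x j)))))"
      by (rule summable_X[OF \<phi>T])
    show "\<phi> (Y S) = (\<Sum>j. if j \<in> S then \<phi> (T (tens (x j))) else 0)" for S
    proof (rule Y(2)[OF \<phi>])
      have "linear_map X scalars (\<lambda>u. \<phi> (T u))"
        using \<phi>T by (simp add: bounded_operator_def)
      then have eq: "(\<lambda>m. \<phi> (T (s S m))) = (\<lambda>m. \<Sum>k<m. if k \<in> S then \<phi> (T (tens (x k))) else 0)"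
        using \<phi>_s by fastforce
      have "summable (\<lambda>j. if j \<in> S then \<phi> (T (tens (x j))) else 0)"
        by (rule summable_comparison_test'[OF summ, of 0]) simp
      then show "(\<lambda>m. \<phi> (T (s S m))) \<longlonglongrightarrow> (\<Sum>j. if j \<in> S then \<phi> (T (tens (x j))) else 0)"
        unfolding eq by (rule summable_LIMSEQ)
    qed
  qed
qed

definition op_bound :: real where
  "op_bound = (SOME C. C > 0 \<and> (\<forall>u\<in>carrier X. vnorm F (T u) \<le> C * vnorm X u))"

lemma op_bound: "op_bound > 0" "u \<in> carrier X \<Longrightarrow> vnorm F (T u) \<le> op_bound * vnorm X u"
proof -
  have "\<exists>C. C > 0 \<and> (\<forall>u\<in>carrier X. vnorm F (T u) \<le> C * vnorm X u)"
    using bounded_operatorE[OF normed_X normed_F T_bounded] by metis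
  from someI_ex[OF this] show "op_bound > 0" "u \<in> carrier X \<Longrightarrow> vnorm F (T u) \<le> op_bound * vnorm X u"
    unfolding op_bound_def by simp_all
qed

sublocale S: multi_seminorm n K \<kappa> "\<lambda>x. vnorm F (T (tens x))" op_bound
proof
  show "0 \<le> op_bound"
    using op_bound(1) by simp
  show "0 \<le> vnorm F (T (tens x))" if "cont_tuple x" for x
    using that by (intro F.vnorm_nonneg T_in tens_in)
  show "vnorm F (T (tens (x(i := \<lambda>t. f t + g t)))) \<le> vnorm F (T (tens (x(i := f)))) + vnorm F (T (tens (x(i := g))))"
    if "cont_tuple x" "i < n" "continuous_fun (K i) f" "continuous_fun (K i) g" for x i f g
    using that by (simp add: tens_add T_add T_in cont_tuple_upd F.vnorm_triangle)
  show "vnorm F (T (tens x)) \<le> op_bound * (\<Prod>i<n. c i)"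
    if "cont_tuple x" "\<And>i t. i < n \<Longrightarrow> t \<in> topspace (K i) \<Longrightarrow> norm (x i t) \<le> c i" for x c
  proof -
    have "vnorm F (T (tens x)) \<le> op_bound * vnorm X (tens x)"
      using that(1) by (intro op_bound(2) tens_in)
    also have "\<dots> \<le> op_bound * (\<Prod>i<n. c i)"
      using op_bound(1) by (intro mult_left_mono vnorm_tens_le that) simp_all
    finally show ?thesis .
  qed
  show "(\<lambda>k. vnorm F (T (tens (x k)))) \<longlonglongrightarrow> 0"
    if "\<And>k. cont_tuple (x k)" "W \<subseteq> {..<n}" "W \<noteq> {}"
      "\<And>i. i \<in> W \<Longrightarrow> abs_summing (K i) (\<lambda>k. x k i)"
      "\<And>i k. i < n \<Longrightarrow> i \<notin> W \<Longrightarrow> x k i = x 0 i" for x W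
    by (rule summing_tendsto_zero[OF that])
qed

text \<open>One slot is exchanged at a time. Each exchange leaves a tensor with a consecutive
  difference, which is pointwise null, in one slot and pointwise convergent entries in the
  others.\<close>

lemma convergent_consecutive_differences:
  fixes x :: "nat \<Rightarrow> nat \<Rightarrow> 'a \<Rightarrow> 'k"
  assumes x: "\<And>k. cont_tuple (x k)" and conv: "\<And>i. i < n \<Longrightarrow> conv_seq (K i) (\<lambda>k. x k i)"
  shows "(\<lambda>k. vnorm F (T (tens (x (Suc k))) \<ominus>\<^bsub>F\<^esub> T (tens (x k)))) \<longlonglongrightarrow> 0"
proof -
  \<comment> \<open>Slots below j come from x k and the others from x (Suc k), so h 0 is the later
    tuple and h n the earlier one.\<close>
  define h where "h j k i = (if i < j then x k i else x (Suc k) i)" for j k i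
  have ch: "cont_tuple (h j k)" for j k
    using x by (simp add: h_def cont_tuple_def)
  define g where "g j k = (h j k)(j := \<lambda>t. x (Suc k) j t - x k j t)" for j k
  have cx: "continuous_fun (K j) (x k j)" if "j < n" for j k
    using cont_tupleD[OF x that] .
  have cg: "cont_tuple (g j k)" if "j < n" for j k
    unfolding g_def using that by (intro cont_tuple_upd ch continuous_fun_diff cx)
  have lim_Suc: "filterlim Suc sequentially sequentially"
    by (rule filterlim_Suc)
  have null: "(\<lambda>k. vnorm F (T (tens (g j k)))) \<longlonglongrightarrow> 0" if j: "j < n" for j
  proof (rule S.null_and_convergent_tendsto_zero[of "{..<n} - {j}" "g j" "{j}", OF _ cg[OF j]])
    show "null_seq (K i) (\<lambda>k. g j k i)" if "i \<in> {j}" for i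
    proof -
      have i: "i = j"
        using that by simp
      have gj: "g j k j = (\<lambda>t. x (Suc k) j t - x k j t)" for k
        by (simp add: g_def)
      obtain c where c: "\<And>k t. t \<in> topspace (K j) \<Longrightarrow> norm (x k j t) \<le> c"
        using conv[OF j] unfolding conv_seq_def bdd_seq_def by blast
      have "norm (g j k j t) \<le> c + c" if "t \<in> topspace (K j)" for k t
        using c[OF that, of "Suc k"] c[OF that, of k] norm_triangle_ineq4[of "x (Suc k) j t" "x k j t"]
        by (simp add: gj)
      moreover have "(\<lambda>k. g j k j t) \<longlonglongrightarrow> 0" if t: "t \<in> topspace (K j)" for t
      proof -
        obtain a where a: "(\<lambda>k. x k j t) \<longlonglongrightarrow> a"
          using conv[OF j] t unfolding conv_seq_def convergent_def by blast
        show ?thesis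
          using tendsto_diff[OF LIMSEQ_Suc[OF a] a] by (simp add: gj)
      qed
      ultimately show ?thesis
        unfolding i null_seq_def bdd_seq_def by blast
    qed
    show "conv_seq (K i) (\<lambda>k. g j k i)" if "i \<in> {..<n} - {j}" for i
    proof -
      have i: "i < n" "i \<noteq> j"
        using that by auto
      have "conv_seq (K i) (\<lambda>k. x (Suc k) i)"
        by (rule conv_seq_compose[OF conv[OF i(1)] lim_Suc])
      then show ?thesis
        using conv[OF i(1)] i(2) by (cases "i < j") (simp_all add: g_def h_def)
    qed
    show "g j k i = g j 0 i" if "i < n" "i \<notin> {j} \<union> ({..<n} - {j})" for i k
      using that by blast
  qed (use j in auto)
  have step: "T (tens (h j k)) \<ominus>\<^bsub>F\<^esub> T (tens (h (Suc j) k)) = T (tens (g j k))" if j: "j < n" for j k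
  proof -
    have e1: "h j k = (h j k)(j := \<lambda>t. (x (Suc k) j t - x k j t) + x k j t)"
      by (auto simp: h_def)
    have e2: "h (Suc j) k = (h j k)(j := x k j)"
      by (auto simp: h_def less_Suc_eq fun_eq_iff)
    have "tens (h j k) = tens (g j k) \<oplus>\<^bsub>X\<^esub> tens (h (Suc j) k)"
      unfolding e2 g_def by (subst e1) (intro tens_add ch j continuous_fun_diff cx)
    then have "T (tens (h j k)) = T (tens (g j k)) \<oplus>\<^bsub>F\<^esub> T (tens (h (Suc j) k))"
      using T_add[OF tens_in[OF cg[OF j, of k]] tens_in[OF ch[of "Suc j" k]]] by simp
    moreover have "T (tens (g j k)) \<in> carrier F" "T (tens (h (Suc j) k)) \<in> carrier F"
      by (intro T_in tens_in cg[OF j] ch)+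
    ultimately show ?thesis
      by (simp add: F.M.minus_eq F.M.a_assoc F.M.r_neg)
  qed
  have "vnorm F (T (tens (h 0 k)) \<ominus>\<^bsub>F\<^esub> T (tens (h m k))) \<le> (\<Sum>j<m. vnorm F (T (tens (g j k))))" if "m \<le> n" for k m
    using that
  proof (induction m)
    case 0
    then show ?case
      using T_in[OF tens_in[OF ch[of 0 k]]] by simp
  next
    case (Suc m)
    have "vnorm F (T (tens (h 0 k)) \<ominus>\<^bsub>F\<^esub> T (tens (h (Suc m) k))) \<le>
        vnorm F (T (tens (h 0 k)) \<ominus>\<^bsub>F\<^esub> T (tens (h m k))) + vnorm F (T (tens (h m k)) \<ominus>\<^bsub>F\<^esub> T (tens (h (Suc m) k)))"
      by (intro F.vnorm_diff_triangle T_in tens_in ch)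
    then show ?case
      using Suc step[of m k] by simp
  qed
  moreover have "tens (h n k) = tens (x k)" "tens (h 0 k) = tens (x (Suc k))" for k
    by (rule tens_cong, simp add: h_def)+
  ultimately have le: "vnorm F (T (tens (x (Suc k))) \<ominus>\<^bsub>F\<^esub> T (tens (x k))) \<le> (\<Sum>j<n. vnorm F (T (tens (g j k))))" for k
    by (metis order_refl)
  have "(\<lambda>k. \<Sum>j<n. vnorm F (T (tens (g j k)))) \<longlonglongrightarrow> (\<Sum>j<n. 0)"
    by (intro tendsto_sum null) simp
  then have "(\<lambda>k. \<Sum>j<n. vnorm F (T (tens (g j k)))) \<longlonglongrightarrow> 0"
    by simp
  then show ?thesis
    by (rule F.tendsto_zero_vnorm_le[OF _ _ le]) (intro F.diff_in T_in tens_in x)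
qed

section \<open>Total boundedness on tensors of unit factors\<close>

definition unit_tuples :: "(nat \<Rightarrow> 'a \<Rightarrow> 'k) set" where
  "unit_tuples = {x. cont_tuple x \<and> (\<forall>i<n. \<forall>t\<in>topspace (K i). norm (x i t) \<le> 1)}"

lemma unit_tuplesD:
  assumes "x \<in> unit_tuples"
  shows "cont_tuple x" "i < n \<Longrightarrow> t \<in> topspace (K i) \<Longrightarrow> norm (x i t) \<le> 1"
  using assms by (auto simp: unit_tuples_def)

text \<open>A greedy choice: without a finite net there is a sequence of unit tuples with
  \<epsilon>-separated images. A subsequence converges pointwise in every slot, and its consecutive
  differences tend to 0 in F.\<close>

lemma finite_net:
  assumes hausdorff: "\<And>i. i < n \<Longrightarrow> Hausdorff_space (K i)" and scattered: "\<And>i. i < n \<Longrightarrow> scattered_space (K i)"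
    and \<epsilon>: "\<epsilon> > 0"
  shows "\<exists>P. finite P \<and> P \<subseteq> unit_tuples \<and> (\<forall>x\<in>unit_tuples. \<exists>p\<in>P. vnorm F (T (tens x) \<ominus>\<^bsub>F\<^esub> T (tens p)) < \<epsilon>)"
proof (rule ccontr)
  assume "\<not> ?thesis"
  then have "\<exists>x\<in>unit_tuples. \<forall>p\<in>P. vnorm F (T (tens x) \<ominus>\<^bsub>F\<^esub> T (tens p)) \<ge> \<epsilon>"
    if "finite P" "P \<subseteq> unit_tuples" for P
    using that by (meson not_le)
  then obtain G where G: "\<And>P. finite P \<Longrightarrow> P \<subseteq> unit_tuples \<Longrightarrow> G P \<in> unit_tuples"
      "\<And>P p. finite P \<Longrightarrow> P \<subseteq> unit_tuples \<Longrightarrow> p \<in> P \<Longrightarrow> vnorm F (T (tens (G P)) \<ominus>\<^bsub>F\<^esub> T (tens p)) \<ge> \<epsilon>"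
    by metis
  \<comment> \<open>The state of the recursion is the list of all earlier choices, since the next
    tuple must keep away from each of them.\<close>
  define L where "L = rec_nat [] (\<lambda>k l. G (set l) # l)"
  have L_Suc: "L (Suc k) = G (set (L k)) # L k" for k
    by (simp add: L_def)
  have L_unit: "set (L k) \<subseteq> unit_tuples" for k
    by (induction k) (auto simp: L_Suc G(1), simp add: L_def)
  define s where "s k = G (set (L k))" for k
  have s_unit: "s k \<in> unit_tuples" for k
    unfolding s_def by (intro G(1) L_unit) simp
  have s_in_L: "s j \<in> set (L k)" if "j < k" for j k
    using that by (induction k) (auto simp: L_Suc s_def less_Suc_eq)
  have sep: "vnorm F (T (tens (s k)) \<ominus>\<^bsub>F\<^esub> T (tens (s j))) \<ge> \<epsilon>" if "j < k" for j k
    unfolding s_def[of k] by (intro G(2) L_unit s_in_L[OF that]) simp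
  have "\<exists>r :: nat \<Rightarrow> nat. strict_mono r \<and> (\<forall>i<m. conv_seq (K i) (\<lambda>k. s (r k) i))" if "m \<le> n" for m
    using that
  proof (induction m)
    case 0
    then show ?case
      using strict_mono_id by auto
  next
    case (Suc m)
    then have m: "m < n"
      by simp
    obtain r :: "nat \<Rightarrow> nat" where r: "strict_mono r" "\<And>i. i < m \<Longrightarrow> conv_seq (K i) (\<lambda>k. s (r k) i)"
      using Suc by (meson Suc_leD)
    have "\<exists>r' :: nat \<Rightarrow> nat. strict_mono r' \<and> conv_seq (K m) (\<lambda>k. s (r (r' k)) m)"
    proof (rule scattered_convergent_subseq[OF compact[OF m] hausdorff[OF m] scattered[OF m], of "\<lambda>k. s (r k) m" 1])
      show "continuous_fun (K m) (s (r k) m)" for k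
        by (rule cont_tupleD[OF unit_tuplesD(1)[OF s_unit] m])
      show "norm (s (r k) m t) \<le> 1" if "t \<in> topspace (K m)" for k t
        by (rule unit_tuplesD(2)[OF s_unit m that])
    qed blast
    then obtain r' :: "nat \<Rightarrow> nat" where r': "strict_mono r'" "conv_seq (K m) (\<lambda>k. s (r (r' k)) m)"
      by blast
    have "conv_seq (K i) (\<lambda>k. s (r (r' k)) i)" if "i < Suc m" for i
    proof (cases "i = m")
      case True
      then show ?thesis
        using r'(2) by simp
    next
      case False
      then have "i < m"
        using that by simp
      then show ?thesis
        by (rule conv_seq_compose[OF r(2) filterlim_subseq[OF r'(1)]])
    qed
    moreover have "strict_mono (\<lambda>k. r (r' k))"
      using r(1) r'(1) by (simp add: strict_mono_def)
    ultimately show ?case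
      by blast
  qed
  then obtain r :: "nat \<Rightarrow> nat" where r: "strict_mono r" "\<And>i. i < n \<Longrightarrow> conv_seq (K i) (\<lambda>k. s (r k) i)"
    by blast
  have "(\<lambda>k. vnorm F (T (tens (s (r (Suc k)))) \<ominus>\<^bsub>F\<^esub> T (tens (s (r k))))) \<longlonglongrightarrow> 0"
    by (rule convergent_consecutive_differences[of "\<lambda>k. s (r k)", OF unit_tuplesD(1)[OF s_unit] r(2)])
  then have "\<forall>\<^sub>F k in sequentially. vnorm F (T (tens (s (r (Suc k)))) \<ominus>\<^bsub>F\<^esub> T (tens (s (r k)))) < \<epsilon>"
    using \<epsilon> by (rule order_tendstoD)
  then obtain k where "vnorm F (T (tens (s (r (Suc k)))) \<ominus>\<^bsub>F\<^esub> T (tens (s (r k)))) < \<epsilon>"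
    using eventually_happens'[OF sequentially_bot] by blast
  moreover have "r k < r (Suc k)"
    using r(1) by (simp add: strict_mono_def)
  ultimately show False
    using sep by fastforce
qed

text \<open>An argument in the manner of Schauder's theorem on adjoints. By the net, finitely many
  values \<phi> (T (tens p)) control the norm of a difference of two functionals \<phi> o T. Along a
  subsequence these values converge, so one fixed functional approximates all later norming ones,
  and at a fixed functional a weakly null sequence tends to 0.\<close>

lemma weakly_null_imp_null:
  assumes hausdorff: "\<And>i. i < n \<Longrightarrow> Hausdorff_space (K i)" and scattered: "\<And>i. i < n \<Longrightarrow> scattered_space (K i)"
    and u: "\<And>k. u k \<in> carrier X"
    and weak: "\<And>\<phi>. bounded_operator X scalars \<phi> \<Longrightarrow> (\<lambda>k. \<phi> (u k)) \<longlonglongrightarrow> 0"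
  shows "(\<lambda>k. vnorm F (T (u k))) \<longlonglongrightarrow> 0"
proof (rule ccontr)
  assume not_null: "\<not> ?thesis"
  have Tu: "T (u k) \<in> carrier F" for k
    by (intro T_in u)
  have "\<exists>\<epsilon>>0. \<exists>r :: nat \<Rightarrow> nat. strict_mono r \<and> (\<forall>k. vnorm F (T (u (r k))) \<ge> \<epsilon>)"
    by (rule not_tendsto_zero_subseq[OF F.vnorm_nonneg[OF Tu] not_null])
  then obtain \<epsilon> and r :: "nat \<Rightarrow> nat" where \<epsilon>: "\<epsilon> > 0" and r: "strict_mono r"
      and big: "\<And>k. vnorm F (T (u (r k))) \<ge> \<epsilon>"
    by blast
  have "\<exists>c. \<forall>k. norm (\<phi> (u k)) \<le> c" if "bounded_operator X scalars \<phi>" for \<phi>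
    using convergent_imp_bounded[OF weak[OF that]] by (auto simp: bounded_iff)
  from weakly_bounded_imp_bounded[where u = u, OF normed_X u this] obtain c where c: "\<And>k. vnorm X (u k) \<le> c"
    by blast
  \<comment> \<open>The approximation costs 3 \<eta> per unit of norm, and vectors of norm at most
    |c| occur; the constant 12 makes the total at most \<epsilon> / 4.\<close>
  define \<eta> where "\<eta> = \<epsilon> / (12 * (\<bar>c\<bar> + 1))"
  have \<eta>: "\<eta> > 0"
    using \<epsilon> by (simp add: \<eta>_def add_nonneg_pos)
  obtain P where P: "finite P" "P \<subseteq> unit_tuples"
      "\<And>x. x \<in> unit_tuples \<Longrightarrow> \<exists>p\<in>P. vnorm F (T (tens x) \<ominus>\<^bsub>F\<^esub> T (tens p)) < \<eta>"
    using finite_net[OF hausdorff scattered \<eta>] by blast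
  have "\<exists>\<phi>. linear_map F scalars \<phi> \<and> (\<forall>y\<in>carrier F. norm (\<phi> y) \<le> vnorm F y) \<and>
      \<phi> (T (u (r k))) = of_real (vnorm F (T (u (r k))))" for k
    using norming_functional[OF normed_F Tu] by metis
  then obtain \<phi> where \<phi>: "\<And>k. linear_map F scalars (\<phi> k)" "\<And>k y. y \<in> carrier F \<Longrightarrow> norm (\<phi> k y) \<le> vnorm F y"
      "\<And>k. \<phi> k (T (u (r k))) = of_real (vnorm F (T (u (r k))))"
    by metis
  have "norm (\<phi> k y) \<le> 1 * vnorm F y" if "y \<in> carrier F" for k y
    using \<phi>(2)[OF that] by simp
  then have \<phi>_op: "bounded_operator F scalars (\<phi> k)" for k
    by (rule bounded_functionalI[OF normed_F \<phi>(1)])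
  have TP: "T (tens x) \<in> carrier F" if "x \<in> unit_tuples" for x
    using that by (intro T_in tens_in unit_tuplesD(1))
  have "norm (\<phi> k (T (tens p))) \<le> op_bound" if "p \<in> P" for k p
  proof -
    have p: "p \<in> unit_tuples"
      using that P(2) by blast
    have "norm (\<phi> k (T (tens p))) \<le> vnorm F (T (tens p))"
      by (rule \<phi>(2)[OF TP[OF p]])
    also have "\<dots> \<le> op_bound * (\<Prod>i<n. 1)"
      by (rule S.N_bound[OF unit_tuplesD(1)[OF p] unit_tuplesD(2)[OF p]])
    finally show ?thesis
      by simp
  qed
  then obtain r' :: "nat \<Rightarrow> nat" where r': "strict_mono r'"
      "\<And>p. p \<in> P \<Longrightarrow> \<exists>l. (\<lambda>k. \<phi> (r' k) (T (tens p))) \<longlonglongrightarrow> l"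
    using function_convergent_subsequence[of P "\<lambda>k p. \<phi> k (T (tens p))" op_bound] countable_finite[OF P(1)] by blast
  have "\<forall>\<^sub>F k in sequentially. \<forall>p\<in>P. \<forall>l\<ge>k. norm (\<phi> (r' l) (T (tens p)) - \<phi> (r' k) (T (tens p))) < \<eta>"
  proof (rule eventually_ball_finite[OF P(1)], intro ballI)
    fix p assume "p \<in> P"
    then have "Cauchy (\<lambda>k. \<phi> (r' k) (T (tens p)))"
      using r'(2) LIMSEQ_imp_Cauchy by blast
    then obtain k0 where "\<And>k l. k \<ge> k0 \<Longrightarrow> l \<ge> k0 \<Longrightarrow> norm (\<phi> (r' l) (T (tens p)) - \<phi> (r' k) (T (tens p))) < \<eta>"
      using \<eta> unfolding Cauchy_iff by meson
    then show "\<forall>\<^sub>F k in sequentially. \<forall>l\<ge>k. norm (\<phi> (r' l) (T (tens p)) - \<phi> (r' k) (T (tens p))) < \<eta>"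
      unfolding eventually_sequentially by (intro exI[of _ k0]) auto
  qed
  then obtain k where k: "\<And>p l. p \<in> P \<Longrightarrow> l \<ge> k \<Longrightarrow> norm (\<phi> (r' l) (T (tens p)) - \<phi> (r' k) (T (tens p))) < \<eta>"
    using eventually_happens'[OF sequentially_bot] by blast
  \<comment> \<open>From here on k is fixed, and \<psi> l measures how far the l-th norming
    functional is from the k-th.\<close>
  define \<psi> where "\<psi> l v = \<phi> (r' l) (T v) - \<phi> (r' k) (T v)" for l v
  have \<phi>T: "bounded_operator X scalars (\<lambda>v. \<phi> l (T v))" for l
    by (rule bounded_operator_compose[OF T_bounded \<phi>_op])
  have \<psi>_lin: "linear_map X scalars (\<psi> l)" for l
    by (rule linear_map_scalarsI)
      (simp_all add: \<psi>_def T_add T_smult T_in linear_mapD(2)[OF \<phi>(1)] linear_mapD(3)[OF \<phi>(1)] algebra_simps)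
  have \<psi>_op: "bounded_operator X scalars (\<psi> l)" for l
  proof (rule bounded_functionalI[OF normed_X \<psi>_lin])
    fix v assume v: "v \<in> carrier X"
    show "norm (\<psi> l v) \<le> (op_bound + op_bound) * vnorm X v"
      using norm_triangle_ineq4[of "\<phi> (r' l) (T v)" "\<phi> (r' k) (T v)"] \<phi>(2)[OF T_in[OF v], of "r' l"]
        \<phi>(2)[OF T_in[OF v], of "r' k"] op_bound(2)[OF v] by (simp add: \<psi>_def distrib_right)
  qed
  have \<psi>_le: "norm (\<psi> l v) \<le> 3 * \<eta> * vnorm X v" if l: "l \<ge> k" and v: "v \<in> carrier X" for l v
  proof (rule functional_bound_by_tens[OF \<psi>_op _ _ v])
    show "0 \<le> 3 * \<eta>"
      using \<eta> by simp
    fix x assume "cont_tuple x" "\<And>i t. i < n \<Longrightarrow> t \<in> topspace (K i) \<Longrightarrow> norm (x i t) \<le> 1"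
    then have x: "x \<in> unit_tuples"
      by (simp add: unit_tuples_def)
    then obtain p where p: "p \<in> P" "vnorm F (T (tens x) \<ominus>\<^bsub>F\<^esub> T (tens p)) < \<eta>"
      using P(3) by blast
    have pu: "p \<in> unit_tuples"
      using p(1) P(2) by blast
    have d: "norm (\<phi> j (T (tens x)) - \<phi> j (T (tens p))) < \<eta>" for j
      using \<phi>(2)[OF F.diff_in[OF TP[OF x] TP[OF pu]], of j] p(2)
        linear_functional_diff[OF normed_F \<phi>(1) TP[OF x] TP[OF pu], of j] by simp
    have "\<psi> l (tens x) = (\<phi> (r' l) (T (tens x)) - \<phi> (r' l) (T (tens p))) +
        (\<phi> (r' l) (T (tens p)) - \<phi> (r' k) (T (tens p))) - (\<phi> (r' k) (T (tens x)) - \<phi> (r' k) (T (tens p)))"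
      by (simp add: \<psi>_def)
    also have "norm \<dots> \<le> norm (\<phi> (r' l) (T (tens x)) - \<phi> (r' l) (T (tens p))) +
        norm (\<phi> (r' l) (T (tens p)) - \<phi> (r' k) (T (tens p))) + norm (\<phi> (r' k) (T (tens x)) - \<phi> (r' k) (T (tens p)))"
      by (intro order_trans[OF norm_triangle_ineq4] add_mono norm_triangle_ineq order_refl)
    also have "\<dots> \<le> 3 * \<eta>"
      using d[of "r' l"] d[of "r' k"] k[OF p(1) l] by linarith
    finally show "norm (\<psi> l (tens x)) \<le> 3 * \<eta>" .
  qed
  have "(\<lambda>l. \<phi> (r' k) (T (u (r (r' l))))) \<longlonglongrightarrow> 0"
  proof -
    have "filterlim (\<lambda>l. r (r' l)) sequentially sequentially"
      using filterlim_compose[OF filterlim_subseq[OF r] filterlim_subseq[OF r'(1)]] .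
    then show ?thesis
      by (rule filterlim_compose[OF weak[OF \<phi>T]])
  qed
  then have "\<forall>\<^sub>F l in sequentially. norm (\<phi> (r' k) (T (u (r (r' l))))) < \<epsilon> / 2"
    using \<epsilon> by (intro order_tendstoD[OF tendsto_norm_zero]) auto
  then obtain l0 where "\<And>l. l \<ge> l0 \<Longrightarrow> norm (\<phi> (r' k) (T (u (r (r' l))))) < \<epsilon> / 2"
    unfolding eventually_sequentially by blast
  then have small: "norm (\<phi> (r' k) (T (u (r (r' (max l0 k)))))) < \<epsilon> / 2"
    by simp
  define l where "l = max l0 k"
  define v where "v = u (r (r' l))"
  have "norm (\<phi> (r' l) (T v)) = vnorm F (T v)"
    unfolding v_def \<phi>(3) using F.vnorm_nonneg[OF Tu] by simp
  moreover have "norm (\<psi> l v) \<le> 3 * \<eta> * vnorm X v"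
    by (rule \<psi>_le) (simp_all add: l_def v_def u)
  moreover have "3 * \<eta> * vnorm X v \<le> 3 * \<eta> * (\<bar>c\<bar> + 1)"
    using c[of "r (r' l)"] \<eta> unfolding v_def by (intro mult_left_mono) linarith+
  moreover have "3 * \<eta> * (\<bar>c\<bar> + 1) = \<epsilon> / 4"
    by (simp add: \<eta>_def field_simps add_nonneg_eq_0_iff)
  moreover have "norm (\<phi> (r' l) (T v)) \<le> norm (\<psi> l v) + norm (\<phi> (r' k) (T v))"
    using norm_triangle_ineq[of "\<psi> l v" "\<phi> (r' k) (T v)"] by (simp add: \<psi>_def)
  moreover have "norm (\<phi> (r' k) (T v)) < \<epsilon> / 2" "vnorm F (T v) \<ge> \<epsilon>"
    using small big[of "r' l"] by (simp_all add: v_def l_def)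
  ultimately show False
    using \<epsilon> by linarith
qed

end

theorem scattered_imp_dunford_pettis:
  fixes K :: "nat \<Rightarrow> 'a topology"
  assumes "n > 0" "\<And>i. i < n \<Longrightarrow> compact_space (K i)" "\<And>i. i < n \<Longrightarrow> topspace (K i) \<noteq> {}"
    and hausdorff: "\<And>i. i < n \<Longrightarrow> Hausdorff_space (K i)" and scattered: "\<And>i. i < n \<Longrightarrow> scattered_space (K i)"
  shows "dunford_pettis TYPE('f)
    (projective_tensor n (\<lambda>i. C_space (K i) :: ('k::{real_normed_field,euclidean_space}, 'a \<Rightarrow> 'k) normed_module))"
proof -
  interpret C: C_tensor n K "TYPE('k)"
    by (intro C_tensor.intro assms(1-3))
  have X: "projective_tensor n (\<lambda>i. C_space (K i) :: ('k, 'a \<Rightarrow> 'k) normed_module) = C.X"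
    by (simp only: C.X_def C.E_def[abs_def])
  show ?thesis
    unfolding X dunford_pettis_def
  proof (intro allI impI)
    fix F :: "('k, (nat \<Rightarrow> (nat \<Rightarrow> ((nat \<Rightarrow> 'a \<Rightarrow> 'k) \<Rightarrow> 'k) \<Rightarrow> 'k) set) + 'f) normed_module" and T
    assume F: "banach_space F" and T: "weakly_compact_operator C.X F T"
    interpret W: weakly_compact_on_tensor n K "TYPE('k)" F T
      by (intro weakly_compact_on_tensor.intro weakly_compact_on_tensor_axioms.intro C.C_tensor_axioms T
          banach_space.axioms(1)[OF F])
    show "completely_continuous C.X F T"
      unfolding completely_continuous_def
    proof (intro conjI allI impI W.T_bounded)
      fix s assume s: "range s \<subseteq> carrier C.X" and "\<exists>x. limitin (weak_topology C.X) s x sequentially"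
      then obtain x where "limitin (weak_topology C.X) s x sequentially"
        by blast
      then have x: "x \<in> carrier C.X"
        and lim: "\<And>\<phi>. bounded_operator C.X scalars \<phi> \<Longrightarrow> (\<lambda>k. \<phi> (s k)) \<longlonglongrightarrow> \<phi> x"
        unfolding limitin_weak_iff[OF C.normed_X s] by blast+
      have s_in: "s k \<in> carrier C.X" for k
        using s by (simp add: image_subset_iff)
      have "(\<lambda>k. vnorm F (T (s k \<ominus>\<^bsub>C.X\<^esub> x))) \<longlonglongrightarrow> 0"
      proof (rule W.weakly_null_imp_null[OF hausdorff scattered])
        show "s k \<ominus>\<^bsub>C.X\<^esub> x \<in> carrier C.X" for k
          by (intro C.X.diff_in s_in x)
        fix \<phi> :: "(nat \<Rightarrow> ((nat \<Rightarrow> 'a \<Rightarrow> 'k) \<Rightarrow> 'k) \<Rightarrow> 'k) set \<Rightarrow> 'k"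
        assume \<phi>: "bounded_operator C.X scalars \<phi>"
        then have "\<phi> (s k \<ominus>\<^bsub>C.X\<^esub> x) = \<phi> (s k) - \<phi> x" for k
          by (intro linear_functional_diff[OF C.normed_X _ s_in x]) (simp add: bounded_operator_def)
        then show "(\<lambda>k. \<phi> (s k \<ominus>\<^bsub>C.X\<^esub> x)) \<longlonglongrightarrow> 0"
          using lim[OF \<phi>] by (simp add: LIM_zero_iff)
      qed
      moreover have "T (s k \<ominus>\<^bsub>C.X\<^esub> x) = (T \<circ> s) k \<ominus>\<^bsub>F\<^esub> T x" for k
        using linear_map_diff[OF C.normed_X W.normed_F W.T_linear s_in x] by simp
      moreover have "range (T \<circ> s) \<subseteq> carrier F"
        using W.T_in[OF s_in] by auto
      ultimately show "\<exists>y. limitin (norm_topology F) (T \<circ> s) y sequentially"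
        using W.T_in[OF x] by (intro exI[of _ "T x"]) (simp add: W.F.limitin_norm_iff)
    qed
  qed
qed

section \<open>The space of square summable sequences\<close>

definition square_summable :: "(nat \<Rightarrow> 'k::real_normed_vector) \<Rightarrow> bool" where
  "square_summable a \<longleftrightarrow> summable (\<lambda>k. (norm (a k))\<^sup>2)"

definition l2norm :: "(nat \<Rightarrow> 'k::real_normed_vector) \<Rightarrow> real" where
  "l2norm a = sqrt (\<Sum>k. (norm (a k))\<^sup>2)"

lemma L2_set_le_l2norm:
  assumes "square_summable a" "finite I"
  shows "L2_set (\<lambda>k. norm (a k)) I \<le> l2norm a"
  unfolding L2_set_def l2norm_def using assms unfolding square_summable_def
  by (intro real_sqrt_le_mono sum_le_suminf) simp_all

lemma l2normI:
  assumes "\<And>N. L2_set (\<lambda>k. norm (a k)) {..<N} \<le> c"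
  shows "square_summable a" "l2norm a \<le> c"
proof -
  have c: "0 \<le> c"
    using assms[of 0] by simp
  have le: "(\<Sum>k<N. (norm (a k))\<^sup>2) \<le> c\<^sup>2" for N
  proof -
    have "(L2_set (\<lambda>k. norm (a k)) {..<N})\<^sup>2 \<le> c\<^sup>2"
      by (intro power_mono assms L2_set_nonneg)
    then show ?thesis
      by (simp add: L2_set_def sum_nonneg)
  qed
  have "(\<Sum>k\<le>N. (norm (a k))\<^sup>2) \<le> c\<^sup>2" for N
    using le[of "Suc N"] unfolding lessThan_Suc_atMost .
  then have s: "summable (\<lambda>k. (norm (a k))\<^sup>2)"
    by (intro bounded_imp_summable[where B = "c\<^sup>2"]) simp_all
  then show "square_summable a"
    by (simp add: square_summable_def)
  have "(\<Sum>k. (norm (a k))\<^sup>2) \<le> c\<^sup>2"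
    by (rule suminf_le_const[OF s le])
  then show "l2norm a \<le> c"
    unfolding l2norm_def using c by (simp add: real_le_lsqrt suminf_nonneg s)
qed

lemma norm_le_l2norm:
  assumes "square_summable a"
  shows "norm (a k) \<le> l2norm a"
  using member_le_L2_set[of "{k}" k "\<lambda>k. norm (a k)"] L2_set_le_l2norm[OF assms, of "{k}"] by simp

lemma l2norm_nonneg: "square_summable a \<Longrightarrow> 0 \<le> l2norm a"
  using norm_le_l2norm[of a 0] norm_ge_zero order_trans by blast

lemma square_summable_add:
  assumes a: "square_summable a" and b: "square_summable b"
  shows "square_summable (\<lambda>k. a k + b k)" "l2norm (\<lambda>k. a k + b k) \<le> l2norm a + l2norm b"
proof -
  have "L2_set (\<lambda>k. norm (a k + b k)) {..<N} \<le> l2norm a + l2norm b" for N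
  proof -
    have "L2_set (\<lambda>k. norm (a k + b k)) {..<N} \<le> L2_set (\<lambda>k. norm (a k) + norm (b k)) {..<N}"
      by (intro L2_set_mono norm_triangle_ineq) simp
    also have "\<dots> \<le> L2_set (\<lambda>k. norm (a k)) {..<N} + L2_set (\<lambda>k. norm (b k)) {..<N}"
      by (rule L2_set_triangle_ineq)
    finally show ?thesis
      using L2_set_le_l2norm[OF a, of "{..<N}"] L2_set_le_l2norm[OF b, of "{..<N}"] by simp
  qed
  from l2normI[OF this] show "square_summable (\<lambda>k. a k + b k)" "l2norm (\<lambda>k. a k + b k) \<le> l2norm a + l2norm b" .
qed

lemma square_summable_mult:
  fixes a :: "nat \<Rightarrow> 'k::real_normed_field"
  assumes a: "square_summable a"
  shows "square_summable (\<lambda>k. c * a k)" "l2norm (\<lambda>k. c * a k) = norm c * l2norm a"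
proof -
  have s: "summable (\<lambda>k. (norm (a k))\<^sup>2)"
    using a by (simp add: square_summable_def)
  then show "square_summable (\<lambda>k. c * a k)"
    unfolding square_summable_def norm_mult power_mult_distrib by (rule summable_mult)
  have "(\<Sum>k. (norm (c * a k))\<^sup>2) = (norm c)\<^sup>2 * (\<Sum>k. (norm (a k))\<^sup>2)"
    unfolding norm_mult power_mult_distrib by (rule suminf_mult[OF s])
  then show "l2norm (\<lambda>k. c * a k) = norm c * l2norm a"
    by (simp add: l2norm_def real_sqrt_mult)
qed

lemma square_summable_finite:
  assumes "\<And>k. k \<ge> N \<Longrightarrow> a k = 0"
  shows "square_summable a" "l2norm a = L2_set (\<lambda>k. norm (a k)) {..<N}"
proof -
  have z: "\<And>k. k \<notin> {..<N} \<Longrightarrow> (norm (a k))\<^sup>2 = 0"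
    using assms by simp
  show "square_summable a"
    unfolding square_summable_def by (rule summable_finite[OF finite_lessThan z])
  show "l2norm a = L2_set (\<lambda>k. norm (a k)) {..<N}"
    unfolding l2norm_def L2_set_def by (subst suminf_finite[OF finite_lessThan z]) simp_all
qed

text \<open>The sequences are transported along an injection \<iota>, since a test space for the
  Dunford-Pettis property has to live in a prescribed type.\<close>

definition l2_space :: "((nat \<Rightarrow> 'k::real_normed_field) \<Rightarrow> 'z) \<Rightarrow> ('k, 'z) normed_module" where
  "l2_space \<iota> =
     \<lparr>carrier = \<iota> ` Collect square_summable, monoid.mult = undefined, one = undefined,
      zero = \<iota> (\<lambda>_. 0), add = (\<lambda>x y. \<iota> (\<lambda>k. inv_into UNIV \<iota> x k + inv_into UNIV \<iota> y k)),
      smult = (\<lambda>c x. \<iota> (\<lambda>k. c * inv_into UNIV \<iota> x k)), vnorm = (\<lambda>x. l2norm (inv_into UNIV \<iota> x))\<rparr>"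

locale l2 =
  fixes \<iota> :: "(nat \<Rightarrow> 'k::{real_normed_field,euclidean_space}) \<Rightarrow> 'z"
  assumes inj: "inj \<iota>"
begin

lemma inv_iota [simp]: "inv_into UNIV \<iota> (\<iota> a) = a"
  by (rule inv_f_f[OF inj])

lemma l2_simps:
  "carrier (l2_space \<iota>) = \<iota> ` Collect square_summable"
  "\<zero>\<^bsub>l2_space \<iota>\<^esub> = \<iota> (\<lambda>_. 0)"
  "\<iota> a \<oplus>\<^bsub>l2_space \<iota>\<^esub> \<iota> b = \<iota> (\<lambda>k. a k + b k)"
  "c \<odot>\<^bsub>l2_space \<iota>\<^esub> \<iota> a = \<iota> (\<lambda>k. c * a k)"
  "vnorm (l2_space \<iota>) (\<iota> a) = l2norm a"
  by (simp_all add: l2_space_def)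

lemma iota_in [simp]: "square_summable a \<Longrightarrow> \<iota> a \<in> carrier (l2_space \<iota>)"
  by (simp add: l2_simps)

lemma l2_cases:
  assumes "x \<in> carrier (l2_space \<iota>)"
  obtains a where "square_summable a" "x = \<iota> a"
  using assms by (auto simp: l2_simps)

lemma normed_space_l2: "normed_space (l2_space \<iota>)"
proof (rule normed_spaceI)
  let ?L = "l2_space \<iota>"
  show "\<zero>\<^bsub>?L\<^esub> \<in> carrier ?L"
    by (simp add: l2_simps(2) square_summable_def)
  fix x assume "x \<in> carrier ?L"
  then obtain a where a: "square_summable a" and x: "x = \<iota> a"
    by (rule l2_cases)
  show "\<zero>\<^bsub>?L\<^esub> \<oplus>\<^bsub>?L\<^esub> x = x" "1 \<odot>\<^bsub>?L\<^esub> x = x" "0 \<odot>\<^bsub>?L\<^esub> x = \<zero>\<^bsub>?L\<^esub>"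
    by (simp_all add: x l2_simps)
  show "x = \<zero>\<^bsub>?L\<^esub>" if "vnorm ?L x = 0"
  proof -
    have "a k = 0" for k
      using norm_le_l2norm[OF a, of k] that by (simp add: x l2_simps)
    then have "a = (\<lambda>_. 0)"
      by (rule ext)
    then show ?thesis
      by (simp add: x l2_simps)
  qed
  fix c
  show "c \<odot>\<^bsub>?L\<^esub> x \<in> carrier ?L" "vnorm ?L (c \<odot>\<^bsub>?L\<^esub> x) = norm c * vnorm ?L x"
    unfolding x l2_simps(4,5) by (simp_all add: square_summable_mult a)
  fix d
  show "(c + d) \<odot>\<^bsub>?L\<^esub> x = c \<odot>\<^bsub>?L\<^esub> x \<oplus>\<^bsub>?L\<^esub> d \<odot>\<^bsub>?L\<^esub> x" "(c * d) \<odot>\<^bsub>?L\<^esub> x = c \<odot>\<^bsub>?L\<^esub> (d \<odot>\<^bsub>?L\<^esub> x)"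
    unfolding x l2_simps(3,4) by (simp_all add: algebra_simps)
  fix y assume "y \<in> carrier ?L"
  then obtain b where b: "square_summable b" and y: "y = \<iota> b"
    by (rule l2_cases)
  show "x \<oplus>\<^bsub>?L\<^esub> y \<in> carrier ?L" "vnorm ?L (x \<oplus>\<^bsub>?L\<^esub> y) \<le> vnorm ?L x + vnorm ?L y"
    unfolding x y l2_simps(3,5) by (simp_all add: square_summable_add a b)
  show "x \<oplus>\<^bsub>?L\<^esub> y = y \<oplus>\<^bsub>?L\<^esub> x" "c \<odot>\<^bsub>?L\<^esub> (x \<oplus>\<^bsub>?L\<^esub> y) = c \<odot>\<^bsub>?L\<^esub> x \<oplus>\<^bsub>?L\<^esub> c \<odot>\<^bsub>?L\<^esub> y"
    unfolding x y l2_simps(3,4) by (simp_all add: algebra_simps)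
  fix z assume "z \<in> carrier ?L"
  then obtain d where z: "z = \<iota> d"
    by (rule l2_cases)
  show "(x \<oplus>\<^bsub>?L\<^esub> y) \<oplus>\<^bsub>?L\<^esub> z = x \<oplus>\<^bsub>?L\<^esub> (y \<oplus>\<^bsub>?L\<^esub> z)"
    unfolding x y z l2_simps(3) by (simp add: add.assoc)
qed

sublocale L: normed_space "l2_space \<iota>"
  by (rule normed_space_l2)

lemma l2_diff:
  assumes "square_summable a" "square_summable b"
  shows "\<iota> a \<ominus>\<^bsub>l2_space \<iota>\<^esub> \<iota> b = \<iota> (\<lambda>k. a k - b k)" "square_summable (\<lambda>k. a k - b k)"
proof -
  show "\<iota> a \<ominus>\<^bsub>l2_space \<iota>\<^esub> \<iota> b = \<iota> (\<lambda>k. a k - b k)"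
    unfolding L.diff_eq_smult[OF iota_in[OF assms(1)] iota_in[OF assms(2)]] l2_simps by simp
  show "square_summable (\<lambda>k. a k - b k)"
    using square_summable_add(1)[OF assms(1) square_summable_mult(1)[OF assms(2), of "-1"]] by simp
qed

lemma banach_space_l2: "banach_space (l2_space \<iota>)"
proof (intro banach_space.intro banach_space_axioms.intro normed_space_l2)
  show "L.metric.mcomplete"
    unfolding L.metric.mcomplete_def
  proof (intro allI impI)
    fix s assume cauchy: "L.metric.MCauchy s"
    then have s_range: "range s \<subseteq> carrier (l2_space \<iota>)"
      unfolding L.MCauchy_iff by blast
    define a where "a j = inv_into UNIV \<iota> (s j)" for j
    have a: "square_summable (a j)" and s: "s j = \<iota> (a j)" for j
    proof -
      have "s j \<in> carrier (l2_space \<iota>)"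
        using s_range by auto
      then obtain b where "square_summable b" "s j = \<iota> b"
        by (rule l2_cases)
      then show "square_summable (a j)" "s j = \<iota> (a j)"
        by (simp_all add: a_def)
    qed
    have cauchy': "\<forall>\<epsilon>>0. \<exists>N. \<forall>i\<ge>N. \<forall>j\<ge>N. vnorm (l2_space \<iota>) (s i \<ominus>\<^bsub>l2_space \<iota>\<^esub> s j) < \<epsilon>"
      using cauchy unfolding L.MCauchy_iff by (rule conjunct2)
    have diff_norm: "vnorm (l2_space \<iota>) (s i \<ominus>\<^bsub>l2_space \<iota>\<^esub> s j) = l2norm (\<lambda>k. a i k - a j k)" for i j
      unfolding s l2_diff(1)[OF a a] l2_simps by (rule refl)
    have close: "\<exists>N. \<forall>i\<ge>N. \<forall>j\<ge>N. l2norm (\<lambda>k. a i k - a j k) < \<epsilon>" if "\<epsilon> > 0" for \<epsilon>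
      using cauchy'[rule_format, OF that] unfolding diff_norm .
    have "Cauchy (\<lambda>j. a j k)" for k
    proof (rule metric_CauchyI)
      fix \<epsilon> :: real assume "\<epsilon> > 0"
      then obtain N where N: "\<And>i j. i \<ge> N \<Longrightarrow> j \<ge> N \<Longrightarrow> l2norm (\<lambda>k. a i k - a j k) < \<epsilon>"
        using close by blast
      have "dist (a i k) (a j k) < \<epsilon>" if "i \<ge> N" "j \<ge> N" for i j
        using norm_le_l2norm[OF l2_diff(2)[OF a[of i] a[of j]], of k] N[OF that] by (simp add: dist_norm)
      then show "\<exists>N. \<forall>i\<ge>N. \<forall>j\<ge>N. dist (a i k) (a j k) < \<epsilon>"
        by blast
    qed
    then have "\<forall>k. \<exists>l. (\<lambda>j. a j k) \<longlonglongrightarrow> l"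
      using Cauchy_convergent_iff convergent_def by blast
    from choice[OF this] obtain b where b: "\<And>k. (\<lambda>j. a j k) \<longlonglongrightarrow> b k"
      by blast
    \<comment> \<open>The limit in j is taken in finite sections, where only finitely many
      coordinates matter; \<open>l2normI\<close> then removes the section.\<close>
    have near: "square_summable (\<lambda>k. a i k - b k) \<and> l2norm (\<lambda>k. a i k - b k) \<le> \<epsilon>"
      if i: "\<And>j. j \<ge> N \<Longrightarrow> l2norm (\<lambda>k. a i k - a j k) < \<epsilon>" for i N \<epsilon>
    proof -
      have "L2_set (\<lambda>k. norm (a i k - b k)) {..<M} \<le> \<epsilon>" for M
      proof (rule LIMSEQ_le_const2)
        show "(\<lambda>j. L2_set (\<lambda>k. norm (a i k - a j k)) {..<M}) \<longlonglongrightarrow> L2_set (\<lambda>k. norm (a i k - b k)) {..<M}"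
          unfolding L2_set_def by (intro tendsto_intros b)
        show "\<exists>N. \<forall>j\<ge>N. L2_set (\<lambda>k. norm (a i k - a j k)) {..<M} \<le> \<epsilon>"
        proof (intro exI[of _ N] allI impI)
          fix j assume "N \<le> j"
          then show "L2_set (\<lambda>k. norm (a i k - a j k)) {..<M} \<le> \<epsilon>"
            using L2_set_le_l2norm[OF l2_diff(2)[OF a[of i] a[of j]], of "{..<M}"] i[of j] by simp
        qed
      qed
      from l2normI[OF this] show ?thesis
        by blast
    qed
    obtain N1 where "\<And>i j. i \<ge> N1 \<Longrightarrow> j \<ge> N1 \<Longrightarrow> l2norm (\<lambda>k. a i k - a j k) < 1"
      using close[of 1] by auto
    then have "square_summable (\<lambda>k. a N1 k - b k)"
      using near[of N1 N1 1] by blast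
    from l2_diff(2)[OF a[of N1] this] have bs: "square_summable b"
      by simp
    have "(\<lambda>i. vnorm (l2_space \<iota>) (s i \<ominus>\<^bsub>l2_space \<iota>\<^esub> \<iota> b)) \<longlonglongrightarrow> 0"
    proof (rule LIMSEQ_I)
      fix \<epsilon> :: real assume "\<epsilon> > 0"
      then have "\<epsilon> / 2 > 0"
        by simp
      then obtain N where N: "\<And>i j. i \<ge> N \<Longrightarrow> j \<ge> N \<Longrightarrow> l2norm (\<lambda>k. a i k - a j k) < \<epsilon> / 2"
        using close by blast
      have "norm (vnorm (l2_space \<iota>) (s i \<ominus>\<^bsub>l2_space \<iota>\<^esub> \<iota> b) - 0) < \<epsilon>" if "i \<ge> N" for i
        using near[of N i "\<epsilon> / 2", OF N[OF that]] l2norm_nonneg[OF l2_diff(2)[OF a[of i] bs]] \<open>\<epsilon> > 0\<close>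
        unfolding s l2_diff(1)[OF a bs] l2_simps by simp
      then show "\<exists>N. \<forall>i\<ge>N. norm (vnorm (l2_space \<iota>) (s i \<ominus>\<^bsub>l2_space \<iota>\<^esub> \<iota> b) - 0) < \<epsilon>"
        by blast
    qed
    then have "limitin (norm_topology (l2_space \<iota>)) s (\<iota> b) sequentially"
      unfolding L.limitin_norm_iff[OF s_range] using bs by simp
    then show "\<exists>x. limitin L.metric.mtopology s x sequentially"
      unfolding norm_topology_def by blast
  qed
qed

lemma functional_finite:
  assumes \<phi>: "linear_map (l2_space \<iota>) scalars \<phi>"
  shows "\<phi> (\<iota> (\<lambda>k. if k < N then a k else 0)) = (\<Sum>k<N. a k * \<phi> (\<iota> (\<lambda>j. if j = k then 1 else 0)))"
proof (induction N)
  case 0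
  then show ?case
    using linear_map_zero[OF normed_space_l2 normed_space_scalars \<phi>] by (simp add: l2_simps)
next
  case (Suc N)
  have s1: "square_summable (\<lambda>k. if k < N then a k else 0)"
    by (rule square_summable_finite(1)[of N]) simp
  have s2: "square_summable (\<lambda>k. if k = N then 1 else 0 :: 'k)"
    by (rule square_summable_finite(1)[of "Suc N"]) simp
  have "\<iota> (\<lambda>k. if k < Suc N then a k else 0) =
      \<iota> (\<lambda>k. if k < N then a k else 0) \<oplus>\<^bsub>l2_space \<iota>\<^esub> (a N \<odot>\<^bsub>l2_space \<iota>\<^esub> \<iota> (\<lambda>k. if k = N then 1 else 0))"
    unfolding l2_simps by (rule arg_cong[of _ _ \<iota>]) (auto simp: less_Suc_eq)
  then show ?case
    using linear_mapD(2)[OF \<phi> iota_in[OF s1] L.smult_in[OF iota_in[OF s2]], of "a N"]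
      linear_mapD(3)[OF \<phi> iota_in[OF s2], of "a N"] Suc.IH by simp
qed

text \<open>On a ball of l2 the functional is a uniform limit of finite sums in the coordinates: its
  coefficients w are square summable, and Cauchy-Schwarz bounds the tail by R times the tail of w.
  Continuity for the product topology is what makes balls weakly compact.\<close>

lemma functional_continuous_on_ball:
  assumes \<phi>: "bounded_operator (l2_space \<iota>) scalars \<phi>"
  shows "continuous_on {a. \<forall>N. L2_set (\<lambda>k. norm (a k)) {..<N} \<le> R} (\<lambda>a. \<phi> (\<iota> a))"
proof -
  define Q where "Q = {a :: nat \<Rightarrow> 'k. \<forall>N. L2_set (\<lambda>k. norm (a k)) {..<N} \<le> R}"
  obtain C where C: "C > 0" "linear_map (l2_space \<iota>) scalars \<phi>"
      "\<And>x. x \<in> carrier (l2_space \<iota>) \<Longrightarrow> norm (\<phi> x) \<le> C * vnorm (l2_space \<iota>) x"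
    using bounded_operatorE[OF normed_space_l2 normed_space_scalars \<phi>] by auto
  define w where "w k = \<phi> (\<iota> (\<lambda>j. if j = k then 1 else 0))" for k
  note fin = functional_finite[OF C(2), folded w_def]
  have w: "square_summable w"
  proof (rule l2normI(1))
    fix N
    \<comment> \<open>At the truncated conjugate of w the functional equals the squared norm of v,
      so that norm is at most C.\<close>
    define v where "v k = (if k < N then conj_scalar (w k) else 0)" for k
    have v: "square_summable v" "l2norm v = L2_set (\<lambda>k. norm (v k)) {..<N}"
      by (rule square_summable_finite(1)[of N], simp add: v_def, rule square_summable_finite(2)[of N], simp add: v_def)
    have "L2_set (\<lambda>k. norm (v k)) {..<N} = L2_set (\<lambda>k. norm (w k)) {..<N}"
      by (rule L2_set_cong) (simp_all add: v_def)
    then have l2v: "l2norm v = L2_set (\<lambda>k. norm (w k)) {..<N}"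
      using v(2) by simp
    have "\<phi> (\<iota> v) = (\<Sum>k<N. conj_scalar (w k) * w k)"
      unfolding v_def[abs_def] by (rule fin)
    also have "\<dots> = of_real (\<Sum>k<N. (norm (w k))\<^sup>2)"
      by (simp add: mult_conj_scalar mult.commute[of "conj_scalar _"])
    also have "(\<Sum>k<N. (norm (w k))\<^sup>2) = (l2norm v)\<^sup>2"
      unfolding l2v L2_set_def by (simp add: sum_nonneg)
    finally have "norm (\<phi> (\<iota> v)) = (l2norm v)\<^sup>2"
      by (simp only: norm_of_real abs_power2)
    then have "(l2norm v)\<^sup>2 \<le> C * l2norm v"
      using C(3)[OF iota_in[OF v(1)]] unfolding l2_simps by simp
    then show "L2_set (\<lambda>k. norm (w k)) {..<N} \<le> C"
      unfolding l2v[symmetric] using l2norm_nonneg[OF v(1)] C(1)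
      by (cases "l2norm v = 0") (auto simp: power2_eq_square)
  qed
  define S where "S N a = (\<Sum>k<N. a k * w k)" for N and a :: "nat \<Rightarrow> 'k"
  have Q_summable: "square_summable a" if "a \<in> Q" for a
    using that unfolding Q_def by (intro l2normI(1)[of a R]) simp
  have S_lim: "(\<lambda>N. S N a) \<longlonglongrightarrow> \<phi> (\<iota> a)" if a: "square_summable a" for a
  proof -
    have sa: "summable (\<lambda>k. (norm (a k))\<^sup>2)"
      using a by (simp add: square_summable_def)
    have head: "square_summable (\<lambda>k. if k < N then a k else 0)" for N
      by (rule square_summable_finite(1)[of N]) simp
    have "norm (\<phi> (\<iota> a) - S N a) \<le> C * sqrt ((\<Sum>k. (norm (a k))\<^sup>2) - (\<Sum>k<N. (norm (a k))\<^sup>2))" for N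
    proof -
      define b where "b k = a k - (if k < N then a k else 0)" for k
      have b: "square_summable b"
        unfolding b_def[abs_def] by (rule l2_diff(2)[OF a head])
      have "\<phi> (\<iota> a) - S N a = \<phi> (\<iota> a \<ominus>\<^bsub>l2_space \<iota>\<^esub> \<iota> (\<lambda>k. if k < N then a k else 0))"
        unfolding S_def fin[symmetric]
        by (rule linear_functional_diff[OF normed_space_l2 C(2) iota_in[OF a] iota_in[OF head], symmetric])
      also have "\<dots> = \<phi> (\<iota> b)"
        unfolding l2_diff(1)[OF a head] b_def[abs_def] by (rule refl)
      finally have "norm (\<phi> (\<iota> a) - S N a) \<le> C * l2norm b"
        using C(3)[OF iota_in[OF b]] unfolding l2_simps by simp
      moreover have "(\<Sum>k. (norm (b k))\<^sup>2) = (\<Sum>k. (norm (a k))\<^sup>2) - (\<Sum>k<N. (norm (a k))\<^sup>2)"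
      proof -
        have "(\<Sum>k. (norm (b k))\<^sup>2) = (\<Sum>k. (norm (b (k + N)))\<^sup>2) + (\<Sum>k<N. (norm (b k))\<^sup>2)"
          using b unfolding square_summable_def by (rule suminf_split_initial_segment)
        moreover have "(\<Sum>k<N. (norm (b k))\<^sup>2) = 0"
          by (rule sum.neutral) (simp add: b_def)
        moreover have "(\<lambda>k. (norm (b (k + N)))\<^sup>2) = (\<lambda>k. (norm (a (k + N)))\<^sup>2)"
          by (rule ext) (simp add: b_def)
        moreover have "(\<Sum>k. (norm (a k))\<^sup>2) = (\<Sum>k. (norm (a (k + N)))\<^sup>2) + (\<Sum>k<N. (norm (a k))\<^sup>2)"
          using sa by (rule suminf_split_initial_segment)
        ultimately show ?thesis
          by (simp only: add_0_right add_diff_cancel_right')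
      qed
      ultimately show ?thesis
        by (simp only: l2norm_def)
    qed
    note bound = this
    have "(\<lambda>N. C * sqrt ((\<Sum>k. (norm (a k))\<^sup>2) - (\<Sum>k<N. (norm (a k))\<^sup>2)))
        \<longlonglongrightarrow> C * sqrt ((\<Sum>k. (norm (a k))\<^sup>2) - (\<Sum>k. (norm (a k))\<^sup>2))"
      by (rule tendsto_mult[OF tendsto_const tendsto_real_sqrt[OF tendsto_diff[OF tendsto_const summable_LIMSEQ[OF sa]]]])
    then have "(\<lambda>N. C * sqrt ((\<Sum>k. (norm (a k))\<^sup>2) - (\<Sum>k<N. (norm (a k))\<^sup>2))) \<longlonglongrightarrow> 0"
      by (simp only: diff_self real_sqrt_zero mult_zero_right)
    with always_eventually[OF allI[OF bound]] have "(\<lambda>N. \<phi> (\<iota> a) - S N a) \<longlonglongrightarrow> 0"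
      by (rule Lim_null_comparison)
    from tendsto_diff[OF tendsto_const[of "\<phi> (\<iota> a)"] this] show ?thesis
      by simp
  qed
  define \<tau> where "\<tau> N = sqrt ((\<Sum>k. (norm (w k))\<^sup>2) - (\<Sum>k<N. (norm (w k))\<^sup>2))" for N
  have sw: "summable (\<lambda>k. (norm (w k))\<^sup>2)"
    using w by (simp add: square_summable_def)
  have \<tau>_lim: "\<tau> \<longlonglongrightarrow> 0"
  proof -
    have "\<tau> \<longlonglongrightarrow> sqrt ((\<Sum>k. (norm (w k))\<^sup>2) - (\<Sum>k. (norm (w k))\<^sup>2))"
      unfolding \<tau>_def[abs_def] by (rule tendsto_real_sqrt[OF tendsto_diff[OF tendsto_const summable_LIMSEQ[OF sw]]])
    then show ?thesis
      by (simp only: diff_self real_sqrt_zero)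
  qed
  have tail: "norm (\<phi> (\<iota> a) - S N a) \<le> R * \<tau> N" if a: "a \<in> Q" for a N
  proof (rule LIMSEQ_le_const2)
    show "(\<lambda>M. norm (S M a - S N a)) \<longlonglongrightarrow> norm (\<phi> (\<iota> a) - S N a)"
      by (intro tendsto_intros S_lim Q_summable a)
    show "\<exists>M0. \<forall>M\<ge>M0. norm (S M a - S N a) \<le> R * \<tau> N"
    proof (intro exI[of _ N] allI impI)
      fix M assume M: "N \<le> M"
      have split: "(\<Sum>k<M. g k) - (\<Sum>k<N. g k) = (\<Sum>k\<in>{N..<M}. g k)" for g :: "nat \<Rightarrow> 'c::ab_group_add"
        using M sum.atLeastLessThan_concat[of 0 N M g] by (simp add: atLeast0LessThan algebra_simps)
      have "norm (S M a - S N a) \<le> (\<Sum>k\<in>{N..<M}. norm (a k * w k))"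
        unfolding S_def split by (rule norm_sum)
      also have "\<dots> = (\<Sum>k\<in>{N..<M}. \<bar>norm (a k)\<bar> * \<bar>norm (w k)\<bar>)"
        by (simp add: norm_mult)
      also have "\<dots> \<le> L2_set (\<lambda>k. norm (a k)) {N..<M} * L2_set (\<lambda>k. norm (w k)) {N..<M}"
        by (rule L2_set_mult_ineq)
      also have "\<dots> \<le> R * \<tau> N"
      proof (intro mult_mono L2_set_nonneg)
        have "L2_set (\<lambda>k. norm (a k)) {N..<M} \<le> L2_set (\<lambda>k. norm (a k)) {..<M}"
          unfolding L2_set_def by (intro real_sqrt_le_mono sum_mono2) auto
        also have "\<dots> \<le> R"
          using a by (simp add: Q_def)
        finally show "L2_set (\<lambda>k. norm (a k)) {N..<M} \<le> R" .
        then show "0 \<le> R"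
          using L2_set_nonneg[of "\<lambda>k. norm (a k)" "{N..<M}"] by linarith
        have "(\<Sum>k\<in>{N..<M}. (norm (w k))\<^sup>2) \<le> (\<Sum>k. (norm (w k))\<^sup>2) - (\<Sum>k<N. (norm (w k))\<^sup>2)"
          using sum_le_suminf[OF sw, of "{..<M}"] split[of "\<lambda>k. (norm (w k))\<^sup>2"] by simp
        then show "L2_set (\<lambda>k. norm (w k)) {N..<M} \<le> \<tau> N"
          unfolding L2_set_def \<tau>_def by (rule real_sqrt_le_mono)
      qed
      finally show "norm (S M a - S N a) \<le> R * \<tau> N" .
    qed
  qed
  have "uniform_limit Q S (\<lambda>a. \<phi> (\<iota> a)) sequentially"
  proof (rule uniform_limitI)
    fix e :: real assume "e > 0"
    have "(\<lambda>N. R * \<tau> N) \<longlonglongrightarrow> R * 0"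
      by (intro tendsto_intros \<tau>_lim)
    then have "\<forall>\<^sub>F N in sequentially. R * \<tau> N < e"
      using \<open>e > 0\<close> by (intro order_tendstoD) auto
    then show "\<forall>\<^sub>F N in sequentially. \<forall>a\<in>Q. dist (S N a) (\<phi> (\<iota> a)) < e"
    proof (rule eventually_mono)
      fix N assume N: "R * \<tau> N < e"
      show "\<forall>a\<in>Q. dist (S N a) (\<phi> (\<iota> a)) < e"
      proof
        fix a assume "a \<in> Q"
        then show "dist (S N a) (\<phi> (\<iota> a)) < e"
          using tail[of a N] N by (simp add: dist_norm norm_minus_commute)
      qed
    qed
  qed
  moreover have "continuous_on Q (S N)" for N
    unfolding S_def[abs_def]
    by (intro continuous_on_sum continuous_on_mult continuous_on_const
        continuous_on_subset[OF continuous_on_product_coordinates subset_UNIV])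
  ultimately show ?thesis
    unfolding Q_def[symmetric] by (intro uniform_limit_theorem[of Q S sequentially]) simp_all
qed

text \<open>Tychonoff's theorem applies to a product of scalar balls, and conditions on finite
  sections are closed in the product topology.\<close>

lemma compact_l2_ball: "compact {a :: nat \<Rightarrow> 'k. \<forall>N. L2_set (\<lambda>k. norm (a k)) {..<N} \<le> R}" (is "compact ?Q")
proof -
  have "compactin (product_topology (\<lambda>_. euclidean) UNIV) (\<Pi>\<^sub>E i\<in>(UNIV::nat set). cball (0::'k) R)"
    unfolding compactin_PiE by simp
  then have comp: "compact (\<Pi>\<^sub>E i\<in>(UNIV::nat set). cball (0::'k) R)"
    unfolding euclidean_product_topology by simp
  have "closed {a :: nat \<Rightarrow> 'k. L2_set (\<lambda>k. norm (a k)) {..<N} \<le> R}" for N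
    unfolding L2_set_def
    by (intro closed_Collect_le continuous_on_real_sqrt continuous_on_sum continuous_on_power continuous_on_norm
        continuous_on_product_coordinates continuous_on_const)
  then have "closed (\<Inter>N. {a :: nat \<Rightarrow> 'k. L2_set (\<lambda>k. norm (a k)) {..<N} \<le> R})"
    by (intro closed_INT) simp
  moreover have "(\<Inter>N. {a :: nat \<Rightarrow> 'k. L2_set (\<lambda>k. norm (a k)) {..<N} \<le> R}) = ?Q"
    by auto
  ultimately have "closed ?Q"
    by simp
  moreover have "?Q \<subseteq> (\<Pi>\<^sub>E i\<in>(UNIV::nat set). cball (0::'k) R)"
  proof
    fix a :: "nat \<Rightarrow> 'k"
    assume a: "a \<in> ?Q"
    have "norm (a k) \<le> R" for k
    proof (rule order_trans)
      show "norm (a k) \<le> L2_set (\<lambda>k. norm (a k)) {..<Suc k}"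
        by (rule member_le_L2_set) simp_all
      show "L2_set (\<lambda>k. norm (a k)) {..<Suc k} \<le> R"
        using a by blast
    qed
    then show "a \<in> (\<Pi>\<^sub>E i\<in>(UNIV::nat set). cball (0::'k) R)"
      by (simp add: PiE_UNIV_domain)
  qed
  ultimately have "compact ((\<Pi>\<^sub>E i\<in>(UNIV::nat set). cball (0::'k) R) \<inter> ?Q)"
    by (intro compact_Int_closed[OF comp])
  then show ?thesis
    using \<open>?Q \<subseteq> _\<close> by (simp only: Int_absorb1)
qed

text \<open>\<iota> maps a compact ball continuously into the weak topology. That topology is
  Hausdorff, so the image is closed and contains the weak closure of the image of B.\<close>

lemma weakly_compact_into_l2:
  assumes E: "normed_space E" and T: "bounded_operator E (l2_space \<iota>) T"
  shows "weakly_compact_operator E (l2_space \<iota>) T"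
  unfolding weakly_compact_operator_def
proof (intro conjI allI impI T)
  let ?W = "weak_topology (l2_space \<iota>)"
  interpret E: normed_space E
    by (rule E)
  fix B assume "E.metric.mbounded B"
  then obtain c where c: "B \<subseteq> carrier E" "\<And>x. x \<in> B \<Longrightarrow> vnorm E x \<le> c"
    unfolding E.mbounded_iff by blast
  obtain C where C: "C > 0" "linear_map E (l2_space \<iota>) T"
      "\<And>x. x \<in> carrier E \<Longrightarrow> vnorm (l2_space \<iota>) (T x) \<le> C * vnorm E x"
    using bounded_operatorE[OF E normed_space_l2 T] by metis
  define R where "R = C * c"
  define Q where "Q = {a :: nat \<Rightarrow> 'k. \<forall>N. L2_set (\<lambda>k. norm (a k)) {..<N} \<le> R}"
  have sub: "T ` B \<subseteq> \<iota> ` Q"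
  proof
    fix y assume "y \<in> T ` B"
    then obtain x where x: "x \<in> B" "y = T x"
      by blast
    then have "T x \<in> carrier (l2_space \<iota>)"
      using c(1) linear_mapD(1)[OF C(2)] by blast
    then obtain a where a: "square_summable a" "T x = \<iota> a"
      by (rule l2_cases)
    have "l2norm a \<le> C * vnorm E x"
      using C(3)[of x] c(1) x(1) unfolding a(2) l2_simps by blast
    also have "\<dots> \<le> R"
      unfolding R_def using c(2)[OF x(1)] C(1) by (intro mult_left_mono) simp_all
    finally have "a \<in> Q"
      unfolding Q_def using L2_set_le_l2norm[OF a(1)] order_trans by blast
    then show "y \<in> \<iota> ` Q"
      using x(2) a(2) by simp
  qed
  have Q_sub: "\<iota> a \<in> carrier (l2_space \<iota>)" if "a \<in> Q" for a
    using that unfolding Q_def by (intro iota_in l2normI(1)[of a R]) simp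
  have "continuous_map (top_of_set Q) ?W \<iota>"
    unfolding weak_topology_def
  proof (rule continuous_on_generated_topo)
    show "\<iota> ` topspace (top_of_set Q) \<subseteq> \<Union>{{x \<in> carrier (l2_space \<iota>). \<phi> x \<in> U} |\<phi> U. bounded_operator (l2_space \<iota>) scalars \<phi> \<and> open U}"
      using topspace_weak_topology[OF normed_space_l2] Q_sub
      unfolding weak_topology_def topology_generated_by_topspace by auto
    fix U' assume "U' \<in> {{x \<in> carrier (l2_space \<iota>). \<phi> x \<in> U} |\<phi> U. bounded_operator (l2_space \<iota>) scalars \<phi> \<and> open U}"
    then obtain \<phi> U where U': "U' = {x \<in> carrier (l2_space \<iota>). \<phi> x \<in> U}"
        and \<phi>: "bounded_operator (l2_space \<iota>) scalars \<phi>" and U: "open U"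
      by blast
    have "\<iota> -` U' \<inter> topspace (top_of_set Q) = Q \<inter> (\<lambda>a. \<phi> (\<iota> a)) -` U"
      using Q_sub unfolding U' by auto
    moreover have "openin (top_of_set Q) (Q \<inter> (\<lambda>a. \<phi> (\<iota> a)) -` U)"
      using functional_continuous_on_ball[OF \<phi>, of R] U unfolding Q_def[symmetric]
      by (rule continuous_openin_preimage_gen)
    ultimately show "openin (top_of_set Q) (\<iota> -` U' \<inter> topspace (top_of_set Q))"
      by simp
  qed
  moreover have "compactin (top_of_set Q) Q"
    using compact_l2_ball[of R] unfolding Q_def[symmetric] by (simp add: compactin_subtopology)
  ultimately have comp: "compactin ?W (\<iota> ` Q)"
    by (rule image_compactin[rotated])
  have "Hausdorff_space ?W"
    unfolding Hausdorff_space_def topspace_weak_topology[OF normed_space_l2]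
  proof (intro allI impI, elim conjE)
    fix x y assume x: "x \<in> carrier (l2_space \<iota>)" and y: "y \<in> carrier (l2_space \<iota>)" and "x \<noteq> y"
    then have d: "vnorm (l2_space \<iota>) (x \<ominus>\<^bsub>l2_space \<iota>\<^esub> y) \<noteq> 0"
      using L.vnorm_eq_0[OF L.diff_in[OF x y]] L.diff_eq_zero_iff[OF x y] by simp
    obtain \<phi> where \<phi>: "linear_map (l2_space \<iota>) scalars \<phi>" "\<And>z. z \<in> carrier (l2_space \<iota>) \<Longrightarrow> norm (\<phi> z) \<le> vnorm (l2_space \<iota>) z"
        "\<phi> (x \<ominus>\<^bsub>l2_space \<iota>\<^esub> y) = of_real (vnorm (l2_space \<iota>) (x \<ominus>\<^bsub>l2_space \<iota>\<^esub> y))"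
      using norming_functional[OF normed_space_l2 L.diff_in[OF x y]] by blast
    have "norm (\<phi> z) \<le> 1 * vnorm (l2_space \<iota>) z" if "z \<in> carrier (l2_space \<iota>)" for z
      using \<phi>(2)[OF that] by simp
    then have b: "bounded_operator (l2_space \<iota>) scalars \<phi>"
      by (rule bounded_functionalI[OF normed_space_l2 \<phi>(1)])
    have "\<phi> x \<noteq> \<phi> y"
      using linear_functional_diff[OF normed_space_l2 \<phi>(1) x y] \<phi>(3) d by auto
    from hausdorff[OF this] obtain U V where UV: "open U" "open V" "\<phi> x \<in> U" "\<phi> y \<in> V" "U \<inter> V = {}"
      by blast
    show "\<exists>U V. openin ?W U \<and> openin ?W V \<and> x \<in> U \<and> y \<in> V \<and> disjnt U V"
    proof (intro exI conjI)
      show "openin ?W {z \<in> carrier (l2_space \<iota>). \<phi> z \<in> U}" "openin ?W {z \<in> carrier (l2_space \<iota>). \<phi> z \<in> V}"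
        by (intro openin_weak_topology b UV)+
      show "disjnt {z \<in> carrier (l2_space \<iota>). \<phi> z \<in> U} {z \<in> carrier (l2_space \<iota>). \<phi> z \<in> V}"
        using UV(5) by (auto simp: disjnt_def)
    qed (use x y UV in auto)
  qed
  then have "closedin ?W (\<iota> ` Q)"
    using comp by (rule compactin_imp_closedin)
  then have "?W closure_of (T ` B) \<subseteq> \<iota> ` Q"
    using sub by (intro closure_of_minimal)
  then show "compactin ?W (?W closure_of (T ` B))"
    using comp by (intro closed_compactin[OF comp]) simp_all
qed

end

section \<open>Orthonormal sequences on compact spaces that are not scattered\<close>

text \<open>Positive normalised functionals, in other words probability measures on K; the last
  clause encodes positivity and the value 1 at the constant 1.\<close>

definition mean :: "'a topology \<Rightarrow> (('a \<Rightarrow> real) \<Rightarrow> real) \<Rightarrow> bool" where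
  "mean K m \<longleftrightarrow>
     (\<forall>f g. continuous_fun K f \<longrightarrow> continuous_fun K g \<longrightarrow> m (\<lambda>t. f t + g t) = m f + m g) \<and>
     (\<forall>c f. continuous_fun K f \<longrightarrow> m (\<lambda>t. c * f t) = c * m f) \<and>
     (\<forall>c f. continuous_fun K f \<longrightarrow> (\<forall>t\<in>topspace K. f t \<le> c) \<longrightarrow> m f \<le> c)"

lemma meanD:
  assumes "mean K m"
  shows "continuous_fun K f \<Longrightarrow> continuous_fun K g \<Longrightarrow> m (\<lambda>t. f t + g t) = m f + m g"
    and "continuous_fun K f \<Longrightarrow> m (\<lambda>t. c * f t) = c * m f"
    and "continuous_fun K f \<Longrightarrow> (\<And>t. t \<in> topspace K \<Longrightarrow> f t \<le> c) \<Longrightarrow> m f \<le> c"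
  using assms unfolding mean_def by blast+

lemma mean_ge:
  assumes m: "mean K m" and f: "continuous_fun K f" and c: "\<And>t. t \<in> topspace K \<Longrightarrow> c \<le> f t"
  shows "c \<le> m f"
proof -
  have "m (\<lambda>t. (- 1) * f t) \<le> - c"
    using f c by (intro meanD(3)[OF m] continuous_fun_mult) auto
  then show ?thesis
    unfolding meanD(2)[OF m f] by linarith
qed

lemma mean_cong:
  assumes m: "mean K m" and f: "continuous_fun K f" and g: "continuous_fun K g"
    and eq: "\<And>t. t \<in> topspace K \<Longrightarrow> f t = g t"
  shows "m f = m g"
proof -
  have *: "m (\<lambda>t. f t + (- 1) * g t) = m f - m g"
    unfolding meanD(1)[OF m f continuous_fun_mult[OF continuous_fun_const g]] meanD(2)[OF m g] by linarith
  have c: "continuous_fun K (\<lambda>t. f t + (- 1) * g t)"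
    by (intro continuous_fun_add continuous_fun_mult continuous_fun_const f g)
  have "m (\<lambda>t. f t + (- 1) * g t) \<le> 0"
    by (rule meanD(3)[OF m c]) (simp add: eq)
  moreover have "0 \<le> m (\<lambda>t. f t + (- 1) * g t)"
    by (rule mean_ge[OF m c]) (simp add: eq)
  ultimately show ?thesis
    unfolding * by linarith
qed

text \<open>p h is the limit superior of \<open>a d h\<close>. A linear functional below p lies
  between the limit inferior and the limit superior, by comparison at h and -h, so it is a Banach
  limit of the means.\<close>

lemma mean_limit:
  fixes a :: "nat \<Rightarrow> ('a \<Rightarrow> real) \<Rightarrow> real"
  assumes K: "compact_space K" "topspace K \<noteq> {}" and a: "\<And>d. mean K (a d)"
  shows "\<exists>m. mean K m \<and> (\<forall>h c. continuous_fun K h \<longrightarrow> (\<lambda>d. a d h) \<longlonglongrightarrow> c \<longrightarrow> m h = c)"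
proof -
  let ?E = "C_space K :: (real, 'a \<Rightarrow> real) normed_module"
  interpret E: normed_space ?E
    by (rule normed_space_C_space[OF K])
  define p :: "('a \<Rightarrow> real) \<Rightarrow> real" where "p h = Inf {c. \<forall>\<^sub>F d in sequentially. a d h \<le> c}" for h
  have ne: "\<exists>c. \<forall>\<^sub>F d in sequentially. a d h \<le> c" if h: "continuous_fun K h" for h
  proof -
    obtain c where c: "\<And>t. t \<in> topspace K \<Longrightarrow> norm (h t) \<le> c"
      using continuous_fun_bounded[OF K(1) h] by blast
    have "a d h \<le> c" for d
      using c by (intro meanD(3)[OF a h]) (simp add: abs_le_iff)
    then show ?thesis
      by (intro exI[of _ c] always_eventually allI)
  qed
  have bd: "bdd_below {c. \<forall>\<^sub>F d in sequentially. a d h \<le> c}" if h: "continuous_fun K h" for h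
  proof -
    obtain c where c: "\<And>t. t \<in> topspace K \<Longrightarrow> norm (h t) \<le> c"
      using continuous_fun_bounded[OF K(1) h] by blast
    have low: "- c \<le> a d h" for d
      using c by (intro mean_ge[OF a h]) (auto simp: abs_le_iff dest: minus_le_iff[THEN iffD1])
    show ?thesis
    proof (rule bdd_belowI[of _ "- c"])
      fix e assume "e \<in> {c. \<forall>\<^sub>F d in sequentially. a d h \<le> c}"
      then obtain d where "a d h \<le> e"
        using eventually_happens'[OF sequentially_bot] by blast
      then show "- c \<le> e"
        using low[of d] by linarith
    qed
  qed
  have p_le: "p h \<le> c" if "continuous_fun K h" "\<forall>\<^sub>F d in sequentially. a d h \<le> c" for h c
    unfolding p_def using bd[OF that(1)] that(2) by (intro cInf_lower) simp_all
  have p_ev: "\<forall>\<^sub>F d in sequentially. a d h \<le> p h + e" if h: "continuous_fun K h" and e: "e > 0" for h e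
  proof -
    have "\<exists>c\<in>{c. \<forall>\<^sub>F d in sequentially. a d h \<le> c}. c < p h + e"
      using ne[OF h] e unfolding p_def by (intro cInf_lessD) auto
    then obtain c where c: "\<forall>\<^sub>F d in sequentially. a d h \<le> c" "c < p h + e"
      by blast
    show ?thesis
      using c(1) by (rule eventually_mono) (use c(2) in linarith)
  qed
  have res: "a d (restrict f (topspace K)) = a d f" if "continuous_fun K f" for f d
    using that by (intro mean_cong[OF a]) simp_all
  have p_res: "p (restrict f (topspace K)) = p f" if "continuous_fun K f" for f
    unfolding p_def res[OF that] by (rule refl)
  have p_add: "p (\<lambda>t. f t + g t) \<le> p f + p g" if f: "continuous_fun K f" and g: "continuous_fun K g" for f g
  proof (rule field_le_epsilon)
    fix e :: real assume e: "e > 0"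
    have "\<forall>\<^sub>F d in sequentially. a d (\<lambda>t. f t + g t) \<le> p f + p g + e"
      using eventually_conj[OF p_ev[OF f half_gt_zero[OF e]] p_ev[OF g half_gt_zero[OF e]]]
      unfolding meanD(1)[OF a f g] by (rule eventually_mono) linarith
    then show "p (\<lambda>t. f t + g t) \<le> p f + p g + e"
      by (rule p_le[OF continuous_fun_add[OF f g]])
  qed
  have p_mult_le: "p (\<lambda>t. c * f t) \<le> c * p f" if f: "continuous_fun K f" and c: "c > 0" for c f
  proof (rule field_le_epsilon)
    fix e :: real assume e: "e > 0"
    have "\<forall>\<^sub>F d in sequentially. a d f \<le> p f + e / c"
      using p_ev[OF f, of "e / c"] e c by simp
    then have "\<forall>\<^sub>F d in sequentially. a d (\<lambda>t. c * f t) \<le> c * p f + e"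
    proof (rule eventually_mono)
      fix d assume "a d f \<le> p f + e / c"
      then have "c * a d f \<le> c * (p f + e / c)"
        using c by (intro mult_left_mono) simp_all
      then show "a d (\<lambda>t. c * f t) \<le> c * p f + e"
        unfolding meanD(2)[OF a f] using c by (simp add: algebra_simps)
    qed
    then show "p (\<lambda>t. c * f t) \<le> c * p f + e"
      by (rule p_le[OF continuous_fun_mult[OF continuous_fun_const f]])
  qed
  have p0: "p (\<lambda>_. 0) = 0"
  proof (rule antisym)
    have z: "a d (\<lambda>_. 0) = 0" for d
      using meanD(2)[OF a[of d] continuous_fun_const, where c = 0] by simp
    show "p (\<lambda>_. 0) \<le> 0"
      by (rule p_le) (simp_all add: z)
    show "0 \<le> p (\<lambda>_. 0)"
      using p_add[of "\<lambda>_. 0" "\<lambda>_. 0"] by simp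
  qed
  have p_mult: "p (\<lambda>t. c * f t) = c * p f" if f: "continuous_fun K f" and c: "c \<ge> 0" for c f
  proof (cases "c = 0")
    case True
    then show ?thesis
      using p0 by simp
  next
    case False
    then have c: "c > 0"
      using c by simp
    have "p (\<lambda>t. inverse c * (c * f t)) \<le> inverse c * p (\<lambda>t. c * f t)"
      using f c by (intro p_mult_le continuous_fun_mult) simp_all
    moreover have "(\<lambda>t. inverse c * (c * f t)) = f"
      using c by (simp add: fun_eq_iff)
    ultimately have "c * p f \<le> p (\<lambda>t. c * f t)"
      using c by (simp add: field_simps)
    then show ?thesis
      using p_mult_le[OF f c] by linarith
  qed
  have "sublinear_on ?E p"
    unfolding sublinear_on_def
  proof (intro conjI ballI allI impI)
    fix x y assume "x \<in> carrier ?E" "y \<in> carrier ?E"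
    then have c: "continuous_fun K x" "continuous_fun K y"
      by (simp_all add: C_space_simps)
    show "p (x \<oplus>\<^bsub>?E\<^esub> y) \<le> p x + p y"
      unfolding C_space_simps p_res[OF continuous_fun_add[OF c]] by (rule p_add[OF c])
  next
    fix t :: real and x assume t: "t \<ge> 0" and "x \<in> carrier ?E"
    then have c: "continuous_fun K x"
      by (simp add: C_space_simps)
    show "p (of_real t \<odot>\<^bsub>?E\<^esub> x) = t * p x"
      unfolding C_space_simps of_real_eq_id id_apply p_res[OF continuous_fun_mult[OF continuous_fun_const c]]
      by (rule p_mult[OF c t])
  qed
  then obtain \<psi> where \<psi>: "\<And>a b. a \<in> carrier ?E \<Longrightarrow> b \<in> carrier ?E \<Longrightarrow> \<psi> (a \<oplus>\<^bsub>?E\<^esub> b) = \<psi> a + \<psi> b"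
      "\<And>t a. a \<in> carrier ?E \<Longrightarrow> \<psi> (of_real t \<odot>\<^bsub>?E\<^esub> a) = t * \<psi> a" "\<And>a. a \<in> carrier ?E \<Longrightarrow> \<psi> a \<le> p a"
    by (rule E.Hahn_Banach_sublinear[OF _ E.zero_closed]) blast
  define m where "m h = \<psi> (restrict h (topspace K))" for h
  have m_le: "m f \<le> p f" if "continuous_fun K f" for f
    using \<psi>(3)[of "restrict f (topspace K)"] that unfolding m_def p_res[OF that] by simp
  have m_mult: "m (\<lambda>t. c * f t) = c * m f" if f: "continuous_fun K f" for c f
  proof -
    have "(\<lambda>t\<in>topspace K. c * f t) = of_real c \<odot>\<^bsub>?E\<^esub> restrict f (topspace K)"
      by (auto simp: C_space_simps)
    then show ?thesis
      unfolding m_def using \<psi>(2)[of "restrict f (topspace K)" c] f by simp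
  qed
  have "mean K m"
    unfolding mean_def
  proof (intro conjI allI impI m_mult)
    fix f g :: "'a \<Rightarrow> real"
    assume f: "continuous_fun K f" and g: "continuous_fun K g"
    have "(\<lambda>t\<in>topspace K. f t + g t) = restrict f (topspace K) \<oplus>\<^bsub>?E\<^esub> restrict g (topspace K)"
      by (auto simp: C_space_simps)
    then show "m (\<lambda>t. f t + g t) = m f + m g"
      unfolding m_def using \<psi>(1)[of "restrict f (topspace K)" "restrict g (topspace K)"] f g by simp
  next
    fix c and f :: "'a \<Rightarrow> real"
    assume f: "continuous_fun K f" and "\<forall>t\<in>topspace K. f t \<le> c"
    then have "\<forall>d. a d f \<le> c"
      by (intro allI meanD(3)[OF a f]) blast
    then show "m f \<le> c"
      by (intro order_trans[OF m_le[OF f]] p_le[OF f] always_eventually)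
  qed
  moreover have "m h = c" if h: "continuous_fun K h" and lim: "(\<lambda>d. a d h) \<longlonglongrightarrow> c" for h c
  proof (rule antisym)
    have up: "m f \<le> l" if f: "continuous_fun K f" and l: "(\<lambda>d. a d f) \<longlonglongrightarrow> l" for f l
    proof (rule field_le_epsilon)
      fix e :: real assume "e > 0"
      then have "\<forall>\<^sub>F d in sequentially. a d f < l + e"
        by (intro order_tendstoD(2)[OF l]) simp
      then have "\<forall>\<^sub>F d in sequentially. a d f \<le> l + e"
        by (rule eventually_mono) simp
      then show "m f \<le> l + e"
        by (intro order_trans[OF m_le[OF f]] p_le[OF f])
    qed
    show "m h \<le> c"
      by (rule up[OF h lim])
    have "(\<lambda>d. a d (\<lambda>t. (- 1) * h t)) \<longlonglongrightarrow> (- 1) * c"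
      unfolding meanD(2)[OF a h] by (intro tendsto_mult tendsto_const lim)
    then have "m (\<lambda>t. (- 1) * h t) \<le> (- 1) * c"
      by (rule up[OF continuous_fun_mult[OF continuous_fun_const h]])
    then show "c \<le> m h"
      unfolding m_mult[OF h] by linarith
  qed
  ultimately show ?thesis
    by blast
qed

text \<open>The mean of h over the points at the 2 ^ d nodes lying d levels below s. Children are
  formed by consing, so a node lists its latest bit first.\<close>

primrec tree_average :: "(bool list \<Rightarrow> 'a) \<Rightarrow> ('a \<Rightarrow> real) \<Rightarrow> nat \<Rightarrow> bool list \<Rightarrow> real" where
  "tree_average x h 0 s = h (x s)"
| "tree_average x h (Suc d) s = (tree_average x h d (True # s) + tree_average x h d (False # s)) / 2"

lemma tree_average_const:
  assumes "\<And>t. length t = d \<Longrightarrow> h (x (t @ s)) = c"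
  shows "tree_average x h d s = c"
  using assms
proof (induction d arbitrary: s)
  case 0
  from 0[of "[]"] show ?case
    by simp
next
  case (Suc d)
  have "tree_average x h d (b # s) = c" for b
  proof (rule Suc.IH)
    fix t :: "bool list" assume "length t = d"
    then show "h (x (t @ b # s)) = c"
      using Suc.prems[of "t @ [b]"] by simp
  qed
  then show ?case
    by simp
qed

lemma tree_average_vanishes:
  assumes "\<And>s. length s = k \<Longrightarrow> tree_average x h d s = 0"
  shows "length s + i = k \<Longrightarrow> tree_average x h (d + i) s = 0"
proof (induction i arbitrary: s)
  case 0
  then show ?case
    using assms by simp
next
  case (Suc i)
  have "tree_average x h (d + i) (b # s) = 0" for b
    using Suc.prems by (intro Suc.IH) simp
  then show ?case
    by simp
qed

lemma mean_tree_average: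
  assumes x: "\<And>s. x s \<in> topspace K"
  shows "mean K (\<lambda>h. tree_average x h d s)"
proof -
  have "tree_average x (\<lambda>t. f t + g t) d s = tree_average x f d s + tree_average x g d s" for f g
    by (induction d arbitrary: s) (simp_all add: field_simps)
  moreover have "tree_average x (\<lambda>t. c * f t) d s = c * tree_average x f d s" for c f
    by (induction d arbitrary: s) (simp_all add: field_simps)
  moreover have "tree_average x f d s \<le> c" if "\<forall>t\<in>topspace K. f t \<le> c" for c f
  proof (induction d arbitrary: s)
    case 0
    then show ?case
      using that x by simp
  next
    case (Suc d)
    show ?case
      using add_mono[OF Suc[of "True # s"] Suc[of "False # s"]] unfolding tree_average.simps by simp
  qed
  ultimately show ?thesis
    by (simp add: mean_def)
qed

text \<open>S has no isolated point, so U contains two points of S. Their disjoint neighbourhoods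
  are shrunk, by regularity, until the closures lie inside U and are disjoint.\<close>

lemma dense_in_itself_split:
  assumes K: "compact_space K" "Hausdorff_space K" and S: "S \<subseteq> topspace K"
    "\<And>x. x \<in> S \<Longrightarrow> \<not> openin (subtopology K S) {x}" and U: "openin K U" "U \<inter> S \<noteq> {}"
  shows "\<exists>V. \<forall>b. openin K (V b) \<and> V b \<inter> S \<noteq> {} \<and> K closure_of V b \<subseteq> U \<and>
    K closure_of V True \<inter> K closure_of V False = {}"
proof -
  obtain x where x: "x \<in> U" "x \<in> S"
    using U(2) by blast
  have "openin (subtopology K S) (U \<inter> S)"
    using U(1) by (auto simp: openin_subtopology)
  then have "U \<inter> S \<noteq> {x}"
    using S(2)[OF x(2)] by metis
  then obtain y where y: "y \<in> U" "y \<in> S" "y \<noteq> x"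
    using x by blast
  then obtain V0 W0 where VW: "openin K V0" "openin K W0" "x \<in> V0" "y \<in> W0" "disjnt V0 W0"
    using K(2) x S(1) unfolding Hausdorff_space_def by (metis subsetD)
  have "regular_space K"
    using K by (simp add: compact_Hausdorff_imp_regular_space)
  then have nb: "neighbourhood_base_of (closedin K) K"
    by (simp only: neighbourhood_base_of_closedin)
  have small: "\<exists>V. openin K V \<and> z \<in> V \<and> K closure_of V \<subseteq> O'" if O': "openin K O'" "z \<in> O'" for z O'
  proof -
    have "\<exists>V C. openin K V \<and> closedin K C \<and> z \<in> V \<and> V \<subseteq> C \<and> C \<subseteq> O'"
      using nb O' by (simp only: neighbourhood_base_of)
    then obtain V C where "openin K V" "closedin K C" "z \<in> V" "V \<subseteq> C" "C \<subseteq> O'"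
      by (elim exE conjE)
    then show ?thesis
      using closure_of_minimal[of V C K] by (intro exI[of _ V]) simp
  qed
  obtain V where V: "openin K V" "x \<in> V" "K closure_of V \<subseteq> V0 \<inter> U"
    using small[of "V0 \<inter> U" x] VW x U(1) by (auto intro: openin_Int)
  obtain W where W: "openin K W" "y \<in> W" "K closure_of W \<subseteq> W0 \<inter> U"
    using small[of "W0 \<inter> U" y] VW y U(1) by (auto intro: openin_Int)
  show ?thesis
  proof (intro exI[of _ "\<lambda>b. if b then V else W"] allI conjI)
    fix b
    show "openin K (if b then V else W)" "(if b then V else W) \<inter> S \<noteq> {}" "K closure_of (if b then V else W) \<subseteq> U"
      using V W x y by auto
    show "K closure_of (if True then V else W) \<inter> K closure_of (if False then V else W) = {}"
      using V(3) W(3) VW(5) unfolding disjnt_def if_True if_False by blast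
  qed
qed

text \<open>The invariant of the recursion is that each node meets the dense-in-itself set S, which
  allows every node to be split again.\<close>

lemma not_scattered_tree:
  assumes K: "compact_space K" "Hausdorff_space K" and ns: "\<not> scattered_space K"
  shows "\<exists>U :: bool list \<Rightarrow> 'a set. \<forall>s. openin K (U s) \<and> U s \<noteq> {} \<and> (\<forall>b. K closure_of U (b # s) \<subseteq> U s) \<and>
    K closure_of U (True # s) \<inter> K closure_of U (False # s) = {}"
proof -
  obtain S where S: "S \<subseteq> topspace K" "S \<noteq> {}" "\<And>x. x \<in> S \<Longrightarrow> \<not> openin (subtopology K S) {x}"
    using ns unfolding scattered_space_def by blast
  define P where "P U V \<longleftrightarrow> (\<forall>b. openin K (V b) \<and> V b \<inter> S \<noteq> {} \<and> K closure_of V b \<subseteq> U \<and>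
    K closure_of V True \<inter> K closure_of V False = {})" for U :: "'a set" and V :: "bool \<Rightarrow> 'a set"
  define c where "c U = (SOME V. P U V)" for U
  have c: "P U (c U)" if "openin K U" "U \<inter> S \<noteq> {}" for U
    unfolding c_def using dense_in_itself_split[OF K S(1,3) that] unfolding P_def[symmetric] by (rule someI_ex)
  define U where "U = rec_list (topspace K) (\<lambda>b s V. c V b)"
  have U0: "U [] = topspace K" and US: "U (b # s) = c (U s) b" for b s
    by (simp_all add: U_def)
  have good: "openin K (U s) \<and> U s \<inter> S \<noteq> {}" for s
  proof (induction s)
    case Nil
    show ?case
      using S(1,2) unfolding U0 by blast
  next
    case (Cons b s)
    then have "P (U s) (c (U s))"
      by (intro c) simp_all
    then show ?case
      unfolding US P_def by blast
  qed
  have "P (U s) (c (U s))" for s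
    using good by (intro c) simp_all
  then show ?thesis
    using good unfolding P_def by (intro exI[of _ U]) (metis US inf_bot_left)
qed

text \<open>f k is a Urysohn function that equals 1 or -1 on a node according to the bit at level k.
  On the points chosen at a level d > k it is a genuine Rademacher function, so averages of products
  have the right values there; a limit of these averages is the functional m.\<close>

lemma rademacher_functions:
  fixes K :: "'a topology"
  assumes K: "compact_space K" "Hausdorff_space K" and ns: "\<not> scattered_space K"
  shows "\<exists>(f :: nat \<Rightarrow> 'a \<Rightarrow> real) m. mean K m \<and> (\<forall>k. continuous_fun K (f k)) \<and>
    (\<forall>k. \<forall>t\<in>topspace K. \<bar>f k t\<bar> \<le> 1) \<and> (\<forall>j k. m (\<lambda>t. f j t * f k t) = (if j = k then 1 else 0))"
proof -
  obtain U :: "bool list \<Rightarrow> 'a set" where op: "\<And>s. openin K (U s)" and ne: "\<And>s. U s \<noteq> {}"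
      and cl: "\<And>b s. K closure_of U (b # s) \<subseteq> U s"
      and dj: "\<And>s. K closure_of U (True # s) \<inter> K closure_of U (False # s) = {}"
    using not_scattered_tree[OF assms] by metis
  have in_cl: "U s \<subseteq> K closure_of U s" for s
    by (rule closure_of_subset[OF openin_subset[OF op]])
  have dj': "K closure_of U (b # s) \<inter> K closure_of U (b' # s) = {}" if "b \<noteq> b'" for b b' s
    using dj[of s] that by (cases b; cases b') auto
  have level: "length s = length s' \<Longrightarrow> s \<noteq> s' \<Longrightarrow> K closure_of U s \<inter> K closure_of U s' = {}" for s s'
  proof (induction s s' rule: list_induct2')
    case (4 b s b' s')
    show ?case
    proof (cases "s = s'")
      case True
      then show ?thesis
        using 4(3) dj'[of b b' s] by simp
    next
      case False
      then have "K closure_of U s \<inter> K closure_of U s' = {}"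
        using 4 by simp
      then show ?thesis
        using cl[of b s] cl[of b' s'] in_cl[of s] in_cl[of s'] by blast
    qed
  qed simp_all
  \<comment> \<open>Finite unions of closures at level k + 1, sorted by the bit chosen last.
    Distinct nodes of one level have disjoint closures, so Urysohn's lemma applies to the two
    unions.\<close>
  define A where "A k b = (\<Union>s\<in>{s. length s = k}. K closure_of U (b # s))" for k b
  have fin: "finite {s :: bool list. length s = k}" for k
    using finite_lists_length_eq[of "UNIV :: bool set" k] by simp
  have closed: "closedin K (A k b)" for k b
    unfolding A_def using fin by (intro closedin_Union) auto
  have disj: "disjnt (A k False) (A k True)" for k
  proof -
    have "K closure_of U (False # s) \<inter> K closure_of U (True # s') = {}" if "length s = k" "length s' = k" for s s'
      using that by (intro level) simp_all
    then show ?thesis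
      unfolding A_def disjnt_def by blast
  qed
  have "normal_space K"
    using K by (simp add: compact_Hausdorff_or_regular_imp_normal_space)
  then have "\<exists>f. continuous_map K (top_of_set {-1..1::real}) f \<and> f ` A k False \<subseteq> {-1} \<and> f ` A k True \<subseteq> {1}" for k
    using Urysohn_lemma[of K "A k False" "A k True" "-1" "1::real"] closed disj by (metis le_minus_one_simps(1) order_trans zero_le_one)
  then obtain f :: "nat \<Rightarrow> 'a \<Rightarrow> real" where f: "\<And>k. continuous_map K (top_of_set {-1..1}) (f k)"
      "\<And>k. f k ` A k False \<subseteq> {-1}" "\<And>k. f k ` A k True \<subseteq> {1}"
    by metis
  have fc: "continuous_fun K (f k)" and fb: "t \<in> topspace K \<Longrightarrow> \<bar>f k t\<bar> \<le> 1" for k t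
    using f(1)[of k] by (auto simp: continuous_map_in_subtopology abs_le_iff)
  define x where "x s = (SOME z. z \<in> U s)" for s
  have x: "x s \<in> U s" for s
    unfolding x_def using ne[of s, folded ex_in_conv] by (rule someI_ex)
  have x_top: "x s \<in> topspace K" for s
    using openin_subset[OF op[of s]] x[of s] by (rule subsetD)
  have "U (b # s) \<subseteq> U s" for b s
    using in_cl[of "b # s"] cl[of b s] by blast
  then have mono: "U (t @ s) \<subseteq> U s" for t s
    by (induction t) (auto dest: subsetD)
  have val: "f k (x (t @ b # s)) = (if b then 1 else -1)" if "length s = k" for k t b s
  proof -
    have "x (t @ b # s) \<in> A k b"
      using x[of "t @ b # s"] mono[of t "b # s"] in_cl[of "b # s"] that unfolding A_def by blast
    then show ?thesis
      using f(2,3)[of k] by (cases b) auto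
  qed
  define a where "a d h = tree_average x h d []" for d h
  have ma: "mean K (a d)" for d
    unfolding a_def[abs_def] by (rule mean_tree_average[OF x_top])
  have "topspace K \<noteq> {}"
    using x_top[of "[]"] by blast
  from mean_limit[OF K(1) this, of a, OF ma] obtain m where m: "mean K m"
      and lim: "\<forall>h c. continuous_fun K h \<longrightarrow> (\<lambda>d. a d h) \<longlonglongrightarrow> c \<longrightarrow> m h = c"
    by (elim exE conjE)
  have fjk: "continuous_fun K (\<lambda>t. f j t * f k t)" for j k
    by (intro continuous_fun_mult fc)
  have diag: "m (\<lambda>t. f k t * f k t) = 1" for k
  proof (rule lim[rule_format, OF fjk])
    have "a d (\<lambda>t. f k t * f k t) = 1" if "d > k" for d
      unfolding a_def
    proof (rule tree_average_const)
      fix t :: "bool list" assume t: "length t = d"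
      \<comment> \<open>Bits are stored latest first, so the bit followed by exactly k others sits
        at position d - (k + 1).\<close>
      define n where "n = d - Suc k"
      have n: "n < length t" "length (drop (Suc n) t) = k"
        using t that by (auto simp: n_def)
      have "t @ [] = take n t @ t ! n # drop (Suc n) t"
        using id_take_nth_drop[OF n(1)] by simp
      then show "f k (x (t @ [])) * f k (x (t @ [])) = 1"
        using val[OF n(2), of "take n t" "t ! n"] by (simp only:) simp
    qed
    then show "(\<lambda>d. a d (\<lambda>t. f k t * f k t)) \<longlonglongrightarrow> 1"
      by (intro tendsto_eventually eventually_sequentiallyI[of "Suc k"]) simp
  qed
  have off: "m (\<lambda>t. f j t * f k t) = 0" if jk: "j < k" for j k
  proof (rule lim[rule_format, OF fjk])
    \<comment> \<open>Below a node of level k > j the value of f j is settled, while the first split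
      gives f k both signs equally often.\<close>
    have *: "tree_average x (\<lambda>t. f j t * f k t) (Suc d) s = 0" if s: "length s = k" for d s
    proof -
      define n where "n = k - Suc j"
      have n: "n < length s" "length (drop (Suc n) s) = j"
        using s jk by (auto simp: n_def)
      define v :: real where "v = (if s ! n then 1 else -1)"
      have s_eq: "s = take n s @ s ! n # drop (Suc n) s"
        using id_take_nth_drop[OF n(1)] .
      have "tree_average x (\<lambda>t. f j t * f k t) d (b # s) = v * (if b then 1 else -1)" for b
      proof (rule tree_average_const)
        fix t :: "bool list"
        have "t @ b # s = (t @ b # take n s) @ s ! n # drop (Suc n) s"
          using s_eq by (metis append_Cons append_assoc)
        then have "f j (x (t @ b # s)) = v"
          using val[OF n(2), of "t @ b # take n s" "s ! n"] unfolding v_def by (simp only:)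
        then show "f j (x (t @ b # s)) * f k (x (t @ b # s)) = v * (if b then 1 else -1)"
          using val[OF s, of t b] by (simp only:)
      qed
      then show ?thesis
        by simp
    qed
    have "a d (\<lambda>t. f j t * f k t) = 0" if d: "d > k" for d
    proof -
      have "tree_average x (\<lambda>t. f j t * f k t) (Suc (d - Suc k) + k) [] = 0"
        by (rule tree_average_vanishes[where k = k]) (rule *, simp_all)
      moreover have "Suc (d - Suc k) + k = d"
        using d by simp
      ultimately show ?thesis
        unfolding a_def by (simp only:)
    qed
    then show "(\<lambda>d. a d (\<lambda>t. f j t * f k t)) \<longlonglongrightarrow> 0"
      by (intro tendsto_eventually eventually_sequentiallyI[of "Suc k"]) simp
  qed
  have off': "m (\<lambda>t. f j t * f k t) = 0" if "k < j" for j k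
    using off[OF that] mult.commute[of "f j _" "f k _"] by (simp only:)
  show ?thesis
  proof (intro exI[of _ f] exI[of _ m] conjI allI ballI)
    fix j k
    show "m (\<lambda>t. f j t * f k t) = (if j = k then 1 else 0)"
      using diag[of k] off[of j k] off'[of k j] by (cases j k rule: linorder_cases) simp_all
  qed (rule m, rule fc, erule fb)
qed

text \<open>g N is h minus its projection onto the span of f 0, ..., f (N - 1), and the mean of its
  square is nonnegative.\<close>

lemma mean_bessel:
  fixes f :: "nat \<Rightarrow> 'a \<Rightarrow> real"
  assumes m: "mean K m" and f: "\<And>k. continuous_fun K (f k)" and h: "continuous_fun K h"
    and orth: "\<And>j k. m (\<lambda>t. f j t * f k t) = (if j = k then 1 else (0::real))"
  shows "(\<Sum>k<N. (m (\<lambda>t. h t * f k t))\<^sup>2) \<le> m (\<lambda>t. h t * h t)"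
proof -
  define a where "a k = m (\<lambda>t. h t * f k t)" for k :: nat
  define g where "g N t = h t + (\<Sum>k<N. (- a k) * f k t)" for N t
  have gS: "g (Suc N) t = g N t + (- a N) * f N t" for N t
    by (simp add: g_def)
  have "continuous_fun K (g N) \<and> (\<forall>j\<ge>N. m (\<lambda>t. g N t * f j t) = a j) \<and>
      m (\<lambda>t. g N t * g N t) = m (\<lambda>t. h t * h t) - (\<Sum>k<N. (a k)\<^sup>2)"
  proof (induction N)
    case 0
    show ?case
      using h by (simp add: g_def a_def)
  next
    case (Suc N)
    then have c: "continuous_fun K (g N)" and ip: "\<And>j. j \<ge> N \<Longrightarrow> m (\<lambda>t. g N t * f j t) = a j"
        and sq: "m (\<lambda>t. g N t * g N t) = m (\<lambda>t. h t * h t) - (\<Sum>k<N. (a k)\<^sup>2)"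
      by simp_all
    have gf: "continuous_fun K (\<lambda>t. g N t * f j t)" and ff: "continuous_fun K (\<lambda>t. f i t * f j t)"
        and gg: "continuous_fun K (\<lambda>t. g N t * g N t)" for i j
      by (intro continuous_fun_mult c f)+
    have "continuous_fun K (g (Suc N))"
      unfolding gS[abs_def] by (intro continuous_fun_add continuous_fun_mult c f continuous_fun_const)
    moreover have "m (\<lambda>t. g (Suc N) t * f j t) = a j" if "j \<ge> Suc N" for j
    proof -
      have "m (\<lambda>t. g (Suc N) t * f j t) = m (\<lambda>t. g N t * f j t + (- a N) * (f N t * f j t))"
        by (simp add: gS algebra_simps)
      also have "\<dots> = m (\<lambda>t. g N t * f j t) + (- a N) * m (\<lambda>t. f N t * f j t)"
        unfolding meanD(1)[OF m gf continuous_fun_mult[OF continuous_fun_const ff]] meanD(2)[OF m ff] ..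
      finally show ?thesis
        unfolding orth using ip[of j] that by simp
    qed
    moreover have "m (\<lambda>t. g (Suc N) t * g (Suc N) t) = m (\<lambda>t. h t * h t) - (\<Sum>k<Suc N. (a k)\<^sup>2)"
    proof -
      have "m (\<lambda>t. g (Suc N) t * g (Suc N) t) =
          m (\<lambda>t. g N t * g N t + ((- 2 * a N) * (g N t * f N t) + (a N)\<^sup>2 * (f N t * f N t)))"
        by (simp add: gS algebra_simps power2_eq_square)
      also have "\<dots> = m (\<lambda>t. g N t * g N t) + ((- 2 * a N) * m (\<lambda>t. g N t * f N t) + (a N)\<^sup>2 * m (\<lambda>t. f N t * f N t))"
        unfolding meanD(1)[OF m gg continuous_fun_add[OF continuous_fun_mult[OF continuous_fun_const gf] continuous_fun_mult[OF continuous_fun_const ff]]]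
          meanD(1)[OF m continuous_fun_mult[OF continuous_fun_const gf] continuous_fun_mult[OF continuous_fun_const ff]]
          meanD(2)[OF m ff] meanD(2)[OF m gf] ..
      finally show ?thesis
        unfolding orth ip[OF order_refl] sq by (simp add: power2_eq_square)
    qed
    ultimately show ?case
      by blast
  qed
  moreover from this have "0 \<le> m (\<lambda>t. g N t * g N t)"
    by (intro mean_ge[OF m] continuous_fun_mult) simp_all
  ultimately show ?thesis
    by (simp add: a_def)
qed

section \<open>Coefficients with respect to the orthonormal functions\<close>

lemma continuous_fun_inner:
  fixes F :: "'a \<Rightarrow> 'k::real_inner"
  shows "continuous_fun K F \<Longrightarrow> continuous_fun K (\<lambda>t. F t \<bullet> z)"
  by (simp add: continuous_map_atin tendsto_inner)

text \<open>q k F is the integral of F f_k, formed in each real coordinate of the scalars because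
  means act on real functions. Bessel's inequality in each coordinate gives the constant sqrt
  DIM('k).\<close>

lemma not_scattered_l2_operator:
  fixes K :: "'a topology"
  assumes K: "compact_space K" "Hausdorff_space K" and ns: "\<not> scattered_space K"
  shows "\<exists>(f :: nat \<Rightarrow> 'a \<Rightarrow> real) (q :: nat \<Rightarrow> ('a \<Rightarrow> 'k::{real_normed_field,euclidean_space}) \<Rightarrow> 'k) C. C \<ge> 0 \<and>
    (\<forall>k. continuous_fun K (f k)) \<and> (\<forall>k. \<forall>t\<in>topspace K. \<bar>f k t\<bar> \<le> 1) \<and>
    (\<forall>k. linear_map (C_space K) scalars (q k)) \<and>
    (\<forall>F\<in>carrier (C_space K). \<forall>N. L2_set (\<lambda>k. norm (q k F)) {..<N} \<le> C * vnorm (C_space K) F) \<and>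
    (\<forall>j k. q k (\<lambda>t\<in>topspace K. of_real (f j t)) = (if j = k then 1 else 0))"
proof -
  obtain f :: "nat \<Rightarrow> 'a \<Rightarrow> real" and m where m: "mean K m" and f: "\<And>k. continuous_fun K (f k)"
      and f1: "\<And>k t. t \<in> topspace K \<Longrightarrow> \<bar>f k t\<bar> \<le> 1"
      and orth: "\<And>j k. m (\<lambda>t. f j t * f k t) = (if j = k then 1 else 0)"
    using rademacher_functions[OF assms] by metis
  define q where "q k F = (\<Sum>b\<in>Basis. m (\<lambda>t. (F t \<bullet> b) * f k t) *\<^sub>R b)" for k and F :: "'a \<Rightarrow> 'k"
  have cont: "continuous_fun K (\<lambda>t. (F t \<bullet> z) * f k t)" if "continuous_fun K F" for F :: "'a \<Rightarrow> 'k" and z k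
    by (intro continuous_fun_mult continuous_fun_inner that f)
  have q_cong: "q k F = q k G" if F: "continuous_fun K F" and G: "continuous_fun K G"
      and eq: "\<And>t. t \<in> topspace K \<Longrightarrow> F t = G t" for F G k
  proof -
    have "m (\<lambda>t. (F t \<bullet> b) * f k t) = m (\<lambda>t. (G t \<bullet> b) * f k t)" for b
      by (rule mean_cong[OF m cont[OF F] cont[OF G]]) (simp add: eq)
    then show ?thesis
      by (simp only: q_def)
  qed
  have q_basis: "q k F \<bullet> b = m (\<lambda>t. (F t \<bullet> b) * f k t)" if "b \<in> Basis" for k F b
    using that by (simp add: q_def inner_sum_left_Basis)
  \<comment> \<open>The defining identity is extended from basis vectors to all z; together with the
    adjointness of \<open>conj_scalar\<close> it yields homogeneity over the full field.\<close>
  have q_inner: "q k F \<bullet> z = m (\<lambda>t. (F t \<bullet> z) * f k t)" if F: "continuous_fun K F" for k F z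
  proof -
    have sums: "m (\<lambda>t. \<Sum>b\<in>B. (z \<bullet> b) * ((F t \<bullet> b) * f k t)) = (\<Sum>b\<in>B. (z \<bullet> b) * m (\<lambda>t. (F t \<bullet> b) * f k t)) \<and>
        continuous_fun K (\<lambda>t. \<Sum>b\<in>B. (z \<bullet> b) * ((F t \<bullet> b) * f k t))" if "finite B" for B
      using that
    proof induction
      case empty
      show ?case
        using meanD(2)[OF m continuous_fun_const, of 0] by simp
    next
      case (insert b B)
      have c: "continuous_fun K (\<lambda>t. (z \<bullet> b) * ((F t \<bullet> b) * f k t))"
        by (intro continuous_fun_mult continuous_fun_const continuous_fun_inner F f)
      have c': "continuous_fun K (\<lambda>t. \<Sum>b\<in>B. (z \<bullet> b) * ((F t \<bullet> b) * f k t))"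
        using insert.IH by blast
      show ?case
        using insert meanD(1)[OF m c c'] meanD(2)[OF m cont[OF F], of "z \<bullet> b" b k] continuous_fun_add[OF c c'] by simp
    qed
    have "m (\<lambda>t. (F t \<bullet> z) * f k t) = m (\<lambda>t. \<Sum>b\<in>Basis. (z \<bullet> b) * ((F t \<bullet> b) * f k t))"
      by (subst euclidean_inner) (simp add: sum_distrib_left mult_ac)
    also have "\<dots> = (\<Sum>b\<in>Basis. (z \<bullet> b) * (q k F \<bullet> b))"
      using sums[OF finite_Basis] by (simp add: q_basis)
    also have "\<dots> = q k F \<bullet> z"
      by (subst (2) euclidean_inner) (simp add: mult.commute)
    finally show ?thesis ..
  qed
  have "linear_map (C_space K) scalars (q k)" for k
  proof (rule linear_map_scalarsI)
    fix F G :: "'a \<Rightarrow> 'k"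
    assume "F \<in> carrier (C_space K)" "G \<in> carrier (C_space K)"
    then have F: "continuous_fun K F" and G: "continuous_fun K G"
      by (simp_all add: C_space_carrierD)
    have "q k (F \<oplus>\<^bsub>C_space K\<^esub> G) = q k (\<lambda>t. F t + G t)"
      unfolding C_space_simps by (rule q_cong) (use F G in \<open>simp_all add: continuous_fun_add\<close>)
    also have "\<dots> = q k F + q k G"
    proof (rule euclidean_eqI)
      fix b :: 'k assume "b \<in> Basis"
      then show "q k (\<lambda>t. F t + G t) \<bullet> b = (q k F + q k G) \<bullet> b"
        unfolding inner_add_left q_inner[OF F] q_inner[OF G] q_inner[OF continuous_fun_add[OF F G]] distrib_right
        by (simp add: meanD(1)[OF m cont[OF F] cont[OF G]])
    qed
    finally show "q k (F \<oplus>\<^bsub>C_space K\<^esub> G) = q k F + q k G" .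
  next
    fix c and F :: "'a \<Rightarrow> 'k"
    assume "F \<in> carrier (C_space K)"
    then have F: "continuous_fun K F"
      by (simp add: C_space_carrierD)
    have cF: "continuous_fun K (\<lambda>t. c * F t)"
      by (intro continuous_fun_mult continuous_fun_const F)
    have "q k (c \<odot>\<^bsub>C_space K\<^esub> F) = q k (\<lambda>t. c * F t)"
      unfolding C_space_simps by (rule q_cong) (use cF in simp_all)
    also have "\<dots> = c * q k F"
      by (rule euclidean_eqI) (simp only: inner_mult_left_conj q_inner[OF F] q_inner[OF cF])
    finally show "q k (c \<odot>\<^bsub>C_space K\<^esub> F) = c * q k F" .
  qed
  moreover have "L2_set (\<lambda>k. norm (q k F)) {..<N} \<le> sqrt (real DIM('k)) * vnorm (C_space K) F"
    if "F \<in> carrier (C_space K)" for F N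
  proof -
    have F: "continuous_fun K F"
      using that by (rule C_space_carrierD)
    define c where "c = vnorm (C_space K) F"
    have Fc: "norm (F t) \<le> c" if "t \<in> topspace K" for t
      unfolding c_def by (rule C_space_norm_le[OF K(1) F that])
    have b_le: "(\<Sum>k<N. (q k F \<bullet> b)\<^sup>2) \<le> c\<^sup>2" if b: "b \<in> Basis" for b
    proof -
      have "(\<Sum>k<N. (q k F \<bullet> b)\<^sup>2) \<le> m (\<lambda>t. (F t \<bullet> b) * (F t \<bullet> b))"
        unfolding q_basis[OF b] by (rule mean_bessel[OF m f continuous_fun_inner[OF F] orth])
      also have "\<dots> \<le> c\<^sup>2"
      proof (rule meanD(3)[OF m])
        show "continuous_fun K (\<lambda>t. (F t \<bullet> b) * (F t \<bullet> b))"
          by (intro continuous_fun_mult continuous_fun_inner F)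
        fix t assume "t \<in> topspace K"
        then have "\<bar>F t \<bullet> b\<bar> \<le> c"
          using Basis_le_norm[OF b, of "F t"] Fc[of t] by linarith
        then have "\<bar>F t \<bullet> b\<bar>\<^sup>2 \<le> c\<^sup>2"
          by (intro power_mono abs_ge_zero)
        then show "(F t \<bullet> b) * (F t \<bullet> b) \<le> c\<^sup>2"
          by (simp add: power2_eq_square)
      qed
      finally show ?thesis .
    qed
    have c0: "c \<ge> 0"
    proof -
      have "topspace K \<noteq> {}"
        using ns unfolding scattered_space_def by auto
      then obtain t where "t \<in> topspace K"
        by blast
      then show ?thesis
        using Fc[of t] norm_ge_zero[of "F t"] by linarith
    qed
    have "(\<Sum>k<N. (norm (q k F))\<^sup>2) = (\<Sum>k<N. \<Sum>b\<in>Basis. (q k F \<bullet> b)\<^sup>2)"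
      unfolding power2_norm_eq_inner by (subst euclidean_inner) (simp add: power2_eq_square)
    also have "\<dots> = (\<Sum>b\<in>Basis. \<Sum>k<N. (q k F \<bullet> b)\<^sup>2)"
      by (rule sum.swap)
    also have "\<dots> \<le> (\<Sum>b\<in>(Basis::'k set). c\<^sup>2)"
      by (rule sum_mono) (rule b_le)
    also have "\<dots> = real DIM('k) * c\<^sup>2"
      by simp
    finally have "L2_set (\<lambda>k. norm (q k F)) {..<N} \<le> sqrt (real DIM('k) * c\<^sup>2)"
      unfolding L2_set_def by (rule real_sqrt_le_mono)
    then show ?thesis
      using c0 by (simp add: real_sqrt_mult c_def)
  qed
  moreover have "q k (\<lambda>t\<in>topspace K. of_real (f j t)) = (if j = k then 1 else 0)" for j k
  proof -
    have fj: "continuous_fun K (\<lambda>t. of_real (f j t) :: 'k)"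
      by (intro continuous_fun_of_real f)
    have ffc: "continuous_fun K (\<lambda>t. f j t * f k t)"
      by (intro continuous_fun_mult f)
    have "q k (\<lambda>t\<in>topspace K. of_real (f j t)) = q k (\<lambda>t. of_real (f j t))"
      by (rule q_cong) (use fj in simp_all)
    also have "\<dots> = (if j = k then 1 else 0)"
    proof (rule euclidean_eqI)
      fix b :: 'k assume b: "b \<in> Basis"
      have "q k (\<lambda>t. of_real (f j t)) \<bullet> b = m (\<lambda>t. (1 \<bullet> b) * (f j t * f k t))"
        unfolding q_basis[OF b] by (simp add: of_real_def mult_ac)
      also have "\<dots> = (1 \<bullet> b) * (if j = k then 1 else 0)"
        unfolding meanD(2)[OF m ffc] orth ..
      finally show "q k (\<lambda>t. of_real (f j t)) \<bullet> b = (if j = k then 1 else 0) \<bullet> b"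
        by simp
    qed
    finally show ?thesis .
  qed
  ultimately show ?thesis
    by (intro exI[of _ f] exI[of _ q] exI[of _ "sqrt (real DIM('k))"]) (simp add: f f1)
qed

text \<open>An infinite compact space has an accumulation point z. Every neighbourhood W n of z
  contains another point t n, which is split off with a neighbourhood V n disjoint from the next W.
  Each point of K sees at most one nonzero bump, hence sums at most 1.\<close>

lemma separated_bumps:
  fixes K :: "'a topology"
  assumes K: "compact_space K" "Hausdorff_space K" and inf: "infinite (topspace K)"
  shows "\<exists>(t :: nat \<Rightarrow> 'a) (g :: nat \<Rightarrow> 'a \<Rightarrow> real). (\<forall>k. t k \<in> topspace K) \<and> (\<forall>k. continuous_fun K (g k)) \<and>
    (\<forall>k. g k (t k) = 1) \<and> (\<forall>k. \<forall>s\<in>topspace K. 0 \<le> g k s) \<and>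
    (\<forall>J. finite J \<longrightarrow> (\<forall>s\<in>topspace K. (\<Sum>k\<in>J. g k s) \<le> 1))"
proof -
  have "topspace K \<inter> K derived_set_of topspace K \<noteq> {}"
    using compactin_imp_Bolzano_Weierstrass[of K "topspace K" "topspace K"] K(1) inf by (simp add: compact_space_def)
  then obtain z where z: "z \<in> topspace K" "z \<in> K derived_set_of topspace K"
    by blast
  define P where "P n W \<longleftrightarrow> openin K W \<and> z \<in> W" for n :: nat and W
  define Q where "Q n W W' \<longleftrightarrow> (\<exists>t V. openin K V \<and> t \<in> V \<and> V \<subseteq> W \<and> W' \<subseteq> W \<and> V \<inter> W' = {})" for n :: nat and W W' :: "'a set"
  have "\<exists>W. \<forall>n. P n (W n) \<and> Q n (W n) (W (Suc n))"
  proof (rule dependent_nat_choice)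
    show "\<exists>W. P 0 W"
      using z(1) unfolding P_def by (intro exI[of _ "topspace K"]) simp
    fix W n assume W: "P n W"
    then obtain t where t: "t \<noteq> z" "t \<in> topspace K" "t \<in> W"
      using z(2) unfolding P_def in_derived_set_of by blast
    then obtain V W' where VW: "openin K V" "openin K W'" "t \<in> V" "z \<in> W'" "disjnt V W'"
      using K(2) z(1) unfolding Hausdorff_space_def by metis
    show "\<exists>W'. P (Suc n) W' \<and> Q n W W'"
      unfolding P_def Q_def
    proof (intro exI conjI)
      show "openin K (W' \<inter> W)" "openin K (V \<inter> W)"
        using VW W by (auto simp: P_def)
      show "z \<in> W' \<inter> W" "t \<in> V \<inter> W" "V \<inter> W \<inter> (W' \<inter> W) = {}"
        using VW W t by (auto simp: P_def disjnt_def)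
    qed simp_all
  qed
  then obtain W where W: "\<And>n. Q n (W n) (W (Suc n))"
    by blast
  then obtain t V where tV: "\<And>n. openin K (V n)" "\<And>n. t n \<in> V n" "\<And>n. V n \<subseteq> W n" "\<And>n. W (Suc n) \<subseteq> W n"
      "\<And>n. V n \<inter> W (Suc n) = {}"
    unfolding Q_def by metis
  have anti: "W k \<subseteq> W j" if "j \<le> k" for j k
    by (rule lift_Suc_antimono_le[of W, OF tV(4) that])
  have disj: "V j \<inter> V k = {}" if "j < k" for j k
    using tV(3)[of k] tV(5)[of j] anti[of "Suc j" k] that by (simp add: Suc_le_eq) blast
  have t_top: "t k \<in> topspace K" for k
    using openin_subset[OF tV(1)[of k]] tV(2)[of k] by (rule subsetD)
  have "\<exists>g. continuous_map K (top_of_set {0..1::real}) g \<and> g ` (topspace K - V k) \<subseteq> {0} \<and> g ` {t k} \<subseteq> {1}" for k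
  proof -
    have "closedin K (topspace K - V k)"
      using tV(1)[of k] by blast
    moreover have "closedin K {t k}"
      using K(2) t_top Hausdorff_imp_t1_space[of K] t1_space_closedin_singleton[of K] by blast
    moreover have "disjnt (topspace K - V k) {t k}"
      using tV(2)[of k] by (simp add: disjnt_def)
    moreover have "normal_space K"
      using K by (simp add: compact_Hausdorff_or_regular_imp_normal_space)
    ultimately show ?thesis
      using Urysohn_lemma[of K "topspace K - V k" "{t k}" 0 "1::real"] zero_le_one by metis
  qed
  then obtain g :: "nat \<Rightarrow> 'a \<Rightarrow> real" where g: "\<And>k. continuous_map K (top_of_set {0..1}) (g k)"
      "\<And>k. g k ` (topspace K - V k) \<subseteq> {0}" "\<And>k. g k ` {t k} \<subseteq> {1}"
    by metis
  have g01: "continuous_fun K (g k)" "s \<in> topspace K \<Longrightarrow> 0 \<le> g k s \<and> g k s \<le> 1" for k s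
    using g(1)[of k] by (auto simp: continuous_map_in_subtopology)
  have g_zero: "g k s = 0" if "s \<in> topspace K" "s \<notin> V k" for k s
    using g(2)[of k] that by blast
  have "(\<Sum>k\<in>J. g k s) \<le> 1" if J: "finite J" and s: "s \<in> topspace K" for J s
  proof (cases "\<exists>k. s \<in> V k")
    case True
    then obtain k where k: "s \<in> V k"
      by blast
    have "s \<notin> V j" if "j \<noteq> k" for j
      using disj[of j k] disj[of k j] that k by (metis IntI empty_iff linorder_neqE_nat)
    then have "(\<Sum>j\<in>J. g j s) = (\<Sum>j\<in>J. if j = k then g k s else 0)"
      using g_zero[OF s] by (intro sum.cong) auto
    then show ?thesis
      using g01(2)[OF s, of k] J by simp
  next
    case False
    then have "(\<Sum>j\<in>J. g j s) = 0"
      using g_zero[OF s] by (intro sum.neutral) blast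
    then show ?thesis
      by simp
  qed
  moreover have "g k (t k) = 1" for k
    using g(3)[of k] by blast
  ultimately show ?thesis
    using t_top g01 by (intro exI[of _ t] exI[of _ g] conjI allI impI ballI) blast+
qed

section \<open>Riesz products\<close>

text \<open>The first argument is a real function because the orthonormal functions are real;
  unimodular coefficients from the scalar field are put into the second argument.\<close>

locale bilinear_on_products =
  fixes K L :: "'a topology" and B :: "('a \<Rightarrow> real) \<Rightarrow> ('a \<Rightarrow> 'k::real_normed_field) \<Rightarrow> 'k" and M :: real
  assumes add_left: "continuous_fun K u \<Longrightarrow> continuous_fun K v \<Longrightarrow> continuous_fun L G \<Longrightarrow>
      B (\<lambda>t. u t + v t) G = B u G + B v G"
    and mult_left: "continuous_fun K u \<Longrightarrow> continuous_fun L G \<Longrightarrow> B (\<lambda>t. c * u t) G = of_real c * B u G"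
    and add_right: "continuous_fun K u \<Longrightarrow> continuous_fun L G \<Longrightarrow> continuous_fun L H \<Longrightarrow>
      B u (\<lambda>t. G t + H t) = B u G + B u H"
    and mult_right: "continuous_fun K u \<Longrightarrow> continuous_fun L G \<Longrightarrow> B u (\<lambda>t. a * G t) = a * B u G"
    and bound: "continuous_fun K u \<Longrightarrow> continuous_fun L G \<Longrightarrow> (\<And>t. t \<in> topspace K \<Longrightarrow> \<bar>u t\<bar> \<le> c) \<Longrightarrow>
      (\<And>s. s \<in> topspace L \<Longrightarrow> norm (G s) \<le> 1) \<Longrightarrow> c \<ge> 0 \<Longrightarrow> norm (B u G) \<le> M * c"
begin

text \<open>The two signs in the step are those of the factors of a Riesz product; averaging over them
  removes all mixed terms.\<close>

lemma riesz_product_bound: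
  assumes f: "\<And>k. continuous_fun K (f k)" "\<And>k t. t \<in> topspace K \<Longrightarrow> (f k t)\<^sup>2 \<le> d"
    and g: "\<And>k. continuous_fun L (g k)" and d: "d \<ge> 0"
  shows "continuous_fun K u \<Longrightarrow> continuous_fun K v \<Longrightarrow> continuous_fun L G \<Longrightarrow> c \<ge> 0 \<Longrightarrow>
    (\<And>t. t \<in> topspace K \<Longrightarrow> (u t)\<^sup>2 + (v t)\<^sup>2 \<le> c\<^sup>2) \<Longrightarrow>
    (\<And>s. s \<in> topspace L \<Longrightarrow> norm (G s) + (\<Sum>k<m. norm (g k s)) \<le> 1) \<Longrightarrow>
    norm (B v G + (\<Sum>k<m. B (\<lambda>t. f k t * u t) (g k))) \<le> M * (c * sqrt (1 + d) ^ m)"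
proof (induction m arbitrary: u v G c)
  case 0
  have "\<bar>v t\<bar> \<le> c" if "t \<in> topspace K" for t
  proof -
    have "(v t)\<^sup>2 \<le> c\<^sup>2"
      using 0(5)[OF that] zero_le_power2[of "u t"] by linarith
    then show ?thesis
      using 0(4) by (simp add: abs_le_square_iff[symmetric])
  qed
  moreover have "norm (G s) \<le> 1" if "s \<in> topspace L" for s
    using 0(6)[OF that] by simp
  ultimately show ?case
    using bound[OF 0(2,3), of c] 0(4) by simp
next
  case (Suc m)
  note u = Suc.prems(1) and v = Suc.prems(2) and G = Suc.prems(3) and c = Suc.prems(4)
  define T where "T v u G = B v G + (\<Sum>k<m. B (\<lambda>t. f k t * u t) (g k))" for v u G
  \<comment> \<open>The pair (\<open>ve e\<close>, \<open>ue (- e)\<close>) is v + i u multiplied by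
    1 - i e f_m: a complex Riesz product written with real functions. Its squared modulus grows only
    by the factor 1 + f_m^2, whereas a real factor 1 + e f_m would allow (1 + |f_m|)^2.\<close>
  define ue where "ue e t = u t + e * (f m t * v t)" for e t
  define ve where "ve e t = v t + e * (f m t * u t)" for e t
  define Ge where "Ge e s = G s + of_real e * g m s" for e :: real and s
  have fu: "continuous_fun K (\<lambda>t. f k t * u t)" and fv: "continuous_fun K (\<lambda>t. f k t * v t)" for k
    by (intro continuous_fun_mult f u v)+
  have ffv: "continuous_fun K (\<lambda>t. f k t * (f m t * v t))" for k
    by (intro continuous_fun_mult f v)
  have ue: "continuous_fun K (ue e)" and ve: "continuous_fun K (ve e)" and Ge: "continuous_fun L (Ge e)" for e
    unfolding ue_def[abs_def] ve_def[abs_def] Ge_def[abs_def]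
    by (intro continuous_fun_add continuous_fun_mult continuous_fun_const f g u v G)+
  have bd: "norm (T (ve e) (ue (- e)) (Ge e)) \<le> M * ((c * sqrt (1 + d)) * sqrt (1 + d) ^ m)" if e: "\<bar>e\<bar> = 1" for e
    unfolding T_def
  proof (rule Suc.IH[OF ue ve Ge])
    show "0 \<le> c * sqrt (1 + d)"
      using c d by simp
    have e2: "e * e = 1"
      using e by (metis abs_mult_self_eq mult_1_right)
    fix t assume t: "t \<in> topspace K"
    have "(ue (- e) t)\<^sup>2 + (ve e t)\<^sup>2 = (u t)\<^sup>2 + (v t)\<^sup>2 + (e * e) * ((f m t)\<^sup>2 * ((u t)\<^sup>2 + (v t)\<^sup>2))"
      by (simp add: ue_def ve_def power2_eq_square algebra_simps)
    also have "\<dots> = (1 + (f m t)\<^sup>2) * ((u t)\<^sup>2 + (v t)\<^sup>2)"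
      unfolding e2 by (simp add: algebra_simps)
    also have "\<dots> \<le> (1 + d) * c\<^sup>2"
      using f(2)[OF t, of m] Suc.prems(5)[OF t] d by (intro mult_mono) simp_all
    also have "\<dots> = (c * sqrt (1 + d))\<^sup>2"
      using d by (simp add: power_mult_distrib mult.commute)
    finally show "(ue (- e) t)\<^sup>2 + (ve e t)\<^sup>2 \<le> (c * sqrt (1 + d))\<^sup>2" .
  next
    fix s assume s: "s \<in> topspace L"
    have "norm (Ge e s) \<le> norm (G s) + norm (g m s)"
      unfolding Ge_def using norm_triangle_ineq[of "G s" "of_real e * g m s"] e by (simp add: norm_mult)
    then show "norm (Ge e s) + (\<Sum>k<m. norm (g k s)) \<le> 1"
      using Suc.prems(6)[OF s] by simp
  qed
  \<comment> \<open>The terms with a single factor e cancel between e = 1 and e = -1; those with e^2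
    contribute the new diagonal term.\<close>
  have exp: "T (ve e) (ue (- e)) (Ge e) = T v u G + of_real (e * e) * B (\<lambda>t. f m t * u t) (g m) +
      of_real e * (B (\<lambda>t. f m t * u t) G + B v (g m) - (\<Sum>k<m. B (\<lambda>t. f k t * (f m t * v t)) (g k)))" for e
  proof -
    have ve_eq: "B (ve e) H = B v H + of_real e * B (\<lambda>t. f m t * u t) H" if "continuous_fun L H" for H
      unfolding ve_def[abs_def] add_left[OF v continuous_fun_mult[OF continuous_fun_const fu] that] mult_left[OF fu that] ..
    have 1: "B (ve e) (Ge e) = B v G + of_real e * B (\<lambda>t. f m t * u t) G +
        of_real e * (B v (g m) + of_real e * B (\<lambda>t. f m t * u t) (g m))"
      unfolding Ge_def[abs_def] add_right[OF ve G continuous_fun_mult[OF continuous_fun_const g]] mult_right[OF ve g]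
        ve_eq[OF G] ve_eq[OF g] ..
    have "B (\<lambda>t. f k t * ue (- e) t) (g k) = B (\<lambda>t. f k t * u t) (g k) + of_real (- e) * B (\<lambda>t. f k t * (f m t * v t)) (g k)" for k
    proof -
      have "(\<lambda>t. f k t * ue (- e) t) = (\<lambda>t. f k t * u t + (- e) * (f k t * (f m t * v t)))"
        by (simp add: ue_def fun_eq_iff algebra_simps)
      then show ?thesis
        by (simp only: add_left[OF fu continuous_fun_mult[OF continuous_fun_const ffv] g] mult_left[OF ffv g])
    qed
    then have 2: "(\<Sum>k<m. B (\<lambda>t. f k t * ue (- e) t) (g k)) =
        (\<Sum>k<m. B (\<lambda>t. f k t * u t) (g k)) - of_real e * (\<Sum>k<m. B (\<lambda>t. f k t * (f m t * v t)) (g k))"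
      by (simp add: sum.distrib sum_negf sum_subtractf sum_distrib_left)
    show ?thesis
      unfolding T_def 1 2 by (simp add: algebra_simps)
  qed
  define Z where "Z = B v G + (\<Sum>k<Suc m. B (\<lambda>t. f k t * u t) (g k))"
  have "Z + Z = T (ve 1) (ue (- 1)) (Ge 1) + T (ve (- 1)) (ue (- (- 1))) (Ge (- 1))"
    unfolding exp by (simp add: Z_def T_def)
  then have "norm (Z + Z) \<le> M * (c * sqrt (1 + d) ^ Suc m) + M * (c * sqrt (1 + d) ^ Suc m)"
    using norm_triangle_mono[OF bd[of 1] bd[of "- 1"]] by (simp add: mult.assoc)
  moreover have "norm (Z + Z) = 2 * norm Z"
    by (simp add: norm_mult flip: mult_2)
  ultimately show ?case
    unfolding Z_def by linarith
qed

text \<open>With N functions scaled by 1 / sqrt N the Riesz product has modulus at most (1 +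
  1/N)^(N/2) \<le> 2. Hence N values |B (f_k, g_k)| have sum at most 2 M sqrt N, which excludes a
  common lower bound \<epsilon> > 0.\<close>

lemma rademacher_bumps_null:
  assumes f: "\<And>k. continuous_fun K (f k)" "\<And>k t. t \<in> topspace K \<Longrightarrow> \<bar>f k t\<bar> \<le> 1"
    and g: "\<And>k. continuous_fun L (g k)" "\<And>k s. s \<in> topspace L \<Longrightarrow> 0 \<le> g k s"
      "\<And>J s. finite J \<Longrightarrow> s \<in> topspace L \<Longrightarrow> (\<Sum>k\<in>J. g k s) \<le> (1::real)"
    and M: "M \<ge> 0"
  shows "(\<lambda>k::nat. norm (B (f k) (\<lambda>s. of_real (g k s)))) \<longlonglongrightarrow> 0"
proof (rule ccontr)
  let ?b = "\<lambda>k. B (f k) (\<lambda>s. of_real (g k s))"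
  assume "\<not> (\<lambda>k. norm (?b k)) \<longlonglongrightarrow> 0"
  then obtain \<epsilon> and r :: "nat \<Rightarrow> nat" where e: "\<epsilon> > 0" and r: "strict_mono r" and ge: "\<And>k. norm (?b (r k)) \<ge> \<epsilon>"
    using not_tendsto_zero_subseq[of "\<lambda>k. norm (?b k)"] norm_ge_zero by blast
  have gc: "continuous_fun L (\<lambda>s. of_real (g k s) :: 'k)" for k
    by (intro continuous_fun_of_real g)
  \<comment> \<open>Phases that turn the values to be summed into positive reals.\<close>
  define \<theta> where "\<theta> k = of_real (norm (?b (r k))) / ?b (r k)" for k
  have b0: "?b (r k) \<noteq> 0" for k
    using ge[of k] e by auto
  have \<theta>: "norm (\<theta> k) = 1" "\<theta> k * ?b (r k) = of_real (norm (?b (r k)))" for k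
    using b0[of k] by (simp_all add: \<theta>_def norm_divide)
  have "real N * \<epsilon> \<le> M * 2 * sqrt N" if N: "N > 0" for N :: nat
  proof -
    define \<delta> where "\<delta> = 1 / sqrt N"
    have \<delta>: "\<delta> > 0" "\<delta>\<^sup>2 = 1 / N"
      using N by (simp_all add: \<delta>_def power_divide)
    define F where "F k t = \<delta> * f (r k) t" for k t
    define H where "H k s = \<theta> k * of_real (g (r k) s)" for k s
    \<comment> \<open>The product starts from u = 1, v = 0 and G = 0, so that c = 1 and just the
      diagonal sum is bounded.\<close>
    have "norm (B (\<lambda>_. 0) (\<lambda>_. 0) + (\<Sum>k<N. B (\<lambda>t. F k t * 1) (H k))) \<le> M * (1 * sqrt (1 + 1 / N) ^ N)"
    proof (rule riesz_product_bound)
      show "continuous_fun K (F k)" "continuous_fun L (H k)" for k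
        unfolding F_def[abs_def] H_def[abs_def] by (intro continuous_fun_mult continuous_fun_const f gc)+
      show "(F k t)\<^sup>2 \<le> 1 / N" if "t \<in> topspace K" for k t
      proof -
        have "\<bar>f (r k) t\<bar>\<^sup>2 \<le> 1\<^sup>2"
          by (intro power_mono f(2)[OF that] abs_ge_zero)
        then have "\<delta>\<^sup>2 * (f (r k) t)\<^sup>2 \<le> \<delta>\<^sup>2 * 1"
          by (intro mult_left_mono) simp_all
        then show ?thesis
          by (simp add: F_def power_mult_distrib \<delta>(2))
      qed
      fix s assume s: "s \<in> topspace L"
      have "(\<Sum>k<N. norm (H k s)) = (\<Sum>k<N. g (r k) s)"
        using g(2)[OF s] by (simp add: H_def norm_mult \<theta>(1))
      also have "\<dots> = (\<Sum>k\<in>r ` {..<N}. g k s)"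
        by (subst sum.reindex) (simp_all add: strict_mono_imp_inj_on r inj_on_subset)
      also have "\<dots> \<le> 1"
        by (intro g(3) s) simp
      finally show "norm (0::'k) + (\<Sum>k<N. norm (H k s)) \<le> 1"
        by simp
    qed simp_all
    moreover have "B (\<lambda>_. 0) (\<lambda>_. 0) = 0"
      using mult_left[of "\<lambda>_. 0" "\<lambda>_. 0" 0] by simp
    moreover have "B (\<lambda>t. F k t * 1) (H k) = of_real (\<delta> * norm (?b (r k)))" for k
    proof -
      have "B (\<lambda>t. F k t * 1) (H k) = of_real \<delta> * (\<theta> k * ?b (r k))"
        unfolding F_def H_def[abs_def] mult_1_right
        using mult_left[OF f(1) continuous_fun_mult[OF continuous_fun_const gc]] mult_right[OF f(1) gc] by simp
      then show ?thesis
        by (simp add: \<theta>(2))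
    qed
    ultimately have "norm (\<Sum>k<N. of_real (\<delta> * norm (?b (r k))) :: 'k) \<le> M * sqrt (1 + 1 / N) ^ N"
      by simp
    then have "\<bar>\<Sum>k<N. \<delta> * norm (?b (r k))\<bar> \<le> M * sqrt (1 + 1 / N) ^ N"
      unfolding of_real_sum[symmetric] norm_of_real .
    moreover have "(\<Sum>k<N. \<delta> * \<epsilon>) \<le> (\<Sum>k<N. \<delta> * norm (?b (r k)))"
      using \<delta>(1) ge by (intro sum_mono mult_left_mono) simp_all
    ultimately have 1: "real N * (\<delta> * \<epsilon>) \<le> M * sqrt (1 + 1 / N) ^ N"
      by simp
    have "(1 + 1 / real N) ^ N \<le> exp 1"
      using exp_ge_one_plus_x_over_n_power_n[of N 1] N by simp
    also have "\<dots> \<le> 2\<^sup>2"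
      using exp_le by simp
    finally have "sqrt (1 + 1 / N) ^ N \<le> 2"
      unfolding real_sqrt_power[symmetric] by (rule real_le_lsqrt[rotated -1]) simp_all
    then have "real N * (\<delta> * \<epsilon>) \<le> M * 2"
      using 1 M mult_left_mono order_trans by blast
    then have "real N * (\<delta> * \<epsilon>) * sqrt N \<le> M * 2 * sqrt N"
      by (intro mult_right_mono) simp_all
    then show ?thesis
      using N by (simp add: \<delta>_def)
  qed
  note le = this
  obtain N :: nat where N: "2 * M / \<epsilon> + 1 < real N"
    using reals_Archimedean2 by blast
  have N0: "N > 0"
    using N M e by (cases N) (auto simp: field_simps)
  \<comment> \<open>The bound is used with N^2 terms, so that the square root disappears.\<close>
  have "real (N * N) * \<epsilon> \<le> M * 2 * sqrt (real (N * N))"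
    using N0 by (intro le) simp
  then have "real N * (real N * \<epsilon>) \<le> real N * (M * 2)"
    by (simp add: real_sqrt_mult mult_ac)
  then have "real N * \<epsilon> \<le> M * 2"
    using N0 by simp
  then have "real N \<le> 2 * M / \<epsilon>"
    using e by (simp add: field_simps)
  then show False
    using N by linarith
qed

end

section \<open>Projective tensor products without the Dunford-Pettis property\<close>

text \<open>For large N, coordinate N of the limit would be within 1/2 of 1, by the N-th unit
  vector, and within 1/2 of 0, by the next one.\<close>

lemma unit_vectors_not_convergent:
  assumes "l2 \<iota>"
  shows "\<not> limitin (norm_topology (l2_space \<iota>)) (\<lambda>k. \<iota> (\<lambda>j. if k = j then 1 else (0::'k::{real_normed_field,euclidean_space}))) y sequentially"
proof
  interpret l2 \<iota>
    by (rule assms)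
  let ?e = "\<lambda>(k::nat) j. if k = j then 1 else (0::'k)"
  have e: "square_summable (?e k)" for k
    by (rule square_summable_finite(1)[of "Suc k"]) simp
  assume "limitin (norm_topology (l2_space \<iota>)) (\<lambda>k. \<iota> (?e k)) y sequentially"
  moreover have "range (\<lambda>k. \<iota> (?e k)) \<subseteq> carrier (l2_space \<iota>)"
    by (rule image_subsetI) (rule iota_in[OF e])
  ultimately have y: "y \<in> carrier (l2_space \<iota>)"
      and lim: "(\<lambda>k. vnorm (l2_space \<iota>) (\<iota> (?e k) \<ominus>\<^bsub>l2_space \<iota>\<^esub> y)) \<longlonglongrightarrow> 0"
    by (simp_all only: L.limitin_norm_iff)
  obtain a where a: "square_summable a" "y = \<iota> a"
    using y by (rule l2_cases)
  have coord: "norm (?e k j - a j) \<le> vnorm (l2_space \<iota>) (\<iota> (?e k) \<ominus>\<^bsub>l2_space \<iota>\<^esub> y)" for k j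
    unfolding a(2) l2_diff(1)[OF e a(1)] l2_simps(5)
    by (rule norm_le_l2norm[OF l2_diff(2)[OF e a(1)]])
  have "\<forall>\<^sub>F k in sequentially. vnorm (l2_space \<iota>) (\<iota> (?e k) \<ominus>\<^bsub>l2_space \<iota>\<^esub> y) < 1 / 2"
    by (rule order_tendstoD(2)[OF lim]) simp
  then obtain N where N: "\<And>k. k \<ge> N \<Longrightarrow> vnorm (l2_space \<iota>) (\<iota> (?e k) \<ominus>\<^bsub>l2_space \<iota>\<^esub> y) < 1 / 2"
    unfolding eventually_sequentially by blast
  have "norm (1 - a N) < 1 / 2"
    using coord[of N N] N[of N] by simp
  moreover have "norm (a N) < 1 / 2"
    using coord[of "Suc N" N] N[of "Suc N"] by simp
  ultimately show False
    using norm_triangle_ineq[of "1 - a N" "a N"] by simp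
qed

section \<open>Coordinate forms and bilinear restrictions on tensor products\<close>

context C_tensor
begin

definition coordinate_form :: "nat \<Rightarrow> (('a \<Rightarrow> 'k) \<Rightarrow> 'k) \<Rightarrow> (nat \<Rightarrow> 'a) \<Rightarrow> (nat \<Rightarrow> 'a \<Rightarrow> 'k) \<Rightarrow> 'k" where
  "coordinate_form i0 \<phi> p y = \<phi> (y i0) * (\<Prod>i\<in>{..<n} - {i0}. y i (p i))"

lemma coordinate_form_multilinear:
  assumes i0: "i0 < n" and \<phi>: "linear_map (E i0) scalars \<phi>" and p: "\<And>i. i < n \<Longrightarrow> p i \<in> topspace (K i)"
  shows "coordinate_form i0 \<phi> p \<in> multilinear_forms n E"
proof (rule multilinear_formsI)
  fix x i assume x: "x \<in> T.tuples" and i: "i < n"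
  show "linear_map (E i) scalars (\<lambda>f. coordinate_form i0 \<phi> p (x(i := f)))"
  proof (cases "i = i0")
    case True
    have "coordinate_form i0 \<phi> p (x(i := f)) = \<phi> f * (\<Prod>i\<in>{..<n} - {i0}. x i (p i))" for f
      unfolding coordinate_form_def True by simp
    then show ?thesis
      unfolding True using linear_mapD[OF \<phi>] by (intro linear_map_scalarsI) (simp_all add: algebra_simps)
  next
    case False
    then have mem: "i \<in> {..<n} - {i0}"
      using i by simp
    have "coordinate_form i0 \<phi> p (x(i := f)) = f (p i) * (\<phi> (x i0) * (\<Prod>j\<in>{..<n} - {i0} - {i}. x j (p j)))" for f
      unfolding coordinate_form_def using False by (subst prod.remove[OF _ mem]) simp_all
    then show ?thesis
      using p[OF i] by (intro linear_map_scalarsI) (simp_all add: E_def C_space_simps algebra_simps)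
  qed
qed

text \<open>On an elementary tensor the point evaluations contribute at most the norms of the other
  factors, uniformly in k, so the square sums are those of the q k in slot i0. The section norm is
  subadditive in u and falls under \<open>seminorm_tensor_bound\<close>.\<close>

lemma coordinate_forms_bound:
  fixes q :: "nat \<Rightarrow> ('a \<Rightarrow> 'k) \<Rightarrow> 'k"
  assumes i0: "i0 < n" and q: "\<And>k. linear_map (E i0) scalars (q k)" and C: "C \<ge> 0"
    and q_le: "\<And>f N. f \<in> carrier (E i0) \<Longrightarrow> L2_set (\<lambda>k. norm (q k f)) {..<N} \<le> C * vnorm (E i0) f"
    and p: "\<And>k i. i < n \<Longrightarrow> p k i \<in> topspace (K i)" and u: "u \<in> carrier A"
  shows "L2_set (\<lambda>k. norm (u (coordinate_form i0 (q k) (p k)))) {..<N} \<le> C * vnorm A u"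
proof -
  define a where "a k = coordinate_form i0 (q k) (p k)" for k :: nat
  have a: "a k \<in> multilinear_forms n E" for k
    unfolding a_def by (rule coordinate_form_multilinear[OF i0 q p])
  have "L2_set (\<lambda>k. norm (u (a k))) {..<N} \<le> C * vnorm (algebraic_tensor n E) u"
  proof (rule T.seminorm_tensor_bound[where p = "\<lambda>u. L2_set (\<lambda>k. norm (u (a k))) {..<N}"])
    show "L2_set (\<lambda>k. norm (\<zero>\<^bsub>algebraic_tensor n E\<^esub> (a k))) {..<N} \<le> 0"
      by (simp add: algebraic_tensor_simps(2) a L2_set_def)
    show "L2_set (\<lambda>k. norm ((v \<oplus>\<^bsub>algebraic_tensor n E\<^esub> w) (a k))) {..<N} \<le>
        L2_set (\<lambda>k. norm (v (a k))) {..<N} + L2_set (\<lambda>k. norm (w (a k))) {..<N}" for v w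
    proof (rule order_trans[OF L2_set_mono L2_set_triangle_ineq])
      show "norm ((v \<oplus>\<^bsub>algebraic_tensor n E\<^esub> w) (a k)) \<le> norm (v (a k)) + norm (w (a k))" for k
        by (simp add: algebraic_tensor_simps(3) a norm_triangle_ineq)
    qed simp
    fix x assume x: "x \<in> T.tuples"
    define P where "P = (\<Prod>i\<in>{..<n} - {i0}. vnorm (E i) (x i))"
    have xi: "x i \<in> carrier (E i)" if "i < n" for i
      using x that by (auto simp: PiE_iff)
    have P0: "P \<ge> 0"
      unfolding P_def using normed_space.vnorm_nonneg[OF normed_E xi] by (intro prod_nonneg) simp
    have le: "norm (elementary_tensor n E x (a k)) \<le> P * norm (q k (x i0))" for k
    proof -
      have "norm (\<Prod>i\<in>{..<n} - {i0}. x i (p k i)) \<le> P"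
        unfolding P_def prod_norm[symmetric]
      proof (intro prod_mono conjI norm_ge_zero)
        fix i assume "i \<in> {..<n} - {i0}"
        then have i: "i < n"
          by simp
        show "norm (x i (p k i)) \<le> vnorm (E i) (x i)"
          unfolding E_def using xi[OF i] i p by (intro C_space_norm_le compact C_space_carrierD) (simp_all add: E_def)
      qed
      then have "norm (q k (x i0)) * norm (\<Prod>i\<in>{..<n} - {i0}. x i (p k i)) \<le> norm (q k (x i0)) * P"
        by (rule mult_left_mono) simp
      then show ?thesis
        using a[of k] by (simp add: elementary_tensor_def a_def coordinate_form_def norm_mult mult.commute)
    qed
    have "L2_set (\<lambda>k. norm (elementary_tensor n E x (a k))) {..<N} \<le> L2_set (\<lambda>k. P * norm (q k (x i0))) {..<N}"
      by (intro L2_set_mono le) simp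
    also have "\<dots> = P * L2_set (\<lambda>k. norm (q k (x i0))) {..<N}"
      using P0 by (simp add: L2_set_right_distrib)
    also have "\<dots> \<le> P * (C * vnorm (E i0) (x i0))"
      by (intro mult_left_mono q_le xi i0 P0)
    also have "\<dots> = C * (\<Prod>i<n. vnorm (E i) (x i))"
      unfolding P_def using i0 by (subst prod.remove[of "{..<n}" i0]) simp_all
    finally show "L2_set (\<lambda>k. norm (elementary_tensor n E x (a k))) {..<N} \<le> C * (\<Prod>i<n. vnorm (E i) (x i))" .
  qed (use C u in \<open>simp_all add: A_def\<close>)
  then show ?thesis
    by (simp only: a_def A_def)
qed

text \<open>The slots other than i0 and i1 hold the constant 1, so the norm bound for elementary
  tensors reduces to the factor c from slot i0.\<close>

lemma bilinear_on_tensors: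
  assumes i: "i0 < n" "i1 < n" "i0 \<noteq> i1" and \<phi>: "linear_map X scalars \<phi>" and M: "M \<ge> 0"
    and \<phi>_le: "\<And>v. v \<in> carrier X \<Longrightarrow> norm (\<phi> v) \<le> M * vnorm X v"
  shows "bilinear_on_products (K i0) (K i1)
    (\<lambda>u G. \<phi> (tens ((\<lambda>_ _. 1)(i0 := \<lambda>t. of_real (u t), i1 := G)))) M"
proof -
  define x where "x h G = ((\<lambda>_ _. 1 :: 'k)(i0 := h, i1 := G)) " for h G :: "'a \<Rightarrow> 'k"
  have x0: "x h G = (x h' G)(i0 := h)" and x1: "x h G = (x h G')(i1 := G)" for h h' G G'
    using i(3) by (auto simp: x_def)
  have x: "cont_tuple (x h G)" if "continuous_fun (K i0) h" "continuous_fun (K i1) G" for h G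
    unfolding x_def using that by (intro cont_tuple_upd) (simp_all add: cont_tuple_def)
  have add0: "\<phi> (tens (x (\<lambda>t. h t + h' t) G)) = \<phi> (tens (x h G)) + \<phi> (tens (x h' G))"
    if h: "continuous_fun (K i0) h" and h': "continuous_fun (K i0) h'" and G: "continuous_fun (K i1) G" for h h' G
    using tens_add[OF x[OF h G] i(1) h h'] linear_mapD(2)[OF \<phi> tens_in[OF x[OF h G]] tens_in[OF x[OF h' G]]]
    unfolding x0[symmetric] by simp
  have mult0: "\<phi> (tens (x (\<lambda>t. c * h t) G)) = c * \<phi> (tens (x h G))"
    if h: "continuous_fun (K i0) h" and G: "continuous_fun (K i1) G" for c h G
    using tens_smult[OF x[OF h G] i(1) h, of c] linear_mapD(3)[OF \<phi> tens_in[OF x[OF h G]], of c]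
    unfolding x0[symmetric] by simp
  have add1: "\<phi> (tens (x h (\<lambda>t. G t + H t))) = \<phi> (tens (x h G)) + \<phi> (tens (x h H))"
    if h: "continuous_fun (K i0) h" and G: "continuous_fun (K i1) G" and H: "continuous_fun (K i1) H" for h G H
    using tens_add[OF x[OF h G] i(2) G H] linear_mapD(2)[OF \<phi> tens_in[OF x[OF h G]] tens_in[OF x[OF h H]]]
    unfolding x1[symmetric] by simp
  have mult1: "\<phi> (tens (x h (\<lambda>t. c * G t))) = c * \<phi> (tens (x h G))"
    if h: "continuous_fun (K i0) h" and G: "continuous_fun (K i1) G" for c h G
    using tens_smult[OF x[OF h G] i(2) G, of c] linear_mapD(3)[OF \<phi> tens_in[OF x[OF h G]], of c]
    unfolding x1[symmetric] by simp
  have r: "continuous_fun (K i0) (\<lambda>t. of_real (u t) :: 'k)" if "continuous_fun (K i0) u" for u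
    by (rule continuous_fun_of_real[OF that])
  show ?thesis
    unfolding x_def[symmetric]
  proof (rule bilinear_on_products.intro)
    fix u v :: "'a \<Rightarrow> real" and G H :: "'a \<Rightarrow> 'k" and c :: real and a :: 'k
    assume u: "continuous_fun (K i0) u" and G: "continuous_fun (K i1) G"
    show "\<phi> (tens (x (\<lambda>t. of_real (c * u t)) G)) = of_real c * \<phi> (tens (x (\<lambda>t. of_real (u t)) G))"
      unfolding of_real_mult by (rule mult0[OF r[OF u] G])
    show "\<phi> (tens (x (\<lambda>t. of_real (u t)) (\<lambda>t. a * G t))) = a * \<phi> (tens (x (\<lambda>t. of_real (u t)) G))"
      by (rule mult1[OF r[OF u] G])
    assume u_le: "\<And>t. t \<in> topspace (K i0) \<Longrightarrow> \<bar>u t\<bar> \<le> c" and G_le: "\<And>s. s \<in> topspace (K i1) \<Longrightarrow> norm (G s) \<le> 1"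
      and c: "c \<ge> 0"
    have "vnorm X (tens (x (\<lambda>t. of_real (u t)) G)) \<le> (\<Prod>i<n. if i = i0 then c else 1)"
      using u_le G_le i(3) by (intro vnorm_tens_le x r u G) (auto simp: x_def)
    also have "\<dots> = c"
      using i(1) by simp
    finally have "M * vnorm X (tens (x (\<lambda>t. of_real (u t)) G)) \<le> M * c"
      using M by (rule mult_left_mono)
    then show "norm (\<phi> (tens (x (\<lambda>t. of_real (u t)) G))) \<le> M * c"
      using \<phi>_le[OF tens_in[OF x[OF r[OF u] G]]] by linarith
  next
    fix u v :: "'a \<Rightarrow> real" and G :: "'a \<Rightarrow> 'k"
    assume u: "continuous_fun (K i0) u" and v: "continuous_fun (K i0) v" and G: "continuous_fun (K i1) G"
    show "\<phi> (tens (x (\<lambda>t. of_real (u t + v t)) G)) = \<phi> (tens (x (\<lambda>t. of_real (u t)) G)) + \<phi> (tens (x (\<lambda>t. of_real (v t)) G))"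
      unfolding of_real_add by (rule add0[OF r[OF u] r[OF v] G])
  next
    fix u :: "'a \<Rightarrow> real" and G H :: "'a \<Rightarrow> 'k"
    assume u: "continuous_fun (K i0) u" and G: "continuous_fun (K i1) G" and H: "continuous_fun (K i1) H"
    show "\<phi> (tens (x (\<lambda>t. of_real (u t)) (\<lambda>t. G t + H t))) = \<phi> (tens (x (\<lambda>t. of_real (u t)) G)) + \<phi> (tens (x (\<lambda>t. of_real (u t)) H))"
      by (rule add1[OF r[OF u] G H])
  qed
qed

end

theorem dunford_pettis_imp_scattered:
  fixes K :: "nat \<Rightarrow> 'a topology"
  assumes n: "n > 1" and compact: "\<And>i. i < n \<Longrightarrow> compact_space (K i)" and inf: "\<And>i. i < n \<Longrightarrow> infinite (topspace (K i))"
    and hausdorff: "\<And>i. i < n \<Longrightarrow> Hausdorff_space (K i)"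
    and dp: "dunford_pettis TYPE('f)
      (projective_tensor n (\<lambda>i. C_space (K i) :: ('k::{real_normed_field,euclidean_space}, 'a \<Rightarrow> 'k) normed_module))"
    and i0: "i0 < n"
  shows "scattered_space (K i0)"
proof (rule ccontr)
  assume ns: "\<not> scattered_space (K i0)"
  interpret C: C_tensor n K "TYPE('k)"
    using n by (intro C_tensor.intro compact infinite_imp_nonempty[OF inf]) simp_all
  have X: "projective_tensor n (\<lambda>i. C_space (K i) :: ('k, 'a \<Rightarrow> 'k) normed_module) = C.X"
    by (simp only: C.X_def C.E_def[abs_def])
  \<comment> \<open>Any slot different from i0 would do; n > 1 provides one.\<close>
  define i1 where "i1 = (if i0 = 0 then 1 else (0::nat))"
  have i1: "i1 < n" "i0 \<noteq> i1"
    using n by (auto simp: i1_def)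
  from not_scattered_l2_operator[OF compact[OF i0] hausdorff[OF i0] ns, where 'k = 'k]
  obtain f :: "nat \<Rightarrow> 'a \<Rightarrow> real" and q :: "nat \<Rightarrow> ('a \<Rightarrow> 'k) \<Rightarrow> 'k" and C where C: "C \<ge> 0"
      and f_all: "\<forall>k. continuous_fun (K i0) (f k)" and f1_all: "\<forall>k. \<forall>t\<in>topspace (K i0). \<bar>f k t\<bar> \<le> 1"
      and q_all: "\<forall>k. linear_map (C_space (K i0)) scalars (q k)"
      and q_le_all: "\<forall>F\<in>carrier (C_space (K i0)). \<forall>N. L2_set (\<lambda>k. norm (q k F)) {..<N} \<le> C * vnorm (C_space (K i0)) F"
      and qf_all: "\<forall>j k. q k (\<lambda>t\<in>topspace (K i0). of_real (f j t)) = (if j = k then 1 else 0)"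
    by (elim exE conjE)
  note f = f_all[rule_format] and f1 = f1_all[rule_format] and q = q_all[rule_format]
    and q_le = q_le_all[rule_format] and qf = qf_all[rule_format]
  from separated_bumps[OF compact[OF i1(1)] hausdorff[OF i1(1)] inf[OF i1(1)]]
  obtain t :: "nat \<Rightarrow> 'a" and g :: "nat \<Rightarrow> 'a \<Rightarrow> real" where t_all: "\<forall>k. t k \<in> topspace (K i1)"
      and g_all: "\<forall>k. continuous_fun (K i1) (g k)" and gt_all: "\<forall>k. g k (t k) = 1"
      and g0_all: "\<forall>k. \<forall>s\<in>topspace (K i1). 0 \<le> g k s"
      and g1_all: "\<forall>J. finite J \<longrightarrow> (\<forall>s\<in>topspace (K i1). (\<Sum>k\<in>J. g k s) \<le> 1)"
    by (elim exE conjE)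
  note t = t_all[rule_format] and g = g_all[rule_format] and gt = gt_all[rule_format]
    and g0 = g0_all[rule_format] and g1 = g1_all[rule_format]
  \<comment> \<open>Slot i1 is evaluated at the peak t k, where g k is 1; the slots that hold the
    constant 1 may be evaluated anywhere.\<close>
  define p where "p k i = (if i = i1 then t k else (SOME s. s \<in> topspace (K i)))" for k i
  have p: "p k i \<in> topspace (K i)" if "i < n" for k i
    using t[of k] C.nonempty[OF that] unfolding p_def by (cases "i = i1") (simp_all add: some_in_eq)
  define a where "a k = C.coordinate_form i0 (q k) (p k)" for k
  have qE: "linear_map (C.E i0) scalars (q k)" for k
    unfolding C.E_def by (rule q)
  have a: "a k \<in> multilinear_forms n C.E" for k
    unfolding a_def by (rule C.coordinate_form_multilinear[OF i0 qE p])
  have a_le: "L2_set (\<lambda>k. norm (u (a k))) {..<N} \<le> C * vnorm C.A u" if "u \<in> carrier C.A" for u N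
    unfolding a_def by (rule C.coordinate_forms_bound[OF i0 qE C q_le[folded C.E_def] p that])
  define x where "x k = (\<lambda>_ _. 1 :: 'k)(i0 := \<lambda>t. of_real (f k t), i1 := \<lambda>s. of_real (g k s))" for k
  have x: "C.cont_tuple (x k)" for k
    unfolding x_def by (intro C.cont_tuple_upd continuous_fun_of_real f g) (simp add: C.cont_tuple_def)
  have ax: "a j (C.tup (x k)) = (if k = j then 1 else 0)" for j k
  proof -
    have "C.tup (x k) i0 = (\<lambda>t\<in>topspace (K i0). of_real (f k t))"
      using i0 i1(2) by (simp add: C.tup_def x_def)
    moreover have "(\<Prod>i\<in>{..<n} - {i0}. C.tup (x k) i (p k i)) = 1"
    proof (rule prod.neutral, rule ballI)
      fix i assume i: "i \<in> {..<n} - {i0}"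
      then have "C.tup (x k) i (p k i) = x k i (p k i)"
        using p[of i k] by (simp add: C.tup_def)
      also have "\<dots> = 1"
        using i gt[of k] by (cases "i = i1") (simp_all add: x_def p_def)
      finally show "C.tup (x k) i (p k i) = 1" .
    qed
    ultimately show ?thesis
      using qf[of j k] unfolding a_def C.coordinate_form_def by (cases "k = j") (simp_all only: if_True if_False mult_1_right mult_zero_left simp_thms)
  qed
  \<comment> \<open>The left summand of the carrier type is large enough to hold the sequence space.\<close>
  define \<iota> :: "(nat \<Rightarrow> 'k) \<Rightarrow> (nat \<Rightarrow> (nat \<Rightarrow> ((nat \<Rightarrow> 'a \<Rightarrow> 'k) \<Rightarrow> 'k) \<Rightarrow> 'k) set) + 'f"
    where "\<iota> b = Inl (\<lambda>k. {\<lambda>_ _. b k})" for b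
  have "inj \<iota>"
    unfolding \<iota>_def[abs_def] by (rule injI) (simp add: fun_eq_iff)
  then have l2: "l2 \<iota>"
    by (rule l2.intro)
  interpret l2 \<iota>
    by (rule l2)
  \<comment> \<open>On algebraic tensors the operator into l2 evaluates a tensor at the forms a k;
    being bounded, it extends to the completion.\<close>
  define R where "R u = \<iota> (\<lambda>k. u (a k))" for u
  have sq: "square_summable (\<lambda>k. u (a k))" and sq_le: "l2norm (\<lambda>k. u (a k)) \<le> C * vnorm C.A u"
    if "u \<in> carrier C.A" for u
    by (rule l2normI[OF a_le[OF that]])+
  have R: "linear_map C.A (l2_space \<iota>) R"
    unfolding linear_map_def
  proof (intro conjI ballI allI)
    show "R \<in> carrier C.A \<rightarrow> carrier (l2_space \<iota>)"
      unfolding R_def by (intro Pi_I iota_in sq)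
    show "R (u \<oplus>\<^bsub>C.A\<^esub> v) = R u \<oplus>\<^bsub>l2_space \<iota>\<^esub> R v" for u v
      unfolding R_def l2_simps(3) C.A_def algebraic_tensor_simps(3) by (simp add: a)
    show "R (c \<odot>\<^bsub>C.A\<^esub> u) = c \<odot>\<^bsub>l2_space \<iota>\<^esub> R u" for c u
      unfolding R_def l2_simps(4) C.A_def algebraic_tensor_simps(4) by (simp add: a)
  qed
  have R_le: "vnorm (l2_space \<iota>) (R u) \<le> C * vnorm C.A u" if "u \<in> carrier C.A" for u
    unfolding R_def l2_simps(5) by (rule sq_le[OF that])
  have "\<exists>R'. bounded_operator (completion C.A) (l2_space \<iota>) R' \<and> (\<forall>u\<in>carrier C.A. R' (C.A.emb u) = R u)"
    by (rule completion_extension[OF C.normed_A banach_space_l2 R R_le C])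
      (assumption, rule exI, rule conjI, assumption, rule ballI, simp)
  then obtain R' where R': "bounded_operator (completion C.A) (l2_space \<iota>) R'"
      and R'_all: "\<forall>u\<in>carrier C.A. R' (C.A.emb u) = R u"
    by (elim exE conjE)
  note R'_emb = R'_all[rule_format]
  have R'_tens: "R' (C.tens (x k)) = \<iota> (\<lambda>j. if k = j then 1 else 0)" for k
    unfolding C.tens_def R'_emb[OF C.elementary_in[OF x]] R_def
    by (simp add: elementary_tensor_def a ax)
  have bR': "bounded_operator C.X (l2_space \<iota>) R'"
    unfolding C.X_eq by (rule R')
  have cc: "completely_continuous C.X (l2_space \<iota>) R'"
    by (rule dp[unfolded X dunford_pettis_def, rule_format, OF banach_space_l2 weakly_compact_into_l2[OF C.normed_X bR']])
  have in_X: "range (\<lambda>k. C.tens (x k)) \<subseteq> carrier C.X"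
    by (rule image_subsetI) (rule C.tens_in[OF x])
  have "limitin (weak_topology C.X) (\<lambda>k. C.tens (x k)) \<zero>\<^bsub>C.X\<^esub> sequentially"
    unfolding limitin_weak_iff[OF C.normed_X in_X]
  proof (intro conjI allI impI C.X.zero_closed)
    fix \<phi> :: "(nat \<Rightarrow> ((nat \<Rightarrow> 'a \<Rightarrow> 'k) \<Rightarrow> 'k) \<Rightarrow> 'k) set \<Rightarrow> 'k"
    assume \<phi>: "bounded_operator C.X scalars \<phi>"
    obtain M where M: "M > 0" "linear_map C.X scalars \<phi>" "\<And>v. v \<in> carrier C.X \<Longrightarrow> norm (\<phi> v) \<le> M * vnorm C.X v"
      using bounded_operatorE[OF C.normed_X normed_space_scalars \<phi>] by auto
    have "(\<lambda>k. norm (\<phi> (C.tens (x k)))) \<longlonglongrightarrow> 0"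
      unfolding x_def
      by (rule bilinear_on_products.rademacher_bumps_null[OF
            C.bilinear_on_tensors[OF i0 i1 M(2) less_imp_le[OF M(1)] M(3)] f f1 g g0 g1 less_imp_le[OF M(1)]])
    then have "(\<lambda>k. \<phi> (C.tens (x k))) \<longlonglongrightarrow> 0"
      by (rule tendsto_norm_zero_cancel)
    moreover have "\<phi> \<zero>\<^bsub>C.X\<^esub> = 0"
      using linear_map_zero[OF C.normed_X normed_space_scalars M(2)] by simp
    ultimately show "(\<lambda>k. \<phi> (C.tens (x k))) \<longlonglongrightarrow> \<phi> \<zero>\<^bsub>C.X\<^esub>"
      by (simp only:)
  qed
  then obtain y where "limitin (norm_topology (l2_space \<iota>)) (R' \<circ> (\<lambda>k. C.tens (x k))) y sequentially"
    using conjunct2[OF cc[unfolded completely_continuous_def], rule_format, OF in_X exI] by blast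
  then show False
    unfolding comp_def R'_tens by (rule notE[OF unit_vectors_not_convergent[OF l2]])
qed

theorem dunford_pettis_iff_scattered:
  fixes K :: "nat \<Rightarrow> 'a topology"
  assumes "n > 1" "\<And>i. i < n \<Longrightarrow> compact_space (K i)" "\<And>i. i < n \<Longrightarrow> Hausdorff_space (K i)"
    and "\<And>i. i < n \<Longrightarrow> infinite (topspace (K i))"
  shows "dunford_pettis TYPE('f)
      (projective_tensor n (\<lambda>i. C_space (K i) :: ('k::{real_normed_field,euclidean_space}, 'a \<Rightarrow> 'k) normed_module))
    \<longleftrightarrow> (\<forall>i<n. scattered_space (K i))" (is "?dp \<longleftrightarrow> _")
proof
  show "\<forall>i<n. scattered_space (K i)" if ?dp
    using dunford_pettis_imp_scattered[OF assms(1,2,4,3) that] by (intro allI impI)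
  have n: "n > 0"
    using assms(1) by simp
  have ne: "topspace (K i) \<noteq> {}" if "i < n" for i
    by (rule infinite_imp_nonempty[OF assms(4)[OF that]])
  show ?dp if s: "\<forall>i<n. scattered_space (K i)"
    by (rule scattered_imp_dunford_pettis[OF n assms(2) ne assms(3)]) (simp_all add: s)
qed

theorem corollary2p5:
  fixes n :: nat and K :: "nat \<Rightarrow> 'a topology"
  assumes "n > 1"
    and "\<And>i. i < n \<Longrightarrow> compact_space (K i)"
    and "\<And>i. i < n \<Longrightarrow> Hausdorff_space (K i)"
    and "\<And>i. i < n \<Longrightarrow> infinite (topspace (K i))"
  shows "(dunford_pettis TYPE('f)
            (projective_tensor n (\<lambda>i. C_space (K i) :: (real, 'a \<Rightarrow> real) normed_module))
          \<longleftrightarrow> (\<forall>i<n. scattered_space (K i)))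
       \<and> (dunford_pettis TYPE('f)
            (projective_tensor n (\<lambda>i. C_space (K i) :: (complex, 'a \<Rightarrow> complex) normed_module))
          \<longleftrightarrow> (\<forall>i<n. scattered_space (K i)))"
  by (intro conjI dunford_pettis_iff_scattered assms)

end
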